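(* Over $\mathsf{RCA}_0^\omega$, each of the following statements implies $\mathsf{HBC}$: (a) (Pincherle's theorem for $[0,1]$) every locally bounded function on $[0,1]$ is bounded on $[0,1]$; (b) if $F^2$ is continuous on a closed set $D\subseteq 2^{\mathbb{N}}$, then $F$ is bounded on $D$; (c) if $F^2$ is continuous on a closed set $D\subseteq 2^{\mathbb{N}}$, then $F$ is uniformly continuous on $D$; (d) if $F:\mathbb{R}\to\mathbb{R}$ is continuous on a closed set $D\subseteq[0,1]$, then $F$ is bounded on $D$; (e) if $F:\mathbb{R}\to\mathbb{R}$ is continuous on a closed set $D\subseteq[0,1]$, then $F$ is uniformly continuous on $D$; (f) if $F:\mathbb{R}\to\mathbb{R}$ is continuous on a closed set $D\subseteq[0,1]$, then $F$ attains a maximum on $D$; (g) if $F:\mathbb{R}\to\mathbb{R}$ is continuous on a closed set $D\subseteq[0,1]$, then for every $\varepsilon>0$ there is a polynomial $p$ with $|p(x)-F(x)|<\varepsilon$ for all $x\in D$.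
   Context: Framework: Kohlenbach's higher-order arithmetic. $\mathsf{RCA}_0^\omega$ is the base theory in the language with variables of all finite types over $\mathbb{N}$, consisting of basic arithmetic axioms, combinators for $\lambda$-abstraction, the primitive recursor $\mathbf{R}_0$, extensionality at all types, quantifier-free induction, and quantifier-free choice $\mathsf{QF\text{-}AC}^{1,0}$. $F^2$ denotes a type-2 functional, i.e. a map from $\mathbb{N}^{\mathbb{N}}$ to $\mathbb{N}$; $2^{\mathbb{N}}$ is Cantor space. Reals are represented by fast-converging Cauchy sequences of rationals. A set of reals is given by a function $Y:\mathbb{R}\to\mathbb{R}$, where $x\in Y$ means $Y(x)>0$; $Y$ is open if for every $x\in Y$ there is a rational $r>0$ with $B(x,r)\subseteq Y$; $Y$ is closed if its complement is open. Subsets of $2^{\mathbb{N}}$ are likewise given by characteristic functionals, with open/closed defined analogously using basic neighbourhoods $[\bar f n]$ (all binary sequences extending the first $n$ bits of $f$). A function $f$ on $[0,1]$ is locally bounded if every $x\in[0,1]$ has a neighbourhood on which $f$ is bounded. $\mathsf{HBC}$: for every closed $C\subseteq[0,1]$ and sequences of reals $(a_n),(b_n)$ with $C\subseteq\bigcup_{n\in\mathbb{N}}(a_n,b_n)$, there is $n_0\in\mathbb{N}$ with $C\subseteq\bigcup_{n\le n_0}(a_n,b_n)$.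
   Formalization: A closed set of reals is given by the function Y of its open complement (x is in it iff not Y(x)>0); with closed sets given as {Y>0}, e.g. (b) would not imply HBC over RCA_0^ω. In (f), D is taken nonempty, since for empty D statement (f) is refutable. *)

theory Defs
  imports Main
begin

section \<open>Language: terms of all finite types, many-sorted first-order formulas\<close>

datatype ty = N | Fn ty ty  (infixr "\<rightarrow>" 60)

abbreviation T1 :: ty where "T1 \<equiv> N \<rightarrow> N"
abbreviation T2 :: ty where "T2 \<equiv> T1 \<rightarrow> N"

text \<open>\<open>Rec\<close> is the recursor for type 0 only; \<open>Comb_K\<close> and \<open>Comb_S\<close> are the combinators, one for
  each choice of types. A variable is an index together with its type.\<close>

datatype con = Zero | One | Plus | Times | Rec | Comb_K ty ty | Comb_S ty ty ty

datatype tm = Var nat ty | Con con | App tm tm  (infixl "\<cdot>" 90)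

primrec con_ty :: "con \<Rightarrow> ty" where
  "con_ty Zero = N"
| "con_ty One = N"
| "con_ty Plus = N \<rightarrow> N \<rightarrow> N"
| "con_ty Times = N \<rightarrow> N \<rightarrow> N"
| "con_ty Rec = (N \<rightarrow> N \<rightarrow> N) \<rightarrow> N \<rightarrow> N \<rightarrow> N"
| "con_ty (Comb_K \<rho> \<sigma>) = \<rho> \<rightarrow> \<sigma> \<rightarrow> \<rho>"
| "con_ty (Comb_S \<rho> \<sigma> \<tau>) = (\<rho> \<rightarrow> \<sigma> \<rightarrow> \<tau>) \<rightarrow> (\<rho> \<rightarrow> \<sigma>) \<rightarrow> \<rho> \<rightarrow> \<tau>"

primrec ty_of :: "tm \<Rightarrow> ty" where
  "ty_of (Var x \<sigma>) = \<sigma>"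
| "ty_of (Con c) = con_ty c"
| "ty_of (t \<cdot> u) = (case ty_of t of \<sigma> \<rightarrow> \<tau> \<Rightarrow> \<tau> | N \<Rightarrow> N)"

primrec wt :: "tm \<Rightarrow> bool" where
  "wt (Var x \<sigma>) \<longleftrightarrow> True"
| "wt (Con c) \<longleftrightarrow> True"
| "wt (t \<cdot> u) \<longleftrightarrow> wt t \<and> wt u \<and> (case ty_of t of \<sigma> \<rightarrow> \<tau> \<Rightarrow> ty_of u = \<sigma> | N \<Rightarrow> False)"

text \<open>Equality is primitive at type 0 only.\<close>

datatype fm =
    Eq tm tm  (infix "\<^bold>=" 50)
  | Lt tm tm  (infix "\<^bold><" 50)
  | Fls
  | Imp fm fm  (infixr "\<^bold>\<longrightarrow>" 25)
  | Forall nat ty fm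

primrec wf :: "fm \<Rightarrow> bool" where
  "wf (t \<^bold>= u) \<longleftrightarrow> wt t \<and> wt u \<and> ty_of t = N \<and> ty_of u = N"
| "wf (t \<^bold>< u) \<longleftrightarrow> wt t \<and> wt u \<and> ty_of t = N \<and> ty_of u = N"
| "wf Fls \<longleftrightarrow> True"
| "wf (\<phi> \<^bold>\<longrightarrow> \<psi>) \<longleftrightarrow> wf \<phi> \<and> wf \<psi>"
| "wf (Forall x \<sigma> \<phi>) \<longleftrightarrow> wf \<phi>"

primrec qf :: "fm \<Rightarrow> bool" where
  "qf (t \<^bold>= u) \<longleftrightarrow> True"
| "qf (t \<^bold>< u) \<longleftrightarrow> True"
| "qf Fls \<longleftrightarrow> True"
| "qf (\<phi> \<^bold>\<longrightarrow> \<psi>) \<longleftrightarrow> qf \<phi> \<and> qf \<psi>"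
| "qf (Forall x \<sigma> \<phi>) \<longleftrightarrow> False"

primrec fvt :: "tm \<Rightarrow> (nat \<times> ty) set" where
  "fvt (Var x \<sigma>) = {(x, \<sigma>)}"
| "fvt (Con c) = {}"
| "fvt (t \<cdot> u) = fvt t \<union> fvt u"

primrec fv :: "fm \<Rightarrow> (nat \<times> ty) set" where
  "fv (t \<^bold>= u) = fvt t \<union> fvt u"
| "fv (t \<^bold>< u) = fvt t \<union> fvt u"
| "fv Fls = {}"
| "fv (\<phi> \<^bold>\<longrightarrow> \<psi>) = fv \<phi> \<union> fv \<psi>"
| "fv (Forall x \<sigma> \<phi>) = fv \<phi> - {(x, \<sigma>)}"

primrec substt :: "nat \<Rightarrow> ty \<Rightarrow> tm \<Rightarrow> tm \<Rightarrow> tm" where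
  "substt x \<sigma> s (Var y \<tau>) = (if y = x \<and> \<tau> = \<sigma> then s else Var y \<tau>)"
| "substt x \<sigma> s (Con c) = Con c"
| "substt x \<sigma> s (t \<cdot> u) = substt x \<sigma> s t \<cdot> substt x \<sigma> s u"

text \<open>Substitution does not rename bound variables; it is used only under \<open>free_for\<close> or on
  quantifier-free formulas.\<close>

primrec subst :: "nat \<Rightarrow> ty \<Rightarrow> tm \<Rightarrow> fm \<Rightarrow> fm" where
  "subst x \<sigma> s (t \<^bold>= u) = (substt x \<sigma> s t \<^bold>= substt x \<sigma> s u)"
| "subst x \<sigma> s (t \<^bold>< u) = (substt x \<sigma> s t \<^bold>< substt x \<sigma> s u)"
| "subst x \<sigma> s Fls = Fls"
| "subst x \<sigma> s (\<phi> \<^bold>\<longrightarrow> \<psi>) = (subst x \<sigma> s \<phi> \<^bold>\<longrightarrow> subst x \<sigma> s \<psi>)"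
| "subst x \<sigma> s (Forall y \<tau> \<phi>) =
     (if y = x \<and> \<tau> = \<sigma> then Forall y \<tau> \<phi> else Forall y \<tau> (subst x \<sigma> s \<phi>))"

primrec free_for :: "tm \<Rightarrow> nat \<Rightarrow> ty \<Rightarrow> fm \<Rightarrow> bool" where
  "free_for s x \<sigma> (t \<^bold>= u) \<longleftrightarrow> True"
| "free_for s x \<sigma> (t \<^bold>< u) \<longleftrightarrow> True"
| "free_for s x \<sigma> Fls \<longleftrightarrow> True"
| "free_for s x \<sigma> (\<phi> \<^bold>\<longrightarrow> \<psi>) \<longleftrightarrow> free_for s x \<sigma> \<phi> \<and> free_for s x \<sigma> \<psi>"
| "free_for s x \<sigma> (Forall y \<tau> \<phi>) \<longleftrightarrow>
     (x, \<sigma>) \<notin> fv (Forall y \<tau> \<phi>) \<or> ((y, \<tau>) \<notin> fvt s \<and> free_for s x \<sigma> \<phi>)"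

definition Neg :: "fm \<Rightarrow> fm"  ("\<^bold>\<not> _" [40] 40) where
  "Neg \<phi> = (\<phi> \<^bold>\<longrightarrow> Fls)"
definition Conj :: "fm \<Rightarrow> fm \<Rightarrow> fm"  (infixr "\<^bold>\<and>" 35) where
  "Conj \<phi> \<psi> = (\<^bold>\<not> (\<phi> \<^bold>\<longrightarrow> \<^bold>\<not> \<psi>))"
definition Disj :: "fm \<Rightarrow> fm \<Rightarrow> fm"  (infixr "\<^bold>\<or>" 30) where
  "Disj \<phi> \<psi> = (\<^bold>\<not> \<phi> \<^bold>\<longrightarrow> \<psi>)"
definition Iff :: "fm \<Rightarrow> fm \<Rightarrow> fm"  (infix "\<^bold>\<longleftrightarrow>" 24) where
  "Iff \<phi> \<psi> = ((\<phi> \<^bold>\<longrightarrow> \<psi>) \<^bold>\<and> (\<psi> \<^bold>\<longrightarrow> \<phi>))"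
definition Exists :: "nat \<Rightarrow> ty \<Rightarrow> fm \<Rightarrow> fm" where
  "Exists x \<sigma> \<phi> = (\<^bold>\<not> Forall x \<sigma> (\<^bold>\<not> \<phi>))"

text \<open>To write formulas without naming variables, the quantifiers \<open>\<^bold>\<forall>x\<^bold>:\<sigma>. F x\<close> and
  \<open>\<^bold>\<exists>x\<^bold>:\<sigma>. F x\<close> take a function \<open>F\<close> from terms to formulas and bind the first variable whose
  index exceeds every index that \<open>F\<close> itself brings in; so nothing is captured.\<close>

primrec idxt :: "tm \<Rightarrow> nat" where
  "idxt (Var x \<sigma>) = Suc x"
| "idxt (Con c) = 0"
| "idxt (t \<cdot> u) = max (idxt t) (idxt u)"

primrec idx :: "fm \<Rightarrow> nat" where
  "idx (t \<^bold>= u) = max (idxt t) (idxt u)"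
| "idx (t \<^bold>< u) = max (idxt t) (idxt u)"
| "idx Fls = 0"
| "idx (\<phi> \<^bold>\<longrightarrow> \<psi>) = max (idx \<phi>) (idx \<psi>)"
| "idx (Forall x \<sigma> \<phi>) = max (Suc x) (idx \<phi>)"

definition all :: "ty \<Rightarrow> (tm \<Rightarrow> fm) \<Rightarrow> fm" where
  "all \<sigma> F = (let x = idx (F (Var 0 \<sigma>)) in Forall x \<sigma> (F (Var x \<sigma>)))"
definition ex :: "ty \<Rightarrow> (tm \<Rightarrow> fm) \<Rightarrow> fm" where
  "ex \<sigma> F = (let x = idx (F (Var 0 \<sigma>)) in Exists x \<sigma> (F (Var x \<sigma>)))"

syntax
  "_all" :: "pttrn \<Rightarrow> ty \<Rightarrow> fm \<Rightarrow> fm"  ("(3\<^bold>\<forall>_\<^bold>:_./ _)" [0, 0, 10] 10)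
  "_ex" :: "pttrn \<Rightarrow> ty \<Rightarrow> fm \<Rightarrow> fm"  ("(3\<^bold>\<exists>_\<^bold>:_./ _)" [0, 0, 10] 10)
translations
  "\<^bold>\<forall>x\<^bold>:\<sigma>. \<phi>" \<rightleftharpoons> "CONST all \<sigma> (\<lambda>x. \<phi>)"
  "\<^bold>\<exists>x\<^bold>:\<sigma>. \<phi>" \<rightleftharpoons> "CONST ex \<sigma> (\<lambda>x. \<phi>)"

abbreviation O0 :: tm  ("\<^bold>0") where "\<^bold>0 \<equiv> Con Zero"
abbreviation I1 :: tm  ("\<^bold>1") where "\<^bold>1 \<equiv> Con One"
abbreviation plus_tm :: "tm \<Rightarrow> tm \<Rightarrow> tm"  (infixl "\<^bold>+" 65) where
  "t \<^bold>+ u \<equiv> Con Plus \<cdot> t \<cdot> u"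
abbreviation times_tm :: "tm \<Rightarrow> tm \<Rightarrow> tm"  (infixl "\<^bold>*" 70) where
  "t \<^bold>* u \<equiv> Con Times \<cdot> t \<cdot> u"

definition Le :: "tm \<Rightarrow> tm \<Rightarrow> fm"  (infix "\<^bold>\<le>" 50) where
  "t \<^bold>\<le> u = (t \<^bold>< u \<^bold>+ \<^bold>1)"

text \<open>Equality at type \<open>\<sigma>\<^sub>1 \<rightarrow> \<dots> \<rightarrow> \<sigma>\<^sub>k \<rightarrow> 0\<close> abbreviates
  \<open>\<forall>z\<^sub>1 \<dots> z\<^sub>k. t z\<^sub>1 \<dots> z\<^sub>k = u z\<^sub>1 \<dots> z\<^sub>k\<close>.\<close>

primrec eq_ty :: "ty \<Rightarrow> tm \<Rightarrow> tm \<Rightarrow> fm" where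
  "eq_ty N t u = (t \<^bold>= u)"
| "eq_ty (\<sigma> \<rightarrow> \<tau>) t u = (\<^bold>\<forall>z\<^bold>:\<sigma>. eq_ty \<tau> (t \<cdot> z) (u \<cdot> z))"


section \<open>Derivability and the theory \<open>RCA\<^sub>0\<^sup>\<omega>\<close>\<close>

text \<open>A Hilbert calculus for classical many-sorted logic. Non-logical axioms with free variables
  stand for their universal closures.\<close>

inductive derivable :: "fm set \<Rightarrow> fm \<Rightarrow> bool"  (infix "\<turnstile>" 10) for T where
  Axiom: "\<phi> \<in> T \<Longrightarrow> wf \<phi> \<Longrightarrow> T \<turnstile> \<phi>"
| Weakening: "wf \<phi> \<Longrightarrow> wf \<psi> \<Longrightarrow> T \<turnstile> (\<phi> \<^bold>\<longrightarrow> \<psi> \<^bold>\<longrightarrow> \<phi>)"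
| Distrib: "wf \<phi> \<Longrightarrow> wf \<psi> \<Longrightarrow> wf \<chi> \<Longrightarrow>
    T \<turnstile> ((\<phi> \<^bold>\<longrightarrow> \<psi> \<^bold>\<longrightarrow> \<chi>) \<^bold>\<longrightarrow> (\<phi> \<^bold>\<longrightarrow> \<psi>) \<^bold>\<longrightarrow> \<phi> \<^bold>\<longrightarrow> \<chi>)"
| Double_neg: "wf \<phi> \<Longrightarrow> T \<turnstile> (\<^bold>\<not> \<^bold>\<not> \<phi> \<^bold>\<longrightarrow> \<phi>)"
| Inst: "wf \<phi> \<Longrightarrow> wt t \<Longrightarrow> ty_of t = \<sigma> \<Longrightarrow> free_for t x \<sigma> \<phi> \<Longrightarrow>
    T \<turnstile> (Forall x \<sigma> \<phi> \<^bold>\<longrightarrow> subst x \<sigma> t \<phi>)"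
| Shift: "wf \<phi> \<Longrightarrow> wf \<psi> \<Longrightarrow> (x, \<sigma>) \<notin> fv \<phi> \<Longrightarrow>
    T \<turnstile> (Forall x \<sigma> (\<phi> \<^bold>\<longrightarrow> \<psi>) \<^bold>\<longrightarrow> \<phi> \<^bold>\<longrightarrow> Forall x \<sigma> \<psi>)"
| Modus_ponens: "T \<turnstile> (\<phi> \<^bold>\<longrightarrow> \<psi>) \<Longrightarrow> T \<turnstile> \<phi> \<Longrightarrow> T \<turnstile> \<psi>"
| Generalisation: "T \<turnstile> \<phi> \<Longrightarrow> T \<turnstile> Forall x \<sigma> \<phi>"

inductive_set RCA0w :: "fm set" where
  eq_refl: "(\<^bold>\<forall>m\<^bold>:N. m \<^bold>= m) \<in> RCA0w"
| eq_euclid: "(\<^bold>\<forall>m\<^bold>:N. \<^bold>\<forall>n\<^bold>:N. \<^bold>\<forall>k\<^bold>:N. m \<^bold>= n \<^bold>\<longrightarrow> m \<^bold>= k \<^bold>\<longrightarrow> n \<^bold>= k) \<in> RCA0w"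
| less_cong: "(\<^bold>\<forall>m\<^bold>:N. \<^bold>\<forall>n\<^bold>:N. \<^bold>\<forall>k\<^bold>:N. \<^bold>\<forall>l\<^bold>:N.
    m \<^bold>= n \<^bold>\<longrightarrow> k \<^bold>= l \<^bold>\<longrightarrow> m \<^bold>< k \<^bold>\<longrightarrow> n \<^bold>< l) \<in> RCA0w"
| succ_nonzero: "(\<^bold>\<forall>n\<^bold>:N. \<^bold>\<not> n \<^bold>+ \<^bold>1 \<^bold>= \<^bold>0) \<in> RCA0w"
| succ_inj: "(\<^bold>\<forall>m\<^bold>:N. \<^bold>\<forall>n\<^bold>:N. m \<^bold>+ \<^bold>1 \<^bold>= n \<^bold>+ \<^bold>1 \<^bold>\<longrightarrow> m \<^bold>= n) \<in> RCA0w"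
| add_zero: "(\<^bold>\<forall>m\<^bold>:N. m \<^bold>+ \<^bold>0 \<^bold>= m) \<in> RCA0w"
| add_succ: "(\<^bold>\<forall>m\<^bold>:N. \<^bold>\<forall>n\<^bold>:N. m \<^bold>+ (n \<^bold>+ \<^bold>1) \<^bold>= (m \<^bold>+ n) \<^bold>+ \<^bold>1) \<in> RCA0w"
| mult_zero: "(\<^bold>\<forall>m\<^bold>:N. m \<^bold>* \<^bold>0 \<^bold>= \<^bold>0) \<in> RCA0w"
| mult_succ: "(\<^bold>\<forall>m\<^bold>:N. \<^bold>\<forall>n\<^bold>:N. m \<^bold>* (n \<^bold>+ \<^bold>1) \<^bold>= m \<^bold>* n \<^bold>+ m) \<in> RCA0w"
| less_zero: "(\<^bold>\<forall>m\<^bold>:N. \<^bold>\<not> m \<^bold>< \<^bold>0) \<in> RCA0w"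
| less_succ: "(\<^bold>\<forall>m\<^bold>:N. \<^bold>\<forall>n\<^bold>:N. m \<^bold>< n \<^bold>+ \<^bold>1 \<^bold>\<longleftrightarrow> (m \<^bold>< n \<^bold>\<or> m \<^bold>= n)) \<in> RCA0w"
| comb_K: "(\<^bold>\<forall>x\<^bold>:\<rho>. \<^bold>\<forall>y\<^bold>:\<sigma>. eq_ty \<rho> (Con (Comb_K \<rho> \<sigma>) \<cdot> x \<cdot> y) x) \<in> RCA0w"
| comb_S: "(\<^bold>\<forall>x\<^bold>:\<rho> \<rightarrow> \<sigma> \<rightarrow> \<tau>. \<^bold>\<forall>y\<^bold>:\<rho> \<rightarrow> \<sigma>. \<^bold>\<forall>z\<^bold>:\<rho>.
    eq_ty \<tau> (Con (Comb_S \<rho> \<sigma> \<tau>) \<cdot> x \<cdot> y \<cdot> z) (x \<cdot> z \<cdot> (y \<cdot> z))) \<in> RCA0w"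
| rec_zero: "(\<^bold>\<forall>f\<^bold>:N \<rightarrow> N \<rightarrow> N. \<^bold>\<forall>m\<^bold>:N. Con Rec \<cdot> f \<cdot> m \<cdot> \<^bold>0 \<^bold>= m) \<in> RCA0w"
| rec_succ: "(\<^bold>\<forall>f\<^bold>:N \<rightarrow> N \<rightarrow> N. \<^bold>\<forall>m\<^bold>:N. \<^bold>\<forall>n\<^bold>:N.
    Con Rec \<cdot> f \<cdot> m \<cdot> (n \<^bold>+ \<^bold>1) \<^bold>= f \<cdot> n \<cdot> (Con Rec \<cdot> f \<cdot> m \<cdot> n)) \<in> RCA0w"
| extensionality: "(\<^bold>\<forall>x\<^bold>:\<rho>. \<^bold>\<forall>y\<^bold>:\<rho>. \<^bold>\<forall>f\<^bold>:\<rho> \<rightarrow> \<tau>.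
    eq_ty \<rho> x y \<^bold>\<longrightarrow> eq_ty \<tau> (f \<cdot> x) (f \<cdot> y)) \<in> RCA0w"
| qf_induction: "qf \<phi> \<Longrightarrow> wf \<phi> \<Longrightarrow>
    (subst x N \<^bold>0 \<phi> \<^bold>\<longrightarrow> Forall x N (\<phi> \<^bold>\<longrightarrow> subst x N (Var x N \<^bold>+ \<^bold>1) \<phi>) \<^bold>\<longrightarrow> Forall x N \<phi>) \<in> RCA0w"
| qf_ac: "qf \<phi> \<Longrightarrow> wf \<phi> \<Longrightarrow> (Y, T2) \<notin> fv \<phi> \<Longrightarrow>
    (Forall f T1 (Exists n N \<phi>) \<^bold>\<longrightarrow>
     Exists Y T2 (Forall f T1 (subst n N (Var Y T2 \<cdot> Var f T1) \<phi>))) \<in> RCA0w"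


section \<open>Primitive recursive terms\<close>

primrec bracket :: "nat \<Rightarrow> ty \<Rightarrow> tm \<Rightarrow> tm" where
  "bracket x \<sigma> (Var y \<tau>) = (if y = x \<and> \<tau> = \<sigma>
     then Con (Comb_S \<sigma> (\<sigma> \<rightarrow> \<sigma>) \<sigma>) \<cdot> Con (Comb_K \<sigma> (\<sigma> \<rightarrow> \<sigma>)) \<cdot> Con (Comb_K \<sigma> \<sigma>)
     else Con (Comb_K \<tau> \<sigma>) \<cdot> Var y \<tau>)"
| "bracket x \<sigma> (Con c) = Con (Comb_K (con_ty c) \<sigma>) \<cdot> Con c"
| "bracket x \<sigma> (t \<cdot> u) = (if (x, \<sigma>) \<notin> fvt (t \<cdot> u)
     then Con (Comb_K (ty_of (t \<cdot> u)) \<sigma>) \<cdot> (t \<cdot> u)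
     else Con (Comb_S \<sigma> (ty_of u) (ty_of (t \<cdot> u))) \<cdot> bracket x \<sigma> t \<cdot> bracket x \<sigma> u)"

definition lam :: "ty \<Rightarrow> (tm \<Rightarrow> tm) \<Rightarrow> tm" where
  "lam \<sigma> F = (let x = idxt (F (Var 0 \<sigma>)) in bracket x \<sigma> (F (Var x \<sigma>)))"

syntax
  "_lam" :: "pttrn \<Rightarrow> ty \<Rightarrow> tm \<Rightarrow> tm"  ("(3\<^bold>\<lambda>_\<^bold>:_./ _)" [0, 0, 10] 10)
translations
  "\<^bold>\<lambda>x\<^bold>:\<sigma>. t" \<rightleftharpoons> "CONST lam \<sigma> (\<lambda>x. t)"

text \<open>All of the following are closed terms.\<close>

definition prd :: tm where
  "prd = (\<^bold>\<lambda>n\<^bold>:N. Con Rec \<cdot> (\<^bold>\<lambda>k\<^bold>:N. \<^bold>\<lambda>v\<^bold>:N. k) \<cdot> \<^bold>0 \<cdot> n)"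

definition monus :: tm where
  "monus = (\<^bold>\<lambda>m\<^bold>:N. \<^bold>\<lambda>n\<^bold>:N. Con Rec \<cdot> (\<^bold>\<lambda>k\<^bold>:N. \<^bold>\<lambda>v\<^bold>:N. prd \<cdot> v) \<cdot> m \<cdot> n)"

abbreviation monus_tm :: "tm \<Rightarrow> tm \<Rightarrow> tm"  (infixl "\<^bold>-" 65) where
  "t \<^bold>- u \<equiv> monus \<cdot> t \<cdot> u"

definition pow2 :: tm where
  "pow2 = (\<^bold>\<lambda>n\<^bold>:N. Con Rec \<cdot> (\<^bold>\<lambda>k\<^bold>:N. \<^bold>\<lambda>v\<^bold>:N. v \<^bold>+ v) \<cdot> \<^bold>1 \<cdot> n)"

text \<open>\<open>sqr\<close> is the integer part of the square root: its value \<open>v\<close> at \<open>k\<close> grows by one at \<open>k + 1\<close>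
  exactly when \<open>(v + 1)\<^sup>2 \<le> k + 1\<close>. It serves to invert the pairing \<open>(a, b) \<mapsto> (a + b)\<^sup>2 + a\<close>.\<close>

definition sqr :: tm where
  "sqr = (\<^bold>\<lambda>n\<^bold>:N. Con Rec \<cdot>
     (\<^bold>\<lambda>k\<^bold>:N. \<^bold>\<lambda>v\<^bold>:N. v \<^bold>+ (\<^bold>1 \<^bold>- ((v \<^bold>+ \<^bold>1) \<^bold>* (v \<^bold>+ \<^bold>1) \<^bold>- (k \<^bold>+ \<^bold>1)))) \<cdot> \<^bold>0 \<cdot> n)"

definition left :: tm where
  "left = (\<^bold>\<lambda>z\<^bold>:N. z \<^bold>- sqr \<cdot> z \<^bold>* (sqr \<cdot> z))"
definition right :: tm where
  "right = (\<^bold>\<lambda>z\<^bold>:N. sqr \<cdot> z \<^bold>- left \<cdot> z)"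


section \<open>Rational and real numbers\<close>

text \<open>A rational expression is a triple \<open>(p, m, d)\<close> of type-0 terms denoting \<open>(p - m) / d\<close>,
  where \<open>d\<close> is positive. Every natural number \<open>q\<close> codes a rational via \<open>rat q\<close>, and every
  rational has a code.\<close>

type_synonym rat_expr = "tm \<times> tm \<times> tm"

definition rat :: "tm \<Rightarrow> rat_expr" where
  "rat q = (left \<cdot> (left \<cdot> q), right \<cdot> (left \<cdot> q), right \<cdot> q \<^bold>+ \<^bold>1)"
definition rat_of_nat :: "tm \<Rightarrow> rat_expr" where
  "rat_of_nat n = (n, \<^bold>0, \<^bold>1)"
definition pow2_neg :: "tm \<Rightarrow> rat_expr" where
  "pow2_neg n = (\<^bold>1, \<^bold>0, pow2 \<cdot> n)"

fun rat_add :: "rat_expr \<Rightarrow> rat_expr \<Rightarrow> rat_expr" where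
  "rat_add (p, m, d) (p', m', d') = (p \<^bold>* d' \<^bold>+ p' \<^bold>* d, m \<^bold>* d' \<^bold>+ m' \<^bold>* d, d \<^bold>* d')"
fun rat_minus :: "rat_expr \<Rightarrow> rat_expr" where
  "rat_minus (p, m, d) = (m, p, d)"
fun rat_mult :: "rat_expr \<Rightarrow> rat_expr \<Rightarrow> rat_expr" where
  "rat_mult (p, m, d) (p', m', d') = (p \<^bold>* p' \<^bold>+ m \<^bold>* m', p \<^bold>* m' \<^bold>+ m \<^bold>* p', d \<^bold>* d')"
fun rat_abs :: "rat_expr \<Rightarrow> rat_expr" where
  "rat_abs (p, m, d) = ((p \<^bold>- m) \<^bold>+ (m \<^bold>- p), \<^bold>0, d)"
fun rat_less :: "rat_expr \<Rightarrow> rat_expr \<Rightarrow> fm"  (infix "<\<^sub>Q" 50) where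
  "(p, m, d) <\<^sub>Q (p', m', d') = (p \<^bold>* d' \<^bold>+ m' \<^bold>* d \<^bold>< p' \<^bold>* d \<^bold>+ m \<^bold>* d')"
definition rat_le :: "rat_expr \<Rightarrow> rat_expr \<Rightarrow> fm"  (infix "\<le>\<^sub>Q" 50) where
  "r \<le>\<^sub>Q s = (\<^bold>\<not> s <\<^sub>Q r)"

text \<open>A real expression gives, for each (term for an) index \<open>n\<close>, the \<open>n\<close>-th rational approximation.\<close>

type_synonym real_expr = "tm \<Rightarrow> rat_expr"

definition real :: "tm \<Rightarrow> real_expr" where
  "real x = (\<lambda>n. rat (x \<cdot> n))"
definition real_of_rat :: "rat_expr \<Rightarrow> real_expr" where
  "real_of_rat r = (\<lambda>n. r)"
definition real_of_nat :: "tm \<Rightarrow> real_expr" where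
  "real_of_nat k = real_of_rat (rat_of_nat k)"

definition real_add :: "real_expr \<Rightarrow> real_expr \<Rightarrow> real_expr"  (infixl "+\<^sub>R" 65) where
  "e +\<^sub>R e' = (\<lambda>n. rat_add (e (n \<^bold>+ \<^bold>1)) (e' (n \<^bold>+ \<^bold>1)))"
definition real_diff :: "real_expr \<Rightarrow> real_expr \<Rightarrow> real_expr"  (infixl "-\<^sub>R" 65) where
  "e -\<^sub>R e' = (\<lambda>n. rat_add (e (n \<^bold>+ \<^bold>1)) (rat_minus (e' (n \<^bold>+ \<^bold>1))))"
definition real_abs :: "real_expr \<Rightarrow> real_expr" where
  "real_abs e = (\<lambda>n. rat_abs (e n))"

text \<open>For products the index is shifted by some \<open>k\<close> with \<open>2\<^sup>k \<ge> \<bar>e\<^sub>0\<bar> + \<bar>e'\<^sub>0\<bar> + 2\<close>, so that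
  the result is again fast converging.\<close>

definition real_mult :: "real_expr \<Rightarrow> real_expr \<Rightarrow> real_expr"  (infixl "*\<^sub>R" 70) where
  "e *\<^sub>R e' = (\<lambda>n. case (e \<^bold>0, e' \<^bold>0) of ((p, m, d), (p', m', d')) \<Rightarrow>
     let k = (p \<^bold>+ m) \<^bold>+ (p' \<^bold>+ m') \<^bold>+ (\<^bold>1 \<^bold>+ \<^bold>1)
     in rat_mult (e (n \<^bold>+ k)) (e' (n \<^bold>+ k)))"

definition is_real :: "tm \<Rightarrow> fm" where
  "is_real x = (\<^bold>\<forall>n\<^bold>:N. \<^bold>\<forall>i\<^bold>:N.
     rat_abs (rat_add (real x n) (rat_minus (real x (n \<^bold>+ i)))) <\<^sub>Q pow2_neg n)"

text \<open>\<open>x = y\<close> iff \<open>\<bar>x\<^sub>n - y\<^sub>n\<bar> \<le> 2\<^bsup>-n+1\<^esup>\<close> for all \<open>n\<close>, and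
  \<open>x < y\<close> iff \<open>x\<^sub>n + 2\<^bsup>-n+1\<^esup> < y\<^sub>n\<close> for some \<open>n\<close>.\<close>

definition real_eq :: "real_expr \<Rightarrow> real_expr \<Rightarrow> fm"  (infix "=\<^sub>R" 50) where
  "e =\<^sub>R e' = (\<^bold>\<forall>n\<^bold>:N.
     rat_abs (rat_add (e n) (rat_minus (e' n))) \<le>\<^sub>Q rat_add (pow2_neg n) (pow2_neg n))"
definition real_less :: "real_expr \<Rightarrow> real_expr \<Rightarrow> fm"  (infix "<\<^sub>R" 50) where
  "e <\<^sub>R e' = (\<^bold>\<exists>n\<^bold>:N. rat_add (e n) (rat_add (pow2_neg n) (pow2_neg n)) <\<^sub>Q e' n)"
definition real_le :: "real_expr \<Rightarrow> real_expr \<Rightarrow> fm"  (infix "\<le>\<^sub>R" 50) where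
  "e \<le>\<^sub>R e' = (\<^bold>\<not> e' <\<^sub>R e)"

definition unit_interval :: "tm \<Rightarrow> fm" where
  "unit_interval x =
     (is_real x \<^bold>\<and> real_of_nat \<^bold>0 \<le>\<^sub>R real x \<^bold>\<and> real x \<le>\<^sub>R real_of_nat \<^bold>1)"

definition pos_rat :: "tm \<Rightarrow> fm" where
  "pos_rat q = (rat_of_nat \<^bold>0 <\<^sub>Q rat q)"

definition near :: "tm \<Rightarrow> tm \<Rightarrow> tm \<Rightarrow> fm" where
  "near x y q = (real_abs (real x -\<^sub>R real y) <\<^sub>R real_of_rat (rat q))"

text \<open>Functions from \<open>A \<subseteq> \<real>\<close> to \<open>\<real>\<close> are type \<open>1 \<rightarrow> 1\<close> objects that respect equality of reals.\<close>

definition real_function_on :: "(tm \<Rightarrow> fm) \<Rightarrow> tm \<Rightarrow> fm" where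
  "real_function_on A F =
     ((\<^bold>\<forall>x\<^bold>:T1. A x \<^bold>\<longrightarrow> is_real (F \<cdot> x)) \<^bold>\<and>
      (\<^bold>\<forall>x\<^bold>:T1. \<^bold>\<forall>y\<^bold>:T1.
         A x \<^bold>\<and> A y \<^bold>\<and> real x =\<^sub>R real y \<^bold>\<longrightarrow> real (F \<cdot> x) =\<^sub>R real (F \<cdot> y)))"


section \<open>Open and closed sets\<close>

definition in_real_set :: "tm \<Rightarrow> tm \<Rightarrow> fm" where
  "in_real_set Y x = (is_real x \<^bold>\<and> real_of_nat \<^bold>0 <\<^sub>R real (Y \<cdot> x))"

definition open_real_set :: "tm \<Rightarrow> fm" where
  "open_real_set Y =
     (real_function_on is_real Y \<^bold>\<and>
      (\<^bold>\<forall>x\<^bold>:T1. in_real_set Y x \<^bold>\<longrightarrow>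
         (\<^bold>\<exists>r\<^bold>:N. pos_rat r \<^bold>\<and>
            (\<^bold>\<forall>y\<^bold>:T1. is_real y \<^bold>\<and> near x y r \<^bold>\<longrightarrow> in_real_set Y y))))"

text \<open>A closed set is one whose complement is an open set, hence it is given by the function
  \<open>Y : \<real> \<rightarrow> \<real>\<close> for that complement: \<open>x\<close> belongs to it iff \<open>\<not> Y(x) > 0\<close>. Representing the closed
  set itself by \<open>Y(x) > 0\<close> would not do without arithmetical comprehension: if all functions on
  the reals are continuous, not even the unit interval has that form.\<close>

definition in_closed :: "tm \<Rightarrow> tm \<Rightarrow> fm" where
  "in_closed Y x = (is_real x \<^bold>\<and> \<^bold>\<not> real_of_nat \<^bold>0 <\<^sub>R real (Y \<cdot> x))"

definition closed_subset_unit :: "tm \<Rightarrow> fm" where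
  "closed_subset_unit Y =
     (open_real_set Y \<^bold>\<and> (\<^bold>\<forall>x\<^bold>:T1. in_closed Y x \<^bold>\<longrightarrow> unit_interval x))"

definition cantor :: "tm \<Rightarrow> fm" where
  "cantor f = (\<^bold>\<forall>n\<^bold>:N. f \<cdot> n \<^bold>\<le> \<^bold>1)"

text \<open>\<open>agree f g n\<close> says that \<open>g\<close> lies in the basic neighbourhood given by the first \<open>n\<close> bits of \<open>f\<close>.\<close>

definition agree :: "tm \<Rightarrow> tm \<Rightarrow> tm \<Rightarrow> fm" where
  "agree f g n = (\<^bold>\<forall>i\<^bold>:N. i \<^bold>< n \<^bold>\<longrightarrow> f \<cdot> i \<^bold>= g \<cdot> i)"

definition in_cantor_set :: "tm \<Rightarrow> tm \<Rightarrow> fm" where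
  "in_cantor_set D f = (cantor f \<^bold>\<and> D \<cdot> f \<^bold>= \<^bold>1)"

definition closed_cantor_set :: "tm \<Rightarrow> fm" where
  "closed_cantor_set D =
     ((\<^bold>\<forall>f\<^bold>:T1. cantor f \<^bold>\<longrightarrow> D \<cdot> f \<^bold>\<le> \<^bold>1) \<^bold>\<and>
      (\<^bold>\<forall>f\<^bold>:T1. cantor f \<^bold>\<and> \<^bold>\<not> in_cantor_set D f \<^bold>\<longrightarrow>
         (\<^bold>\<exists>n\<^bold>:N. \<^bold>\<forall>g\<^bold>:T1. cantor g \<^bold>\<and> agree f g n \<^bold>\<longrightarrow> \<^bold>\<not> in_cantor_set D g)))"


section \<open>The principles\<close>

definition HBC :: fm where
  "HBC = (\<^bold>\<forall>C\<^bold>:T1 \<rightarrow> T1. \<^bold>\<forall>a\<^bold>:N \<rightarrow> T1. \<^bold>\<forall>b\<^bold>:N \<rightarrow> T1.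
     closed_subset_unit C \<^bold>\<and> (\<^bold>\<forall>n\<^bold>:N. is_real (a \<cdot> n) \<^bold>\<and> is_real (b \<cdot> n)) \<^bold>\<and>
     (\<^bold>\<forall>x\<^bold>:T1. in_closed C x \<^bold>\<longrightarrow>
        (\<^bold>\<exists>n\<^bold>:N. real (a \<cdot> n) <\<^sub>R real x \<^bold>\<and> real x <\<^sub>R real (b \<cdot> n))) \<^bold>\<longrightarrow>
     (\<^bold>\<exists>n0\<^bold>:N. \<^bold>\<forall>x\<^bold>:T1. in_closed C x \<^bold>\<longrightarrow>
        (\<^bold>\<exists>n\<^bold>:N. n \<^bold>\<le> n0 \<^bold>\<and> real (a \<cdot> n) <\<^sub>R real x \<^bold>\<and> real x <\<^sub>R real (b \<cdot> n))))"

definition bounded_on :: "(tm \<Rightarrow> fm) \<Rightarrow> tm \<Rightarrow> fm" where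
  "bounded_on A F =
     (\<^bold>\<exists>k\<^bold>:N. \<^bold>\<forall>x\<^bold>:T1. A x \<^bold>\<longrightarrow> real_abs (real (F \<cdot> x)) \<le>\<^sub>R real_of_nat k)"

definition locally_bounded_unit :: "tm \<Rightarrow> fm" where
  "locally_bounded_unit F =
     (\<^bold>\<forall>x\<^bold>:T1. unit_interval x \<^bold>\<longrightarrow>
        (\<^bold>\<exists>r\<^bold>:N. pos_rat r \<^bold>\<and> bounded_on (\<lambda>y. unit_interval y \<^bold>\<and> near x y r) F))"

definition Pincherle :: fm where
  "Pincherle = (\<^bold>\<forall>F\<^bold>:T1 \<rightarrow> T1. real_function_on unit_interval F \<^bold>\<and> locally_bounded_unit F
     \<^bold>\<longrightarrow> bounded_on unit_interval F)"

definition cantor_continuous_on :: "tm \<Rightarrow> tm \<Rightarrow> fm" where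
  "cantor_continuous_on D F =
     (\<^bold>\<forall>f\<^bold>:T1. in_cantor_set D f \<^bold>\<longrightarrow>
        (\<^bold>\<exists>n\<^bold>:N. \<^bold>\<forall>g\<^bold>:T1. in_cantor_set D g \<^bold>\<and> agree f g n \<^bold>\<longrightarrow> F \<cdot> f \<^bold>= F \<cdot> g))"

definition Cantor_bounded :: fm where
  "Cantor_bounded = (\<^bold>\<forall>F\<^bold>:T2. \<^bold>\<forall>D\<^bold>:T2. closed_cantor_set D \<^bold>\<and> cantor_continuous_on D F \<^bold>\<longrightarrow>
     (\<^bold>\<exists>k\<^bold>:N. \<^bold>\<forall>f\<^bold>:T1. in_cantor_set D f \<^bold>\<longrightarrow> F \<cdot> f \<^bold>\<le> k))"

definition Cantor_uniform :: fm where
  "Cantor_uniform = (\<^bold>\<forall>F\<^bold>:T2. \<^bold>\<forall>D\<^bold>:T2. closed_cantor_set D \<^bold>\<and> cantor_continuous_on D F \<^bold>\<longrightarrow>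
     (\<^bold>\<exists>n\<^bold>:N. \<^bold>\<forall>f\<^bold>:T1. \<^bold>\<forall>g\<^bold>:T1.
        in_cantor_set D f \<^bold>\<and> in_cantor_set D g \<^bold>\<and> agree f g n \<^bold>\<longrightarrow> F \<cdot> f \<^bold>= F \<cdot> g))"

definition continuous_on_closed :: "tm \<Rightarrow> tm \<Rightarrow> fm" where
  "continuous_on_closed D F =
     (\<^bold>\<forall>x\<^bold>:T1. in_closed D x \<^bold>\<longrightarrow>
        (\<^bold>\<forall>e\<^bold>:N. pos_rat e \<^bold>\<longrightarrow>
           (\<^bold>\<exists>d\<^bold>:N. pos_rat d \<^bold>\<and>
              (\<^bold>\<forall>y\<^bold>:T1. in_closed D y \<^bold>\<and> near x y d \<^bold>\<longrightarrow> near (F \<cdot> x) (F \<cdot> y) e))))"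

definition uniformly_continuous_on_closed :: "tm \<Rightarrow> tm \<Rightarrow> fm" where
  "uniformly_continuous_on_closed D F =
     (\<^bold>\<forall>e\<^bold>:N. pos_rat e \<^bold>\<longrightarrow>
        (\<^bold>\<exists>d\<^bold>:N. pos_rat d \<^bold>\<and>
           (\<^bold>\<forall>x\<^bold>:T1. \<^bold>\<forall>y\<^bold>:T1.
              in_closed D x \<^bold>\<and> in_closed D y \<^bold>\<and> near x y d \<^bold>\<longrightarrow> near (F \<cdot> x) (F \<cdot> y) e)))"

definition continuous_on_closed_unit :: "tm \<Rightarrow> tm \<Rightarrow> fm" where
  "continuous_on_closed_unit D F =
     (closed_subset_unit D \<^bold>\<and> real_function_on is_real F \<^bold>\<and> continuous_on_closed D F)"

definition Real_bounded :: fm where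
  "Real_bounded = (\<^bold>\<forall>F\<^bold>:T1 \<rightarrow> T1. \<^bold>\<forall>D\<^bold>:T1 \<rightarrow> T1.
     continuous_on_closed_unit D F \<^bold>\<longrightarrow> bounded_on (in_closed D) F)"

definition Real_uniform :: fm where
  "Real_uniform = (\<^bold>\<forall>F\<^bold>:T1 \<rightarrow> T1. \<^bold>\<forall>D\<^bold>:T1 \<rightarrow> T1.
     continuous_on_closed_unit D F \<^bold>\<longrightarrow> uniformly_continuous_on_closed D F)"

text \<open>Without the restriction to nonempty sets, the maximum principle would be refutable.\<close>

definition Real_maximum :: fm where
  "Real_maximum = (\<^bold>\<forall>F\<^bold>:T1 \<rightarrow> T1. \<^bold>\<forall>D\<^bold>:T1 \<rightarrow> T1.
     continuous_on_closed_unit D F \<^bold>\<and> (\<^bold>\<exists>x\<^bold>:T1. in_closed D x) \<^bold>\<longrightarrow>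
     (\<^bold>\<exists>x\<^bold>:T1. in_closed D x \<^bold>\<and>
        (\<^bold>\<forall>y\<^bold>:T1. in_closed D y \<^bold>\<longrightarrow> real (F \<cdot> y) \<le>\<^sub>R real (F \<cdot> x))))"

text \<open>\<open>s\<close> is the sequence of partial sums of \<open>\<Sum>\<^sub>i c\<^sub>i x\<^sup>i\<close>, with \<open>w\<close> the sequence of powers
  of \<open>x\<close>; \<open>s \<cdot> d\<close> is the value at \<open>x\<close> of the polynomial with real coefficients
  \<open>c\<^sub>0, \<dots>, c\<^sub>d\<close>.\<close>

definition poly_sums :: "tm \<Rightarrow> tm \<Rightarrow> tm \<Rightarrow> tm \<Rightarrow> fm" where
  "poly_sums c x w s =
     ((\<^bold>\<forall>i\<^bold>:N. is_real (w \<cdot> i) \<^bold>\<and> is_real (s \<cdot> i)) \<^bold>\<and>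
      real (w \<cdot> \<^bold>0) =\<^sub>R real_of_nat \<^bold>1 \<^bold>\<and>
      real (s \<cdot> \<^bold>0) =\<^sub>R real (c \<cdot> \<^bold>0) \<^bold>\<and>
      (\<^bold>\<forall>i\<^bold>:N. real (w \<cdot> (i \<^bold>+ \<^bold>1)) =\<^sub>R real (w \<cdot> i) *\<^sub>R real x) \<^bold>\<and>
      (\<^bold>\<forall>i\<^bold>:N. real (s \<cdot> (i \<^bold>+ \<^bold>1)) =\<^sub>R
         real (s \<cdot> i) +\<^sub>R real (c \<cdot> (i \<^bold>+ \<^bold>1)) *\<^sub>R real (w \<cdot> (i \<^bold>+ \<^bold>1))))"

definition Real_polynomial :: fm where
  "Real_polynomial = (\<^bold>\<forall>F\<^bold>:T1 \<rightarrow> T1. \<^bold>\<forall>D\<^bold>:T1 \<rightarrow> T1. \<^bold>\<forall>e\<^bold>:T1.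
     continuous_on_closed_unit D F \<^bold>\<and> is_real e \<^bold>\<and> real_of_nat \<^bold>0 <\<^sub>R real e \<^bold>\<longrightarrow>
     (\<^bold>\<exists>c\<^bold>:N \<rightarrow> T1. \<^bold>\<exists>d\<^bold>:N. (\<^bold>\<forall>i\<^bold>:N. is_real (c \<cdot> i)) \<^bold>\<and>
        (\<^bold>\<forall>x\<^bold>:T1. in_closed D x \<^bold>\<longrightarrow>
           (\<^bold>\<exists>w\<^bold>:N \<rightarrow> T1. \<^bold>\<exists>s\<^bold>:N \<rightarrow> T1. poly_sums c x w s \<^bold>\<and>
              real_abs (real (s \<cdot> d) -\<^sub>R real (F \<cdot> x)) <\<^sub>R real e))))"

end

theory Submission
  imports Defs "HOL-Library.Countable" "HOL-Computational_Algebra.Fraction_Field"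
begin

text \<open>By completeness of the calculus, a failure of one of the implications yields a term model of
  \<open>RCA\<^sub>0\<^sup>\<omega>\<close> in which the principle holds and \<open>HBC\<close> fails, so it suffices to derive \<open>HBC\<close> from the
  principle inside an arbitrary model. Its real numbers are compared inside an ultrapower of its
  rational numbers, an ordered field in which every fast converging sequence has a value.

  Given a countable cover of a closed set \<open>C\<close>, there is a continuous function \<open>H\<close> that is positive on
  \<open>C\<close> and has a positive lower bound there if and only if finitely many of the intervals suffice;
  adding the function that represents the complement of \<open>C\<close> yields a \<open>U\<close> that is positive everywhere.
  Boundedness of \<open>1 / U\<close> on \<open>C\<close> gives a finite subcover, and so does a maximum or a polynomial
  approximation of \<open>1 / U\<close>. The other principles need a case distinction. If the functional \<open>E\<^sup>2\<close>
  that decides \<open>\<exists>n. f n = 0\<close> does not exist, then, by Grilliot's trick, all functionals are continuous,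
  and it suffices to consider functions on all of \<open>[0,1]\<close> or \<open>2\<^sup>\<nat>\<close>. If it exists, membership in \<open>C\<close> is
  decidable, so that functions can be redefined outside \<open>C\<close>, and closed subsets of \<open>2\<^sup>\<nat>\<close> can be
  transferred to closed subsets of \<open>[0,1]\<close>. Boundedness on subsets of \<open>2\<^sup>\<nat>\<close> follows from uniform
  continuity by interleaving \<open>f\<close> with a sequence that has to be read at position \<open>F f\<close>.\<close>

section \<open>Completeness of the calculus\<close>

text \<open>Only quantifier-free induction is available, so inductions inside a model run on
  decidable statements: existence claims become explicit functions, and reals are replaced by
  rational approximations with explicit bounds.

  The ultrapower is needed because a model has no field of reals on which linear arithmetic works,
  equality of reals being a universal statement. There a real becomes the class of its
  approximations; equal reals have classes closer than every \<open>Pw n\<close>, and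
  \<open>x < y\<close> means a gap of some \<open>Pw n\<close>.

  The distinction on \<open>E2\<close> is forced by closed sets being given negatively: without
  deciding membership a function cannot be redefined off the set, and where membership is decidable,
  functionals obtained from choice need not be continuous.

  Binary sequences are summed with weights \<open>(1 - \<rho>) * \<rho>^n\<close>. For \<rho> = 2/3
  the two halves overlap, so all of [0,1] is reached; for \<rho> = 1/4 they are separated by a gap,
  so digits can be read off from approximations.\<close>

lemma wt_substt: "wt u \<Longrightarrow> wt s \<Longrightarrow> ty_of s = \<sigma> \<Longrightarrow> wt (substt x \<sigma> s u) \<and> ty_of (substt x \<sigma> s u) = ty_of u"
  by (induction u) (auto split: ty.splits)

lemma wf_subst: "wf \<phi> \<Longrightarrow> wt s \<Longrightarrow> ty_of s = \<sigma> \<Longrightarrow> wf (subst x \<sigma> s \<phi>)"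
  by (induction \<phi>) (auto simp: wt_substt)

lemma wf_Neg [simp]: "wf (Neg \<phi>) \<longleftrightarrow> wf \<phi>" by (simp add: Neg_def)

lemma derivable_wf: "T \<turnstile> \<phi> \<Longrightarrow> wf \<phi>"
  by (induction rule: derivable.induct) (auto simp: wf_subst)

section \<open>Derivations from hypotheses and the deduction theorem\<close>

inductive entails :: "fm set \<Rightarrow> fm set \<Rightarrow> fm \<Rightarrow> bool" for T \<Gamma> where
  base: "T \<turnstile> \<phi> \<Longrightarrow> entails T \<Gamma> \<phi>"
| hyp: "\<phi> \<in> \<Gamma> \<Longrightarrow> wf \<phi> \<Longrightarrow> entails T \<Gamma> \<phi>"
| mp: "entails T \<Gamma> (\<phi> \<^bold>\<longrightarrow> \<psi>) \<Longrightarrow> entails T \<Gamma> \<phi> \<Longrightarrow> entails T \<Gamma> \<psi>"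

lemma entails_wf: "entails T \<Gamma> \<phi> \<Longrightarrow> wf \<phi>"
  by (induction rule: entails.induct) (auto dest: derivable_wf)

lemma entails_mono: "entails T \<Gamma> \<phi> \<Longrightarrow> \<Gamma> \<subseteq> \<Delta> \<Longrightarrow> entails T \<Delta> \<phi>"
  by (induction rule: entails.induct) (auto intro: entails.intros)

lemma entails_empty: "entails T {} \<phi> \<Longrightarrow> T \<turnstile> \<phi>"
  by (induction rule: entails.induct) (auto intro: derivable.Modus_ponens)

lemma entails_finite: "entails T \<Gamma> \<phi> \<Longrightarrow> \<exists>\<Delta>. finite \<Delta> \<and> \<Delta> \<subseteq> \<Gamma> \<and> entails T \<Delta> \<phi>"
proof (induction rule: entails.induct)
  case (base \<phi>) then show ?case by (intro exI[of _ "{}"]) (auto intro: entails.base)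
next
  case (hyp \<phi>) then show ?case by (intro exI[of _ "{\<phi>}"]) (auto intro: entails.hyp)
next
  case (mp \<phi> \<psi>)
  then obtain \<Delta> \<Delta>' where "finite \<Delta>" "\<Delta> \<subseteq> \<Gamma>" "entails T \<Delta> (\<phi> \<^bold>\<longrightarrow> \<psi>)" "finite \<Delta>'" "\<Delta>' \<subseteq> \<Gamma>" "entails T \<Delta>' \<phi>" by blast
  then show ?case
    by (intro exI[of _ "\<Delta> \<union> \<Delta>'"]) (auto intro: entails.mp entails_mono)
qed

lemma entails_weaken: "entails T \<Gamma> \<psi> \<Longrightarrow> wf \<phi> \<Longrightarrow> entails T \<Gamma> (\<phi> \<^bold>\<longrightarrow> \<psi>)"
  by (meson base derivable.Weakening entails.mp entails_wf)

lemma entails_refl: "wf \<phi> \<Longrightarrow> entails T \<Gamma> (\<phi> \<^bold>\<longrightarrow> \<phi>)"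
  by (meson base derivable.Weakening derivable.Distrib entails.mp wf.simps)

lemma derivable_refl: "wf \<phi> \<Longrightarrow> T \<turnstile> (\<phi> \<^bold>\<longrightarrow> \<phi>)"
  by (rule entails_empty[OF entails_refl])

lemma not_both: "\<not> entails T \<Gamma> Fls \<Longrightarrow> wf \<phi> \<Longrightarrow> Neg \<phi> \<in> \<Gamma> \<Longrightarrow> \<phi> \<notin> \<Gamma>"
  unfolding Neg_def by (auto dest!: entails.hyp[of _ \<Gamma> T] intro: entails.mp)

text \<open>Holds without a condition on variables, because \<open>entails\<close> closes the
  hypotheses under modus ponens only; generalisation stays inside
  \<open>T \<turnstile> \<phi>\<close>, where no hypothesis is in play.\<close>

lemma deduct: "entails T (insert \<gamma> \<Gamma>) \<phi> \<Longrightarrow> wf \<gamma> \<Longrightarrow> entails T \<Gamma> (\<gamma> \<^bold>\<longrightarrow> \<phi>)"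
proof (induction rule: entails.induct)
  case (base \<phi>) then show ?case by (intro entails_weaken) (auto intro: entails.base)
next
  case (hyp \<phi>) then show ?case by (cases "\<phi> = \<gamma>") (auto intro: entails_refl entails_weaken entails.hyp)
next
  case (mp \<phi> \<psi>)
  have "wf \<phi>" "wf \<psi>" using entails_wf[OF mp.hyps(1)] by auto
  then show ?case by (meson mp.IH mp.prems base derivable.Distrib entails.mp)
qed

lemma undeduct: "entails T \<Gamma> (\<gamma> \<^bold>\<longrightarrow> \<phi>) \<Longrightarrow> entails T (insert \<gamma> \<Gamma>) \<phi>"
  by (meson entails.hyp entails.mp entails_mono entails_wf insertI1 subset_insertI wf.simps(4))

lemma entails_notnot: "entails T \<Gamma> (Neg (Neg \<phi>)) \<Longrightarrow> entails T \<Gamma> \<phi>"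
  by (meson base derivable.Double_neg entails.mp entails_wf wf_Neg)

lemma entails_Fls: "entails T \<Gamma> Fls \<Longrightarrow> wf \<phi> \<Longrightarrow> entails T \<Gamma> \<phi>"
  by (metis entails_notnot entails_weaken Neg_def wf_Neg)

lemma entails_trans: "entails T \<Gamma> (\<phi> \<^bold>\<longrightarrow> \<psi>) \<Longrightarrow> entails T \<Gamma> (\<psi> \<^bold>\<longrightarrow> \<chi>) \<Longrightarrow> entails T \<Gamma> (\<phi> \<^bold>\<longrightarrow> \<chi>)"
  by (meson deduct entails.mp entails_mono entails_wf subset_insertI undeduct wf.simps(4))

text \<open>The hypotheses are finitely many, so they can be moved to the left of the arrow one by
  one; \<open>Shift\<close> then lets the quantifier pass each of them, as its variable is not free
  there.\<close>

lemma entails_gen: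
  assumes "finite \<Gamma>" "\<And>\<gamma>. \<gamma> \<in> \<Gamma> \<Longrightarrow> wf \<gamma> \<and> (x, \<sigma>) \<notin> fv \<gamma>" "entails T \<Gamma> \<phi>"
  shows "entails T \<Gamma> (Forall x \<sigma> \<phi>)"
  using assms
proof (induction arbitrary: \<phi> rule: finite_induct)
  case empty then show ?case by (blast intro: base entails_empty derivable.Generalisation)
next
  case (insert \<gamma> \<Gamma>)
  then have "entails T \<Gamma> (\<gamma> \<^bold>\<longrightarrow> \<phi>)" by (auto intro: deduct)
  then have "entails T \<Gamma> (Forall x \<sigma> (\<gamma> \<^bold>\<longrightarrow> \<phi>))" using insert by auto
  moreover have "wf \<phi>" using insert.prems by (auto dest: entails_wf)
  ultimately have "entails T \<Gamma> (\<gamma> \<^bold>\<longrightarrow> Forall x \<sigma> \<phi>)"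
    using insert.prems by (meson base derivable.Shift entails.mp insertI1)
  then show ?case by (rule undeduct)
qed

lemma fvt_idxt: "(x, \<sigma>) \<in> fvt t \<Longrightarrow> x < idxt t" by (induction t) auto
lemma fv_idx: "(x, \<sigma>) \<in> fv \<phi> \<Longrightarrow> x < idx \<phi>" by (induction \<phi>) (auto dest: fvt_idxt)

lemma substt_fresh: "(x, \<sigma>) \<notin> fvt t \<Longrightarrow> substt x \<sigma> s t = t" by (induction t) auto
lemma subst_fresh: "(x, \<sigma>) \<notin> fv \<phi> \<Longrightarrow> subst x \<sigma> s \<phi> = \<phi>"
  by (induction \<phi>) (auto simp: substt_fresh)

lemma free_for_fresh_var: "idx \<phi> \<le> y \<Longrightarrow> free_for (Var y \<tau>) x \<sigma> \<phi>"
  by (induction \<phi>) auto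

lemma substt_back: "idxt t \<le> y \<Longrightarrow> substt y \<sigma> (Var x \<sigma>) (substt x \<sigma> (Var y \<sigma>) t) = t"
  by (induction t) auto
lemma subst_back: "idx \<phi> \<le> y \<Longrightarrow> subst y \<sigma> (Var x \<sigma>) (subst x \<sigma> (Var y \<sigma>) \<phi>) = \<phi>"
  by (induction \<phi>) (auto simp: substt_back intro!: subst_fresh dest: fv_idx fvt_idxt)

lemma fvt_substt: "fvt (substt x \<sigma> s t) \<subseteq> (fvt t - {(x, \<sigma>)}) \<union> fvt s"
  by (induction t) auto
lemma fv_subst: "fv (subst x \<sigma> s \<phi>) \<subseteq> (fv \<phi> - {(x, \<sigma>)}) \<union> fvt s"
proof (induction \<phi>)
  case (Eq t u) then show ?case using fvt_substt[of x \<sigma> s] by fastforce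
next
  case (Lt t u) then show ?case using fvt_substt[of x \<sigma> s] by fastforce
qed auto

text \<open>Since \<open>y\<close> is beyond every index of \<open>\<phi>\<close>, it occurs in the
  substituted formula only where \<open>x\<close> was free, hence never under a quantifier for
  \<open>x\<close>.\<close>

lemma free_for_back: "idx \<phi> \<le> y \<Longrightarrow> free_for (Var x \<sigma>) y \<sigma> (subst x \<sigma> (Var y \<sigma>) \<phi>)"
proof (induction \<phi>)
  case (Forall z \<tau> \<phi>)
  show ?case
  proof (cases "z = x \<and> \<tau> = \<sigma>")
    case True
    then show ?thesis using Forall.prems by (auto dest: fv_idx)
  next
    case False then show ?thesis using Forall by auto
  qed
qed auto

text \<open>The calculus has no rule for renaming bound variables; it follows from
  \<open>Inst\<close>, \<open>Generalisation\<close> and \<open>Shift\<close> once the new variable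
  is beyond every index of the formula.\<close>

lemma rename_Forall:
  assumes "wf \<phi>" "idx \<phi> \<le> y"
  shows "T \<turnstile> (Forall x \<sigma> \<phi> \<^bold>\<longrightarrow> Forall y \<sigma> (subst x \<sigma> (Var y \<sigma>) \<phi>))"
    and "T \<turnstile> (Forall y \<sigma> (subst x \<sigma> (Var y \<sigma>) \<phi>) \<^bold>\<longrightarrow> Forall x \<sigma> \<phi>)"
proof -
  let ?\<psi> = "subst x \<sigma> (Var y \<sigma>) \<phi>"
  have w: "wf ?\<psi>" using assms by (simp add: wf_subst)
  have "T \<turnstile> (Forall x \<sigma> \<phi> \<^bold>\<longrightarrow> ?\<psi>)"
    using assms by (intro derivable.Inst) (auto intro: free_for_fresh_var)
  then have "T \<turnstile> Forall y \<sigma> (Forall x \<sigma> \<phi> \<^bold>\<longrightarrow> ?\<psi>)" by (rule derivable.Generalisation)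
  moreover have "(y, \<sigma>) \<notin> fv (Forall x \<sigma> \<phi>)" using assms by (auto dest: fv_idx)
  ultimately show "T \<turnstile> (Forall x \<sigma> \<phi> \<^bold>\<longrightarrow> Forall y \<sigma> ?\<psi>)"
    using assms w by (meson derivable.Shift derivable.Modus_ponens wf.simps)
  have "T \<turnstile> (Forall y \<sigma> ?\<psi> \<^bold>\<longrightarrow> subst y \<sigma> (Var x \<sigma>) ?\<psi>)"
    using w assms by (intro derivable.Inst) (auto intro: free_for_back)
  then have "T \<turnstile> Forall x \<sigma> (Forall y \<sigma> ?\<psi> \<^bold>\<longrightarrow> \<phi>)"
    using assms by (simp add: subst_back derivable.Generalisation)
  moreover have "(x, \<sigma>) \<notin> fv (Forall y \<sigma> ?\<psi>)" using fv_subst[of x \<sigma> "Var y \<sigma>" \<phi>] by auto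
  ultimately show "T \<turnstile> (Forall y \<sigma> ?\<psi> \<^bold>\<longrightarrow> Forall x \<sigma> \<phi>)"
    using assms w by (meson derivable.Shift derivable.Modus_ponens wf.simps)
qed

lemma derivable_Forall_mono:
  assumes "T \<turnstile> (\<phi> \<^bold>\<longrightarrow> \<psi>)" shows "T \<turnstile> (Forall x \<sigma> \<phi> \<^bold>\<longrightarrow> Forall x \<sigma> \<psi>)"
proof -
  have w: "wf \<phi>" "wf \<psi>" using derivable_wf[OF assms] by auto
  have ff: "free_for (Var x \<sigma>) x \<sigma> \<chi>" for \<chi> by (induction \<chi>) auto
  have sst: "substt x \<sigma> (Var x \<sigma>) t = t" for t by (induction t) auto
  have ss: "subst x \<sigma> (Var x \<sigma>) \<chi> = \<chi>" for \<chi> by (induction \<chi>) (auto simp: sst)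
  have "T \<turnstile> (Forall x \<sigma> \<phi> \<^bold>\<longrightarrow> \<phi>)"
    using derivable.Inst[of \<phi> "Var x \<sigma>" \<sigma> x T] w ff ss by simp
  then have "T \<turnstile> (Forall x \<sigma> \<phi> \<^bold>\<longrightarrow> \<psi>)"
    using assms by (meson base entails_empty entails_trans)
  then have "T \<turnstile> Forall x \<sigma> (Forall x \<sigma> \<phi> \<^bold>\<longrightarrow> \<psi>)" by (rule derivable.Generalisation)
  moreover have "T \<turnstile> (Forall x \<sigma> (Forall x \<sigma> \<phi> \<^bold>\<longrightarrow> \<psi>) \<^bold>\<longrightarrow> Forall x \<sigma> \<phi> \<^bold>\<longrightarrow> Forall x \<sigma> \<psi>)"
    using w by (intro derivable.Shift) auto
  ultimately show ?thesis by (blast intro: derivable.Modus_ponens)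
qed

section \<open>The term model: terms as elements, valuations as substitutions\<close>

primrec sub :: "(nat \<times> ty \<Rightarrow> tm) \<Rightarrow> tm \<Rightarrow> tm" where
  "sub e (Var x \<sigma>) = e (x, \<sigma>)"
| "sub e (Con c) = Con c"
| "sub e (t \<cdot> u) = sub e t \<cdot> sub e u"

text \<open>The carriers consist of all well-typed terms, open ones included: variables play the
  part of Henkin constants, and no quotient by provable equality is taken at this stage.\<close>

definition Dom :: "ty \<Rightarrow> tm set" where "Dom \<sigma> = {t. wt t \<and> ty_of t = \<sigma>}"

definition typed :: "(nat \<times> ty \<Rightarrow> tm) \<Rightarrow> bool" where "typed e \<longleftrightarrow> (\<forall>x \<sigma>. e (x, \<sigma>) \<in> Dom \<sigma>)"

lemma typed_Var [simp]: "typed (\<lambda>(x, \<sigma>). Var x \<sigma>)" by (simp add: typed_def Dom_def)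
lemma typed_upd [simp]: "typed e \<Longrightarrow> s \<in> Dom \<sigma> \<Longrightarrow> typed (e((x, \<sigma>) := s))" by (simp add: typed_def)

lemma wt_sub: "typed e \<Longrightarrow> wt t \<Longrightarrow> wt (sub e t) \<and> ty_of (sub e t) = ty_of t"
  by (induction t) (auto simp: typed_def Dom_def split: ty.splits)

lemma sub_dom: "typed e \<Longrightarrow> wt t \<Longrightarrow> ty_of t = \<sigma> \<Longrightarrow> sub e t \<in> Dom \<sigma>"
  by (auto simp: Dom_def wt_sub)

lemma sub_Var: "sub (\<lambda>(x, \<sigma>). Var x \<sigma>) t = t" by (induction t) auto

lemma sub_cong: "(\<And>x \<sigma>. (x, \<sigma>) \<in> fvt t \<Longrightarrow> e (x, \<sigma>) = e' (x, \<sigma>)) \<Longrightarrow> sub e t = sub e' t"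
  by (induction t) auto

lemma sub_substt: "sub e (substt x \<sigma> s t) = sub (e((x, \<sigma>) := sub e s)) t"
  by (induction t) auto

text \<open>Equality is treated like any other relation symbol: atoms are looked up in
  \<open>\<Gamma>\<close>. That it is a congruence comes later, from the axioms.\<close>

primrec ev :: "fm set \<Rightarrow> (nat \<times> ty \<Rightarrow> tm) \<Rightarrow> fm \<Rightarrow> bool" where
  "ev \<Gamma> e (t \<^bold>= u) \<longleftrightarrow> (sub e t \<^bold>= sub e u) \<in> \<Gamma>"
| "ev \<Gamma> e (t \<^bold>< u) \<longleftrightarrow> (sub e t \<^bold>< sub e u) \<in> \<Gamma>"
| "ev \<Gamma> e Fls \<longleftrightarrow> False"
| "ev \<Gamma> e (\<phi> \<^bold>\<longrightarrow> \<psi>) \<longleftrightarrow> (ev \<Gamma> e \<phi> \<longrightarrow> ev \<Gamma> e \<psi>)"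
| "ev \<Gamma> e (Forall x \<sigma> \<phi>) \<longleftrightarrow> (\<forall>s\<in>Dom \<sigma>. ev \<Gamma> (e((x, \<sigma>) := s)) \<phi>)"

lemma ev_cong: "(\<And>x \<sigma>. (x, \<sigma>) \<in> fv \<phi> \<Longrightarrow> e (x, \<sigma>) = e' (x, \<sigma>)) \<Longrightarrow> ev \<Gamma> e \<phi> = ev \<Gamma> e' \<phi>"
proof (induction \<phi> arbitrary: e e')
  case (Eq t u)
  then show ?case using sub_cong[of t e e'] sub_cong[of u e e'] by auto
next
  case (Lt t u)
  then show ?case using sub_cong[of t e e'] sub_cong[of u e e'] by auto
next
  case (Forall x \<sigma> \<phi>)
  have "ev \<Gamma> (e((x, \<sigma>) := s)) \<phi> = ev \<Gamma> (e'((x, \<sigma>) := s)) \<phi>" for s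
    by (rule Forall.IH) (use Forall.prems in auto)
  then show ?case by simp
next
  case (Imp \<phi> \<psi>)
  then show ?case by (metis UnCI ev.simps(4) fv.simps(4))
qed auto

lemma ev_subst: "free_for s x \<sigma> \<phi> \<Longrightarrow> ev \<Gamma> e (subst x \<sigma> s \<phi>) = ev \<Gamma> (e((x, \<sigma>) := sub e s)) \<phi>"
proof (induction \<phi> arbitrary: e)
  case (Forall y \<tau> \<phi>)
  show ?case
  proof (cases "(x, \<sigma>) \<notin> fv (Forall y \<tau> \<phi>)")
    case True
    then show ?thesis unfolding subst_fresh[OF True] by (intro ev_cong) auto
  next
    case False
    then have ff: "(y, \<tau>) \<notin> fvt s" "free_for s x \<sigma> \<phi>" "\<not> (y = x \<and> \<tau> = \<sigma>)" using Forall.prems by auto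
    have "sub (e((y, \<tau>) := r)) s = sub e s" for r by (rule sub_cong) (use ff in auto)
    moreover have "e((y, \<tau>) := r, (x, \<sigma>) := sub e s) = e((x, \<sigma>) := sub e s, (y, \<tau>) := r)" for r
      using ff by (intro fun_upd_twist) auto
    ultimately show ?thesis using ff(2,3) Forall.IH by (simp del: fun_upd_apply)
  qed
qed (auto simp: sub_substt)

primrec bv :: "fm \<Rightarrow> (nat \<times> ty) set" where
  "bv (t \<^bold>= u) = {}"
| "bv (t \<^bold>< u) = {}"
| "bv Fls = {}"
| "bv (\<phi> \<^bold>\<longrightarrow> \<psi>) = bv \<phi> \<union> bv \<psi>"
| "bv (Forall x \<sigma> \<phi>) = insert (x, \<sigma>) (bv \<phi>)"

primrec complexity :: "fm \<Rightarrow> nat" where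
  "complexity (t \<^bold>= u) = 0"
| "complexity (t \<^bold>< u) = 0"
| "complexity Fls = 0"
| "complexity (\<phi> \<^bold>\<longrightarrow> \<psi>) = Suc (complexity \<phi> + complexity \<psi>)"
| "complexity (Forall x \<sigma> \<phi>) = Suc (complexity \<phi>)"

lemma complexity_subst [simp]: "complexity (subst x \<sigma> s \<phi>) = complexity \<phi>" by (induction \<phi>) auto
lemma bv_subst: "bv (subst x \<sigma> s \<phi>) = bv \<phi>" by (induction \<phi>) auto
lemma free_for_bv: "bv \<phi> \<inter> fvt s = {} \<Longrightarrow> free_for s x \<sigma> \<phi>" by (induction \<phi>) auto
lemma finite_fvt [simp]: "finite (fvt t)" by (induction t) auto

text \<open>Substitution does not rename, so an instance by a term \<open>s\<close> may be illegal
  for the formula at hand. A variant with bound variables outside a given finite set repairs this.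
  It has to be interchangeable with the formula in three respects: provably, under
  \<open>ev\<close>, and for the induction measure \<open>complexity\<close>.\<close>

lemma ex_variant:
  assumes "finite A" "wf \<phi>"
  shows "\<exists>\<phi>'. wf \<phi>' \<and> complexity \<phi>' = complexity \<phi> \<and> bv \<phi>' \<inter> A = {} \<and> (T \<turnstile> (\<phi> \<^bold>\<longrightarrow> \<phi>')) \<and> (T \<turnstile> (\<phi>' \<^bold>\<longrightarrow> \<phi>)) \<and>
    (\<forall>e. ev \<Gamma> e \<phi>' = ev \<Gamma> e \<phi>)"
  using assms(2)
proof (induction \<phi>)
  case (Imp \<phi> \<psi>)
  then obtain \<phi>' \<psi>' where *: "wf \<phi>'" "complexity \<phi>' = complexity \<phi>" "bv \<phi>' \<inter> A = {}" "T \<turnstile> (\<phi> \<^bold>\<longrightarrow> \<phi>')" "T \<turnstile> (\<phi>' \<^bold>\<longrightarrow> \<phi>)"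
    "\<forall>e. ev \<Gamma> e \<phi>' = ev \<Gamma> e \<phi>" "wf \<psi>'" "complexity \<psi>' = complexity \<psi>" "bv \<psi>' \<inter> A = {}" "T \<turnstile> (\<psi> \<^bold>\<longrightarrow> \<psi>')" "T \<turnstile> (\<psi>' \<^bold>\<longrightarrow> \<psi>)"
    "\<forall>e. ev \<Gamma> e \<psi>' = ev \<Gamma> e \<psi>" by auto
  have imp: "T \<turnstile> ((\<alpha> \<^bold>\<longrightarrow> \<beta>) \<^bold>\<longrightarrow> (\<alpha>' \<^bold>\<longrightarrow> \<beta>'))" if "T \<turnstile> (\<alpha>' \<^bold>\<longrightarrow> \<alpha>)" "T \<turnstile> (\<beta> \<^bold>\<longrightarrow> \<beta>')" for \<alpha> \<beta> \<alpha>' \<beta>'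
  proof -
    have "entails T {\<alpha> \<^bold>\<longrightarrow> \<beta>} (\<alpha>' \<^bold>\<longrightarrow> \<beta>')"
      using that derivable_wf[OF that(1)] derivable_wf[OF that(2)]
      by (meson base entails.hyp entails_trans insertI1 wf.simps(4))
    then show ?thesis
      using that derivable_wf[OF that(1)] derivable_wf[OF that(2)] by (auto intro!: entails_empty deduct)
  qed
  show ?case using * imp by (intro exI[of _ "\<phi>' \<^bold>\<longrightarrow> \<psi>'"]) auto
next
  case (Forall z \<tau> \<phi>)
  then obtain \<phi>' where *: "wf \<phi>'" "complexity \<phi>' = complexity \<phi>" "bv \<phi>' \<inter> A = {}" "T \<turnstile> (\<phi> \<^bold>\<longrightarrow> \<phi>')" "T \<turnstile> (\<phi>' \<^bold>\<longrightarrow> \<phi>)"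
    "\<forall>e. ev \<Gamma> e \<phi>' = ev \<Gamma> e \<phi>" by auto
  obtain m where m: "\<forall>x\<in>fst ` A. x < m" using assms(1) by (meson finite_imageI finite_nat_set_iff_bounded)
  define y where "y = max m (idx \<phi>')"
  have y: "idx \<phi>' \<le> y" "(y, \<tau>) \<notin> A" using m by (force simp: y_def)+
  let ?\<psi> = "subst z \<tau> (Var y \<tau>) \<phi>'"
  note trans = entails_empty[OF entails_trans[OF base base]]
  have "ev \<Gamma> e (Forall y \<tau> ?\<psi>) = ev \<Gamma> e (Forall z \<tau> \<phi>)" for e
  proof -
    have "ev \<Gamma> ((e((y, \<tau>) := r))((z, \<tau>) := r)) \<phi>' = ev \<Gamma> (e((z, \<tau>) := r)) \<phi>'" for r
      by (rule ev_cong) (use y in \<open>auto dest: fv_idx\<close>)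
    then show ?thesis using * y by (simp add: ev_subst free_for_fresh_var)
  qed
  moreover have "T \<turnstile> (Forall z \<tau> \<phi> \<^bold>\<longrightarrow> Forall y \<tau> ?\<psi>)"
    by (rule trans[OF derivable_Forall_mono rename_Forall(1)]) (use * y in auto)
  moreover have "T \<turnstile> (Forall y \<tau> ?\<psi> \<^bold>\<longrightarrow> Forall z \<tau> \<phi>)"
    by (rule trans[OF rename_Forall(2) derivable_Forall_mono]) (use * y in auto)
  ultimately show ?case
    using * y by (intro exI[of _ "Forall y \<tau> ?\<psi>"]) (auto simp: wf_subst bv_subst)
next
  case (Eq t u) then show ?case by (intro exI[of _ "t \<^bold>= u"]) (auto intro!: derivable_refl)
next
  case (Lt t u) then show ?case by (intro exI[of _ "t \<^bold>< u"]) (auto intro!: derivable_refl)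
next
  case Fls then show ?case by (intro exI[of _ "Fls"]) (auto intro!: derivable_refl)
qed

text \<open>Counterexamples to universal formulas are variables rather than new constants;
  \<open>y \<ge> idx \<phi>\<close> makes the substitution capture-free.\<close>

definition henkin :: "fm set \<Rightarrow> fm set \<Rightarrow> bool" where
  "henkin T \<Gamma> \<longleftrightarrow> \<not> entails T \<Gamma> Fls \<and> (\<forall>\<phi>. wf \<phi> \<longrightarrow> \<phi> \<in> \<Gamma> \<or> Neg \<phi> \<in> \<Gamma>) \<and>
    (\<forall>x \<sigma> \<phi>. wf \<phi> \<longrightarrow> Forall x \<sigma> \<phi> \<notin> \<Gamma> \<longrightarrow> (\<exists>y\<ge>idx \<phi>. subst x \<sigma> (Var y \<sigma>) \<phi> \<notin> \<Gamma>))"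

lemma henkin_entails:
  assumes "henkin T \<Gamma>" "wf \<phi>"
  shows "\<phi> \<in> \<Gamma> \<longleftrightarrow> entails T \<Gamma> \<phi>"
proof
  show "\<phi> \<in> \<Gamma> \<Longrightarrow> entails T \<Gamma> \<phi>" using assms by (auto intro: entails.hyp)
  assume "entails T \<Gamma> \<phi>"
  then have "Neg \<phi> \<notin> \<Gamma>"
    using assms unfolding henkin_def by (metis Neg_def entails.hyp entails.mp wf_Neg)
  then show "\<phi> \<in> \<Gamma>" using assms unfolding henkin_def by auto
qed

lemma henkin_Imp:
  assumes "henkin T \<Gamma>" "wf \<phi>" "wf \<psi>"
  shows "(\<phi> \<^bold>\<longrightarrow> \<psi>) \<in> \<Gamma> \<longleftrightarrow> (\<phi> \<in> \<Gamma> \<longrightarrow> \<psi> \<in> \<Gamma>)"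
proof -
  have "entails T \<Gamma> (\<phi> \<^bold>\<longrightarrow> \<psi>)" if "Neg \<phi> \<in> \<Gamma>"
  proof -
    have "entails T (insert \<phi> \<Gamma>) Fls" using that assms by (auto simp: Neg_def intro!: undeduct entails.hyp)
    then show ?thesis using assms by (auto intro: deduct entails_Fls)
  qed
  moreover have "\<psi> \<in> \<Gamma> \<Longrightarrow> entails T \<Gamma> (\<phi> \<^bold>\<longrightarrow> \<psi>)" using assms by (auto intro: entails_weaken entails.hyp)
  moreover have "\<phi> \<in> \<Gamma> \<or> Neg \<phi> \<in> \<Gamma>" using assms by (auto simp: henkin_def)
  ultimately show ?thesis
    using henkin_entails[OF assms(1)] assms by (metis entails.mp wf.simps(4))
qed

text \<open>Induction on \<open>complexity\<close>, because an instance
  \<open>subst x \<sigma> s \<psi>\<close> is no subformula. From truth to membership the Henkin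
  variable is used; from membership to truth an arbitrary term has to be substituted, which is where
  a variant of the formula is needed.\<close>

lemma truth:
  assumes "henkin T \<Gamma>" "wf \<phi>"
  shows "ev \<Gamma> (\<lambda>(x, \<sigma>). Var x \<sigma>) \<phi> \<longleftrightarrow> \<phi> \<in> \<Gamma>"
  using assms(2)
proof (induction "complexity \<phi>" arbitrary: \<phi> rule: less_induct)
  case less
  show ?case
  proof (cases \<phi>)
    case (Forall x \<sigma> \<psi>)
    let ?V = "\<lambda>(x, \<sigma>). Var x \<sigma>"
    have w: "wf \<psi>" using less.prems Forall by simp
    have "\<phi> \<in> \<Gamma>" if ev: "ev \<Gamma> ?V \<phi>"
    proof (rule ccontr)
      assume "\<phi> \<notin> \<Gamma>"
      then obtain y where y: "y \<ge> idx \<psi>" "subst x \<sigma> (Var y \<sigma>) \<psi> \<notin> \<Gamma>"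
        using assms(1) w Forall unfolding henkin_def by blast
      have "ev \<Gamma> ?V (subst x \<sigma> (Var y \<sigma>) \<psi>)"
        using ev y Forall by (auto simp: ev_subst free_for_fresh_var Dom_def)
      then show False using less.hyps[of "subst x \<sigma> (Var y \<sigma>) \<psi>"] Forall w y by (simp add: wf_subst)
    qed
    moreover have "ev \<Gamma> (?V((x, \<sigma>) := s)) \<psi>" if m: "\<phi> \<in> \<Gamma>" and s: "s \<in> Dom \<sigma>" for s
    proof -
      obtain \<psi>' where *: "wf \<psi>'" "complexity \<psi>' = complexity \<psi>" "bv \<psi>' \<inter> fvt s = {}" "T \<turnstile> (\<psi> \<^bold>\<longrightarrow> \<psi>')"
        "\<forall>e. ev \<Gamma> e \<psi>' = ev \<Gamma> e \<psi>" using ex_variant[OF finite_fvt w] by metis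
      have "entails T \<Gamma> (Forall x \<sigma> \<psi>')"
        using m less.prems Forall by (auto intro: entails.mp[OF base[OF derivable_Forall_mono[OF *(4)]] entails.hyp])
      moreover have "T \<turnstile> (Forall x \<sigma> \<psi>' \<^bold>\<longrightarrow> subst x \<sigma> s \<psi>')"
        using * s by (intro derivable.Inst) (auto simp: Dom_def free_for_bv)
      ultimately have "entails T \<Gamma> (subst x \<sigma> s \<psi>')" by (meson base entails.mp)
      then have "subst x \<sigma> s \<psi>' \<in> \<Gamma>" using henkin_entails[OF assms(1)] entails_wf by blast
      then have "ev \<Gamma> ?V (subst x \<sigma> s \<psi>')"
        using less.hyps[of "subst x \<sigma> s \<psi>'"] * s Forall by (simp add: wf_subst Dom_def)
      then show ?thesis using * by (simp add: ev_subst free_for_bv sub_Var)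
    qed
    ultimately show ?thesis using Forall by auto
  next
    case Fls
    then show ?thesis using assms(1) henkin_entails[OF assms(1), of Fls] by (auto simp: henkin_def)
  next
    case (Imp \<psi> \<chi>)
    then show ?thesis using less henkin_Imp[OF assms(1), of \<psi> \<chi>] by simp
  qed (auto simp: sub_Var)
qed

section \<open>Construction of a Henkin set\<close>

instance ty :: countable by countable_datatype
instance con :: countable by countable_datatype
instance tm :: countable by countable_datatype
instance fm :: countable by countable_datatype

definition fresh_index :: "fm set \<Rightarrow> nat" where
  "fresh_index S = Max (insert 0 (idx ` S))"

lemma fresh_index: "finite S \<Longrightarrow> \<phi> \<in> S \<Longrightarrow> idx \<phi> \<le> fresh_index S"
  by (simp add: fresh_index_def)

text \<open>All stages are finite, so when a universal formula is refuted, a variable beyond all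
  indices in use is available as its counterexample.\<close>

definition extend :: "fm set \<Rightarrow> fm set \<Rightarrow> fm \<Rightarrow> fm set" where
  "extend T S \<phi> = (if \<not> wf \<phi> then S else if \<not> entails T (insert \<phi> S) Fls then insert \<phi> S else insert (Neg \<phi>)
     (case \<phi> of Forall x \<sigma> \<psi> \<Rightarrow> insert (Neg (subst x \<sigma> (Var (fresh_index (insert \<psi> S)) \<sigma>) \<psi>)) S | _ \<Rightarrow> S))"

lemma extend:
  assumes "finite S" "\<And>\<gamma>. \<gamma> \<in> S \<Longrightarrow> wf \<gamma>" "\<not> entails T S Fls"
  shows "finite (extend T S \<phi>)" "\<gamma> \<in> extend T S \<phi> \<Longrightarrow> wf \<gamma>" "\<not> entails T (extend T S \<phi>) Fls" "S \<subseteq> extend T S \<phi>"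
proof -
  show "finite (extend T S \<phi>)" using assms(1) by (auto simp: extend_def split: fm.splits)
  show "\<gamma> \<in> extend T S \<phi> \<Longrightarrow> wf \<gamma>" using assms(2)
    by (auto simp: extend_def intro!: wf_subst split: fm.splits if_splits)
  show "S \<subseteq> extend T S \<phi>" by (auto simp: extend_def split: fm.splits)
  show "\<not> entails T (extend T S \<phi>) Fls"
  proof (cases "wf \<phi> \<and> entails T (insert \<phi> S) Fls")
    case False then show ?thesis using assms(3) by (auto simp: extend_def)
  next
    case True
    then have neg: "entails T S (Neg \<phi>)" unfolding Neg_def by (auto intro: deduct)
    \<comment> \<open>Adding \<open>Neg \<phi>\<close> last is harmless, since \<open>S\<close>
      already entails it.\<close>
    have *: "\<not> entails T (insert (Neg \<phi>) S') Fls" if "S \<subseteq> S'" "\<not> entails T S' Fls" for S'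
    proof
      assume "entails T (insert (Neg \<phi>) S') Fls"
      then have "entails T S' (Neg (Neg \<phi>))" using True by (auto simp: Neg_def[of "Neg \<phi>"] intro: deduct)
      moreover have "entails T S' (Neg \<phi>)" using neg that(1) by (rule entails_mono)
      ultimately show False using that(2) unfolding Neg_def[of "Neg \<phi>"] by (blast intro: entails.mp)
    qed
    \<comment> \<open>If the counterexample were inconsistent with \<open>S\<close>, then
      \<open>S\<close> would entail the instance at a fresh variable and hence, by
      \<open>entails_gen\<close>, the universal formula itself.\<close>
    have "\<not> entails T (insert (Neg (subst x \<sigma> (Var (fresh_index (insert \<psi> S)) \<sigma>) \<psi>)) S) Fls"
      if \<phi>: "\<phi> = Forall x \<sigma> \<psi>" for x \<sigma> \<psi>
    proof
      let ?y = "fresh_index (insert \<psi> S)"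
      let ?\<chi> = "subst x \<sigma> (Var ?y \<sigma>) \<psi>"
      have w: "wf ?\<chi>" "wf \<psi>" using True \<phi> by (auto intro: wf_subst)
      assume "entails T (insert (Neg ?\<chi>) S) Fls"
      then have "entails T S (Neg (Neg ?\<chi>))" using w unfolding Neg_def[of "Neg ?\<chi>"] by (auto intro: deduct)
      then have "entails T S ?\<chi>" by (rule entails_notnot)
      moreover have "(?y, \<sigma>) \<notin> fv \<gamma>" if "\<gamma> \<in> S" for \<gamma>
        using fresh_index[of "insert \<psi> S" \<gamma>] that assms(1) by (auto dest: fv_idx)
      ultimately have "entails T S (Forall ?y \<sigma> ?\<chi>)" using assms by (intro entails_gen) auto
      moreover have "T \<turnstile> (Forall ?y \<sigma> ?\<chi> \<^bold>\<longrightarrow> Forall x \<sigma> \<psi>)"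
        using w fresh_index[of "insert \<psi> S" \<psi>] assms(1) by (intro rename_Forall) auto
      ultimately have "entails T S \<phi>" unfolding \<phi> by (blast intro: entails.intros)
      then show False using neg assms(3) unfolding Neg_def by (blast intro: entails.mp)
    qed
    then have "\<not> entails T (case \<phi> of Forall x \<sigma> \<psi> \<Rightarrow>
        insert (Neg (subst x \<sigma> (Var (fresh_index (insert \<psi> S)) \<sigma>) \<psi>)) S | _ \<Rightarrow> S) Fls" (is "\<not> entails T ?S Fls")
      using assms(3) by (cases \<phi>) simp_all
    moreover have "S \<subseteq> ?S" by (cases \<phi>) auto
    ultimately have "\<not> entails T (insert (Neg \<phi>) ?S) Fls" by (intro *)
    then show ?thesis using True by (simp add: extend_def)
  qed
qed

lemma completeness:
  assumes "wf \<phi>" "\<not> (T \<turnstile> \<phi>)"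
  shows "\<exists>\<Gamma>. henkin T \<Gamma> \<and> \<phi> \<notin> \<Gamma>"
proof -
  define S where "S = rec_nat {Neg \<phi>} (\<lambda>n S. extend T S (from_nat n))"
  have S0: "S 0 = {Neg \<phi>}" and SS: "S (Suc n) = extend T (S n) (from_nat n)" for n by (simp_all add: S_def)
  have "\<not> entails T {Neg \<phi>} Fls"
  proof
    assume "entails T {Neg \<phi>} Fls"
    then have "entails T {} (Neg (Neg \<phi>))" using assms by (auto simp: Neg_def[of "Neg \<phi>"] intro: deduct)
    then show False using assms by (blast dest: entails_notnot entails_empty)
  qed
  then have inv: "finite (S n) \<and> (\<forall>\<gamma>\<in>S n. wf \<gamma>) \<and> \<not> entails T (S n) Fls" for n
    using assms by (induction n) (auto simp: S0 SS dest: extend)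
  have mono: "S m \<subseteq> S n" if "m \<le> n" for m n
    by (rule lift_Suc_mono_le[OF _ that]) (use inv in \<open>simp add: SS extend(4)\<close>)
  define \<Gamma> where "\<Gamma> = (\<Union>n. S n)"
  have cons: "\<not> entails T \<Gamma> Fls"
  proof
    assume "entails T \<Gamma> Fls"
    from entails_finite[OF this] obtain \<Delta> where \<Delta>: "finite \<Delta>" "\<Delta> \<subseteq> \<Gamma>" "entails T \<Delta> Fls" by blast
    have "\<forall>\<gamma>\<in>\<Delta>. \<exists>n. \<gamma> \<in> S n" using \<Delta>(2) unfolding \<Gamma>_def by blast
    then obtain f where f: "\<And>\<gamma>. \<gamma> \<in> \<Delta> \<Longrightarrow> \<gamma> \<in> S (f \<gamma>)" by metis
    have "f \<gamma> \<le> Max (f ` \<Delta>)" if "\<gamma> \<in> \<Delta>" for \<gamma> using \<Delta>(1) that by simp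
    then have "\<exists>n. \<Delta> \<subseteq> S n" using f mono by blast
    then obtain n where "\<Delta> \<subseteq> S n" ..
    then show False using \<Delta>(3) inv[of n] entails_mono[of T \<Delta> Fls "S n"] by simp
  qed
  have decide: "\<psi> \<in> S (Suc (to_nat \<psi>)) \<or> Neg \<psi> \<in> S (Suc (to_nat \<psi>))" if "wf \<psi>" for \<psi>
    using that by (simp add: SS extend_def)
  have d: "\<psi> \<in> \<Gamma> \<or> Neg \<psi> \<in> \<Gamma>" if "wf \<psi>" for \<psi>
    using decide[OF that] by (auto simp: \<Gamma>_def)
  \<comment> \<open>The variable comes from the stage at which this universal formula was processed
    and rejected.\<close>
  have h: "\<exists>y\<ge>idx \<psi>. subst x \<sigma> (Var y \<sigma>) \<psi> \<notin> \<Gamma>" if w: "wf \<psi>" and n: "Forall x \<sigma> \<psi> \<notin> \<Gamma>" for x \<sigma> \<psi>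
  proof -
    let ?n = "to_nat (Forall x \<sigma> \<psi>)"
    let ?y = "fresh_index (insert \<psi> (S ?n))"
    have "Forall x \<sigma> \<psi> \<notin> S (Suc ?n)" using n by (auto simp: \<Gamma>_def)
    then have "Neg (subst x \<sigma> (Var ?y \<sigma>) \<psi>) \<in> S (Suc ?n)"
      using w by (auto simp: SS extend_def split: if_splits)
    then have "Neg (subst x \<sigma> (Var ?y \<sigma>) \<psi>) \<in> \<Gamma>" by (auto simp: \<Gamma>_def)
    then have "subst x \<sigma> (Var ?y \<sigma>) \<psi> \<notin> \<Gamma>"
      using cons w by (intro not_both[OF cons]) (auto intro: wf_subst)
    then show ?thesis using fresh_index[of "insert \<psi> (S ?n)" \<psi>] inv by blast
  qed
  have "henkin T \<Gamma>" unfolding henkin_def by (intro conjI allI impI cons d h)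
  moreover have "Neg \<phi> \<in> \<Gamma>" using S0 by (auto simp: \<Gamma>_def)
  then have "\<phi> \<notin> \<Gamma>" using cons assms(1) by (intro not_both)
  ultimately show ?thesis by blast
qed

text \<open>\<open>truth\<close> covers the identity valuation only, whereas axioms with free
  variables are needed for all parameters. Generalising over the finitely many free variables, one
  at a time, reduces every typed valuation to the identity.\<close>

lemma henkin_axiom:
  assumes "henkin T \<Gamma>" "\<phi> \<in> T" "wf \<phi>" "typed e"
  shows "ev \<Gamma> e \<phi>"
proof -
  define vs where "vs = {x. (\<exists>\<sigma>. (x, \<sigma>) \<in> fv \<phi>)}"
  have fin: "finite (fv \<phi>)" by (induction \<phi>) auto
  have gen: "T \<turnstile> \<psi> \<Longrightarrow> (\<forall>e'. typed e' \<and> (\<forall>p. p \<notin> A \<longrightarrow> e' p = (\<lambda>(x, \<sigma>). Var x \<sigma>) p) \<longrightarrow> ev \<Gamma> e' \<psi>)"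
    if "finite A" for A \<psi>
    using that
  proof (induction arbitrary: \<psi> rule: finite_induct)
    case empty
    then have "\<psi> \<in> \<Gamma>" using henkin_entails[OF assms(1)] by (blast intro: base derivable_wf)
    then have "ev \<Gamma> (\<lambda>(x, \<sigma>). Var x \<sigma>) \<psi>" using truth[OF assms(1)] empty derivable_wf by blast
    moreover have "e' = (\<lambda>(x, \<sigma>). Var x \<sigma>)" if "\<forall>p. e' p = (\<lambda>(x, \<sigma>). Var x \<sigma>) p" for e' using that by (rule_tac ext) blast
    ultimately show ?case by auto
  next
    case (insert a A)
    obtain x \<sigma> where a: "a = (x, \<sigma>)" by force
    have IH: "T \<turnstile> Forall x \<sigma> \<psi>" using insert by (auto intro: derivable.Generalisation)
    show ?case
    proof (intro allI impI)
      fix e' assume e': "typed e' \<and> (\<forall>p. p \<notin> insert a A \<longrightarrow> e' p = (\<lambda>(x, \<sigma>). Var x \<sigma>) p)"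
      have "typed (e'((x, \<sigma>) := Var x \<sigma>))" using e' by (simp add: Dom_def)
      then have "ev \<Gamma> (e'((x, \<sigma>) := Var x \<sigma>)) (Forall x \<sigma> \<psi>)"
        using insert.IH[OF IH, rule_format, of "e'((x, \<sigma>) := Var x \<sigma>)"] e' a by (auto simp del: ev.simps)
      moreover have "e' (x, \<sigma>) \<in> Dom \<sigma>" using e' by (simp add: typed_def)
      ultimately show "ev \<Gamma> e' \<psi>" by (metis ev.simps(5) fun_upd_triv fun_upd_upd)
    qed
  qed
  define e' where "e' = (\<lambda>p. if p \<in> fv \<phi> then e p else (\<lambda>(x, \<sigma>). Var x \<sigma>) p)"
  have "typed e'" using assms(4) by (auto simp: e'_def typed_def Dom_def)
  moreover have "T \<turnstile> \<phi>" using assms by (blast intro: derivable.Axiom)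
  ultimately have "ev \<Gamma> e' \<phi>" using gen[OF fin] by (auto simp: e'_def)
  then show ?thesis using ev_cong[of \<phi> e e'] by (auto simp: e'_def)
qed

section \<open>Evaluation of terms and formulas\<close>

definition upd :: "(nat \<times> ty \<Rightarrow> tm) \<Rightarrow> nat \<Rightarrow> ty \<Rightarrow> tm \<Rightarrow> nat \<times> ty \<Rightarrow> tm" where
  "upd e x \<sigma> s = e((x, \<sigma>) := s)"

lemma upd_apply [simp]: "upd e x \<sigma> s (y, \<tau>) = (if y = x \<and> \<tau> = \<sigma> then s else e (y, \<tau>))"
  by (simp add: upd_def)

lemma typed_upd' [simp]: "typed e \<Longrightarrow> s \<in> Dom \<sigma> \<Longrightarrow> typed (upd e x \<sigma> s)" by (simp add: upd_def)

lemma sub_fresh [simp]: "idxt t \<le> x \<Longrightarrow> sub (upd e x \<sigma> s) t = sub e t"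
  by (rule sub_cong) (auto dest: fvt_idxt)

lemma ev_Neg [simp]: "ev \<Gamma> e (Neg \<phi>) \<longleftrightarrow> \<not> ev \<Gamma> e \<phi>" by (simp add: Neg_def)
lemma ev_Conj [simp]: "ev \<Gamma> e (Conj \<phi> \<psi>) \<longleftrightarrow> ev \<Gamma> e \<phi> \<and> ev \<Gamma> e \<psi>" by (simp add: Conj_def)
lemma ev_Disj [simp]: "ev \<Gamma> e (Disj \<phi> \<psi>) \<longleftrightarrow> ev \<Gamma> e \<phi> \<or> ev \<Gamma> e \<psi>" by (auto simp: Disj_def)
lemma ev_Iff [simp]: "ev \<Gamma> e (Iff \<phi> \<psi>) \<longleftrightarrow> (ev \<Gamma> e \<phi> \<longleftrightarrow> ev \<Gamma> e \<psi>)" by (auto simp: Iff_def)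

lemma idx_Neg [simp]: "idx (Neg \<phi>) = idx \<phi>" by (simp add: Neg_def)
lemma idx_Conj [simp]: "idx (Conj \<phi> \<psi>) = max (idx \<phi>) (idx \<psi>)" by (simp add: Conj_def)
lemma idx_Disj [simp]: "idx (Disj \<phi> \<psi>) = max (idx \<phi>) (idx \<psi>)" by (simp add: Disj_def)
lemma idx_Iff [simp]: "idx (Iff \<phi> \<psi>) = max (idx \<phi>) (idx \<psi>)" by (simp add: Iff_def)

lemma wf_Conj [simp]: "wf (Conj \<phi> \<psi>) \<longleftrightarrow> wf \<phi> \<and> wf \<psi>" by (simp add: Conj_def)
lemma wf_Disj [simp]: "wf (Disj \<phi> \<psi>) \<longleftrightarrow> wf \<phi> \<and> wf \<psi>" by (simp add: Disj_def)
lemma wf_Iff [simp]: "wf (Iff \<phi> \<psi>) \<longleftrightarrow> wf \<phi> \<and> wf \<psi>" by (auto simp: Iff_def)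

lemma wf_all [intro!]: "(\<And>x. wf (F (Var x \<sigma>))) \<Longrightarrow> wf (all \<sigma> F)" by (simp add: all_def Let_def)
lemma wf_ex [intro!]: "(\<And>x. wf (F (Var x \<sigma>))) \<Longrightarrow> wf (ex \<sigma> F)" by (simp add: ex_def Exists_def Let_def)

text \<open>The index that the binder uses is hidden inside \<open>all\<close>. A bound on the whole
  formula yields one for the body at some variable, and from there for the parameters; this is how
  bound variables are seen to be fresh for them.\<close>

lemma idx_all: "idx (all \<sigma> F) \<le> k \<Longrightarrow> \<exists>x. idx (F (Var x \<sigma>)) \<le> k"
  by (auto simp: all_def Let_def)
lemma idx_ex: "idx (ex \<sigma> F) \<le> k \<Longrightarrow> \<exists>x. idx (F (Var x \<sigma>)) \<le> k"
  by (auto simp: ex_def Exists_def Let_def)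

lemma idx_Imp: "idx (\<phi> \<^bold>\<longrightarrow> \<psi>) \<le> k \<Longrightarrow> idx \<phi> \<le> k \<and> idx \<psi> \<le> k" by simp

text \<open>The variable that \<open>all\<close> picks never has to be computed: the premise asks
  for the meaning of the body under every variable that is large enough.\<close>

lemma ev_all:
  assumes "\<And>x s. idx (F (Var 0 \<sigma>)) \<le> x \<Longrightarrow> s \<in> Dom \<sigma> \<Longrightarrow> ev \<Gamma> (upd e x \<sigma> s) (F (Var x \<sigma>)) \<longleftrightarrow> P s"
  shows "ev \<Gamma> e (all \<sigma> F) \<longleftrightarrow> (\<forall>s\<in>Dom \<sigma>. P s)"
  using assms by (simp add: all_def Let_def upd_def)

lemma ev_ex:
  assumes "\<And>x s. idx (F (Var 0 \<sigma>)) \<le> x \<Longrightarrow> s \<in> Dom \<sigma> \<Longrightarrow> ev \<Gamma> (upd e x \<sigma> s) (F (Var x \<sigma>)) \<longleftrightarrow> P s"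
  shows "ev \<Gamma> e (ex \<sigma> F) \<longleftrightarrow> (\<exists>s\<in>Dom \<sigma>. P s)"
  using assms by (simp add: ex_def Exists_def Let_def upd_def)

lemma wf_eq_ty: "wt t \<Longrightarrow> wt u \<Longrightarrow> ty_of t = \<sigma> \<Longrightarrow> ty_of u = \<sigma> \<Longrightarrow> wf (eq_ty \<sigma> t u)"
  by (induction \<sigma> arbitrary: t u) auto

lemma idx_eq_ty: "idx (eq_ty \<sigma> t u) \<le> k \<Longrightarrow> idxt t \<le> k \<and> idxt u \<le> k"
proof (induction \<sigma> arbitrary: t u)
  case (Fn \<sigma> \<tau>)
  then obtain x where "idx (eq_ty \<tau> (t \<cdot> Var x \<sigma>) (u \<cdot> Var x \<sigma>)) \<le> k" by (auto dest: idx_all)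
  then show ?case using Fn.IH(2) by fastforce
qed auto

primrec eqv :: "fm set \<Rightarrow> ty \<Rightarrow> tm \<Rightarrow> tm \<Rightarrow> bool" where
  "eqv \<Gamma> N t u \<longleftrightarrow> (t \<^bold>= u) \<in> \<Gamma>"
| "eqv \<Gamma> (\<sigma> \<rightarrow> \<tau>) t u \<longleftrightarrow> (\<forall>s\<in>Dom \<sigma>. eqv \<Gamma> \<tau> (t \<cdot> s) (u \<cdot> s))"

lemma ev_eq_ty [simp]: "ev \<Gamma> e (eq_ty \<sigma> t u) \<longleftrightarrow> eqv \<Gamma> \<sigma> (sub e t) (sub e u)"
proof (induction \<sigma> arbitrary: e t u)
  case (Fn \<sigma> \<tau>)
  show ?case unfolding eq_ty.simps eqv.simps
    by (rule ev_all) (auto simp: Fn dest!: idx_eq_ty)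
qed simp

lemma app_Dom [simp]: "f \<in> Dom (\<sigma> \<rightarrow> \<tau>) \<Longrightarrow> s \<in> Dom \<sigma> \<Longrightarrow> f \<cdot> s \<in> Dom \<tau>" by (simp add: Dom_def)

lemma con_Dom [simp]: "Con c \<in> Dom \<sigma> \<longleftrightarrow> con_ty c = \<sigma>" by (simp add: Dom_def)

lemma plus_Dom [simp]: "s \<in> Dom N \<Longrightarrow> t \<in> Dom N \<Longrightarrow> s \<^bold>+ t \<in> Dom N" by (simp add: Dom_def)
lemma times_Dom [simp]: "s \<in> Dom N \<Longrightarrow> t \<in> Dom N \<Longrightarrow> s \<^bold>* t \<in> Dom N" by (simp add: Dom_def)

lemma bracket_wt: "wt t \<Longrightarrow> wt (bracket x \<sigma> t) \<and> ty_of (bracket x \<sigma> t) = \<sigma> \<rightarrow> ty_of t"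
  by (induction t) (auto split: ty.splits)

lemma fvt_bracket: "fvt (bracket x \<sigma> t) = fvt t - {(x, \<sigma>)}"
  by (induction t) auto

section \<open>The axioms as facts about the term model\<close>

locale rca_theory =
  fixes \<Gamma> assumes henkin: "henkin RCA0w \<Gamma>"
begin

lemma axiom: "\<phi> \<in> RCA0w \<Longrightarrow> wf \<phi> \<Longrightarrow> ev \<Gamma> (\<lambda>(x, \<sigma>). Var x \<sigma>) \<phi>"
  by (rule henkin_axiom[OF henkin]) auto

abbreviation (input) same (infix "\<approx>" 50) where "s \<approx> t \<equiv> (s \<^bold>= t) \<in> \<Gamma>"

lemma N_refl: "s \<in> Dom N \<Longrightarrow> s \<approx> s"
proof -
  have "ev \<Gamma> (\<lambda>(x, \<sigma>). Var x \<sigma>) (\<^bold>\<forall>m\<^bold>:N. m \<^bold>= m) \<longleftrightarrow> (\<forall>s\<in>Dom N. s \<approx> s)"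
    by (intro ev_all) auto
  moreover have "ev \<Gamma> (\<lambda>(x, \<sigma>). Var x \<sigma>) (\<^bold>\<forall>m\<^bold>:N. m \<^bold>= m)"
    by (rule axiom[OF eq_refl]) auto
  ultimately show "s \<in> Dom N \<Longrightarrow> s \<approx> s" by blast
qed

lemma N_euclid: "s \<in> Dom N \<Longrightarrow> t \<in> Dom N \<Longrightarrow> u \<in> Dom N \<Longrightarrow> s \<approx> t \<Longrightarrow> s \<approx> u \<Longrightarrow> t \<approx> u"
proof -
  have "ev \<Gamma> (\<lambda>(x, \<sigma>). Var x \<sigma>) (\<^bold>\<forall>m\<^bold>:N. \<^bold>\<forall>n\<^bold>:N. \<^bold>\<forall>k\<^bold>:N. m \<^bold>= n \<^bold>\<longrightarrow> m \<^bold>= k \<^bold>\<longrightarrow> n \<^bold>= k) =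
     (\<forall>s\<in>Dom N. \<forall>t\<in>Dom N. \<forall>u\<in>Dom N. s \<approx> t \<longrightarrow> s \<approx> u \<longrightarrow> t \<approx> u)"
    by (rule ev_all, rule ev_all, rule ev_all) (auto dest!: idx_all)
  moreover have "ev \<Gamma> (\<lambda>(x, \<sigma>). Var x \<sigma>) (\<^bold>\<forall>m\<^bold>:N. \<^bold>\<forall>n\<^bold>:N. \<^bold>\<forall>k\<^bold>:N. m \<^bold>= n \<^bold>\<longrightarrow> m \<^bold>= k \<^bold>\<longrightarrow> n \<^bold>= k)"
    by (rule axiom[OF eq_euclid]) auto
  ultimately show "s \<in> Dom N \<Longrightarrow> t \<in> Dom N \<Longrightarrow> u \<in> Dom N \<Longrightarrow> s \<approx> t \<Longrightarrow> s \<approx> u \<Longrightarrow> t \<approx> u" 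
    by blast
qed

abbreviation (input) VV where "VV \<equiv> \<lambda>(x, \<sigma>). Var x \<sigma>"

lemma N_sym: "s \<in> Dom N \<Longrightarrow> t \<in> Dom N \<Longrightarrow> s \<approx> t \<Longrightarrow> t \<approx> s"
  using N_euclid N_refl by blast
lemma N_trans: "s \<in> Dom N \<Longrightarrow> t \<in> Dom N \<Longrightarrow> u \<in> Dom N \<Longrightarrow> s \<approx> t \<Longrightarrow> t \<approx> u \<Longrightarrow> s \<approx> u"
  using N_euclid N_sym by blast

lemma Lt_cong:
  assumes "s \<in> Dom N" "t \<in> Dom N" "u \<in> Dom N" "v \<in> Dom N" "s \<approx> t" "u \<approx> v" "(s \<^bold>< u) \<in> \<Gamma>"
  shows "(t \<^bold>< v) \<in> \<Gamma>"
proof -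
  have "ev \<Gamma> VV (\<^bold>\<forall>m\<^bold>:N. \<^bold>\<forall>n\<^bold>:N. \<^bold>\<forall>k\<^bold>:N. \<^bold>\<forall>l\<^bold>:N.
    m \<^bold>= n \<^bold>\<longrightarrow> k \<^bold>= l \<^bold>\<longrightarrow> m \<^bold>< k \<^bold>\<longrightarrow> n \<^bold>< l) = (\<forall>s\<in>Dom N. \<forall>t\<in>Dom N. \<forall>u\<in>Dom N. \<forall>v\<in>Dom N.
      s \<approx> t \<longrightarrow> u \<approx> v \<longrightarrow> (s \<^bold>< u) \<in> \<Gamma> \<longrightarrow> (t \<^bold>< v) \<in> \<Gamma>)"
    by (rule ev_all, rule ev_all, rule ev_all, rule ev_all)
      (drule idx_all idx_Imp | erule exE | simp)+
  moreover have "ev \<Gamma> VV (\<^bold>\<forall>m\<^bold>:N. \<^bold>\<forall>n\<^bold>:N. \<^bold>\<forall>k\<^bold>:N. \<^bold>\<forall>l\<^bold>:N.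
    m \<^bold>= n \<^bold>\<longrightarrow> k \<^bold>= l \<^bold>\<longrightarrow> m \<^bold>< k \<^bold>\<longrightarrow> n \<^bold>< l)"
    by (rule axiom[OF less_cong]) auto
  ultimately have F: "\<forall>s\<in>Dom N. \<forall>t\<in>Dom N. \<forall>u\<in>Dom N. \<forall>v\<in>Dom N.
      s \<approx> t \<longrightarrow> u \<approx> v \<longrightarrow> (s \<^bold>< u) \<in> \<Gamma> \<longrightarrow> (t \<^bold>< v) \<in> \<Gamma>" by (rule iffD1)
  show ?thesis
    using F[THEN bspec, OF assms(1), THEN bspec, OF assms(2), THEN bspec, OF assms(3), THEN bspec, OF assms(4)] assms by blast
qed

lemma succ_nonzero: "s \<in> Dom N \<Longrightarrow> \<not> s \<^bold>+ \<^bold>1 \<approx> \<^bold>0"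
proof -
  have "ev \<Gamma> VV (\<^bold>\<forall>n\<^bold>:N. \<^bold>\<not> n \<^bold>+ \<^bold>1 \<^bold>= \<^bold>0) = (\<forall>s\<in>Dom N. \<not> s \<^bold>+ \<^bold>1 \<approx> \<^bold>0)" by (rule ev_all) auto
  moreover have "ev \<Gamma> VV (\<^bold>\<forall>n\<^bold>:N. \<^bold>\<not> n \<^bold>+ \<^bold>1 \<^bold>= \<^bold>0)" by (rule axiom[OF RCA0w.succ_nonzero]) auto
  ultimately show "s \<in> Dom N \<Longrightarrow> \<not> s \<^bold>+ \<^bold>1 \<approx> \<^bold>0" by blast
qed

lemma succ_inj: "s \<in> Dom N \<Longrightarrow> t \<in> Dom N \<Longrightarrow> s \<^bold>+ \<^bold>1 \<approx> t \<^bold>+ \<^bold>1 \<Longrightarrow> s \<approx> t"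
proof -
  have "ev \<Gamma> VV (\<^bold>\<forall>m\<^bold>:N. \<^bold>\<forall>n\<^bold>:N. m \<^bold>+ \<^bold>1 \<^bold>= n \<^bold>+ \<^bold>1 \<^bold>\<longrightarrow> m \<^bold>= n) =
      (\<forall>s\<in>Dom N. \<forall>t\<in>Dom N. s \<^bold>+ \<^bold>1 \<approx> t \<^bold>+ \<^bold>1 \<longrightarrow> s \<approx> t)"
    by (rule ev_all, rule ev_all) (auto dest!: idx_all)
  moreover have "ev \<Gamma> VV (\<^bold>\<forall>m\<^bold>:N. \<^bold>\<forall>n\<^bold>:N. m \<^bold>+ \<^bold>1 \<^bold>= n \<^bold>+ \<^bold>1 \<^bold>\<longrightarrow> m \<^bold>= n)"
    by (rule axiom[OF RCA0w.succ_inj]) auto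
  ultimately show "s \<in> Dom N \<Longrightarrow> t \<in> Dom N \<Longrightarrow> s \<^bold>+ \<^bold>1 \<approx> t \<^bold>+ \<^bold>1 \<Longrightarrow> s \<approx> t" by blast
qed

lemma add_zero: "s \<in> Dom N \<Longrightarrow> s \<^bold>+ \<^bold>0 \<approx> s"
proof -
  have "ev \<Gamma> VV (\<^bold>\<forall>m\<^bold>:N. m \<^bold>+ \<^bold>0 \<^bold>= m) = (\<forall>s\<in>Dom N. s \<^bold>+ \<^bold>0 \<approx> s)" by (rule ev_all) auto
  moreover have "ev \<Gamma> VV (\<^bold>\<forall>m\<^bold>:N. m \<^bold>+ \<^bold>0 \<^bold>= m)" by (rule axiom[OF RCA0w.add_zero]) auto
  ultimately show "s \<in> Dom N \<Longrightarrow> s \<^bold>+ \<^bold>0 \<approx> s" by blast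
qed

lemma add_succ: "s \<in> Dom N \<Longrightarrow> t \<in> Dom N \<Longrightarrow> s \<^bold>+ (t \<^bold>+ \<^bold>1) \<approx> (s \<^bold>+ t) \<^bold>+ \<^bold>1"
proof -
  have "ev \<Gamma> VV (\<^bold>\<forall>m\<^bold>:N. \<^bold>\<forall>n\<^bold>:N. m \<^bold>+ (n \<^bold>+ \<^bold>1) \<^bold>= (m \<^bold>+ n) \<^bold>+ \<^bold>1) =
      (\<forall>s\<in>Dom N. \<forall>t\<in>Dom N. s \<^bold>+ (t \<^bold>+ \<^bold>1) \<approx> (s \<^bold>+ t) \<^bold>+ \<^bold>1)"
    by (rule ev_all, rule ev_all) (auto dest!: idx_all)
  moreover have "ev \<Gamma> VV (\<^bold>\<forall>m\<^bold>:N. \<^bold>\<forall>n\<^bold>:N. m \<^bold>+ (n \<^bold>+ \<^bold>1) \<^bold>= (m \<^bold>+ n) \<^bold>+ \<^bold>1)"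
    by (rule axiom[OF RCA0w.add_succ]) auto
  ultimately show "s \<in> Dom N \<Longrightarrow> t \<in> Dom N \<Longrightarrow> s \<^bold>+ (t \<^bold>+ \<^bold>1) \<approx> (s \<^bold>+ t) \<^bold>+ \<^bold>1" by blast
qed

lemma mult_zero: "s \<in> Dom N \<Longrightarrow> s \<^bold>* \<^bold>0 \<approx> \<^bold>0"
proof -
  have "ev \<Gamma> VV (\<^bold>\<forall>m\<^bold>:N. m \<^bold>* \<^bold>0 \<^bold>= \<^bold>0) = (\<forall>s\<in>Dom N. s \<^bold>* \<^bold>0 \<approx> \<^bold>0)" by (rule ev_all) auto
  moreover have "ev \<Gamma> VV (\<^bold>\<forall>m\<^bold>:N. m \<^bold>* \<^bold>0 \<^bold>= \<^bold>0)" by (rule axiom[OF RCA0w.mult_zero]) auto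
  ultimately show "s \<in> Dom N \<Longrightarrow> s \<^bold>* \<^bold>0 \<approx> \<^bold>0" by blast
qed

lemma mult_succ: "s \<in> Dom N \<Longrightarrow> t \<in> Dom N \<Longrightarrow> s \<^bold>* (t \<^bold>+ \<^bold>1) \<approx> s \<^bold>* t \<^bold>+ s"
proof -
  have "ev \<Gamma> VV (\<^bold>\<forall>m\<^bold>:N. \<^bold>\<forall>n\<^bold>:N. m \<^bold>* (n \<^bold>+ \<^bold>1) \<^bold>= m \<^bold>* n \<^bold>+ m) =
      (\<forall>s\<in>Dom N. \<forall>t\<in>Dom N. s \<^bold>* (t \<^bold>+ \<^bold>1) \<approx> s \<^bold>* t \<^bold>+ s)"
    by (rule ev_all, rule ev_all) (auto dest!: idx_all)
  moreover have "ev \<Gamma> VV (\<^bold>\<forall>m\<^bold>:N. \<^bold>\<forall>n\<^bold>:N. m \<^bold>* (n \<^bold>+ \<^bold>1) \<^bold>= m \<^bold>* n \<^bold>+ m)"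
    by (rule axiom[OF RCA0w.mult_succ]) auto
  ultimately show "s \<in> Dom N \<Longrightarrow> t \<in> Dom N \<Longrightarrow> s \<^bold>* (t \<^bold>+ \<^bold>1) \<approx> s \<^bold>* t \<^bold>+ s" by blast
qed

lemma less_zero: "s \<in> Dom N \<Longrightarrow> (s \<^bold>< \<^bold>0) \<notin> \<Gamma>"
proof -
  have "ev \<Gamma> VV (\<^bold>\<forall>m\<^bold>:N. \<^bold>\<not> m \<^bold>< \<^bold>0) = (\<forall>s\<in>Dom N. (s \<^bold>< \<^bold>0) \<notin> \<Gamma>)" by (rule ev_all) auto
  moreover have "ev \<Gamma> VV (\<^bold>\<forall>m\<^bold>:N. \<^bold>\<not> m \<^bold>< \<^bold>0)" by (rule axiom[OF RCA0w.less_zero]) auto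
  ultimately show "s \<in> Dom N \<Longrightarrow> (s \<^bold>< \<^bold>0) \<notin> \<Gamma>" by blast
qed

lemma less_succ: "s \<in> Dom N \<Longrightarrow> t \<in> Dom N \<Longrightarrow> (s \<^bold>< t \<^bold>+ \<^bold>1) \<in> \<Gamma> \<longleftrightarrow> (s \<^bold>< t) \<in> \<Gamma> \<or> s \<approx> t"
proof -
  have "ev \<Gamma> VV (\<^bold>\<forall>m\<^bold>:N. \<^bold>\<forall>n\<^bold>:N. m \<^bold>< n \<^bold>+ \<^bold>1 \<^bold>\<longleftrightarrow> (m \<^bold>< n \<^bold>\<or> m \<^bold>= n)) =
      (\<forall>s\<in>Dom N. \<forall>t\<in>Dom N. (s \<^bold>< t \<^bold>+ \<^bold>1) \<in> \<Gamma> \<longleftrightarrow> (s \<^bold>< t) \<in> \<Gamma> \<or> s \<approx> t)"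
    by (rule ev_all, rule ev_all) (auto dest!: idx_all)
  moreover have "ev \<Gamma> VV (\<^bold>\<forall>m\<^bold>:N. \<^bold>\<forall>n\<^bold>:N. m \<^bold>< n \<^bold>+ \<^bold>1 \<^bold>\<longleftrightarrow> (m \<^bold>< n \<^bold>\<or> m \<^bold>= n))"
    by (rule axiom[OF RCA0w.less_succ]) auto
  ultimately show "s \<in> Dom N \<Longrightarrow> t \<in> Dom N \<Longrightarrow> (s \<^bold>< t \<^bold>+ \<^bold>1) \<in> \<Gamma> \<longleftrightarrow> (s \<^bold>< t) \<in> \<Gamma> \<or> s \<approx> t" by blast
qed

lemma comb_K: "s \<in> Dom \<rho> \<Longrightarrow> t \<in> Dom \<sigma> \<Longrightarrow> eqv \<Gamma> \<rho> (Con (Comb_K \<rho> \<sigma>) \<cdot> s \<cdot> t) s"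
proof -
  have "ev \<Gamma> VV (\<^bold>\<forall>x\<^bold>:\<rho>. \<^bold>\<forall>y\<^bold>:\<sigma>. eq_ty \<rho> (Con (Comb_K \<rho> \<sigma>) \<cdot> x \<cdot> y) x) =
      (\<forall>s\<in>Dom \<rho>. \<forall>t\<in>Dom \<sigma>. eqv \<Gamma> \<rho> (Con (Comb_K \<rho> \<sigma>) \<cdot> s \<cdot> t) s)"
    by (rule ev_all, rule ev_all) (auto dest!: idx_all idx_eq_ty)
  moreover have "ev \<Gamma> VV (\<^bold>\<forall>x\<^bold>:\<rho>. \<^bold>\<forall>y\<^bold>:\<sigma>. eq_ty \<rho> (Con (Comb_K \<rho> \<sigma>) \<cdot> x \<cdot> y) x)"
    by (rule axiom[OF RCA0w.comb_K]) (auto intro!: wf_eq_ty)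
  ultimately show "s \<in> Dom \<rho> \<Longrightarrow> t \<in> Dom \<sigma> \<Longrightarrow> eqv \<Gamma> \<rho> (Con (Comb_K \<rho> \<sigma>) \<cdot> s \<cdot> t) s" by blast
qed

lemma comb_S:
  assumes "s \<in> Dom (\<rho> \<rightarrow> \<sigma> \<rightarrow> \<tau>)" "t \<in> Dom (\<rho> \<rightarrow> \<sigma>)" "u \<in> Dom \<rho>"
  shows "eqv \<Gamma> \<tau> (Con (Comb_S \<rho> \<sigma> \<tau>) \<cdot> s \<cdot> t \<cdot> u) (s \<cdot> u \<cdot> (t \<cdot> u))"
proof -
  have "ev \<Gamma> VV (\<^bold>\<forall>x\<^bold>:\<rho> \<rightarrow> \<sigma> \<rightarrow> \<tau>. \<^bold>\<forall>y\<^bold>:\<rho> \<rightarrow> \<sigma>. \<^bold>\<forall>z\<^bold>:\<rho>.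
    eq_ty \<tau> (Con (Comb_S \<rho> \<sigma> \<tau>) \<cdot> x \<cdot> y \<cdot> z) (x \<cdot> z \<cdot> (y \<cdot> z))) =
      (\<forall>s\<in>Dom (\<rho> \<rightarrow> \<sigma> \<rightarrow> \<tau>). \<forall>t\<in>Dom (\<rho> \<rightarrow> \<sigma>). \<forall>u\<in>Dom \<rho>.
         eqv \<Gamma> \<tau> (Con (Comb_S \<rho> \<sigma> \<tau>) \<cdot> s \<cdot> t \<cdot> u) (s \<cdot> u \<cdot> (t \<cdot> u)))"
    by (rule ev_all, rule ev_all, rule ev_all) (auto dest!: idx_all idx_eq_ty)
  moreover have "ev \<Gamma> VV (\<^bold>\<forall>x\<^bold>:\<rho> \<rightarrow> \<sigma> \<rightarrow> \<tau>. \<^bold>\<forall>y\<^bold>:\<rho> \<rightarrow> \<sigma>. \<^bold>\<forall>z\<^bold>:\<rho>.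
    eq_ty \<tau> (Con (Comb_S \<rho> \<sigma> \<tau>) \<cdot> x \<cdot> y \<cdot> z) (x \<cdot> z \<cdot> (y \<cdot> z)))"
    by (rule axiom[OF RCA0w.comb_S]) (auto intro!: wf_eq_ty)
  ultimately show ?thesis using assms by blast
qed

lemma extensionality:
  assumes "s \<in> Dom \<rho>" "t \<in> Dom \<rho>" "f \<in> Dom (\<rho> \<rightarrow> \<tau>)" "eqv \<Gamma> \<rho> s t"
  shows "eqv \<Gamma> \<tau> (f \<cdot> s) (f \<cdot> t)"
proof -
  have "ev \<Gamma> VV (\<^bold>\<forall>x\<^bold>:\<rho>. \<^bold>\<forall>y\<^bold>:\<rho>. \<^bold>\<forall>f\<^bold>:\<rho> \<rightarrow> \<tau>. eq_ty \<rho> x y \<^bold>\<longrightarrow> eq_ty \<tau> (f \<cdot> x) (f \<cdot> y)) =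
      (\<forall>s\<in>Dom \<rho>. \<forall>t\<in>Dom \<rho>. \<forall>f\<in>Dom (\<rho> \<rightarrow> \<tau>). eqv \<Gamma> \<rho> s t \<longrightarrow> eqv \<Gamma> \<tau> (f \<cdot> s) (f \<cdot> t))"
    by (rule ev_all, rule ev_all, rule ev_all) (auto dest!: idx_all idx_eq_ty)
  moreover have "ev \<Gamma> VV (\<^bold>\<forall>x\<^bold>:\<rho>. \<^bold>\<forall>y\<^bold>:\<rho>. \<^bold>\<forall>f\<^bold>:\<rho> \<rightarrow> \<tau>. eq_ty \<rho> x y \<^bold>\<longrightarrow> eq_ty \<tau> (f \<cdot> x) (f \<cdot> y))"
    by (rule axiom[OF RCA0w.extensionality]) (auto intro!: wf_eq_ty)
  ultimately show ?thesis using assms by blast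
qed

lemma rec_zero: "f \<in> Dom (N \<rightarrow> N \<rightarrow> N) \<Longrightarrow> s \<in> Dom N \<Longrightarrow> Con Rec \<cdot> f \<cdot> s \<cdot> \<^bold>0 \<approx> s"
proof -
  have "ev \<Gamma> VV (\<^bold>\<forall>f\<^bold>:N \<rightarrow> N \<rightarrow> N. \<^bold>\<forall>m\<^bold>:N. Con Rec \<cdot> f \<cdot> m \<cdot> \<^bold>0 \<^bold>= m) =
      (\<forall>f\<in>Dom (N \<rightarrow> N \<rightarrow> N). \<forall>s\<in>Dom N. Con Rec \<cdot> f \<cdot> s \<cdot> \<^bold>0 \<approx> s)"
    by (rule ev_all, rule ev_all) (auto dest!: idx_all)
  moreover have "ev \<Gamma> VV (\<^bold>\<forall>f\<^bold>:N \<rightarrow> N \<rightarrow> N. \<^bold>\<forall>m\<^bold>:N. Con Rec \<cdot> f \<cdot> m \<cdot> \<^bold>0 \<^bold>= m)"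
    by (rule axiom[OF RCA0w.rec_zero]) auto
  ultimately show "f \<in> Dom (N \<rightarrow> N \<rightarrow> N) \<Longrightarrow> s \<in> Dom N \<Longrightarrow> Con Rec \<cdot> f \<cdot> s \<cdot> \<^bold>0 \<approx> s" by blast
qed

lemma rec_succ:
  assumes "f \<in> Dom (N \<rightarrow> N \<rightarrow> N)" "s \<in> Dom N" "t \<in> Dom N"
  shows "Con Rec \<cdot> f \<cdot> s \<cdot> (t \<^bold>+ \<^bold>1) \<approx> f \<cdot> t \<cdot> (Con Rec \<cdot> f \<cdot> s \<cdot> t)"
proof -
  have "ev \<Gamma> VV (\<^bold>\<forall>f\<^bold>:N \<rightarrow> N \<rightarrow> N. \<^bold>\<forall>m\<^bold>:N. \<^bold>\<forall>n\<^bold>:N.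
    Con Rec \<cdot> f \<cdot> m \<cdot> (n \<^bold>+ \<^bold>1) \<^bold>= f \<cdot> n \<cdot> (Con Rec \<cdot> f \<cdot> m \<cdot> n)) =
      (\<forall>f\<in>Dom (N \<rightarrow> N \<rightarrow> N). \<forall>s\<in>Dom N. \<forall>t\<in>Dom N. Con Rec \<cdot> f \<cdot> s \<cdot> (t \<^bold>+ \<^bold>1) \<approx> f \<cdot> t \<cdot> (Con Rec \<cdot> f \<cdot> s \<cdot> t))"
    by (rule ev_all, rule ev_all, rule ev_all) (auto dest!: idx_all)
  moreover have "ev \<Gamma> VV (\<^bold>\<forall>f\<^bold>:N \<rightarrow> N \<rightarrow> N. \<^bold>\<forall>m\<^bold>:N. \<^bold>\<forall>n\<^bold>:N.
    Con Rec \<cdot> f \<cdot> m \<cdot> (n \<^bold>+ \<^bold>1) \<^bold>= f \<cdot> n \<cdot> (Con Rec \<cdot> f \<cdot> m \<cdot> n))"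
    by (rule axiom[OF RCA0w.rec_succ]) auto
  ultimately show ?thesis using assms by blast
qed

lemma qf_free_for: "qf \<phi> \<Longrightarrow> free_for s x \<sigma> \<phi>" by (induction \<phi>) auto

lemma qf_induction:
  assumes "qf \<phi>" "wf \<phi>" "ev \<Gamma> (upd VV x N \<^bold>0) \<phi>"
    and "\<And>s. s \<in> Dom N \<Longrightarrow> ev \<Gamma> (upd VV x N s) \<phi> \<Longrightarrow> ev \<Gamma> (upd VV x N (s \<^bold>+ \<^bold>1)) \<phi>"
    and "s \<in> Dom N"
  shows "ev \<Gamma> (upd VV x N s) \<phi>"
proof -
  have "ev \<Gamma> VV (subst x N \<^bold>0 \<phi> \<^bold>\<longrightarrow> Forall x N (\<phi> \<^bold>\<longrightarrow> subst x N (Var x N \<^bold>+ \<^bold>1) \<phi>) \<^bold>\<longrightarrow> Forall x N \<phi>)"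
    by (rule axiom[OF RCA0w.qf_induction]) (use assms in \<open>auto intro!: wf_subst\<close>)
  then show ?thesis using assms by (simp add: ev_subst qf_free_for upd_def)
qed

text \<open>One instance of the schema, with \<open>g\<close> as a parameter, is enough: decidable
  relations will be given by characteristic functionals with value 1.\<close>

lemma qf_ac:
  assumes "g \<in> Dom (T1 \<rightarrow> N \<rightarrow> N)" "\<And>f. f \<in> Dom T1 \<Longrightarrow> \<exists>n\<in>Dom N. g \<cdot> f \<cdot> n \<approx> \<^bold>1"
  shows "\<exists>Y\<in>Dom T2. \<forall>f\<in>Dom T1. g \<cdot> f \<cdot> (Y \<cdot> f) \<approx> \<^bold>1"
proof -
  let ?\<phi> = "Var 2 (T1 \<rightarrow> N \<rightarrow> N) \<cdot> Var 0 T1 \<cdot> Var 1 N \<^bold>= \<^bold>1"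
  let ?e = "VV((2, T1 \<rightarrow> N \<rightarrow> N) := g)"
  have "ev \<Gamma> ?e (Forall 0 T1 (Exists 1 N ?\<phi>) \<^bold>\<longrightarrow>
     Exists 3 T2 (Forall 0 T1 (subst 1 N (Var 3 T2 \<cdot> Var 0 T1) ?\<phi>)))"
    by (rule henkin_axiom[OF henkin RCA0w.qf_ac]) (use assms(1) in \<open>auto simp: Exists_def Neg_def\<close>)
  then show ?thesis using assms by (simp add: Exists_def Neg_def)
qed

lemma eqv_refl: "s \<in> Dom \<sigma> \<Longrightarrow> eqv \<Gamma> \<sigma> s s"
  by (induction \<sigma> arbitrary: s) (auto simp: N_refl)

lemma eqv_euclid:
  "s \<in> Dom \<sigma> \<Longrightarrow> t \<in> Dom \<sigma> \<Longrightarrow> u \<in> Dom \<sigma> \<Longrightarrow> eqv \<Gamma> \<sigma> s t \<Longrightarrow> eqv \<Gamma> \<sigma> s u \<Longrightarrow> eqv \<Gamma> \<sigma> t u"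
proof (induction \<sigma> arbitrary: s t u)
  case N then show ?case using N_euclid[of s t u] by simp
next
  case (Fn \<sigma> \<tau>)
  have "eqv \<Gamma> \<tau> (t \<cdot> v) (u \<cdot> v)" if "v \<in> Dom \<sigma>" for v
    by (rule Fn.IH(2)[of "s \<cdot> v"]) (use Fn.prems that in auto)
  then show ?case by simp
qed

lemma eqv_sym: "s \<in> Dom \<sigma> \<Longrightarrow> t \<in> Dom \<sigma> \<Longrightarrow> eqv \<Gamma> \<sigma> s t \<Longrightarrow> eqv \<Gamma> \<sigma> t s"
  using eqv_euclid[of s \<sigma> t s] eqv_refl[of s \<sigma>] by simp
lemma eqv_trans: "s \<in> Dom \<sigma> \<Longrightarrow> t \<in> Dom \<sigma> \<Longrightarrow> u \<in> Dom \<sigma> \<Longrightarrow> eqv \<Gamma> \<sigma> s t \<Longrightarrow> eqv \<Gamma> \<sigma> t u \<Longrightarrow> eqv \<Gamma> \<sigma> s u"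
  using eqv_euclid[of t \<sigma> s u] eqv_sym[of s \<sigma> t] by simp

lemma eqv_app:
  assumes "f \<in> Dom (\<sigma> \<rightarrow> \<tau>)" "g \<in> Dom (\<sigma> \<rightarrow> \<tau>)" "s \<in> Dom \<sigma>" "t \<in> Dom \<sigma>" "eqv \<Gamma> (\<sigma> \<rightarrow> \<tau>) f g" "eqv \<Gamma> \<sigma> s t"
  shows "eqv \<Gamma> \<tau> (f \<cdot> s) (g \<cdot> t)"
  using assms extensionality[of s \<sigma> t f \<tau>] eqv_trans[of "f \<cdot> s" \<tau> "f \<cdot> t" "g \<cdot> t"] by auto

text \<open>Correctness of combinatory abstraction. The induction hypotheses hold only up to
  \<open>eqv\<close>, so in the application case function and argument have to be replaced by
  equals, which needs extensionality.\<close>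

lemma sub_bracket:
  assumes "typed e" "s \<in> Dom \<sigma>"
  shows "wt t \<Longrightarrow> eqv \<Gamma> (ty_of t) (sub e (bracket x \<sigma> t) \<cdot> s) (sub (upd e x \<sigma> s) t)"
proof (induction t)
  case (Var y \<tau>)
  have e: "e (y, \<tau>) \<in> Dom \<tau>" using assms(1) by (simp add: typed_def)
  show ?case
  proof (cases "y = x \<and> \<tau> = \<sigma>")
    case True
    let ?K = "Con (Comb_K \<sigma> (\<sigma> \<rightarrow> \<sigma>))" and ?K' = "Con (Comb_K \<sigma> \<sigma>)"
    have "eqv \<Gamma> \<sigma> (Con (Comb_S \<sigma> (\<sigma> \<rightarrow> \<sigma>) \<sigma>) \<cdot> ?K \<cdot> ?K' \<cdot> s) (?K \<cdot> s \<cdot> (?K' \<cdot> s))"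
      using assms by (intro comb_S) auto
    moreover have "eqv \<Gamma> \<sigma> (?K \<cdot> s \<cdot> (?K' \<cdot> s)) s"
      using assms by (intro comb_K) (auto simp: Dom_def)
    ultimately have "eqv \<Gamma> \<sigma> (Con (Comb_S \<sigma> (\<sigma> \<rightarrow> \<sigma>) \<sigma>) \<cdot> ?K \<cdot> ?K' \<cdot> s) s"
      by (rule eqv_trans[rotated 3]) (use assms in \<open>simp_all add: Dom_def\<close>)
    then show ?thesis using True by simp
  next
    case False
    then show ?thesis using comb_K[of "e (y, \<tau>)" \<tau> s \<sigma>] e assms by auto
  qed
next
  case (Con c)
  show ?case using comb_K[of "Con c" "con_ty c" s \<sigma>] assms by auto
next
  case (App t u)
  obtain \<rho> \<tau> where ty: "ty_of t = \<rho> \<rightarrow> \<tau>" "ty_of u = \<rho>" using App.prems by (auto split: ty.splits)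
  have w: "wt t" "wt u" using App.prems by auto
  show ?case
  proof (cases "(x, \<sigma>) \<in> fvt (t \<cdot> u)")
    case False
    have "sub (upd e x \<sigma> s) (t \<cdot> u) = sub e (t \<cdot> u)" by (rule sub_cong) (use False in auto)
    then show ?thesis using False comb_K[of "sub e (t \<cdot> u)" \<tau> s \<sigma>] sub_dom[OF assms(1), of "t \<cdot> u"] App.prems assms ty by auto
  next
    case True
    let ?T = "sub e (bracket x \<sigma> t)" and ?U = "sub e (bracket x \<sigma> u)"
    have d: "?T \<in> Dom (\<sigma> \<rightarrow> \<rho> \<rightarrow> \<tau>)" "?U \<in> Dom (\<sigma> \<rightarrow> \<rho>)"
      using w ty bracket_wt assms by (auto intro!: sub_dom)
    have d': "sub (upd e x \<sigma> s) t \<in> Dom (\<rho> \<rightarrow> \<tau>)" "sub (upd e x \<sigma> s) u \<in> Dom \<rho>"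
      using w ty assms by (auto intro!: sub_dom)
    have "eqv \<Gamma> \<tau> (Con (Comb_S \<sigma> \<rho> \<tau>) \<cdot> ?T \<cdot> ?U \<cdot> s) (?T \<cdot> s \<cdot> (?U \<cdot> s))"
      using d assms by (intro comb_S) auto
    moreover have "eqv \<Gamma> \<tau> (?T \<cdot> s \<cdot> (?U \<cdot> s)) (sub (upd e x \<sigma> s) t \<cdot> sub (upd e x \<sigma> s) u)"
      using d d' assms App.IH w ty by (intro eqv_app[of _ \<rho>]) (auto intro!: app_Dom simp del: eqv.simps)
    ultimately have "eqv \<Gamma> \<tau> (Con (Comb_S \<sigma> \<rho> \<tau>) \<cdot> ?T \<cdot> ?U \<cdot> s) (sub (upd e x \<sigma> s) t \<cdot> sub (upd e x \<sigma> s) u)"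
      by (rule eqv_trans[rotated 3]) (use d d' assms in \<open>simp_all add: Dom_def\<close>)
    then show ?thesis using True ty by auto
  qed
qed

end

section \<open>The numbers of a countermodel\<close>

definition principles :: "fm set" where
  "principles = {Pincherle, Cantor_bounded, Cantor_uniform, Real_bounded, Real_uniform, Real_maximum, Real_polynomial}"

text \<open>One theory serves all seven implications: it violates \<open>HBC\<close> and contains
  some principle, whichever it is. The choice must not depend on the principle, as the type
  \<open>mnat\<close> is built from it.\<close>

definition \<Gamma>\<^sub>0 :: "fm set" where
  "\<Gamma>\<^sub>0 = (SOME \<Gamma>. henkin RCA0w \<Gamma> \<and> HBC \<notin> \<Gamma> \<and> \<Gamma> \<inter> principles \<noteq> {})"

definition good :: bool where "good \<longleftrightarrow> henkin RCA0w \<Gamma>\<^sub>0"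

text \<open>To be an equivalence on all terms, the relation lets every term outside
  \<open>Dom N\<close> count as zero. In the absence of a countermodel \<open>idxt\<close> is used,
  which takes every natural number as a value.\<close>

definition same_num :: "tm \<Rightarrow> tm \<Rightarrow> bool" where
  "same_num s t \<longleftrightarrow> (if good
     then ((if s \<in> Dom N then s else \<^bold>0) \<^bold>= (if t \<in> Dom N then t else \<^bold>0)) \<in> \<Gamma>\<^sub>0
     else idxt s = idxt t)"

lemma rca_theory_good: "good \<Longrightarrow> rca_theory \<Gamma>\<^sub>0" by (simp add: good_def rca_theory_def)

text \<open>Type classes need a type and unconditional laws, so the numbers of a countermodel are taken
  for one chosen countermodel; should there be none, the type is a copy of \<open>nat\<close>.\<close>

quotient_type mnat = tm / same_num
proof (rule equivpI)
  show "reflp same_num"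
    by (rule reflpI) (auto simp: same_num_def rca_theory.N_refl[OF rca_theory_good])
  show "symp same_num"
    by (rule sympI) (auto simp: same_num_def intro: rca_theory.N_sym[OF rca_theory_good] split: if_splits)
  show "transp same_num"
  proof (rule transpI)
    fix s t u assume "same_num s t" "same_num t u"
    then show "same_num s u"
      unfolding same_num_def
      using rca_theory.N_trans[OF rca_theory_good, of "if s \<in> Dom N then s else \<^bold>0" "if t \<in> Dom N then t else \<^bold>0" "if u \<in> Dom N then u else \<^bold>0"]
      by (simp split: if_splits)
  qed
qed

abbreviation num :: "tm \<Rightarrow> mnat" where "num \<equiv> abs_mnat"

lemma num_eq: "num s = num t \<longleftrightarrow> same_num s t" by (rule mnat.abs_eq_iff)

definition term_of :: "mnat \<Rightarrow> tm" where "term_of a = (SOME s. s \<in> Dom N \<and> num s = a)"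

definition index_of :: "mnat \<Rightarrow> nat" where "index_of a = idxt (rep_mnat a)"
definition of_index :: "nat \<Rightarrow> mnat" where
  "of_index n = num (case n of 0 \<Rightarrow> \<^bold>0 | Suc k \<Rightarrow> Var k N)"

instantiation mnat :: "{zero, one, plus, times}"
begin
definition "0 = num \<^bold>0"
definition "1 = (if good then num \<^bold>1 else of_index 1)"
definition "a + b = (if good then num (term_of a \<^bold>+ term_of b) else of_index (index_of a + index_of b))"
definition "a * b = (if good then num (term_of a \<^bold>* term_of b) else of_index (index_of a * index_of b))"
instance ..
end

lemma index_of_of_index: "\<not> good \<Longrightarrow> index_of (of_index n) = n"
  using Quotient_rep_abs[OF Quotient_mnat, of "case n of 0 \<Rightarrow> \<^bold>0 | Suc k \<Rightarrow> Var k N"]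
  by (auto simp: index_of_def of_index_def same_num_def
      num_eq[of "rep_mnat (num t)" t for t, unfolded same_num_def] split: nat.splits
      dest: Quotient_rep_abs[OF Quotient_mnat])

lemma index_of_inject: "\<not> good \<Longrightarrow> index_of a = index_of b \<longleftrightarrow> a = b"
proof
  assume "\<not> good" "index_of a = index_of b"
  then have "same_num (rep_mnat a) (rep_mnat b)" by (simp add: same_num_def index_of_def)
  then have "num (rep_mnat a) = num (rep_mnat b)" by (simp add: num_eq)
  then show "a = b" using Quotient_abs_rep[OF Quotient_mnat] by metis
qed simp

locale countermodel = rca_theory \<Gamma>\<^sub>0
begin

abbreviation (input) same0 (infix "\<approx>" 50) where "s \<approx> t \<equiv> (s \<^bold>= t) \<in> \<Gamma>\<^sub>0"

lemma good: good using henkin by (simp add: good_def)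

lemma num_eq_iff: "s \<in> Dom N \<Longrightarrow> t \<in> Dom N \<Longrightarrow> num s = num t \<longleftrightarrow> s \<approx> t"
  by (simp add: num_eq same_num_def good)

lemma term_of: "term_of a \<in> Dom N" "num (term_of a) = a"
proof -
  have "\<exists>s. s \<in> Dom N \<and> num s = a"
  proof -
    let ?s = "rep_mnat a"
    have "num ?s = a" by (rule Quotient_abs_rep[OF Quotient_mnat])
    moreover have "num (if ?s \<in> Dom N then ?s else \<^bold>0) = num ?s"
      by (simp add: num_eq same_num_def good N_refl)
    ultimately show ?thesis by (intro exI[of _ "if ?s \<in> Dom N then ?s else \<^bold>0"]) auto
  qed
  then have "term_of a \<in> Dom N \<and> num (term_of a) = a" unfolding term_of_def by (rule someI_ex)
  then show "term_of a \<in> Dom N" "num (term_of a) = a" by auto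
qed

lemma all_num: "(\<forall>s\<in>Dom N. P (num s)) \<longleftrightarrow> (\<forall>n. P n)" by (metis term_of)
lemma ex_num: "(\<exists>s\<in>Dom N. P (num s)) \<longleftrightarrow> (\<exists>n. P n)" by (metis term_of)

lemma num_app:
  assumes "f \<in> Dom (\<sigma> \<rightarrow> N)" "g \<in> Dom (\<sigma> \<rightarrow> N)" "s \<in> Dom \<sigma>" "t \<in> Dom \<sigma>" "eqv \<Gamma>\<^sub>0 (\<sigma> \<rightarrow> N) f g" "eqv \<Gamma>\<^sub>0 \<sigma> s t"
  shows "num (f \<cdot> s) = num (g \<cdot> t)"
  using eqv_app[OF assms] assms by (simp add: num_eq_iff)

lemma num_cong: "f \<in> Dom T1 \<Longrightarrow> s \<in> Dom N \<Longrightarrow> t \<in> Dom N \<Longrightarrow> num s = num t \<Longrightarrow> num (f \<cdot> s) = num (f \<cdot> t)"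
  by (rule num_app[where \<sigma> = N]) (auto simp: num_eq_iff N_refl)

lemma num_cong2:
  assumes "f \<in> Dom (N \<rightarrow> T1)" "s \<in> Dom N" "t \<in> Dom N" "s' \<in> Dom N" "t' \<in> Dom N" "num s = num t" "num s' = num t'"
  shows "num (f \<cdot> s \<cdot> s') = num (f \<cdot> t \<cdot> t')"
  by (rule num_app[where \<sigma> = N])
    (use assms extensionality[of s N t f T1] in \<open>auto simp: num_eq_iff simp del: eqv.simps(2)\<close>)

lemma num_zero [simp]: "num \<^bold>0 = 0" by (simp add: zero_mnat_def)
lemma num_one [simp]: "num \<^bold>1 = 1" by (simp add: one_mnat_def good)
lemma num_plus [simp]: "s \<in> Dom N \<Longrightarrow> t \<in> Dom N \<Longrightarrow> num (s \<^bold>+ t) = num s + num t"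
  using num_cong2[of "Con Plus" s "term_of (num s)" t "term_of (num t)"] by (simp add: plus_mnat_def good term_of)
lemma num_times [simp]: "s \<in> Dom N \<Longrightarrow> t \<in> Dom N \<Longrightarrow> num (s \<^bold>* t) = num s * num t"
  using num_cong2[of "Con Times" s "term_of (num s)" t "term_of (num t)"] by (simp add: times_mnat_def good term_of)

definition definable :: "(mnat \<Rightarrow> mnat) \<Rightarrow> bool" where
  "definable G \<longleftrightarrow> (\<exists>f\<in>Dom T1. \<forall>s\<in>Dom N. num (f \<cdot> s) = G (num s))"

lemma definable_term:
  assumes "typed e" "wt t" "ty_of t = N"
    and "\<And>s. s \<in> Dom N \<Longrightarrow> num (sub (upd e x N s) t) = G (num s)"
  shows "definable G"
  unfolding definable_def
proof (intro bexI ballI)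
  show d: "sub e (bracket x N t) \<in> Dom T1" using assms bracket_wt by (intro sub_dom) auto
  fix s assume s: "s \<in> Dom N"
  have "num (sub e (bracket x N t) \<cdot> s) = num (sub (upd e x N s) t)"
    using sub_bracket[OF assms(1) s, of t x] assms s d
    by (subst num_eq_iff) (auto intro: sub_dom)
  then show "num (sub e (bracket x N t) \<cdot> s) = G (num s)" using assms s by simp
qed

abbreviation (input) env where "env \<equiv> upd VV"

lemma definable_id: "definable (\<lambda>n. n)"
  by (rule definable_term[of VV "Var 0 N" 0]) auto

lemma definable_const: "definable (\<lambda>n. a)"
  by (rule definable_term[of "env 1 N (term_of a)" "Var 1 N" 0]) (auto simp: term_of)

lemma definable_plus:
  assumes "definable G" "definable H" shows "definable (\<lambda>n. G n + H n)"
proof -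
  obtain g h where *: "g \<in> Dom T1" "h \<in> Dom T1" "\<forall>s\<in>Dom N. num (g \<cdot> s) = G (num s)" "\<forall>s\<in>Dom N. num (h \<cdot> s) = H (num s)"
    using assms unfolding definable_def by blast
  then show ?thesis
    by (intro definable_term[of "upd (env 1 T1 g) 2 T1 h" "Var 1 T1 \<cdot> Var 0 N \<^bold>+ Var 2 T1 \<cdot> Var 0 N" 0]) auto
qed

lemma definable_times:
  assumes "definable G" "definable H" shows "definable (\<lambda>n. G n * H n)"
proof -
  obtain g h where *: "g \<in> Dom T1" "h \<in> Dom T1" "\<forall>s\<in>Dom N. num (g \<cdot> s) = G (num s)" "\<forall>s\<in>Dom N. num (h \<cdot> s) = H (num s)"
    using assms unfolding definable_def by blast
  then show ?thesis
    by (intro definable_term[of "upd (env 1 T1 g) 2 T1 h" "Var 1 T1 \<cdot> Var 0 N \<^bold>* Var 2 T1 \<cdot> Var 0 N" 0]) auto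
qed

lemma definable_comp:
  assumes "definable G" "definable H" shows "definable (\<lambda>n. G (H n))"
proof -
  obtain g h where *: "g \<in> Dom T1" "h \<in> Dom T1" "\<forall>s\<in>Dom N. num (g \<cdot> s) = G (num s)" "\<forall>s\<in>Dom N. num (h \<cdot> s) = H (num s)"
    using assms unfolding definable_def by blast
  then show ?thesis
    by (intro definable_term[of "upd (env 1 T1 g) 2 T1 h" "Var 1 T1 \<cdot> (Var 2 T1 \<cdot> Var 0 N)" 0]) auto
qed

text \<open>A formula is demanded for every sufficiently large variable, so that two decidable
  properties can be expressed over a common one.\<close>

definition decidable :: "(mnat \<Rightarrow> bool) \<Rightarrow> bool" where
  "decidable P \<longleftrightarrow> (\<exists>k. \<forall>x\<ge>k. \<exists>\<phi>. qf \<phi> \<and> wf \<phi> \<and> (\<forall>s\<in>Dom N. ev \<Gamma>\<^sub>0 (env x N s) \<phi> \<longleftrightarrow> P (num s)))"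

lemma decidable_eq:
  assumes "definable G" "definable H" shows "decidable (\<lambda>n. G n = H n)"
proof -
  obtain g h where *: "g \<in> Dom T1" "h \<in> Dom T1" "\<forall>s\<in>Dom N. num (g \<cdot> s) = G (num s)" "\<forall>s\<in>Dom N. num (h \<cdot> s) = H (num s)"
    using assms unfolding definable_def by blast
  have "\<exists>\<phi>. qf \<phi> \<and> wf \<phi> \<and> (\<forall>s\<in>Dom N. ev \<Gamma>\<^sub>0 (env x N s) \<phi> \<longleftrightarrow> G (num s) = H (num s))" if "x \<ge> max (idxt g) (idxt h)" for x
  proof (intro exI conjI ballI)
    let ?\<phi> = "g \<cdot> Var x N \<^bold>= h \<cdot> Var x N"
    show "qf ?\<phi>" "wf ?\<phi>" using * by (auto simp: Dom_def)
    fix s assume "s \<in> Dom N"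
    then show "ev \<Gamma>\<^sub>0 (env x N s) ?\<phi> \<longleftrightarrow> G (num s) = H (num s)"
      using * that by (simp add: sub_Var num_eq_iff[symmetric])
  qed
  then show ?thesis unfolding decidable_def by blast
qed

lemma decidable_less:
  assumes "a \<in> Dom N" shows "decidable (\<lambda>n. (a \<^bold>< term_of n) \<in> \<Gamma>\<^sub>0)"
proof -
  have "\<exists>\<phi>. qf \<phi> \<and> wf \<phi> \<and> (\<forall>s\<in>Dom N. ev \<Gamma>\<^sub>0 (env x N s) \<phi> \<longleftrightarrow> (a \<^bold>< term_of (num s)) \<in> \<Gamma>\<^sub>0)" if "x \<ge> idxt a" for x
  proof (intro exI conjI ballI)
    let ?\<phi> = "a \<^bold>< Var x N"
    show "qf ?\<phi>" "wf ?\<phi>" using assms by (auto simp: Dom_def)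
    fix s assume s: "s \<in> Dom N"
    have "s \<approx> term_of (num s)" using num_eq_iff[of s "term_of (num s)"] s by (simp add: term_of)
    then have "(a \<^bold>< s) \<in> \<Gamma>\<^sub>0 \<longleftrightarrow> (a \<^bold>< term_of (num s)) \<in> \<Gamma>\<^sub>0"
      using Lt_cong[of a a s "term_of (num s)"] Lt_cong[of a a "term_of (num s)" s] N_refl[OF assms]
        N_sym[of s "term_of (num s)"] s assms term_of by blast
    then show "ev \<Gamma>\<^sub>0 (env x N s) ?\<phi> \<longleftrightarrow> (a \<^bold>< term_of (num s)) \<in> \<Gamma>\<^sub>0"
      using that by (simp add: sub_Var)
  qed
  then show ?thesis unfolding decidable_def by blast
qed

lemma decidable_imp:
  assumes "decidable P" "decidable Q" shows "decidable (\<lambda>n. P n \<longrightarrow> Q n)"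
proof -
  obtain k l where k: "\<forall>x\<ge>k. \<exists>\<phi>. qf \<phi> \<and> wf \<phi> \<and> (\<forall>s\<in>Dom N. ev \<Gamma>\<^sub>0 (env x N s) \<phi> \<longleftrightarrow> P (num s))"
    and l: "\<forall>x\<ge>l. \<exists>\<phi>. qf \<phi> \<and> wf \<phi> \<and> (\<forall>s\<in>Dom N. ev \<Gamma>\<^sub>0 (env x N s) \<phi> \<longleftrightarrow> Q (num s))"
    using assms unfolding decidable_def by blast
  have "\<exists>\<phi>. qf \<phi> \<and> wf \<phi> \<and> (\<forall>s\<in>Dom N. ev \<Gamma>\<^sub>0 (env x N s) \<phi> \<longleftrightarrow> P (num s) \<longrightarrow> Q (num s))" if x: "x \<ge> max k l" for x
  proof -
    obtain \<phi> \<psi> where "qf \<phi> \<and> wf \<phi> \<and> (\<forall>s\<in>Dom N. ev \<Gamma>\<^sub>0 (env x N s) \<phi> \<longleftrightarrow> P (num s))"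
      "qf \<psi> \<and> wf \<psi> \<and> (\<forall>s\<in>Dom N. ev \<Gamma>\<^sub>0 (env x N s) \<psi> \<longleftrightarrow> Q (num s))"
      using k[rule_format, of x] l[rule_format, of x] x by auto
    then show ?thesis by (intro exI[of _ "\<phi> \<^bold>\<longrightarrow> \<psi>"]) auto
  qed
  then show ?thesis unfolding decidable_def by blast
qed

lemma decidable_False: "decidable (\<lambda>n. False)"
  unfolding decidable_def by (intro exI[of _ 0] allI impI exI[of _ Fls]) auto

lemma decidable_not: "decidable P \<Longrightarrow> decidable (\<lambda>n. \<not> P n)"
  using decidable_imp[OF _ decidable_False] by simp

lemma decidable_or: "decidable P \<Longrightarrow> decidable Q \<Longrightarrow> decidable (\<lambda>n. P n \<or> Q n)"
  using decidable_imp[OF decidable_not, of P Q] by (simp add: disj_imp)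

lemma decidable_and: "decidable P \<Longrightarrow> decidable Q \<Longrightarrow> decidable (\<lambda>n. P n \<and> Q n)"
  using decidable_not[OF decidable_imp[OF _ decidable_not], of P Q] by simp

lemma decidable_iff: "decidable P \<Longrightarrow> decidable Q \<Longrightarrow> decidable (\<lambda>n. P n \<longleftrightarrow> Q n)"
  using decidable_and[OF decidable_imp[of P Q] decidable_imp[of Q P]] by (simp add: iff_conv_conj_imp)

lemma num_induct:
  assumes "decidable P" "P 0" "\<And>n. P n \<Longrightarrow> P (n + 1)"
  shows "P n"
proof -
  obtain x \<phi> where *: "qf \<phi>" "wf \<phi>" "\<forall>s\<in>Dom N. ev \<Gamma>\<^sub>0 (env x N s) \<phi> \<longleftrightarrow> P (num s)"
    using assms(1) unfolding decidable_def by blast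
  have "ev \<Gamma>\<^sub>0 (env x N (term_of n)) \<phi>"
    by (rule qf_induction) (use * assms term_of in auto)
  then show ?thesis using * term_of by auto
qed

lemma num_Rec:
  assumes "f \<in> Dom (N \<rightarrow> N \<rightarrow> N)" "s \<in> Dom N"
  shows "num (Con Rec \<cdot> f \<cdot> s \<cdot> \<^bold>0) = num s"
    and "t \<in> Dom N \<Longrightarrow> num (Con Rec \<cdot> f \<cdot> s \<cdot> (t \<^bold>+ \<^bold>1)) = num (f \<cdot> t \<cdot> (Con Rec \<cdot> f \<cdot> s \<cdot> t))"
proof -
  have R: "Con Rec \<cdot> f \<cdot> s \<in> Dom T1" using assms by (auto simp: Dom_def)
  show "num (Con Rec \<cdot> f \<cdot> s \<cdot> \<^bold>0) = num s"
    using rec_zero[OF assms] assms R by (subst num_eq_iff) auto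
  show "t \<in> Dom N \<Longrightarrow> num (Con Rec \<cdot> f \<cdot> s \<cdot> (t \<^bold>+ \<^bold>1)) = num (f \<cdot> t \<cdot> (Con Rec \<cdot> f \<cdot> s \<cdot> t))"
    using rec_succ[OF assms] assms R by (subst num_eq_iff) (auto intro!: app_Dom)
qed

section \<open>Arithmetic of the numbers by quantifier-free induction\<close>

lemma num_add_0: "a + 0 = (a :: mnat)"
  using add_zero[OF term_of(1)[of a]] term_of[of a] num_eq_iff[of "term_of a \<^bold>+ \<^bold>0" "term_of a"] by simp

lemma num_add_Suc: "a + (b + 1) = (a + b) + (1 :: mnat)"
  using add_succ[OF term_of(1)[of a] term_of(1)[of b]] term_of
    num_eq_iff[of "term_of a \<^bold>+ (term_of b \<^bold>+ \<^bold>1)" "(term_of a \<^bold>+ term_of b) \<^bold>+ \<^bold>1"] by simp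

lemma num_mult_0: "a * 0 = (0 :: mnat)"
  using mult_zero[OF term_of(1)[of a]] term_of[of a] num_eq_iff[of "term_of a \<^bold>* \<^bold>0" "\<^bold>0"] by simp

lemma num_mult_Suc: "a * (b + 1) = a * b + (a :: mnat)"
  using mult_succ[OF term_of(1)[of a] term_of(1)[of b]] term_of
    num_eq_iff[of "term_of a \<^bold>* (term_of b \<^bold>+ \<^bold>1)" "(term_of a \<^bold>* term_of b) \<^bold>+ term_of a"] by simp

lemma num_Suc_0: "a + 1 \<noteq> (0 :: mnat)"
  using succ_nonzero[OF term_of(1)[of a]] term_of[of a] num_eq_iff[of "term_of a \<^bold>+ \<^bold>1" "\<^bold>0"] by simp

lemma num_Suc_inj: "a + 1 = b + 1 \<Longrightarrow> a = (b :: mnat)"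
  using succ_inj[OF term_of(1)[of a] term_of(1)[of b]] term_of
    num_eq_iff[of "term_of a \<^bold>+ \<^bold>1" "term_of b \<^bold>+ \<^bold>1"] num_eq_iff[of "term_of a" "term_of b"] by simp

lemma num_add_assoc: "(a + b) + c = a + (b + c :: mnat)"
proof (induction c rule: num_induct)
  show "decidable (\<lambda>c. a + b + c = a + (b + c))" by (intro decidable_eq definable_const definable_id definable_plus)
qed (simp_all add: num_add_0 num_add_Suc)

lemma num_0_add: "0 + a = (a :: mnat)"
proof (induction a rule: num_induct)
  show "decidable (\<lambda>c. 0 + c = c)" by (intro decidable_eq definable_const definable_id definable_plus)
qed (simp_all add: num_add_0 num_add_Suc)

lemma num_Suc_add: "(a + 1) + b = (a + b) + (1 :: mnat)"
proof (induction b rule: num_induct)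
  show "decidable (\<lambda>b. (a + 1) + b = (a + b) + 1)" by (intro decidable_eq definable_const definable_id definable_plus)
qed (simp_all add: num_add_0 num_add_Suc)

lemma num_add_comm: "a + b = b + (a :: mnat)"
proof (induction b rule: num_induct)
  show "decidable (\<lambda>b. a + b = b + a)" by (intro decidable_eq definable_const definable_id definable_plus)
qed (simp_all add: num_add_0 num_add_Suc num_Suc_add num_0_add)

lemma num_add_left_comm: "a + (b + c) = b + (a + c :: mnat)"
  by (metis num_add_assoc num_add_comm)

lemmas num_add_ac = num_add_assoc num_add_comm num_add_left_comm

lemma num_0_mult: "0 * a = (0 :: mnat)"
proof (induction a rule: num_induct)
  show "decidable (\<lambda>a. 0 * a = 0)" by (intro decidable_eq definable_const definable_id definable_times)
qed (simp_all add: num_mult_0 num_mult_Suc num_add_0)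

lemma num_Suc_mult: "(a + 1) * b = a * b + (b :: mnat)"
proof (induction b rule: num_induct)
  show "decidable (\<lambda>b. (a + 1) * b = a * b + b)"
    by (intro decidable_eq definable_const definable_id definable_times definable_plus)
qed (simp_all add: num_mult_0 num_add_0 num_mult_Suc num_add_ac)

lemma num_mult_comm: "a * b = b * (a :: mnat)"
proof (induction b rule: num_induct)
  show "decidable (\<lambda>b. a * b = b * a)" by (intro decidable_eq definable_const definable_id definable_times)
qed (simp_all add: num_mult_0 num_0_mult num_mult_Suc num_Suc_mult)

lemma num_distrib: "(a + b) * c = a * c + b * (c :: mnat)"
proof (induction c rule: num_induct)
  show "decidable (\<lambda>c. (a + b) * c = a * c + b * c)"
    by (intro decidable_eq definable_const definable_id definable_times definable_plus)
qed (simp_all add: num_mult_0 num_add_0 num_mult_Suc num_add_ac)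

lemma num_mult_assoc: "(a * b) * c = a * (b * c :: mnat)"
proof (induction c rule: num_induct)
  show "decidable (\<lambda>c. (a * b) * c = a * (b * c))"
    by (intro decidable_eq definable_const definable_id definable_times)
next
  fix c assume "a * b * c = a * (b * c)"
  then show "a * b * (c + 1) = a * (b * (c + 1))"
    by (metis num_mult_Suc num_distrib num_mult_comm)
qed (simp add: num_mult_0)

lemma num_mult_1: "a * 1 = (a :: mnat)"
  using num_mult_Suc[of a 0] by (simp add: num_mult_0 num_0_add)

lemma num_cancel: "a + c = b + c \<longrightarrow> a = (b :: mnat)"
proof (induction c rule: num_induct)
  show "decidable (\<lambda>c. a + c = b + c \<longrightarrow> a = b)"
    by (intro decidable_imp decidable_eq definable_const definable_id definable_plus)
qed (auto simp: num_add_0 num_add_Suc dest: num_Suc_inj)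

lemma num_bracket:
  assumes "typed e" "s \<in> Dom N" "wt t" "ty_of t = N"
  shows "num (sub e (bracket x N t) \<cdot> s) = num (sub (upd e x N s) t)"
proof -
  have "sub e (bracket x N t) \<in> Dom T1" using assms bracket_wt[of t x N] by (intro sub_dom) auto
  then show ?thesis
    using sub_bracket[OF assms(1,2,3), of x] assms by (subst num_eq_iff) (auto intro: sub_dom)
qed

lemma num_bracket2:
  assumes "typed e" "s \<in> Dom N" "r \<in> Dom N" "wt t" "ty_of t = N"
  shows "num (sub e (bracket x N (bracket y N t)) \<cdot> s \<cdot> r) = num (sub (upd (upd e x N s) y N r) t)"
proof -
  let ?b = "bracket y N t"
  have b: "wt ?b" "ty_of ?b = T1" using bracket_wt[of t y N] assms by auto
  have d: "sub e (bracket x N ?b) \<in> Dom (N \<rightarrow> T1)" "sub (upd e x N s) ?b \<in> Dom T1"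
    using b assms bracket_wt[of ?b x N] by (auto intro!: sub_dom)
  then have "num (sub e (bracket x N ?b) \<cdot> s \<cdot> r) = num (sub (upd e x N s) ?b \<cdot> r)"
    using sub_bracket[OF assms(1,2) b(1), of x] assms b
    by (intro num_app[where \<sigma> = N]) (auto intro!: N_refl app_Dom[of _ N])
  then show ?thesis using num_bracket[of "upd e x N s" r t y] assms by simp
qed

definition definable2 :: "(mnat \<Rightarrow> mnat \<Rightarrow> mnat) \<Rightarrow> bool" where
  "definable2 F \<longleftrightarrow> (\<exists>f\<in>Dom (N \<rightarrow> T1). \<forall>s\<in>Dom N. \<forall>t\<in>Dom N. num (f \<cdot> s \<cdot> t) = F (num s) (num t))"

lemma definable2_term:
  assumes "typed e" "wt t" "ty_of t = N"
    and "\<And>s r. s \<in> Dom N \<Longrightarrow> r \<in> Dom N \<Longrightarrow> num (sub (upd (upd e 0 N s) 1 N r) t) = F (num s) (num r)"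
  shows "definable2 F"
  unfolding definable2_def
proof (intro bexI ballI)
  show "sub e (bracket 0 N (bracket 1 N t)) \<in> Dom (N \<rightarrow> T1)"
    using assms bracket_wt[of t 1 N] bracket_wt[of "bracket 1 N t" 0 N] by (intro sub_dom) auto
qed (use assms num_bracket2 in auto)

lemma definable_rec:
  assumes "definable2 F"
  shows "\<exists>m. definable m \<and> m 0 = a \<and> (\<forall>n. m (n + 1) = F n (m n))"
proof -
  obtain f where f: "f \<in> Dom (N \<rightarrow> T1)" "\<forall>s\<in>Dom N. \<forall>t\<in>Dom N. num (f \<cdot> s \<cdot> t) = F (num s) (num t)"
    using assms unfolding definable2_def by blast
  let ?g = "Con Rec \<cdot> f \<cdot> term_of a"
  let ?m = "\<lambda>n. num (?g \<cdot> term_of n)"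
  have g: "?g \<in> Dom T1" using f term_of(1)[of a] by (simp add: Dom_def)
  have eq: "num (?g \<cdot> s) = ?m (num s)" if "s \<in> Dom N" for s
    using g that term_of by (intro num_cong) auto
  have "definable ?m" unfolding definable_def using g eq by blast
  moreover have "?m 0 = a" using eq[of "\<^bold>0"] num_Rec(1)[OF f(1) term_of(1)[of a]] term_of(2)[of a] by simp
  moreover have "?m (n + 1) = F n (?m n)" for n
  proof -
    have "?g \<cdot> term_of n \<in> Dom N" using g term_of(1)[of n] by auto
    then show ?thesis
      using eq[of "term_of n \<^bold>+ \<^bold>1"] num_Rec(2)[OF f(1) term_of(1)[of a] term_of(1)[of n]] f(2) term_of[of n] by simp
  qed
  ultimately show ?thesis by blast
qed

lemma ex_pred: "\<exists>p. definable p \<and> p 0 = 0 \<and> (\<forall>n. p (n + 1) = n)"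
proof -
  have "definable2 (\<lambda>k v. k)" by (rule definable2_term[of VV "Var 0 N"]) auto
  from definable_rec[OF this, of 0] show ?thesis by blast
qed

lemma num_cases_Suc: "a = 0 \<or> (\<exists>b. a = b + (1 :: mnat))"
proof -
  obtain p where p: "definable p" "p 0 = 0" "\<And>n. p (n + 1) = n" using ex_pred by blast
  have "a = 0 \<or> a = p a + 1"
  proof (induction a rule: num_induct)
    show "decidable (\<lambda>a. a = 0 \<or> a = p a + 1)"
      by (intro decidable_or decidable_eq definable_const definable_id definable_plus p(1))
  qed (auto simp: p)
  then show ?thesis by blast
qed

text \<open>That two numbers differ by a number is not a quantifier-free statement, so the induction
  uses explicit functions: \<open>m b\<close> and \<open>e b\<close> are the two truncated
  differences of \<open>a\<close> and \<open>b\<close>, of which one is always zero.\<close>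

lemma num_linear_strong:
  "\<exists>m e. definable m \<and> definable e \<and> (\<forall>b. b + m b = a + e b \<and> (m b = 0 \<or> e b = (0 :: mnat)))"
proof -
  obtain p where p: "definable p" "p 0 = 0" "\<And>n. p (n + 1) = n" using ex_pred by blast
  obtain p' where p': "p' \<in> Dom T1" "\<forall>s\<in>Dom N. num (p' \<cdot> s) = p (num s)" using p(1) unfolding definable_def by blast
  have "definable2 (\<lambda>k v. p v)" by (rule definable2_term[of "env 2 T1 p'" "Var 2 T1 \<cdot> Var 1 N"]) (use p' in auto)
  from definable_rec[OF this, of a]
  obtain m where m: "definable m" "m 0 = a" "\<And>n. m (n + 1) = p (m n)" by blast
  \<comment> \<open>The next function, \<open>g\<close>, is the test for zero that lets
    \<open>e\<close> start growing once \<open>m\<close> has reached zero.\<close>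
  have "definable2 (\<lambda>k v. 0)" by (rule definable2_term[of VV "\<^bold>0"]) auto
  from definable_rec[OF this, of 1]
  obtain g where g: "definable g" "g 0 = 1" "\<And>n. g (n + 1) = 0" by blast
  obtain g' where g': "g' \<in> Dom T1" "\<forall>s\<in>Dom N. num (g' \<cdot> s) = g (num s)" using g(1) unfolding definable_def by blast
  obtain m' where m': "m' \<in> Dom T1" "\<forall>s\<in>Dom N. num (m' \<cdot> s) = m (num s)" using m(1) unfolding definable_def by blast
  have "definable2 (\<lambda>k v. v + g (m k))"
    by (rule definable2_term[of "upd (env 2 T1 g') 3 T1 m'" "Var 1 N \<^bold>+ Var 2 T1 \<cdot> (Var 3 T1 \<cdot> Var 0 N)"]) (use g' m' in auto)
  from definable_rec[OF this, of 0]
  obtain e where e: "definable e" "e 0 = 0" "\<And>n. e (n + 1) = e n + g (m n)" by blast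
  have "b + m b = a + e b \<and> (m b = 0 \<or> e b = 0)" for b
  proof (induction b rule: num_induct)
    show "decidable (\<lambda>b. b + m b = a + e b \<and> (m b = 0 \<or> e b = 0))"
      by (intro decidable_and decidable_or decidable_eq definable_const definable_id definable_plus m(1) e(1))
  next
    fix n assume IH: "n + m n = a + e n \<and> (m n = 0 \<or> e n = 0)"
    consider "m n = 0" | k where "m n = k + 1" using num_cases_Suc by blast
    then show "n + 1 + m (n + 1) = a + e (n + 1) \<and> (m (n + 1) = 0 \<or> e (n + 1) = 0)"
    proof cases
      case 1
      then have "n = a + e n" "m (n + 1) = 0" "e (n + 1) = e n + 1" using IH by (simp_all add: m e g p num_add_0)
      then show ?thesis by (metis num_add_0 num_add_assoc)
    next
      case 2
      then have "n + (k + 1) = a + e n" "m (n + 1) = k" "e (n + 1) = e n + 0" "e n = 0"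
        using IH num_Suc_0[of k] by (simp_all add: m e g p)
      then show ?thesis by (metis num_add_0 num_add_assoc num_add_comm)
    qed
  qed (simp add: m e num_add_0 num_0_add)
  then show ?thesis using m(1) e(1) by blast
qed

lemma num_linear: "(\<exists>c. b = a + c) \<or> (\<exists>c. a = b + (c :: mnat))"
proof -
  obtain m e where "b + m b = a + e b" "m b = 0 \<or> e b = 0" using num_linear_strong[of a] by blast
  then show ?thesis using num_add_0 by metis
qed

lemma num_no_zero_divisors: "a * b = 0 \<Longrightarrow> a = 0 \<or> b = (0 :: mnat)"
  using num_cases_Suc[of a] num_cases_Suc[of b] num_Suc_0 by (auto simp: num_mult_Suc num_add_assoc[symmetric])

lemma num_zero_sum: "a + b = 0 \<Longrightarrow> a = (0 :: mnat)"
  using num_cases_Suc[of b] num_Suc_0 by (auto simp: num_add_assoc[symmetric] num_add_0)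

lemma num_0_1: "0 \<noteq> (1 :: mnat)" using num_Suc_0[of 0] by (simp add: num_0_add)

end

section \<open>The numbers as an ordered semiring\<close>

lemma mnat_laws_conj:
  fixes a b c :: mnat
  shows "a + b + c = a + (b + c) \<and> a + b = b + a \<and> a + 0 = a \<and> a * b * c = a * (b * c)
     \<and> a * b = b * a \<and> a * 1 = a \<and> a * 0 = 0 \<and> (a + b) * c = a * c + b * c \<and> (a + c = b + c \<longrightarrow> a = b)
     \<and> ((\<exists>d. b = a + d) \<or> (\<exists>d. a = b + d)) \<and> (a + b = 0 \<longrightarrow> a = 0) \<and> (a * b = 0 \<longrightarrow> a = 0 \<or> b = 0)
     \<and> 0 \<noteq> (1 :: mnat) \<and> (a = 0 \<or> (\<exists>d. a = d + 1))"
proof (cases good)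
  case True
  then interpret countermodel by unfold_locales (simp add: good_def)
  show ?thesis
    by (intro conjI impI num_add_assoc num_add_comm num_add_0 num_mult_assoc num_mult_comm num_mult_1 num_mult_0
      num_distrib num_cancel num_linear num_0_1 num_cases_Suc)
      (auto dest: num_zero_sum num_no_zero_divisors)
next
  case False
  note [simp] = index_of_of_index[OF False]
  have zero: "index_of 0 = 0"
    using index_of_of_index[OF False, of 0] by (simp add: zero_mnat_def of_index_def)
  have one: "index_of 1 = 1" and plus: "index_of (a + b) = index_of a + index_of b"
    and times: "index_of (a * b) = index_of a * index_of b" for a b :: mnat
    using False by (simp_all add: one_mnat_def plus_mnat_def times_mnat_def)
  have eq: "a = b \<longleftrightarrow> index_of a = index_of b" for a b :: mnat using index_of_inject[OF False] by simp
  have ex: "\<exists>d. b = a + d" if "index_of a \<le> index_of b" for a b :: mnat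
    using that by (intro exI[of _ "of_index (index_of b - index_of a)"]) (simp add: eq plus)
  have lin: "(\<exists>d. b = a + d) \<or> (\<exists>d. a = b + d)" for a b :: mnat
    using ex[of a b] ex[of b a] nat_le_linear by blast
  have pred: "a = 0 \<or> (\<exists>d. a = d + 1)" for a :: mnat
    by (cases "index_of a = 0", simp add: eq zero)
      (intro disjI2 exI[of _ "of_index (index_of a - 1)"], simp add: eq plus one)
  show ?thesis
    using lin[of b a] pred[of a] by (simp add: eq zero one plus times algebra_simps)
qed

lemma
  fixes a b c :: mnat
  shows mnat_add_assoc: "a + b + c = a + (b + c)" and mnat_add_comm: "a + b = b + a" and mnat_add_0: "a + 0 = a"
    and mnat_mult_assoc: "a * b * c = a * (b * c)" and mnat_mult_comm: "a * b = b * a" and mnat_mult_1: "a * 1 = a"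
    and mnat_mult_0: "a * 0 = 0" and mnat_distrib: "(a + b) * c = a * c + b * c"
    and mnat_cancel: "a + c = b + c \<longrightarrow> a = b" and mnat_linear: "(\<exists>d. b = a + d) \<or> (\<exists>d. a = b + d)"
    and mnat_zero_sum: "a + b = 0 \<longrightarrow> a = 0" and mnat_no_zero_divisors: "a * b = 0 \<longrightarrow> a = 0 \<or> b = 0"
    and mnat_0_1: "0 \<noteq> (1 :: mnat)" and mnat_cases: "a = 0 \<or> (\<exists>d. a = d + 1)"
  using mnat_laws_conj[of a b c] by blast+

instance mnat :: comm_semiring_1
proof
  fix a b c :: mnat
  show "0 + a = a" "1 * a = a" "0 * a = 0" "a * 0 = 0"
    using mnat_add_0[of a] mnat_add_comm[of a 0] mnat_mult_1[of a] mnat_mult_comm[of a 1]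
      mnat_mult_0[of a] mnat_mult_comm[of a 0] by simp_all
  show "a + b + c = a + (b + c)" "a + b = b + a" "a * b * c = a * (b * c)" "a * b = b * a" "(a + b) * c = a * c + b * c"
    by (rule mnat_add_assoc mnat_add_comm mnat_mult_assoc mnat_mult_comm mnat_distrib)+
  show "(0::mnat) \<noteq> 1" by (rule mnat_0_1)
qed

instantiation mnat :: linordered_semidom
begin
definition "a \<le> b \<longleftrightarrow> (\<exists>d. b = a + d)" for a b :: mnat
definition "a < b \<longleftrightarrow> a \<le> b \<and> a \<noteq> b" for a b :: mnat
definition "a - b = (if \<exists>d. a = b + d then SOME d. a = b + d else 0)" for a b :: mnat

instance
proof
  fix a b c :: mnat
  have cancel: "a + b = a + c \<Longrightarrow> b = c" for a b c :: mnat using mnat_cancel[of b a c] by (simp add: add.commute)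
  have minus: "a + b - a = b" for a b :: mnat
  proof -
    have "a + b = a + (SOME d. a + b = a + d)" by (rule someI) simp
    then have "b = (SOME d. a + b = a + d)" by (rule cancel)
    then show ?thesis by (auto simp: minus_mnat_def)
  qed
  have minus0: "a - (a + d) = 0" for a d :: mnat
  proof (cases "\<exists>e. a = a + d + e")
    case True
    then obtain e where "a = a + d + e" ..
    then have "d + e = 0" using cancel[of a 0 "d + e"] by (simp add: add.assoc)
    then have "d = 0" using mnat_zero_sum by blast
    then show ?thesis using minus[of a 0] by simp
  qed (simp add: minus_mnat_def)
  have le_antisym: "a = b" if le: "a \<le> b" "b \<le> a" for a b :: mnat
  proof -
    obtain d e where *: "b = a + d" "a = b + e" using le unfolding less_eq_mnat_def by blast
    then have "a + (d + e) = a + 0" by (metis add.assoc add_0_right)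
    then have "d + e = 0" by (rule cancel)
    then have "d = 0" using mnat_zero_sum by blast
    then show ?thesis using * by simp
  qed
  show "a + b - a = b" by (rule minus)
  show "a - b - c = a - (b + c)"
  proof -
    consider d where "a = b + c + d" | d e where "a = b + d" "c = d + e" | d where "b = a + d"
      using mnat_linear[of a b] mnat_linear[of _ c] add.assoc by metis
    then show ?thesis
    proof cases
      case 1 then show ?thesis using minus[of "b + c" d] minus[of b "c + d"] minus[of c d] by (simp add: add.assoc)
    next
      case 2 then show ?thesis using minus[of b d] minus0[of d e] minus0[of "b + d" e] by (simp add: add.assoc)
    next
      case 3 then show ?thesis using minus0[of a d] minus0[of a "d + c"] minus0[of 0 c] by (simp add: add.assoc)
    qed
  qed
  show "a * (b - c) = a * b - a * c"
  proof -
    consider d where "b = c + d" | d where "c = b + d" using mnat_linear by blast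
    then show ?thesis
      using minus minus0 by cases (simp_all add: distrib_left)
  qed
  show "a * b \<noteq> 0" if "a \<noteq> 0" "b \<noteq> 0" using that mnat_no_zero_divisors by blast
  show "a < b \<longleftrightarrow> a \<le> b \<and> \<not> b \<le> a"
    using le_antisym[of a b] by (auto simp: less_mnat_def less_eq_mnat_def intro: exI[of _ 0])
  show "a \<le> a" unfolding less_eq_mnat_def by (intro exI[of _ 0]) simp
  show "a \<le> b \<Longrightarrow> b \<le> c \<Longrightarrow> a \<le> c" unfolding less_eq_mnat_def by (auto simp: add.assoc)
  show "a \<le> b \<Longrightarrow> b \<le> a \<Longrightarrow> a = b" by (rule le_antisym)
  show "a \<le> b \<or> b \<le> a" unfolding less_eq_mnat_def by (rule mnat_linear)
  show "a \<le> b \<Longrightarrow> c + a \<le> c + b" unfolding less_eq_mnat_def by (auto simp: add.assoc)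
  show "c * a < c * b" if lt: "a < b" "0 < c"
  proof -
    obtain d where d: "b = a + d" using lt unfolding less_mnat_def less_eq_mnat_def by blast
    have "d \<noteq> 0" using lt d by (auto simp: less_mnat_def)
    note d = d this
    have "c * b = c * a + c * d" "c * d \<noteq> 0"
      using d lt mnat_no_zero_divisors[of c d] by (auto simp: distrib_left less_mnat_def)
    moreover from this have "c * a \<noteq> c * b" using cancel[of "c * a" 0 "c * d"] by auto
    ultimately show ?thesis unfolding less_mnat_def less_eq_mnat_def by blast
  qed
  show "(0::mnat) < 1" using mnat_0_1 unfolding less_mnat_def less_eq_mnat_def by auto
  show "b \<le> a \<Longrightarrow> a - b + b = a" unfolding less_eq_mnat_def by (elim exE) (simp add: minus, simp add: add.commute)
qed
end

lemma mnat_nonneg: "0 \<le> (a :: mnat)" unfolding less_eq_mnat_def by (intro exI[of _ a]) simp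

lemma mnat_discrete: "a < b \<Longrightarrow> a + 1 \<le> (b :: mnat)"
proof -
  assume "a < b"
  then obtain d where d: "b = a + d" "d \<noteq> 0" unfolding less_mnat_def less_eq_mnat_def by auto
  then obtain e where "d = e + 1" using mnat_cases[of d] by blast
  then show "a + 1 \<le> b" unfolding less_eq_mnat_def using d by (intro exI[of _ e]) (simp add: ac_simps)
qed

context countermodel
begin

text \<open>The primitive relation and the order defined by addition obey the same recursion in the
  right argument. For the induction, \<open>n \<le> num s\<close> is replaced by an equation
  \<open>m n = 0\<close>, because the defined order hides an existential quantifier.\<close>

lemma Lt_iff: "s \<in> Dom N \<Longrightarrow> t \<in> Dom N \<Longrightarrow> (s \<^bold>< t) \<in> \<Gamma>\<^sub>0 \<longleftrightarrow> num s < num t"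
proof -
  assume s: "s \<in> Dom N" and t: "t \<in> Dom N"
  have add: "(s \<^bold>< u) \<in> \<Gamma>\<^sub>0 \<longleftrightarrow> (s \<^bold>< v) \<in> \<Gamma>\<^sub>0" if "u \<in> Dom N" "v \<in> Dom N" "num u = num v" for u v
    using that s Lt_cong[of s s u v] Lt_cong[of s s v u] N_refl[OF s] num_eq_iff[of u v] num_eq_iff[of v u] by auto
  have "(s \<^bold>< term_of n) \<in> \<Gamma>\<^sub>0 \<longleftrightarrow> num s < n" for n
  proof -
    have less_Suc: "a < b + 1 \<longleftrightarrow> a < b \<or> a = b" for a b :: mnat
    proof (cases a b rule: linorder_cases)
      case less then show ?thesis using less_trans[OF less less_add_one] by simp
    next
      case greater then show ?thesis using mnat_discrete[of b a] by auto
    qed simp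
    have "\<exists>m. definable m \<and> (\<forall>n. m n = 0 \<longleftrightarrow> n \<le> num s)"
    proof -
      obtain m e where me: "definable e" "\<And>b. b + m b = num s + e b" "\<And>b. m b = 0 \<or> e b = 0"
        using num_linear_strong[of "num s"] by blast
      have "e n = 0 \<longleftrightarrow> n \<le> num s" for n
      proof
        assume "e n = 0"
        then have "num s = n + m n" using me(2)[of n] by simp
        then show "n \<le> num s" unfolding less_eq_mnat_def by blast
      next
        assume le: "n \<le> num s"
        show "e n = 0"
        proof (rule ccontr)
          assume "e n \<noteq> 0"
          then have "n = num s + e n" "0 < e n" using me(2)[of n] me(3)[of n] mnat_nonneg[of "e n"] by auto
          then show False using le by (metis add_le_same_cancel1 not_le)
        qed
      qed
      then show ?thesis using me(1) by blast
    qed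
    then obtain m where m: "definable m" "\<And>n. m n = 0 \<longleftrightarrow> n \<le> num s" by blast
    have "(s \<^bold>< term_of n) \<in> \<Gamma>\<^sub>0 \<longleftrightarrow> \<not> m n = 0"
    proof (induction n rule: num_induct)
      show "decidable (\<lambda>n. (s \<^bold>< term_of n) \<in> \<Gamma>\<^sub>0 \<longleftrightarrow> \<not> m n = 0)"
        by (intro decidable_iff decidable_less s decidable_not decidable_eq definable_const m(1))
    next
      show "(s \<^bold>< term_of 0) \<in> \<Gamma>\<^sub>0 \<longleftrightarrow> \<not> m 0 = 0"
        using add[of "term_of 0" "\<^bold>0"] term_of less_zero[OF s] m(2) mnat_nonneg by simp
    next
      fix n assume IH: "(s \<^bold>< term_of n) \<in> \<Gamma>\<^sub>0 \<longleftrightarrow> \<not> m n = 0"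
      have "(s \<^bold>< term_of (n + 1)) \<in> \<Gamma>\<^sub>0 \<longleftrightarrow> (s \<^bold>< term_of n \<^bold>+ \<^bold>1) \<in> \<Gamma>\<^sub>0"
        using term_of by (intro add) auto
      also have "\<dots> \<longleftrightarrow> num s < n \<or> num s = n"
        using less_succ[OF s, of "term_of n"] IH m(2)[of n] term_of num_eq_iff[of s "term_of n"] s by auto
      finally show "(s \<^bold>< term_of (n + 1)) \<in> \<Gamma>\<^sub>0 \<longleftrightarrow> \<not> m (n + 1) = 0"
        using less_Suc[of "num s" n] m(2)[of "n + 1"] by auto
    qed
    then show ?thesis using m(2)[of n] by (simp add: not_le)
  qed
  then show ?thesis using add[of t "term_of (num t)"] t term_of[of "num t"] by simp
qed

end

section \<open>Differences, fractions and ultrapowers\<close>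

quotient_type (overloaded) 'a zz = "'a::linordered_semidom \<times> 'a" / "\<lambda>(a, b) (c, d). a + d = c + b"
proof (rule equivpI)
  show "transp (\<lambda>(a, b) (c, d). a + d = c + (b::'a))"
  proof (rule transpI, clarify)
    fix a b c d e f :: 'a assume "a + d = c + b" "c + f = e + d"
    then have "a + f + (c + d) = e + b + (c + d)" by (metis (no_types) add.assoc add.commute)
    then show "a + f = e + b" by simp
  qed
qed (auto simp: reflp_def symp_def)

instantiation zz :: (linordered_semidom) "{comm_ring_1, linorder}"
begin
lift_definition zero_zz :: "'a zz" is "(0, 0)" .
lift_definition one_zz :: "'a zz" is "(1, 0)" .
lift_definition plus_zz :: "'a zz \<Rightarrow> 'a zz \<Rightarrow> 'a zz" is "\<lambda>(a, b) (c, d). (a + c, b + d)"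
  by clarsimp (metis (no_types) add.assoc add.commute)
lift_definition uminus_zz :: "'a zz \<Rightarrow> 'a zz" is "\<lambda>(a, b). (b, a)" by (clarsimp simp: add.commute)
lift_definition minus_zz :: "'a zz \<Rightarrow> 'a zz \<Rightarrow> 'a zz" is "\<lambda>(a, b) (c, d). (a + d, b + c)"
  by clarsimp (metis (no_types) add.assoc add.commute)
lift_definition times_zz :: "'a zz \<Rightarrow> 'a zz \<Rightarrow> 'a zz" is "\<lambda>(a, b) (c, d). (a * c + b * d, a * d + b * c)"
proof clarsimp
  fix a b c d a' b' c' d' :: 'a assume 1: "a + b' = a' + b" and 2: "c + d' = c' + d"
  \<comment> \<open>Independence of the representatives is checked one factor at a time:
    \<open>l\<close> exchanges the first pair, \<open>r\<close> the second, and adding both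
    equations leaves a common summand to cancel.\<close>
  have l: "(a * c + b * d) + (a' * d + b' * c) = (a' * c + b' * d) + (a * d + b * c)"
  proof -
    have "(a * c + b * d) + (a' * d + b' * c) = (a + b') * c + (a' + b) * d" by (simp add: algebra_simps)
    also have "\<dots> = (a' + b) * c + (a + b') * d" by (simp add: 1)
    also have "\<dots> = (a' * c + b' * d) + (a * d + b * c)" by (simp add: algebra_simps)
    finally show ?thesis .
  qed
  have r: "(a' * c + b' * d) + (a' * d' + b' * c') = (a' * c' + b' * d') + (a' * d + b' * c)"
  proof -
    have "(a' * c + b' * d) + (a' * d' + b' * c') = a' * (c + d') + b' * (c' + d)" by (simp add: algebra_simps)
    also have "\<dots> = a' * (c' + d) + b' * (c + d')" by (simp add: 2)
    also have "\<dots> = (a' * c' + b' * d') + (a' * d + b' * c)" by (simp add: algebra_simps)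
    finally show ?thesis .
  qed
  have "(a * c + b * d + (a' * d' + b' * c')) + ((a' * c + b' * d) + (a' * d + b' * c))
      = (a' * c' + b' * d' + (a * d + b * c)) + ((a' * c + b' * d) + (a' * d + b' * c))"
    using arg_cong2[OF l r, of "(+)"] by (simp only: add_ac)
  then show "a * c + b * d + (a' * d' + b' * c') = a' * c' + b' * d' + (a * d + b * c)" by simp
qed
lift_definition less_eq_zz :: "'a zz \<Rightarrow> 'a zz \<Rightarrow> bool" is "\<lambda>(a, b) (c, d). a + d \<le> c + b"
proof clarsimp
  fix a b c d a' b' c' d' :: 'a assume 1: "a + b' = a' + b" and 2: "c + d' = c' + d"
  have "a + d \<le> c + b \<longleftrightarrow> a + d + (b' + d') \<le> c + b + (b' + d')" by simp
  also have "\<dots> \<longleftrightarrow> (a + b') + d + d' \<le> (c + d') + b + b'" by (simp add: add_ac)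
  also have "\<dots> \<longleftrightarrow> (a' + d') + (b + d) \<le> (c' + b') + (b + d)" unfolding 1 2 by (simp add: add_ac)
  finally show "a + d \<le> c + b \<longleftrightarrow> a' + d' \<le> c' + b'" by simp
qed
definition less_zz :: "'a zz \<Rightarrow> 'a zz \<Rightarrow> bool" where "less_zz a b \<longleftrightarrow> a \<le> b \<and> \<not> b \<le> a"
instance
proof
  fix a b c :: "'a zz"
  show "a \<le> b \<Longrightarrow> b \<le> c \<Longrightarrow> a \<le> c"
  proof (transfer, clarsimp)
    fix a b c d e f :: 'a assume 1: "a + d \<le> c + b" and 2: "c + f \<le> e + d"
    from add_mono[OF 1 2] have "(a + f) + (c + d) \<le> (e + b) + (c + d)" by (simp add: add_ac)
    then show "a + f \<le> e + b" by simp
  qed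
qed (transfer; force simp: less_zz_def algebra_simps)+
end

instantiation zz :: (linordered_semidom) linordered_idom
begin
definition zz_abs: "\<bar>a :: 'a zz\<bar> = (if a < 0 then - a else a)"
definition sgn_zz :: "'a zz \<Rightarrow> 'a zz" where "sgn_zz a = (if a = 0 then 0 else if 0 < a then 1 else - 1)"
instance
proof
  fix a b c :: "'a zz"
  show "a \<le> b \<Longrightarrow> c + a \<le> c + b" by transfer (force simp: add_ac)
  show "a < b \<Longrightarrow> 0 < c \<Longrightarrow> c * a < c * b"
    unfolding less_zz_def
  proof (transfer, clarify, unfold prod.case mult_zero_left mult_zero_right add_0_left add_0_right not_le, intro conjI)
    fix a b c d e f :: 'a assume 1: "a + d < c + b" and 2: "f < e"
    obtain g where e: "e = f + g" "0 < g"
      using 2 le_add_diff_inverse[of f e] by (metis add_less_same_cancel1 add.commute add_less_cancel_left add_0_right less_imp_le)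
    have "g * (a + d) < g * (c + b)" using 1 e by (intro mult_strict_left_mono)
    then have "g * (a + d) + f * (a + b + c + d) < g * (c + b) + f * (a + b + c + d)" by simp
    also have "g * (a + d) + f * (a + b + c + d) = e * a + f * b + (e * d + f * c)" unfolding e by (simp add: algebra_simps)
    also have "g * (c + b) + f * (a + b + c + d) = e * c + f * d + (e * b + f * a)" unfolding e by (simp add: algebra_simps)
    finally show "e * a + f * b + (e * d + f * c) < e * c + f * d + (e * b + f * a)" .
    then show "e * a + f * b + (e * d + f * c) \<le> e * c + f * d + (e * b + f * a)" by simp
  qed
qed (simp_all add: zz_abs sgn_zz_def)
end

lift_definition zn :: "'a::linordered_semidom \<Rightarrow> 'a zz" is "\<lambda>a. (a, 0)" .

lemma zn_simps [simp]:
  "zn 0 = 0" "zn 1 = 1" "zn (a + b) = zn a + zn b" "zn (a * b) = zn a * zn b" "zn a \<le> zn b \<longleftrightarrow> a \<le> b" "zn a = zn b \<longleftrightarrow> a = b"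
  by (transfer; simp)+
lemma zn_less [simp]: "zn a < zn b \<longleftrightarrow> a < b" by (simp add: less_le)

lemma zn_cases: "\<exists>a b. z = zn a - zn b" by transfer auto

definition qn :: "'a::linordered_semidom \<Rightarrow> 'a zz fract" where "qn a = Fract (zn a) 1"

lemma qn_simps [simp]:
  "qn 0 = 0" "qn 1 = 1" "qn (a + b) = qn a + qn b" "qn (a * b) = qn a * qn b" "qn a \<le> qn b \<longleftrightarrow> a \<le> b" "qn a = qn b \<longleftrightarrow> a = b"
  "qn a < qn b \<longleftrightarrow> a < b"
  by (simp_all add: qn_def Zero_fract_def One_fract_def eq_fract zero_less_one less_le)

lemma qn_pos [simp]: "0 < qn a \<longleftrightarrow> 0 < a" using qn_simps(7)[of 0 a] by simp

lemma qn_cases: "\<exists>a b c. 0 < c \<and> q = (qn a - qn b) / qn c"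
proof (cases q rule: Fract_cases_nonzero)
  case 0 then show ?thesis by (intro exI[of _ 0] exI[of _ 1]) simp
next
  case (Fract a b)
  have *: "\<exists>a b c. 0 < c \<and> Fract x y = (qn a - qn b) / qn c" if "0 < y" for x y :: "'a zz"
  proof -
    obtain a b c d where x: "x = zn a - zn b" "y = zn c - zn d" using zn_cases by metis
    with that have "d < c" by simp
    then obtain e where e: "c = d + e" "0 < e"
      by (metis add.commute add_less_same_cancel1 le_add_diff_inverse less_imp_le add_less_cancel_left add_0_right)
    then have "y = zn e" "zn e \<noteq> 0" using x zn_simps(6)[of e 0] by (auto simp del: zn_simps(6))
    then have "Fract x y = (qn a - qn b) / qn e" using x by (simp add: qn_def)
    then show ?thesis using e by blast
  qed
  have "q = Fract a b" "q = Fract (- a) (- b)" using Fract by simp_all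
  moreover have "0 < b \<or> 0 < - b" using Fract by auto
  ultimately show ?thesis using *[of b a] *[of "- b" "- a"] by metis
qed

section \<open>An ultrafilter of end segments and its ultrapower\<close>

definition proper :: "'a set set \<Rightarrow> bool" where
  "proper U \<longleftrightarrow> {} \<notin> U \<and> (\<forall>A\<in>U. \<forall>B\<in>U. A \<inter> B \<in> U) \<and> (\<forall>A\<in>U. \<forall>B. A \<subseteq> B \<longrightarrow> B \<in> U)"

text \<open>Containing all end segments \<open>{a..}\<close> is what makes a relation that holds
  from some index on true between the classes of sequences.\<close>

definition ultra :: "'a::linorder set set" where
  "ultra = (SOME U. proper U \<and> (\<forall>a. {a..} \<in> U) \<and> (\<forall>A. A \<in> U \<or> - A \<in> U))"

text \<open>Zorn's lemma for the proper filters that contain all end segments. A maximal one decides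
  every \<open>A\<close>: if it omits \<open>- A\<close>, then it generates together with
  \<open>A\<close> a filter that is still proper.\<close>

lemma ex_ultra: "\<exists>U :: 'a::linorder set set. proper U \<and> (\<forall>a. {a..} \<in> U) \<and> (\<forall>A. A \<in> U \<or> - A \<in> U)"
proof -
  define T :: "'a set set" where "T = {A. \<exists>a. {a..} \<subseteq> A}"
  define \<A> where "\<A> = {U. proper U \<and> T \<subseteq> U}"
  have "T \<in> \<A>"
  proof -
    have "{max a b..} \<subseteq> A \<inter> B" if "{a..} \<subseteq> A" "{b..} \<subseteq> B" for a b :: 'a and A B using that by auto
    then show ?thesis unfolding \<A>_def proper_def T_def by blast
  qed
  have "\<exists>M\<in>\<A>. \<forall>X\<in>\<A>. M \<subseteq> X \<longrightarrow> X = M"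
  proof (rule subset_Zorn_nonempty)
    show "\<A> \<noteq> {}" using \<open>T \<in> \<A>\<close> by blast
    fix C assume C: "C \<noteq> {}" "subset.chain \<A> C"
    then have sub: "C \<subseteq> \<A>" and ch: "\<And>X Y. X \<in> C \<Longrightarrow> Y \<in> C \<Longrightarrow> X \<subseteq> Y \<or> Y \<subseteq> X"
      by (auto simp: subset_chain_def)
    have "A \<inter> B \<in> \<Union>C" if AB: "A \<in> \<Union>C" "B \<in> \<Union>C" for A B
    proof -
      obtain X Y where "X \<in> C" "Y \<in> C" "A \<in> X" "B \<in> Y" using AB by blast
      then obtain Z where "Z \<in> C" "A \<in> Z" "B \<in> Z" using ch by blast
      then show ?thesis using sub unfolding \<A>_def proper_def by blast
    qed
    moreover have "{} \<notin> \<Union>C" using sub unfolding \<A>_def proper_def by blast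
    moreover have "B \<in> \<Union>C" if "A \<in> \<Union>C" "A \<subseteq> B" for A B using that sub unfolding \<A>_def proper_def by blast
    moreover have "T \<subseteq> \<Union>C" using C(1) sub unfolding \<A>_def by blast
    ultimately show "\<Union>C \<in> \<A>" unfolding \<A>_def proper_def by blast
  qed
  then obtain M where M: "M \<in> \<A>" "\<And>X. X \<in> \<A> \<Longrightarrow> M \<subseteq> X \<Longrightarrow> X = M" by blast
  have "A \<in> M \<or> - A \<in> M" for A
  proof (rule disjCI)
    assume n: "- A \<notin> M"
    define X where "X = {B. \<exists>D\<in>M. D \<inter> A \<subseteq> B}"
    have pM: "proper M" "T \<subseteq> M" using M(1) unfolding \<A>_def by auto
    have "M \<subseteq> X" unfolding X_def by blast
    moreover have "{} \<notin> X"
    proof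
      assume "{} \<in> X"
      then obtain D where "D \<in> M" "D \<subseteq> - A" unfolding X_def by blast
      then show False using n pM unfolding proper_def by blast
    qed
    moreover have "B \<inter> B' \<in> X" if BB: "B \<in> X" "B' \<in> X" for B B'
    proof -
      obtain D D' where "D \<in> M" "D' \<in> M" "D \<inter> A \<subseteq> B" "D' \<inter> A \<subseteq> B'" using BB unfolding X_def by blast
      moreover from this have "D \<inter> D' \<in> M" using pM unfolding proper_def by blast
      moreover have "D \<inter> D' \<inter> A \<subseteq> B \<inter> B'" using calculation by blast
      ultimately show ?thesis unfolding X_def by (intro CollectI bexI)
    qed
    moreover have "B' \<in> X" if "B \<in> X" "B \<subseteq> B'" for B B' using that unfolding X_def by blast
    ultimately have "proper X" unfolding proper_def by (intro conjI ballI allI impI)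
    then have "X \<in> \<A>" using pM \<open>M \<subseteq> X\<close> unfolding \<A>_def by blast
    then have "X = M" using M(2) \<open>M \<subseteq> X\<close> by blast
    moreover have "UNIV \<in> T" unfolding T_def by blast
    then have "UNIV \<in> M" using pM by blast
    then have "A \<in> X" unfolding X_def by (intro CollectI bexI[of _ UNIV]) auto
    ultimately show "A \<in> M" by simp
  qed
  moreover have "{a..} \<in> M" for a using M(1) unfolding \<A>_def T_def by blast
  ultimately show ?thesis using M(1) unfolding \<A>_def by blast
qed

lemma ultra: "proper (ultra :: 'a::linorder set set)" "{a..} \<in> ultra" "A \<in> ultra \<or> - A \<in> ultra" for a :: "'a::linorder" and A :: "'a set"
  using someI_ex[OF ex_ultra[where 'a='a]] unfolding ultra_def by blast+

definition almost :: "('a::linorder \<Rightarrow> bool) \<Rightarrow> bool" where "almost P \<longleftrightarrow> Collect P \<in> ultra"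

lemma almost_mono: "almost P \<Longrightarrow> (\<And>x. P x \<Longrightarrow> Q x) \<Longrightarrow> almost Q"
  using ultra(1) unfolding almost_def proper_def by (metis Collect_mono)
lemma almost_conj: "almost P \<Longrightarrow> almost Q \<Longrightarrow> almost (\<lambda>x. P x \<and> Q x)"
  using ultra(1) unfolding almost_def proper_def by (metis Collect_conj_eq)
lemma almost_mono2: "almost P \<Longrightarrow> almost Q \<Longrightarrow> (\<And>x. P x \<Longrightarrow> Q x \<Longrightarrow> R x) \<Longrightarrow> almost R"
  using almost_conj almost_mono by (metis (mono_tags, lifting))
lemma almost_not:
  fixes P :: "'a::linorder \<Rightarrow> bool"
  shows "almost (\<lambda>x. \<not> P x) \<longleftrightarrow> \<not> almost P"
proof
  assume *: "almost (\<lambda>x. \<not> P x)"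
  show "\<not> almost P"
  proof
    assume "almost P"
    from almost_conj[OF this *] show False using ultra(1)[where 'a='a] unfolding almost_def proper_def by simp
  qed
next
  assume "\<not> almost P"
  then have "- Collect P \<in> ultra" using ultra(3) unfolding almost_def by blast
  then show "almost (\<lambda>x. \<not> P x)" unfolding almost_def by (simp add: Collect_neg_eq)
qed
lemma almost_ge: "(\<And>x. a \<le> x \<Longrightarrow> P x) \<Longrightarrow> almost P"
proof -
  assume "\<And>x. a \<le> x \<Longrightarrow> P x"
  moreover have "almost (\<lambda>x. a \<le> x)" using ultra(2)[of a] by (simp add: almost_def atLeast_def)
  ultimately show "almost P" by (blast intro: almost_mono)
qed
lemma almost_all: "(\<And>x. P x) \<Longrightarrow> almost P" by (rule almost_ge)
lemma almost_cong: "almost (\<lambda>x. P x = Q x) \<Longrightarrow> almost P = almost Q"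
  by (rule iffI; erule (1) almost_mono2; simp)
lemma almost_const [simp]: "almost (\<lambda>x. P) \<longleftrightarrow> P"
  using almost_not[of "\<lambda>x. True"] by (cases P) (simp_all add: almost_all)

quotient_type (overloaded) ('a, 'b) upower = "'a::linorder \<Rightarrow> 'b" / "\<lambda>f g. almost (\<lambda>x. f x = g x)"
  by (rule equivpI) (auto simp: reflp_def symp_def transp_def intro: almost_all elim: almost_mono almost_mono2)

instantiation upower :: (linorder, linordered_field) linordered_field
begin
lift_definition zero_upower :: "('a, 'b) upower" is "\<lambda>_. 0" .
lift_definition one_upower :: "('a, 'b) upower" is "\<lambda>_. 1" .
lift_definition plus_upower :: "('a, 'b) upower \<Rightarrow> ('a, 'b) upower \<Rightarrow> ('a, 'b) upower" is "\<lambda>f g x. f x + g x"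
  by (erule (1) almost_mono2, simp)
lift_definition times_upower :: "('a, 'b) upower \<Rightarrow> ('a, 'b) upower \<Rightarrow> ('a, 'b) upower" is "\<lambda>f g x. f x * g x"
  by (erule (1) almost_mono2, simp)
lift_definition minus_upower :: "('a, 'b) upower \<Rightarrow> ('a, 'b) upower \<Rightarrow> ('a, 'b) upower" is "\<lambda>f g x. f x - g x"
  by (erule (1) almost_mono2, simp)
lift_definition uminus_upower :: "('a, 'b) upower \<Rightarrow> ('a, 'b) upower" is "\<lambda>f x. - f x"
  by (erule almost_mono) simp
lift_definition inverse_upower :: "('a, 'b) upower \<Rightarrow> ('a, 'b) upower" is "\<lambda>f x. inverse (f x)"
  by (erule almost_mono) simp
definition divide_upower :: "('a, 'b) upower \<Rightarrow> ('a, 'b) upower \<Rightarrow> ('a, 'b) upower" where "divide_upower a b = a * inverse b"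
lift_definition less_eq_upower :: "('a, 'b) upower \<Rightarrow> ('a, 'b) upower \<Rightarrow> bool" is "\<lambda>f g. almost (\<lambda>x. f x \<le> g x)"
  by (rule almost_cong, erule (1) almost_mono2, simp)
definition less_upower :: "('a, 'b) upower \<Rightarrow> ('a, 'b) upower \<Rightarrow> bool" where "less_upower a b \<longleftrightarrow> a \<le> b \<and> \<not> b \<le> a"
definition upower_abs: "\<bar>a :: ('a, 'b) upower\<bar> = (if a < 0 then - a else a)"
definition sgn_upower :: "('a, 'b) upower \<Rightarrow> ('a, 'b) upower" where "sgn_upower a = (if a = 0 then 0 else if 0 < a then 1 else - 1)"
instance
proof
  fix a b c :: "('a, 'b) upower"
  show "a + b + c = a + (b + c)" "a + b = b + a" "0 + a = a" "- a + a = 0" "a - b = a + - b" "a * b * c = a * (b * c)"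
    "a * b = b * a" "1 * a = a" "(a + b) * c = a * c + b * c" "a + b - a = b" "a - b - c = a - (b + c)" "0 * a = 0" "a * 0 = 0"
    by (transfer; rule almost_all; simp add: algebra_simps)+
  show "(0 :: ('a, 'b) upower) \<noteq> 1" by transfer simp
  show "inverse a * a = 1" if "a \<noteq> 0" using that
    by transfer (auto simp: almost_not[symmetric] elim: almost_mono)
  show "inverse (0 :: ('a, 'b) upower) = 0" by transfer simp
  show "a \<le> a" by transfer (simp add: almost_all)
  show "a \<le> b \<Longrightarrow> b \<le> c \<Longrightarrow> a \<le> c" by transfer (auto elim: almost_mono2)
  show "a \<le> b \<Longrightarrow> b \<le> a \<Longrightarrow> a = b" by transfer (auto elim: almost_mono2)
  show "a \<le> b \<or> b \<le> a"
  proof transfer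
    fix f g :: "'a \<Rightarrow> 'b"
    show "almost (\<lambda>x. f x \<le> g x) \<or> almost (\<lambda>x. g x \<le> f x)"
      using almost_not[of "\<lambda>x. f x \<le> g x"] almost_mono[of "\<lambda>x. \<not> f x \<le> g x" "\<lambda>x. g x \<le> f x"] by auto
  qed
  show "a \<le> b \<Longrightarrow> c + a \<le> c + b" by transfer (erule almost_mono, simp)
  show "a < b \<Longrightarrow> 0 < c \<Longrightarrow> c * a < c * b"
    unfolding less_upower_def
  proof transfer
    fix f g h :: "'a \<Rightarrow> 'b"
    assume 1: "almost (\<lambda>x. f x \<le> g x) \<and> \<not> almost (\<lambda>x. g x \<le> f x)" and 2: "almost (\<lambda>x. 0 \<le> h x) \<and> \<not> almost (\<lambda>x. h x \<le> 0)"
    have "almost (\<lambda>x. \<not> g x \<le> f x)" "almost (\<lambda>x. \<not> h x \<le> 0)" using 1 2 by (simp_all add: almost_not)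
    then have 3: "almost (\<lambda>x. \<not> h x * g x \<le> h x * f x)" by (rule almost_mono2) (simp add: not_le)
    then have "almost (\<lambda>x. h x * f x \<le> h x * g x)" by (rule almost_mono) simp
    then show "almost (\<lambda>x. h x * f x \<le> h x * g x) \<and> \<not> almost (\<lambda>x. h x * g x \<le> h x * f x)"
      using 3 almost_not[of "\<lambda>x. h x * g x \<le> h x * f x"] by simp
  qed
qed (auto simp: divide_upower_def less_upower_def upower_abs sgn_upower_def)
end

lift_definition seq :: "('a::linorder \<Rightarrow> 'b::linordered_field) \<Rightarrow> ('a, 'b) upower" is "\<lambda>f. f" .

lemma seq_diff: "seq (\<lambda>n. s n - t n) = seq s - seq t" by transfer (simp add: almost_all)
lemma seq_mono: "(\<And>n. a \<le> n \<Longrightarrow> s n \<le> t n) \<Longrightarrow> seq s \<le> seq t" by transfer (rule almost_ge)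

definition cst :: "'b::linordered_field \<Rightarrow> ('a::linorder, 'b) upower" where "cst q = seq (\<lambda>_. q)"

lemma cst_simps [simp]:
  "cst 0 = 0" "cst 1 = 1" "cst (a + b) = cst a + cst b" "cst (a - b) = cst a - cst b" "cst (- a) = - cst a"
  "cst (a * b) = cst a * cst b" "cst (inverse a) = inverse (cst a)" "cst (a / b) = cst a / cst b"
  "cst a \<le> cst b \<longleftrightarrow> a \<le> b" "cst a = cst b \<longleftrightarrow> a = b" "cst a < cst b \<longleftrightarrow> a < b"
  unfolding cst_def divide_upower_def less_upower_def divide_inverse by (transfer; simp add: less_le_not_le)+

lemma cst_neg [simp]: "cst a < 0 \<longleftrightarrow> a < 0" by (subst cst_simps(1)[symmetric]) (simp only: cst_simps(11))
lemma cst_pos [simp]: "0 < cst a \<longleftrightarrow> 0 < a" by (subst cst_simps(1)[symmetric]) (simp only: cst_simps(11))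
lemma cst_abs [simp]: "cst \<bar>a\<bar> = \<bar>cst a\<bar>" by (simp add: abs_if)
lemma cst_numeral [simp]: "cst (numeral k) = numeral k"
  by (induction k) (simp_all only: numeral.simps cst_simps)

section \<open>Models of recursive comprehension\<close>

definition pair :: "'n::linordered_semidom \<Rightarrow> 'n \<Rightarrow> 'n" where "pair a b = (a + b) * (a + b) + a"

text \<open>The type variables \<open>'n\<close> and \<open>'f\<close> stand for the objects of type \<open>0\<close> and \<open>1\<close>; \<open>dfn\<close> and \<open>dm\<close>
  single out the functionals that are objects of type \<open>2\<close> and \<open>1 \<rightarrow> 1\<close>. A functional with an
  additional number argument \<open>n\<close> is treated as a functional of \<open>push z n\<close>, from which \<open>lft\<close> and
  \<open>rgt\<close> recover \<open>z\<close> and \<open>n\<close>.\<close>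

locale rca =
  fixes ap :: "'f \<Rightarrow> 'n::linordered_semidom \<Rightarrow> 'n" (infixl "$" 900)
    and lf rg p2 :: "'n \<Rightarrow> 'n"
    and lft rgt :: "'f \<Rightarrow> 'f"
    and push :: "'f \<Rightarrow> 'n \<Rightarrow> 'f"
    and dfn :: "('f \<Rightarrow> 'n) \<Rightarrow> bool"
    and dm :: "('f \<Rightarrow> 'f) \<Rightarrow> bool"
  assumes ext: "(\<And>n. x $ n = y $ n) \<Longrightarrow> x = y"
    and nonneg [simp]: "0 \<le> (a :: 'n)"
    and discrete: "a < b \<Longrightarrow> a + 1 \<le> (b :: 'n)"
    and lf_pair [simp]: "lf (pair a b) = a"
    and rg_pair [simp]: "rg (pair a b) = b"
    and p2_0 [simp]: "p2 0 = 1"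
    and p2_Suc [simp]: "p2 (n + 1) = p2 n + p2 n"
    and lft_ap: "lft z $ n = lf (z $ n)"
    and rgt_ap: "rgt z $ n = rg (z $ n)"
    and push_ap: "push z a $ n = pair (z $ n) a"
    and dfn_const: "dfn (\<lambda>z. a)"
    and dfn_plus: "dfn G \<Longrightarrow> dfn H \<Longrightarrow> dfn (\<lambda>z. G z + H z)"
    and dfn_times: "dfn G \<Longrightarrow> dfn H \<Longrightarrow> dfn (\<lambda>z. G z * H z)"
    and dfn_minus: "dfn G \<Longrightarrow> dfn H \<Longrightarrow> dfn (\<lambda>z. G z - H z)"
    and dfn_lf: "dfn G \<Longrightarrow> dfn (\<lambda>z. lf (G z))"
    and dfn_rg: "dfn G \<Longrightarrow> dfn (\<lambda>z. rg (G z))"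
    and dfn_p2: "dfn G \<Longrightarrow> dfn (\<lambda>z. p2 (G z))"
    and dfn_ap: "dm A \<Longrightarrow> dfn G \<Longrightarrow> dfn (\<lambda>z. A z $ G z)"
    and dfn_comp: "dfn G \<Longrightarrow> dm A \<Longrightarrow> dfn (\<lambda>z. G (A z))"
    and dm_comp: "dm B \<Longrightarrow> dm A \<Longrightarrow> dm (\<lambda>z. B (A z))"
    and dm_id: "dm (\<lambda>z. z)"
    and dm_const: "dm (\<lambda>z. x)"
    and dm_lft0: "dm lft" and dm_rgt0: "dm rgt"
    and dm_lam: "dfn (\<lambda>z. K (lft z) (rgt z $ 0)) \<Longrightarrow> \<exists>A. dm A \<and> (\<forall>z n. A z $ n = K z n)"
    and dfn_rec: "dfn G \<Longrightarrow> dfn (\<lambda>z. S (lft z) (lf (rgt z $ 0)) (rg (rgt z $ 0))) \<Longrightarrow>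
      \<exists>R. dfn (\<lambda>z. R (lft z) (rgt z $ 0)) \<and> (\<forall>z. R z 0 = G z) \<and> (\<forall>z n. R z (n + 1) = S z n (R z n))"
    and induct0: "dfn (\<lambda>z. f (z $ 0)) \<Longrightarrow> f 0 = 1 \<Longrightarrow> (\<And>n. f n = 1 \<Longrightarrow> f (n + 1) = 1) \<Longrightarrow> f n = 1"
    and choice0: "dfn (\<lambda>z. K (lft z) (rgt z $ 0)) \<Longrightarrow> (\<And>x. \<exists>n. K x n = 1) \<Longrightarrow> \<exists>Y. dfn Y \<and> (\<forall>x. K x (Y x) = 1)"
begin

lemma lft_push [simp]: "lft (push z a) = z" by (rule ext) (simp add: push_ap lft_ap)
lemma rgt_push [simp]: "rgt (push z a) $ n = a" by (simp add: push_ap rgt_ap)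

lemma dm_lft: "dm A \<Longrightarrow> dm (\<lambda>z. lft (A z))" by (rule dm_comp[OF dm_lft0])
lemma dm_rgt: "dm A \<Longrightarrow> dm (\<lambda>z. rgt (A z))" by (rule dm_comp[OF dm_rgt0])

lemma dfn_pair: "dfn G \<Longrightarrow> dfn H \<Longrightarrow> dfn (\<lambda>z. pair (G z) (H z))"
  unfolding pair_def by (intro dfn_plus dfn_times)

text \<open>Turns a numerical function into the object that represents it; by \<open>ext\<close>
  there is at most one, and \<open>Fn_ap\<close> gives a condition under which there is one.\<close>

definition Fn :: "('n \<Rightarrow> 'n) \<Rightarrow> 'f" where "Fn g = (SOME w. \<forall>n. w $ n = g n)"

lemma Fn_eq: "(\<And>n. w $ n = g n) \<Longrightarrow> Fn g = w"
proof -
  assume w: "\<And>n. w $ n = g n"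
  then have "\<forall>n. Fn g $ n = g n" unfolding Fn_def by (rule_tac someI[of _ w]) blast
  then show ?thesis using w by (intro ext) simp
qed

lemma Fn:
  assumes "dfn (\<lambda>z. G (lft z) (rgt z $ 0))"
  shows dm_Fn: "dm (\<lambda>z. Fn (G z))" and Fn_ap: "Fn (G z) $ n = G z n"
proof -
  obtain A where A: "dm A" "\<And>z n. A z $ n = G z n" using dm_lam[OF assms] by blast
  have eq: "Fn (G z) = A z" for z by (rule Fn_eq) (rule A(2))
  then have "(\<lambda>z. Fn (G z)) = A" by blast
  then show "dm (\<lambda>z. Fn (G z))" using A by simp
  show "Fn (G z) $ n = G z n" using eq A by simp
qed

lemmas Fn_ap' = Fn_ap[of "\<lambda>_. g" for g]

lemma dm_push: "dm A \<Longrightarrow> dfn G \<Longrightarrow> dm (\<lambda>z. push (A z) (G z))"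
proof -
  assume A: "dm A" and G: "dfn G"
  have d: "dfn (\<lambda>z. pair (A (lft z) $ (rgt z $ 0)) (G (lft z)))"
    by (intro dfn_pair dfn_ap dm_comp[OF A] dfn_comp[OF G] dm_lft0 dm_rgt0 dfn_const)
  obtain B where B: "dm B" "\<And>z n. B z $ n = pair (A z $ n) (G z)"
    using dm_lam[of "\<lambda>z n. pair (A z $ n) (G z)", OF d] by blast
  have "(\<lambda>z. push (A z) (G z)) = B" by (intro HOL.ext ext) (simp add: B push_ap)
  then show ?thesis using B by simp
qed

definition kst :: "'n \<Rightarrow> 'f" where "kst a = Fn (\<lambda>_. a)"

lemma kst_ap [simp]: "kst a $ n = a"
  unfolding kst_def by (rule Fn_ap') (rule dfn_const)

lemma dm_kst: "dfn G \<Longrightarrow> dm (\<lambda>z. kst (G z))"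
  unfolding kst_def by (rule dm_Fn[of "\<lambda>z n. G z"]) (rule dfn_comp[OF _ dm_lft0])

lemma dfn_subst: "dfn (\<lambda>z. G (lft z) (rgt z $ 0)) \<Longrightarrow> dm A \<Longrightarrow> dfn H \<Longrightarrow> dfn (\<lambda>z. G (A z) (H z))"
  using dfn_comp[of "\<lambda>z. G (lft z) (rgt z $ 0)" "\<lambda>z. push (A z) (H z)"] by (simp add: dm_push)

text \<open>Functions with a number argument are coded as functionals of a sequence that look at its
  entry 0 only; \<open>kst\<close> turns a number back into such a sequence.\<close>

definition dmN :: "('n \<Rightarrow> 'f) \<Rightarrow> bool" where "dmN a \<longleftrightarrow> dm (\<lambda>z. a (z $ 0))"

lemma dm_idx: "dmN a \<Longrightarrow> dfn G \<Longrightarrow> dm (\<lambda>z. a (G z))"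
  using dm_comp[of "\<lambda>z. a (z $ 0)" "\<lambda>z. kst (G z)"] by (simp add: dmN_def dm_kst)

section \<open>Decidable properties, bounded quantifiers and least numbers\<close>

definition dec :: "('f \<Rightarrow> bool) \<Rightarrow> bool" where "dec P \<longleftrightarrow> dfn (\<lambda>z. if P z then 1 else 0)"

lemma zero_less_one_n [simp]: "0 < (1 :: 'n)" by (rule zero_less_one)

lemma not_less_0 [simp]: "\<not> a < (0 :: 'n)" by (simp add: not_less)

lemma less_one [simp]: "a < 1 \<longleftrightarrow> a = (0 :: 'n)"
  using discrete[of 0 a] by (metis add_0 antisym_conv1 leD nonneg zero_less_one_n)

lemma less_Suc [simp]: "a < b + 1 \<longleftrightarrow> a \<le> (b :: 'n)"
  using discrete[of b a] by (metis leD le_less_trans less_add_one not_le)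

lemma Suc_le: "a + 1 \<le> b \<longleftrightarrow> a < (b :: 'n)"
  using discrete[of a b] less_le_trans[OF less_add_one[of a], of b] by blast

lemma Suc_neq_0 [simp]: "a + 1 \<noteq> (0 :: 'n)" by (metis less_Suc less_irrefl nonneg)

lemma num_cases: obtains "a = 0" | b where "a = b + (1 :: 'n)"
proof (cases "a = 0")
  case False
  then have "1 \<le> a" using nonneg[of a] by (metis less_one not_le)
  then have "a = (a - 1) + 1" by (simp add: le_add_diff_inverse2)
  then show ?thesis using that by blast
qed

text \<open>Subtraction in an ordered semiring need not be truncated. With all numbers nonnegative
  and discrete it is: \<open>?k = 0 - 1\<close> satisfies \<open>?k - 1 = ?k + ?k\<close>, which no
  successor can do.\<close>

lemma monus_0 [simp]: "a - 0 = (a :: 'n)" "0 - a = (0 :: 'n)"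
proof -
  show "a - 0 = a" using le_add_diff_inverse2[of 0 a] by simp
  let ?k = "0 - 1 :: 'n"
  have "?k - 1 = 0 - (1 + 1)" by (rule diff_diff_add)
  also have "\<dots> = (1 + 1) * 0 - (1 + 1) * 1" by simp
  also have "\<dots> = (1 + 1) * ?k" by (rule right_diff_distrib'[symmetric])
  also have "\<dots> = ?k + ?k" by (simp only: distrib_right mult_1_left)
  finally have eq: "?k - 1 = ?k + ?k" .
  have "?k = 0"
  proof (cases ?k rule: num_cases)
    case (2 b)
    then have "b = b + 1 + (b + 1)" using eq by simp
    then have "b + 0 = b + (1 + b + 1)" by (simp only: add_0_right add.assoc)
    then have "0 = 1 + b + 1" by (simp only: add_left_cancel)
    then show ?thesis using Suc_neq_0[of "1 + b"] by simp
  qed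
  then have "a * (0 - 1) = 0" by simp
  then show "0 - a = 0" by (simp add: right_diff_distrib')
qed

lemma monus_less: "a < b \<Longrightarrow> a - b = (0 :: 'n)"
proof -
  assume "a < b"
  then have "b = a + (b - a)" by (simp add: le_add_diff_inverse)
  then have "a - b = (a - a) - (b - a)" by (metis diff_diff_add)
  then show ?thesis by simp
qed

lemma dec_True: "dec (\<lambda>z. True)" "dec (\<lambda>z. False)" unfolding dec_def by (simp_all add: dfn_const)

lemma dec_not: "dec P \<Longrightarrow> dec (\<lambda>z. \<not> P z)"
proof -
  assume "dec P"
  then have "dfn (\<lambda>z. 1 - (if P z then 1 else 0))" unfolding dec_def by (intro dfn_minus dfn_const)
  moreover have "(\<lambda>z. 1 - (if P z then 1 else 0)) = (\<lambda>z. if \<not> P z then 1 else (0::'n))" by (rule HOL.ext) simp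
  ultimately show ?thesis unfolding dec_def by simp
qed

lemma dec_and: "dec P \<Longrightarrow> dec Q \<Longrightarrow> dec (\<lambda>z. P z \<and> Q z)"
proof -
  assume "dec P" "dec Q"
  then have "dfn (\<lambda>z. (if P z then 1 else 0) * (if Q z then 1 else 0))" unfolding dec_def by (intro dfn_times)
  moreover have "(\<lambda>z. (if P z then 1 else 0) * (if Q z then 1 else 0)) = (\<lambda>z. if P z \<and> Q z then 1 else (0::'n))" by (rule HOL.ext) simp
  ultimately show ?thesis unfolding dec_def by simp
qed

lemma dec_or: "dec P \<Longrightarrow> dec Q \<Longrightarrow> dec (\<lambda>z. P z \<or> Q z)"
  using dec_not[OF dec_and[OF dec_not dec_not], of P Q] by simp
lemma dec_imp: "dec P \<Longrightarrow> dec Q \<Longrightarrow> dec (\<lambda>z. P z \<longrightarrow> Q z)"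
  unfolding imp_conv_disj by (rule dec_or[OF dec_not])
lemma dec_less: "dfn G \<Longrightarrow> dfn H \<Longrightarrow> dec (\<lambda>z. G z < H z)"
proof -
  assume "dfn G" "dfn H"
  then have "dfn (\<lambda>z. 1 - (1 - (H z - G z)))" by (intro dfn_minus dfn_const)
  moreover have "1 - (1 - (b - a)) = (if a < b then 1 else 0)" for a b :: 'n
  proof (cases "a < b")
    case True
    then have "b - a \<noteq> 0" using le_add_diff_inverse2[of a b] by (metis add_0_left less_imp_le less_irrefl)
    then obtain c where "b - a = c + 1" by (metis num_cases)
    moreover have "1 - (c + 1) = 0" using diff_diff_add[of 1 1 c] by (simp add: add.commute)
    ultimately show ?thesis using True by simp
  next
    case False
    then have "b - a = 0" using monus_less[of b a] by (cases "b = a") auto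
    then show ?thesis using False by simp
  qed
  ultimately show ?thesis unfolding dec_def by simp
qed

lemma dec_le: "dfn G \<Longrightarrow> dfn H \<Longrightarrow> dec (\<lambda>z. G z \<le> H z)"
  using dec_not[OF dec_less[of H G]] by (simp add: not_less)
lemma dec_eq: "dfn G \<Longrightarrow> dfn H \<Longrightarrow> dec (\<lambda>z. G z = H z)"
  using dec_and[OF dec_le[of G H] dec_le[of H G]] by (simp add: antisym_conv2 order_eq_iff)

lemma dfn_if: "dec P \<Longrightarrow> dfn G \<Longrightarrow> dfn H \<Longrightarrow> dfn (\<lambda>z. if P z then G z else H z)"
proof -
  assume a: "dec P" "dfn G" "dfn H"
  have "dec (\<lambda>z. \<not> P z)" using a dec_not by simp
  with a have "dfn (\<lambda>z. (if P z then 1 else 0) * G z + (if \<not> P z then 1 else 0) * H z)"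
    unfolding dec_def by (intro dfn_plus dfn_times)
  moreover have "(\<lambda>z. (if P z then 1 else 0) * G z + (if \<not> P z then 1 else 0) * H z) = (\<lambda>z. if P z then G z else H z)"
    by (rule HOL.ext) simp
  ultimately show ?thesis by simp
qed

lemma dec_comp: "dec P \<Longrightarrow> dm A \<Longrightarrow> dec (\<lambda>z. P (A z))"
  unfolding dec_def by (rule dfn_comp[of "\<lambda>z. if P z then 1 else 0"])

lemma dec_subst: "dec (\<lambda>z. P (lft z) (rgt z $ 0)) \<Longrightarrow> dm A \<Longrightarrow> dfn H \<Longrightarrow> dec (\<lambda>z. P (A z) (H z))"
  using dec_comp[of "\<lambda>z. P (lft z) (rgt z $ 0)" "\<lambda>z. push (A z) (H z)"] by (simp add: dm_push)

lemma num_induct: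
  assumes "dec (\<lambda>z. P (z $ 0))" "P 0" "\<And>n. P n \<Longrightarrow> P (n + 1)"
  shows "P n"
proof -
  have "(if P n then 1 else 0) = (1::'n)"
    by (rule induct0[of "\<lambda>n. if P n then 1 else 0"]) (use assms in \<open>auto simp: dec_def split: if_splits\<close>)
  then show ?thesis by (simp split: if_splits)
qed

lemma choice:
  assumes "dec (\<lambda>z. P (lft z) (rgt z $ 0))" "\<And>x. \<exists>n. P x n"
  obtains Y where "dfn Y" "\<And>x. P x (Y x)"
proof -
  have "\<exists>Y. dfn Y \<and> (\<forall>x. (if P x (Y x) then 1 else 0) = (1::'n))"
    by (rule choice0[of "\<lambda>x n. if P x n then 1 else 0"]) (use assms in \<open>auto simp: dec_def\<close>)
  then show ?thesis using that by (metis zero_neq_one)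
qed

lemma choiceN:
  assumes "dec (\<lambda>z. P (lft z $ 0) (rgt z $ 0))" "\<And>m. \<exists>n. P m n"
  obtains Y where "dfn (\<lambda>z. Y (z $ 0))" "\<And>m. P m (Y m)"
proof -
  obtain Y where Y: "dfn Y" "\<And>x. P (x $ 0) (Y x)"
    using choice[of "\<lambda>x n. P (x $ 0) n"] assms by blast
  have "dfn (\<lambda>z. Y (kst (z $ 0)))" by (intro dfn_comp[OF Y(1)] dm_kst dfn_ap dm_id dfn_const)
  moreover have "P m (Y (kst m))" for m using Y(2)[of "kst m"] by simp
  ultimately show ?thesis using that[of "\<lambda>m. Y (kst m)"] by blast
qed

text \<open>\<open>R z n\<close> is the product of the truth values of \<open>P z k\<close> for
  \<open>k < n\<close>; in this way a recursion expresses a bounded quantifier.\<close>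

lemma prod_tests:
  assumes "dec (\<lambda>z. P (lft z) (rgt z $ 0))"
  obtains R where "dfn (\<lambda>z. R (lft z) (rgt z $ 0))" "\<And>z. R z 0 = 1"
    "\<And>z n. R z (n + 1) = R z n * (if P z n then 1 else 0)"
    "\<And>z n. R z n = 1 \<or> R z n = 0" "\<And>z n k. R z n = 1 \<Longrightarrow> k < n \<Longrightarrow> P z k"
proof -
  have P': "dfn (\<lambda>z. if P (lft z) (lf (rgt z $ 0)) then 1 else 0)"
    using dec_subst[OF assms, of lft "\<lambda>z. lf (rgt z $ 0)"]
    unfolding dec_def by (simp add: dm_lft0 dfn_lf dfn_ap dm_rgt0 dfn_const)
  have "dfn (\<lambda>z. rg (rgt z $ 0) * (if P (lft z) (lf (rgt z $ 0)) then 1 else 0))"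
    by (intro dfn_times P' dfn_rg dfn_ap dm_rgt0 dfn_const)
  from dfn_rec[of "\<lambda>_. 1" "\<lambda>z n v. v * (if P z n then 1 else 0)", OF dfn_const this]
  obtain R where R: "dfn (\<lambda>z. R (lft z) (rgt z $ 0))" "\<And>z. R z 0 = 1"
    "\<And>z n. R z (n + 1) = R z n * (if P z n then 1 else 0)" by blast
  have dR: "dfn (\<lambda>x. R z (x $ 0))" for z
    by (rule dfn_subst[OF R(1)]) (intro dm_const dfn_ap dm_id dfn_const)+
  have 01: "R z n = 1 \<or> R z n = 0" for z n
  proof (induction n rule: num_induct)
    show "dec (\<lambda>x. R z (x $ 0) = 1 \<or> R z (x $ 0) = 0)" by (intro dec_or dec_eq dR dfn_const)
  qed (auto simp: R)
  have "R z n = 1 \<longrightarrow> k < n \<longrightarrow> P z k" for z n k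
  proof (induction n rule: num_induct)
    show "dec (\<lambda>x. R z (x $ 0) = 1 \<longrightarrow> k < x $ 0 \<longrightarrow> P z k)"
      by (intro dec_imp dec_eq dR dfn_const dec_less dfn_ap dm_id dec_subst[OF assms] dm_const)
  next
    fix n assume IH: "R z n = 1 \<longrightarrow> k < n \<longrightarrow> P z k"
    show "R z (n + 1) = 1 \<longrightarrow> k < n + 1 \<longrightarrow> P z k"
    proof (intro impI)
      assume "R z (n + 1) = 1" "k < n + 1"
      then have "R z n = 1" "P z n" "k < n \<or> k = n" using R(3)[of z n] by (auto split: if_splits)
      then show "P z k" using IH by auto
    qed
  qed simp
  then show ?thesis using that[of R] R 01 by blast
qed

text \<open>The product of the tests for \<open>\<not> P\<close> starts at 1 and is 0 after
  \<open>n\<close>, so by induction it drops somewhere; the place of the drop is the least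
  number.\<close>

lemma least_num:
  assumes "dec (\<lambda>z. P (z $ 0))" "P n"
  obtains m where "P m" "\<And>k. k < m \<Longrightarrow> \<not> P k"
proof -
  have "dec (\<lambda>z. \<not> P (rgt z $ 0))"
    using dec_not[OF dec_comp[OF assms(1) dm_rgt0]] by simp
  from prod_tests[of "\<lambda>z n. \<not> P n", OF this]
  obtain R where R: "dfn (\<lambda>z. R (lft z) (rgt z $ 0))" "\<And>z. R z 0 = 1"
    "\<And>z n. R z (n + 1) = R z n * (if \<not> P n then 1 else 0)" "\<And>z n. R z n = 1 \<or> R z n = 0"
    "\<And>z n k. R z n = 1 \<Longrightarrow> k < n \<Longrightarrow> \<not> P k" by blast
  let ?R = "R (kst 0)"
  have "\<exists>m. ?R m = 1 \<and> ?R (m + 1) = 0"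
  proof (rule ccontr)
    assume *: "\<not> ?thesis"
    have "?R k = 1" for k
    proof (induction k rule: num_induct)
      show "dec (\<lambda>z. ?R (z $ 0) = 1)"
        by (intro dec_eq dfn_const dfn_subst[OF R(1)] dm_const dfn_ap dm_id)
    qed (use * R(2,4) in auto)
    then show False using R(3)[of "kst 0" n] assms(2) by (metis mult_zero_right zero_neq_one)
  qed
  then obtain m where "?R m = 1" "?R (m + 1) = 0" by blast
  then show ?thesis using that[of m] R(3)[of "kst 0" m] R(5)[of "kst 0" m] by (auto split: if_splits)
qed

lemma dec_ball:
  assumes "dec (\<lambda>z. P (lft z) (rgt z $ 0))" "dfn H"
  shows "dec (\<lambda>z. \<forall>k<H z. P z k)"
proof -
  from prod_tests[OF assms(1)]
  obtain R where R: "dfn (\<lambda>z. R (lft z) (rgt z $ 0))" "\<And>z. R z 0 = 1"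
    "\<And>z n. R z (n + 1) = R z n * (if P z n then 1 else 0)" "\<And>z n. R z n = 1 \<or> R z n = 0"
    "\<And>z n k. R z n = 1 \<Longrightarrow> k < n \<Longrightarrow> P z k" by blast
  have "R z n = 1 \<longleftrightarrow> (\<forall>k<n. P z k)" for z n
  proof
    assume all: "\<forall>k<n. P z k"
    show "R z n = 1"
    proof (rule ccontr)
      assume "R z n \<noteq> 1"
      moreover have "dec (\<lambda>x. R z (x $ 0) \<noteq> 1)"
        by (intro dec_not dec_eq dfn_const dfn_subst[OF R(1)] dm_const dfn_ap dm_id)
      ultimately obtain m where m': "R z m \<noteq> 1" "\<And>k. k < m \<Longrightarrow> \<not> R z k \<noteq> 1"
        using least_num[of "\<lambda>n. R z n \<noteq> 1" n] by blast
      then have "m \<le> n" using \<open>R z n \<noteq> 1\<close> by (metis not_le)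
      note m = m'(1) m'(2)[simplified not_not] this
      show False
      proof (cases m rule: num_cases)
        case 1 then show False using m R(2) by simp
      next
        case (2 j)
        then show False using m(1) m(2)[of j] R(3)[of z j] all m(3) Suc_le[of j n] by simp
      qed
    qed
  qed (use R(5) in blast)
  moreover have "dec (\<lambda>z. R z (H z) = 1)" by (intro dec_eq dfn_const dfn_subst[OF R(1)] dm_id assms(2))
  ultimately show ?thesis by simp
qed

lemmas dfn_intros = dfn_const dfn_plus dfn_times dfn_minus dfn_lf dfn_rg dfn_p2 dfn_ap dfn_pair dfn_if
  dm_id dm_const dm_lft dm_rgt dm_kst dm_push dec_True dec_not dec_and dec_or dec_imp dec_less dec_le dec_eq

end

section \<open>Rational and real numbers in a model\<close>

context rca begin

section \<open>Rational-valued functionals\<close>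

definition rv :: "'n \<Rightarrow> 'n zz fract" where
  "rv q = (qn (lf (lf q)) - qn (rg (lf q))) / (qn (rg q) + 1)"

text \<open>The denominator is stored minus 1, to match \<open>rv\<close>, where no code can produce
  the denominator zero.\<close>

definition code :: "'n \<Rightarrow> 'n \<Rightarrow> 'n \<Rightarrow> 'n" where "code p m d = pair (pair p m) (d - 1)"

lemma pos_Suc [simp]: "0 < d \<Longrightarrow> d - 1 + 1 = (d :: 'n)"
  using le_add_diff_inverse2[of 1 d] Suc_le[of 0 d] by simp

lemma rv_code: "0 < d \<Longrightarrow> rv (code p m d) = (qn p - qn m) / qn d"
  using qn_simps(3)[of "d - 1" 1] unfolding rv_def code_def by (simp del: qn_simps(3))

lemma qn_nonneg [simp]: "0 \<le> qn (a :: 'n)" using qn_simps(5)[of 0 a] nonneg by simp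
lemma den_pos [simp]: "0 < qn (a :: 'n) + 1" by (simp add: add_nonneg_pos)

text \<open>Rationals are not objects of a model. As each has many codes, nothing is demanded of the
  code beyond its value.\<close>

definition qdfn :: "('f \<Rightarrow> 'n zz fract) \<Rightarrow> bool" where
  "qdfn G \<longleftrightarrow> (\<exists>g. dfn g \<and> (\<forall>z. rv (g z) = G z))"

lemma qdfnI: "dfn g \<Longrightarrow> (\<And>z. rv (g z) = G z) \<Longrightarrow> qdfn G" unfolding qdfn_def by blast

lemma qdfn_rv: "dfn g \<Longrightarrow> qdfn (\<lambda>z. rv (g z))" by (rule qdfnI[of g]) simp_all

lemma dfn_code: "dfn p \<Longrightarrow> dfn m \<Longrightarrow> dfn d \<Longrightarrow> dfn (\<lambda>z. code (p z) (m z) (d z))"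
  unfolding code_def by (intro dfn_intros)

lemma qdfn_frac: "dfn p \<Longrightarrow> dfn m \<Longrightarrow> dfn d \<Longrightarrow> (\<And>z. 0 < d z) \<Longrightarrow> qdfn (\<lambda>z. (qn (p z) - qn (m z)) / qn (d z))"
  by (rule qdfnI[OF dfn_code[of p m d]]) (simp_all add: rv_code)

lemma qdfn_parts:
  assumes "qdfn G"
  obtains p m d where "dfn p" "dfn m" "dfn d" "\<And>z. 0 < d z" "\<And>z. G z = (qn (p z) - qn (m z)) / qn (d z)"
proof -
  obtain g where g: "dfn g" "\<And>z. rv (g z) = G z" using assms unfolding qdfn_def by blast
  show ?thesis
  proof (rule that)
    show "G z = (qn (lf (lf (g z))) - qn (rg (lf (g z)))) / qn (rg (g z) + 1)" for z
      unfolding g(2)[symmetric] rv_def by simp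
  qed (use g in \<open>auto intro: dfn_intros\<close>)
qed

lemma qdfn_const: "qdfn (\<lambda>z. q)"
proof -
  obtain a b c where "0 < c" "q = (qn a - qn b) / qn c" using qn_cases by blast
  then show ?thesis using qdfn_frac[of "\<lambda>_. a" "\<lambda>_. b" "\<lambda>_. c"] by (simp add: dfn_const)
qed

lemma qdfn_qn: "dfn g \<Longrightarrow> qdfn (\<lambda>z. qn (g z))"
  using qdfn_frac[of g "\<lambda>_. 0" "\<lambda>_. 1"] by (simp add: dfn_const)

lemma qdfn_add: "qdfn G \<Longrightarrow> qdfn H \<Longrightarrow> qdfn (\<lambda>z. G z + H z)"
proof -
  assume "qdfn G" "qdfn H"
  then obtain p m d p' m' d' where *: "dfn p" "dfn m" "dfn d" "\<And>z. 0 < d z" "\<And>z. G z = (qn (p z) - qn (m z)) / qn (d z)"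
    "dfn p'" "dfn m'" "dfn d'" "\<And>z. 0 < d' z" "\<And>z. H z = (qn (p' z) - qn (m' z)) / qn (d' z)"
    by (elim qdfn_parts) blast
  have "qdfn (\<lambda>z. (qn (p z * d' z + p' z * d z) - qn (m z * d' z + m' z * d z)) / qn (d z * d' z))"
    using * by (intro qdfn_frac dfn_intros) simp_all
  moreover have "(qn (p z * d' z + p' z * d z) - qn (m z * d' z + m' z * d z)) / qn (d z * d' z) = G z + H z" for z
  proof -
    have "qn (d z) \<noteq> 0" "qn (d' z) \<noteq> 0" using *(4,9)[of z] qn_simps(6)[of "d z" 0] qn_simps(6)[of "d' z" 0] by auto
    then show ?thesis unfolding *(5,10) by (simp add: add_frac_eq algebra_simps)
  qed
  ultimately show ?thesis by simp
qed

lemma qdfn_mult: "qdfn G \<Longrightarrow> qdfn H \<Longrightarrow> qdfn (\<lambda>z. G z * H z)"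
proof -
  assume "qdfn G" "qdfn H"
  then obtain p m d p' m' d' where *: "dfn p" "dfn m" "dfn d" "\<And>z. 0 < d z" "\<And>z. G z = (qn (p z) - qn (m z)) / qn (d z)"
    "dfn p'" "dfn m'" "dfn d'" "\<And>z. 0 < d' z" "\<And>z. H z = (qn (p' z) - qn (m' z)) / qn (d' z)"
    by (elim qdfn_parts) blast
  have "qdfn (\<lambda>z. (qn (p z * p' z + m z * m' z) - qn (p z * m' z + m z * p' z)) / qn (d z * d' z))"
    using * by (intro qdfn_frac dfn_intros) simp_all
  moreover have "(qn (p z * p' z + m z * m' z) - qn (p z * m' z + m z * p' z)) / qn (d z * d' z) = G z * H z" for z
    unfolding *(5,10) by (simp add: algebra_simps)
  ultimately show ?thesis by simp
qed

lemma qdfn_uminus: "qdfn G \<Longrightarrow> qdfn (\<lambda>z. - G z)"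
  using qdfn_mult[of "\<lambda>_. - 1" G] by (simp add: qdfn_const)
lemma qdfn_diff: "qdfn G \<Longrightarrow> qdfn H \<Longrightarrow> qdfn (\<lambda>z. G z - H z)"
  using qdfn_add[OF _ qdfn_uminus, of G H] by simp

lemma dec_qless: "qdfn G \<Longrightarrow> qdfn H \<Longrightarrow> dec (\<lambda>z. G z < H z)"
proof -
  assume "qdfn G" "qdfn H"
  then obtain p m d p' m' d' where *: "dfn p" "dfn m" "dfn d" "\<And>z. 0 < d z" "\<And>z. G z = (qn (p z) - qn (m z)) / qn (d z)"
    "dfn p'" "dfn m'" "dfn d'" "\<And>z. 0 < d' z" "\<And>z. H z = (qn (p' z) - qn (m' z)) / qn (d' z)"
    by (elim qdfn_parts) blast
  have "dec (\<lambda>z. p z * d' z + m' z * d z < p' z * d z + m z * d' z)" using * by (intro dfn_intros)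
  moreover have "p z * d' z + m' z * d z < p' z * d z + m z * d' z \<longleftrightarrow> G z < H z" for z
  proof -
    have d: "0 < qn (d z)" "0 < qn (d' z)" using *(4,9)[of z] by simp_all
    have "G z < H z \<longleftrightarrow> (qn (p z) - qn (m z)) * qn (d' z) < (qn (p' z) - qn (m' z)) * qn (d z)"
      unfolding *(5,10) using d by (simp add: pos_less_divide_eq pos_divide_less_eq times_divide_eq_left)
    also have "\<dots> \<longleftrightarrow> qn (p z * d' z + m' z * d z) < qn (p' z * d z + m z * d' z)"
      by (simp del: qn_simps(7) add: algebra_simps)
    finally have "qn (p z * d' z + m' z * d z) < qn (p' z * d z + m z * d' z) \<longleftrightarrow> G z < H z" by simp
    then show ?thesis by (simp only: qn_simps(7))
  qed
  ultimately show ?thesis by simp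
qed

lemma dec_qle: "qdfn G \<Longrightarrow> qdfn H \<Longrightarrow> dec (\<lambda>z. G z \<le> H z)"
  using dec_not[OF dec_qless[of H G]] by (simp add: not_less)

lemma qdfn_if: "dec P \<Longrightarrow> qdfn G \<Longrightarrow> qdfn H \<Longrightarrow> qdfn (\<lambda>z. if P z then G z else H z)"
proof -
  assume P: "dec P" and "qdfn G" "qdfn H"
  then obtain g h where "dfn g" "\<And>z. rv (g z) = G z" "dfn h" "\<And>z. rv (h z) = H z" unfolding qdfn_def by blast
  then show ?thesis by (intro qdfnI[OF dfn_if[OF P, of g h]]) auto
qed

lemma qdfn_max: "qdfn G \<Longrightarrow> qdfn H \<Longrightarrow> qdfn (\<lambda>z. max (G z) (H z))"
  unfolding max_def by (intro qdfn_if dec_qle)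
lemma qdfn_min: "qdfn G \<Longrightarrow> qdfn H \<Longrightarrow> qdfn (\<lambda>z. min (G z) (H z))"
  unfolding min_def by (intro qdfn_if dec_qle)
lemma qdfn_abs: "qdfn G \<Longrightarrow> qdfn (\<lambda>z. \<bar>G z\<bar>)"
  unfolding abs_if by (intro qdfn_if dec_qless qdfn_const qdfn_uminus)

text \<open>Numerator and denominator are exchanged with a distinction on the sign, since
  denominators have to be positive; 0 is sent to 0, in line with
  \<open>inverse 0 = 0\<close>.\<close>

lemma qdfn_inverse: "qdfn G \<Longrightarrow> qdfn (\<lambda>z. inverse (G z))"
proof -
  assume "qdfn G"
  then obtain p m d where *: "dfn p" "dfn m" "dfn d" "\<And>z. 0 < d z" "\<And>z. G z = (qn (p z) - qn (m z)) / qn (d z)"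
    by (elim qdfn_parts) blast
  let ?c = "\<lambda>z. if m z < p z then code (d z) 0 (p z - m z) else if p z < m z then code 0 (d z) (m z - p z) else code 0 0 1"
  have "dfn ?c" using * by (intro dfn_intros dfn_code)
  moreover have "rv (?c z) = inverse (G z)" for z
  proof -
    have minus: "qn (a - b) = qn a - qn b" "0 < a - b" if "b < a" for a b :: 'n
    proof -
      have "qn (a - b) + qn b = qn a" using that qn_simps(3)[of "a - b" b] le_add_diff_inverse2[of b a] by simp
      then show "qn (a - b) = qn a - qn b" by simp
      moreover have "0 < qn a - qn b" using that by simp
      ultimately have "0 < qn (a - b)" by simp
      then show "0 < a - b" by simp
    qed
    consider "m z < p z" | "p z < m z" | "p z = m z" by (rule linorder_cases)
    then show ?thesis
    proof cases
      case 1 then show ?thesis unfolding *(5) using minus[of "m z" "p z"] by (simp add: rv_code)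
    next
      case 2
      have "inverse ((qn (p z) - qn (m z)) / qn (d z)) = qn (d z) / - (qn (m z) - qn (p z))" by simp
      then have "- qn (d z) / (qn (m z) - qn (p z)) = inverse ((qn (p z) - qn (m z)) / qn (d z))"
        by (simp only: minus_divide_left[symmetric] divide_minus_right)
      then show ?thesis unfolding *(5) using 2 less_not_sym[OF 2] minus[of "p z" "m z"] by (simp add: rv_code)
    next
      case 3 then show ?thesis unfolding *(5) by (simp add: rv_code)
    qed
  qed
  ultimately show ?thesis by (rule qdfnI)
qed

lemma qdfn_divide: "qdfn G \<Longrightarrow> qdfn H \<Longrightarrow> qdfn (\<lambda>z. G z / H z)"
  unfolding divide_inverse by (intro qdfn_mult qdfn_inverse)

lemma qdfn_comp: "qdfn G \<Longrightarrow> dm A \<Longrightarrow> qdfn (\<lambda>z. G (A z))"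
  unfolding qdfn_def using dfn_comp by blast

lemma qdfn_subst: "qdfn (\<lambda>z. G (lft z) (rgt z $ 0)) \<Longrightarrow> dm A \<Longrightarrow> dfn H \<Longrightarrow> qdfn (\<lambda>z. G (A z) (H z))"
  using qdfn_comp[of "\<lambda>z. G (lft z) (rgt z $ 0)" "\<lambda>z. push (A z) (H z)"] by (simp add: dm_push)

text \<open>The recursion runs on codes. The value of its step depends on the previous code only
  through \<open>rv\<close>, so the values satisfy the recursion as well.\<close>

lemma qdfn_rec:
  assumes "qdfn G" "qdfn (\<lambda>z. S (lft z) (lf (rgt z $ 0)) (rv (rg (rgt z $ 0))))"
  obtains R where "qdfn (\<lambda>z. R (lft z) (rgt z $ 0))" "\<And>z. R z 0 = G z" "\<And>z n. R z (n + 1) = S z n (R z n)"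
proof -
  obtain g where g: "dfn g" "\<And>z. rv (g z) = G z" using assms(1) unfolding qdfn_def by blast
  obtain s where s: "dfn s" "\<And>z. rv (s z) = S (lft z) (lf (rgt z $ 0)) (rv (rg (rgt z $ 0)))"
    using assms(2) unfolding qdfn_def by blast
  have "dfn (\<lambda>z. s (push (lft z) (pair (lf (rgt z $ 0)) (rg (rgt z $ 0)))))"
    by (intro dfn_comp[OF s(1)] dm_push dm_lft dm_id dfn_pair dfn_lf dfn_rg dfn_ap dm_rgt dfn_const)
  from dfn_rec[of g "\<lambda>z k v. s (push z (pair k v))", OF g(1) this]
  obtain R where R: "dfn (\<lambda>z. R (lft z) (rgt z $ 0))" "\<And>z. R z 0 = g z" "\<And>z n. R z (n + 1) = s (push z (pair n (R z n)))"
    by blast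
  show ?thesis by (rule that[of "\<lambda>z n. rv (R z n)"]) (use R g s in \<open>auto intro: qdfn_rv\<close>)
qed

section \<open>Powers of one half and fast converging sequences\<close>

definition pw :: "'n \<Rightarrow> 'n zz fract" where "pw n = 1 / qn (p2 n)"

lemma qdfn_pw: "dfn g \<Longrightarrow> qdfn (\<lambda>z. pw (g z))"
  unfolding pw_def by (intro qdfn_divide qdfn_const qdfn_qn dfn_p2)

definition rs :: "'f \<Rightarrow> 'n \<Rightarrow> 'n zz fract" where "rs x n = rv (x $ n)"

lemma qdfn_rs: "dm A \<Longrightarrow> dfn g \<Longrightarrow> qdfn (\<lambda>z. rs (A z) (g z))"
  unfolding rs_def by (intro qdfn_rv dfn_ap)

lemma rs_dm:
  assumes "qdfn (\<lambda>z. G (lft z) (rgt z $ 0))"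
  obtains A where "dm A" "\<And>z n. rs (A z) n = G z n"
proof -
  obtain g where g: "dfn g" "\<And>z. rv (g z) = G (lft z) (rgt z $ 0)" using assms unfolding qdfn_def by blast
  have "dfn (\<lambda>z. g (push (lft z) (rgt z $ 0)))"
    by (intro dfn_comp[OF g(1)] dm_push dm_lft dm_id dfn_ap dm_rgt dfn_const)
  from Fn[of "\<lambda>z n. g (push z n)", OF this]
  show ?thesis by (intro that[of "\<lambda>z. Fn (\<lambda>n. g (push z n))"]) (simp_all add: rs_def g)
qed

lemmas qdfn_intros = qdfn_const qdfn_rs qdfn_qn qdfn_rv qdfn_pw qdfn_add qdfn_diff qdfn_mult qdfn_uminus qdfn_max qdfn_min
  qdfn_abs qdfn_divide qdfn_inverse qdfn_if dec_qless dec_qle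

lemma p2_pos [simp]: "0 < p2 n"
proof (induction n rule: num_induct)
  show "dec (\<lambda>z. 0 < p2 (z $ 0))" by (intro dfn_intros)
qed (simp_all add: add_pos_pos)

lemma pw_pos [simp]: "0 < pw n" by (simp add: pw_def)
lemma pw_nonneg [simp]: "0 \<le> pw n" using pw_pos[of n] by (rule less_imp_le)
lemma pw_0 [simp]: "pw 0 = 1" by (simp add: pw_def)
lemma pw_Suc: "pw (n + 1) = pw n / 2" by (simp add: pw_def)

lemma pw_add: "pw (a + b) = pw a * pw b"
proof (induction b rule: num_induct)
  show "dec (\<lambda>z. pw (a + z $ 0) = pw a * pw (z $ 0))"
    unfolding order_eq_iff by (intro dfn_intros qdfn_intros)
next
  fix n assume "pw (a + n) = pw a * pw n"
  then show "pw (a + (n + 1)) = pw a * pw (n + 1)"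
    using pw_Suc[of "a + n"] by (simp add: pw_Suc add.assoc)
qed simp

lemma pw_le_1: "pw n \<le> 1"
proof (induction n rule: num_induct)
  show "dec (\<lambda>z. pw (z $ 0) \<le> 1)" by (intro dfn_intros qdfn_intros)
next
  fix n assume "pw n \<le> 1" then show "pw (n + 1) \<le> 1" using pw_nonneg[of n] unfolding pw_Suc by linarith
qed simp

lemma pw_mono: "m \<le> n \<Longrightarrow> pw n \<le> pw m"
proof -
  assume "m \<le> n"
  then have "n = m + (n - m)" by (simp add: le_add_diff_inverse)
  then have "pw n = pw m * pw (n - m)" by (metis pw_add)
  then show ?thesis using mult_left_mono[OF pw_le_1[of "n - m"] pw_nonneg[of m]] by simp
qed

lemma less_p2: "n < p2 n"
proof (induction n rule: num_induct)
  show "dec (\<lambda>z. z $ 0 < p2 (z $ 0))" by (intro dfn_intros)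
next
  fix n assume "n < p2 n"
  then have "n + 1 \<le> p2 n" by (rule discrete)
  then have "n + 1 < p2 n + p2 n" using p2_pos[of n] by (metis add_le_same_cancel2 le_less_trans less_add_same_cancel1 not_le)
  then show "n + 1 < p2 (n + 1)" by simp
qed simp

text \<open>Holds relative to the numbers of the model: a positive rational \<open>q\<close> with
  denominator \<open>c\<close> is at least \<open>1 / c\<close>, and
  \<open>c < p2 c\<close>.\<close>

lemma archimedean: "0 < q \<Longrightarrow> \<exists>n. pw n < q"
proof -
  assume q: "0 < q"
  obtain a b c where *: "0 < c" "q = (qn a - qn b) / qn c" using qn_cases by blast
  then have "\<not> qn c < 0" using qn_nonneg[of c] by (simp add: not_less)
  then have "b < a" using q * by (simp add: zero_less_divide_iff)
  then have "qn (b + 1) \<le> qn a" using qn_simps(5)[of "b + 1" a] by (simp only: Suc_le)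
  then have "1 / qn c \<le> q" using * by (simp add: divide_right_mono)
  moreover have "pw c < 1 / qn c" unfolding pw_def using less_p2[of c] * by (intro divide_strict_left_mono) simp_all
  ultimately show ?thesis by (meson less_le_trans)
qed

lemma ex_upper: "\<exists>k :: 'n. q \<le> qn k"
proof -
  obtain a b c where *: "0 < c" "q = (qn a - qn b) / qn c" using qn_cases by blast
  have "1 \<le> qn c" using *(1) Suc_le[of 0 c] qn_simps(5)[of 1 c] by simp
  then have "qn a * 1 \<le> qn a * qn c" by (intro mult_left_mono) simp_all
  then have "qn a / qn c \<le> qn a" using * by (simp add: divide_le_eq)
  moreover have "q \<le> qn a / qn c" using * by (simp add: divide_right_mono)
  ultimately show ?thesis by (meson order_trans)
qed

lemma ex_rv: "\<exists>c. rv c = q"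
  using qdfn_const[of q] unfolding qdfn_def by blast

text \<open>Equal reals may have different values here, though closer than every
  \<open>Pw n\<close>. Hence statements about \<open>V\<close> carry a spare summand
  \<open>Pw n\<close> with arbitrary \<open>n\<close>.\<close>

abbreviation V :: "'f \<Rightarrow> ('n, 'n zz fract) upower" where "V x \<equiv> seq (rs x)"
abbreviation Pw :: "'n \<Rightarrow> ('n, 'n zz fract) upower" where "Pw n \<equiv> cst (pw n)"

definition fast :: "('n \<Rightarrow> 'n zz fract) \<Rightarrow> bool" where
  "fast s \<longleftrightarrow> (\<forall>n i. \<bar>s n - s (n + i)\<bar> < pw n)"

definition isR :: "'f \<Rightarrow> bool" where "isR x \<longleftrightarrow> (\<forall>n i. \<bar>rs x n - rs x (n + i)\<bar> < pw n)"

lemma isR_fast: "isR x \<longleftrightarrow> fast (rs x)" by (simp add: isR_def fast_def)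

lemma fastD: "fast s \<Longrightarrow> n \<le> m \<Longrightarrow> \<bar>s n - s m\<bar> < pw n"
  unfolding fast_def by (metis le_add_diff_inverse)

lemma fastI: "(\<And>n m. n \<le> m \<Longrightarrow> \<bar>s n - s m\<bar> < pw n) \<Longrightarrow> fast s"
  unfolding fast_def by (metis add_0_right add_left_mono nonneg)

lemma seq_const: "seq (\<lambda>_. q) = cst q" by (simp add: cst_def)

text \<open>From index \<open>n\<close> on the sequence stays within \<open>pw n\<close> of its
  member at \<open>n\<close>, and end segments belong to the ultrafilter.\<close>

lemma seq_bound: "fast s \<Longrightarrow> \<bar>seq s - cst (s n)\<bar> \<le> Pw n"
proof -
  assume s: "fast s"
  have "seq s \<le> seq (\<lambda>_. s n + pw n)"
    by (rule seq_mono[of n]) (use fastD[OF s] in \<open>fastforce simp: abs_less_iff\<close>)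
  moreover have "seq (\<lambda>_. s n - pw n) \<le> seq s"
    by (rule seq_mono[of n]) (use fastD[OF s] in \<open>fastforce simp: abs_less_iff\<close>)
  ultimately show ?thesis by (simp add: seq_const abs_le_iff)
qed

lemma seq_abs: "seq (\<lambda>n. \<bar>s n\<bar>) = \<bar>seq s\<bar>"
proof (cases "0 \<le> seq s")
  case True
  then have "almost (\<lambda>n. s n = \<bar>s n\<bar>)" by transfer (erule almost_mono, simp)
  then have "seq s = seq (\<lambda>n. \<bar>s n\<bar>)" by transfer
  then show ?thesis using True by simp
next
  case False
  then have "seq s \<le> 0" by simp
  then have "almost (\<lambda>n. - s n = \<bar>s n\<bar>)" by transfer (erule almost_mono, simp)
  then have "- seq s = seq (\<lambda>n. \<bar>s n\<bar>)" by transfer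
  then show ?thesis using False by simp
qed

lemma seq_max: "seq (\<lambda>n. max (s n) (t n)) = max (seq s) (seq t)"
proof (cases "seq s \<le> seq t")
  case True
  then have "almost (\<lambda>n. t n = max (s n) (t n))" by transfer (erule almost_mono, simp)
  then have "seq t = seq (\<lambda>n. max (s n) (t n))" by transfer
  then show ?thesis using True by simp
next
  case False
  then have "seq t \<le> seq s" by simp
  then have "almost (\<lambda>n. s n = max (s n) (t n))" by transfer (erule almost_mono, simp)
  then have "seq s = seq (\<lambda>n. max (s n) (t n))" by transfer
  then show ?thesis using False by simp
qed

definition slt :: "('n \<Rightarrow> 'n zz fract) \<Rightarrow> ('n \<Rightarrow> 'n zz fract) \<Rightarrow> bool" where
  "slt s t \<longleftrightarrow> (\<exists>n. s n + (pw n + pw n) < t n)"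
definition seqeq :: "('n \<Rightarrow> 'n zz fract) \<Rightarrow> ('n \<Rightarrow> 'n zz fract) \<Rightarrow> bool" where
  "seqeq s t \<longleftrightarrow> (\<forall>n. \<bar>s n - t n\<bar> \<le> pw n + pw n)"

lemma Pw_Suc: "Pw (n + 1) = Pw n / 2" by (simp only: pw_Suc) simp

lemma Pw_mono: "m \<le> n \<Longrightarrow> Pw n \<le> Pw m" by (simp add: pw_mono)

text \<open>The quantifier over indices in the definition of \<open>slt\<close> survives as a gap
  \<open>Pw n\<close> between the values; strict inequalities between reals are used in this form
  from here on.\<close>

lemma slt_iff:
  assumes "fast s" "fast t"
  shows "slt s t \<longleftrightarrow> (\<exists>n. seq s + Pw n \<le> seq t)"
proof
  assume "slt s t"
  then obtain n where n: "s n + (pw n + pw n) < t n" unfolding slt_def by blast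
  then obtain m where "pw m < t n - (s n + (pw n + pw n))" using archimedean[of "t n - (s n + (pw n + pw n))"] by auto
  then have "pw m + s n + pw n + pw n < t n" by linarith
  then have "cst (pw m + s n + pw n + pw n) < (cst (t n) :: ('n, 'n zz fract) upower)" by (simp only: cst_simps(11))
  then have "seq s + Pw m \<le> seq t" using seq_bound[OF assms(1), of n] seq_bound[OF assms(2), of n] by simp
  then show "\<exists>n. seq s + Pw n \<le> seq t" by blast
next
  assume "\<exists>n. seq s + Pw n \<le> seq t"
  then obtain n where n: "seq s + Pw n \<le> seq t" by blast
  \<comment> \<open>The approximations cost \<open>Pw ?m\<close> each and the definition of
    \<open>slt\<close> asks for two more, together less than the available
    \<open>8 * Pw ?m\<close>.\<close>
  let ?m = "n + 1 + 1 + 1"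
  have "Pw n = 8 * Pw ?m" by (simp only: Pw_Suc; simp)
  moreover have "0 < Pw ?m" by simp
  ultimately have "cst (s ?m + (pw ?m + pw ?m)) < (cst (t ?m) :: ('n, 'n zz fract) upower)"
    using n seq_bound[OF assms(1), of ?m] seq_bound[OF assms(2), of ?m] unfolding cst_simps by linarith
  then have "s ?m + (pw ?m + pw ?m) < t ?m" by (simp only: cst_simps(11))
  then show "slt s t" unfolding slt_def by blast
qed

lemma small_le: "(\<And>n :: 'n. (a :: ('n, 'n zz fract) upower) \<le> cst q + Pw n) \<Longrightarrow> a = cst r \<Longrightarrow> r \<le> q"
proof (rule ccontr)
  assume *: "\<And>n. a \<le> cst q + Pw n" "a = cst r" "\<not> r \<le> q"
  then obtain n where "pw n < r - q" using archimedean[of "r - q"] by auto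
  then have "q + pw n < r" by simp
  then have "cst q + Pw n < a" unfolding *(2) by (simp only: cst_simps flip: cst_simps(3))
  then show False using *(1)[of n] by simp
qed

lemma seqeq_iff:
  assumes "fast s" "fast t"
  shows "seqeq s t \<longleftrightarrow> (\<forall>n. \<bar>seq s - seq t\<bar> \<le> Pw n)"
proof
  assume *: "seqeq s t"
  show "\<forall>n. \<bar>seq s - seq t\<bar> \<le> Pw n"
  proof
    fix n :: 'n
    let ?m = "n + 1 + 1"
    have P: "Pw n = 4 * Pw ?m" by (simp only: Pw_Suc; simp)
    have "\<bar>s ?m - t ?m\<bar> \<le> pw ?m + pw ?m" using * unfolding seqeq_def by blast
    then have "cst \<bar>s ?m - t ?m\<bar> \<le> (cst (pw ?m + pw ?m) :: ('n, 'n zz fract) upower)" by (simp only: cst_simps(9))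
    then have "\<bar>cst (s ?m) - cst (t ?m)\<bar> \<le> Pw ?m + Pw ?m" by (simp only: cst_simps cst_abs)
    then show "\<bar>seq s - seq t\<bar> \<le> Pw n"
      using P seq_bound[OF assms(1), of ?m] seq_bound[OF assms(2), of ?m] by linarith
  qed
next
  assume *: "\<forall>n. \<bar>seq s - seq t\<bar> \<le> Pw n"
  show "seqeq s t" unfolding seqeq_def
  proof
    fix n :: 'n
    have "\<bar>cst (s n) - cst (t n)\<bar> \<le> cst (pw n + pw n) + Pw m" for m
      using *[rule_format, of m] seq_bound[OF assms(1), of n] seq_bound[OF assms(2), of n] unfolding cst_simps by linarith
    then show "\<bar>s n - t n\<bar> \<le> pw n + pw n"
      by (rule small_le) simp
  qed
qed

lemma fast_const [simp]: "fast (\<lambda>_. q)" by (simp add: fast_def)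

lemma fast_abs: "fast s \<Longrightarrow> fast (\<lambda>n. \<bar>s n\<bar>)"
proof (rule fastI)
  fix n m :: 'n assume "fast s" "n \<le> m"
  then have "\<bar>s n - s m\<bar> < pw n" by (rule fastD)
  then show "\<bar>\<bar>s n\<bar> - \<bar>s m\<bar>\<bar> < pw n" by linarith
qed

lemma fast_diff: "fast s \<Longrightarrow> fast t \<Longrightarrow> fast (\<lambda>n. s (n + 1) - t (n + 1))"
proof (rule fastI)
  fix n m :: 'n assume st: "fast s" "fast t" "n \<le> m"
  then have "\<bar>s (n + 1) - s (m + 1)\<bar> < pw (n + 1)" "\<bar>t (n + 1) - t (m + 1)\<bar> < pw (n + 1)"
    by (auto intro!: fastD)
  then show "\<bar>(s (n + 1) - t (n + 1)) - (s (m + 1) - t (m + 1))\<bar> < pw n" unfolding pw_Suc by linarith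
qed

text \<open>Sums and differences of reals shift indices. This changes the class of a sequence, but
  by no more than any \<open>Pw m\<close>.\<close>

lemma seq_shift: "fast s \<Longrightarrow> \<bar>seq (\<lambda>n. s (n + a)) - seq s\<bar> \<le> Pw m"
proof -
  assume s: "fast s"
  have b: "\<bar>s (n + a) - s n\<bar> \<le> pw m" if "m \<le> n" for n
  proof -
    have "\<bar>s n - s (n + a)\<bar> < pw n" by (rule fastD[OF s]) simp
    then show ?thesis using pw_mono[OF that] by linarith
  qed
  have "seq (\<lambda>n. \<bar>s (n + a) - s n\<bar>) \<le> seq (\<lambda>_. pw m)" by (rule seq_mono[of m]) (rule b)
  then show ?thesis by (simp add: seq_abs seq_diff seq_const)
qed

definition near :: "'f \<Rightarrow> 'f \<Rightarrow> 'n \<Rightarrow> bool" where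
  "near x y q \<longleftrightarrow> slt (\<lambda>n. \<bar>rs x (n + 1) - rs y (n + 1)\<bar>) (\<lambda>n. rv q)"

lemma near_iff:
  assumes "isR x" "isR y"
  shows "near x y q \<longleftrightarrow> (\<exists>n. \<bar>V x - V y\<bar> + Pw n \<le> cst (rv q))"
proof -
  have f: "fast (rs x)" "fast (rs y)" using assms by (simp_all add: isR_fast)
  let ?s = "\<lambda>n. \<bar>rs x (n + 1) - rs y (n + 1)\<bar>"
  have "seq ?s = \<bar>seq (\<lambda>n. rs x (n + 1)) - seq (\<lambda>n. rs y (n + 1))\<bar>" by (simp add: seq_abs seq_diff)
  then have d: "\<bar>seq ?s - \<bar>V x - V y\<bar>\<bar> \<le> 2 * Pw m" for m
    using seq_shift[OF f(1), of 1 m] seq_shift[OF f(2), of 1 m] by linarith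
  have P: "Pw n = 4 * Pw (n + 1 + 1)" for n by (simp only: Pw_Suc; simp)
  have "near x y q \<longleftrightarrow> (\<exists>n. seq ?s + Pw n \<le> cst (rv q))"
    unfolding near_def using slt_iff[OF fast_abs[OF fast_diff[OF f]] fast_const] by (simp add: seq_const)
  also have "\<dots> \<longleftrightarrow> (\<exists>n. \<bar>V x - V y\<bar> + Pw n \<le> cst (rv q))"
  proof (safe)
    fix n assume "seq ?s + Pw n \<le> cst (rv q)"
    then have "\<bar>V x - V y\<bar> + Pw (n + 1) \<le> cst (rv q)"
      using d[of "n + 1 + 1"] P[of n] Pw_Suc[of n] by linarith
    then show "\<exists>n. \<bar>V x - V y\<bar> + Pw n \<le> cst (rv q)" by blast
  next
    fix n assume "\<bar>V x - V y\<bar> + Pw n \<le> cst (rv q)"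
    then have "seq ?s + Pw (n + 1) \<le> cst (rv q)"
      using d[of "n + 1 + 1"] P[of n] Pw_Suc[of n] by linarith
    then show "\<exists>n. seq ?s + Pw n \<le> cst (rv q)" by blast
  qed
  finally show ?thesis .
qed

end

section \<open>Covers and the distance to the uncovered part\<close>

context rca begin

definition seqeqR :: "'f \<Rightarrow> 'f \<Rightarrow> bool" where "seqeqR x y \<longleftrightarrow> seqeq (rs x) (rs y)"

definition pos0 :: "'f \<Rightarrow> bool" where "pos0 x \<longleftrightarrow> slt (\<lambda>_. qn 0) (rs x)"

definition unitR :: "'f \<Rightarrow> bool" where
  "unitR x \<longleftrightarrow> isR x \<and> \<not> slt (rs x) (\<lambda>_. qn 0) \<and> \<not> slt (\<lambda>_. qn 1) (rs x)"

definition RFun :: "('f \<Rightarrow> bool) \<Rightarrow> ('f \<Rightarrow> 'f) \<Rightarrow> bool" where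
  "RFun A F \<longleftrightarrow> (\<forall>x. A x \<longrightarrow> isR (F x)) \<and> (\<forall>x y. A x \<and> A y \<and> seqeqR x y \<longrightarrow> seqeqR (F x) (F y))"

definition inO :: "('f \<Rightarrow> 'f) \<Rightarrow> 'f \<Rightarrow> bool" where "inO Y x \<longleftrightarrow> isR x \<and> pos0 (Y x)"

definition openR :: "('f \<Rightarrow> 'f) \<Rightarrow> bool" where
  "openR Y \<longleftrightarrow> RFun isR Y \<and> (\<forall>x. inO Y x \<longrightarrow> (\<exists>r. 0 < rv r \<and> (\<forall>y. isR y \<and> near x y r \<longrightarrow> inO Y y)))"

definition inC :: "('f \<Rightarrow> 'f) \<Rightarrow> 'f \<Rightarrow> bool" where "inC Y x \<longleftrightarrow> isR x \<and> \<not> pos0 (Y x)"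

definition closedU :: "('f \<Rightarrow> 'f) \<Rightarrow> bool" where
  "closedU Y \<longleftrightarrow> openR Y \<and> (\<forall>x. inC Y x \<longrightarrow> unitR x)"

lemma rs_fast: "isR x \<Longrightarrow> fast (rs x)" by (simp add: isR_fast)

lemma pos0_iff: "isR x \<Longrightarrow> pos0 x \<longleftrightarrow> (\<exists>n. Pw n \<le> V x)"
  unfolding pos0_def by (simp add: slt_iff[OF fast_const rs_fast] seq_const)

lemma not_pos0: "isR x \<Longrightarrow> \<not> pos0 x \<longleftrightarrow> (\<forall>n. V x < Pw n)"
  by (simp add: pos0_iff not_le)

lemma slt_V: "isR x \<Longrightarrow> isR y \<Longrightarrow> slt (rs x) (rs y) \<longleftrightarrow> (\<exists>n. V x + Pw n \<le> V y)"
  by (rule slt_iff) (simp_all add: rs_fast)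

lemma seqeqR_iff: "isR x \<Longrightarrow> isR y \<Longrightarrow> seqeqR x y \<longleftrightarrow> (\<forall>n. \<bar>V x - V y\<bar> \<le> Pw n)"
  unfolding seqeqR_def by (rule seqeq_iff) (simp_all add: rs_fast)

lemma unitR_iff: "unitR x \<longleftrightarrow> isR x \<and> (\<forall>n. - Pw n < V x \<and> V x < 1 + Pw n)"
proof (cases "isR x")
  case True
  have "(V x + Pw n \<le> 0) = (\<not> - Pw n < V x)" "(1 + Pw n \<le> V x) = (\<not> V x < 1 + Pw n)" for n by linarith+
  then show ?thesis unfolding unitR_def
    using True slt_iff[OF rs_fast[OF True] fast_const, of "qn 0"] slt_iff[OF fast_const rs_fast[OF True], of "qn 1"]
    by (auto simp: seq_const)
qed (simp add: unitR_def)

text \<open>Used with \<open>p = x - a\<close> and \<open>q = b - x\<close>: a tent over the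
  interval from \<open>a\<close> to \<open>b\<close>, positive exactly inside it, at most 1 and with
  Lipschitz constant 1.\<close>

definition clip :: "'n zz fract \<Rightarrow> 'n zz fract \<Rightarrow> 'n zz fract" where "clip p q = max 0 (min 1 (min p q))"

lemma clip_lip: "\<bar>p - p'\<bar> \<le> c \<Longrightarrow> \<bar>q - q'\<bar> \<le> c \<Longrightarrow> \<bar>clip p q - clip p' q'\<bar> \<le> c"
  unfolding clip_def max_def min_def abs_le_iff by (auto split: if_splits)

lemma clip_bounds: "0 \<le> clip p q" "clip p q \<le> 1" unfolding clip_def by auto

lemma fast_max: "fast s \<Longrightarrow> fast t \<Longrightarrow> fast (\<lambda>n. max (s n) (t n))"
proof (rule fastI)
  fix n m :: 'n assume "fast s" "fast t" "n \<le> m"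
  then have "\<bar>s n - s m\<bar> < pw n" "\<bar>t n - t m\<bar> < pw n" by (auto intro: fastD)
  then show "\<bar>max (s n) (t n) - max (s m) (t m)\<bar> < pw n" unfolding max_def abs_less_iff by (auto split: if_splits)
qed

lemma seq_inverse: "seq (\<lambda>n. 1 / s n) = 1 / seq s"
proof -
  have "seq (\<lambda>n. inverse (s n)) = inverse (seq s)" by transfer (simp add: almost_all)
  then show ?thesis by (simp add: divide_inverse)
qed

lemma seq_le_shift:
  assumes "fast s" "fast t" "\<And>n. \<bar>p n - q n\<bar> \<le> \<bar>s (n + c) - t (n + c)\<bar>"
  shows "\<bar>seq p - seq q\<bar> \<le> \<bar>seq s - seq t\<bar> + Pw m"
proof -
  have "seq (\<lambda>n. \<bar>p n - q n\<bar>) \<le> seq (\<lambda>n. \<bar>s (n + c) - t (n + c)\<bar>)" by (rule seq_mono[of 0]) (rule assms(3))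
  then have "\<bar>seq p - seq q\<bar> \<le> \<bar>seq (\<lambda>n. s (n + c)) - seq (\<lambda>n. t (n + c))\<bar>" by (simp add: seq_abs seq_diff)
  then show ?thesis
    using seq_shift[OF assms(1), of c "m + 1"] seq_shift[OF assms(2), of c "m + 1"] Pw_Suc[of m] by linarith
qed

end

locale cover = rca ap lf rg p2 lft rgt push dfn dm
  for ap :: "'f \<Rightarrow> 'n::linordered_semidom \<Rightarrow> 'n" (infixl "$" 900) and lf rg p2 lft rgt push dfn dm +
  fixes C :: "'f \<Rightarrow> 'f" and a b :: "'n \<Rightarrow> 'f"
  assumes dmC: "dm C" and dma: "dmN a" and dmb: "dmN b" and closedC: "closedU C"
    and ab: "isR (a n)" "isR (b n)"
    and covered: "inC C x \<Longrightarrow> \<exists>n. slt (rs (a n)) (rs x) \<and> slt (rs x) (rs (b n))"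
begin

definition finite_subcover :: bool where
  "finite_subcover \<longleftrightarrow> (\<exists>n0. \<forall>x. inC C x \<longrightarrow> (\<exists>n. n \<le> n0 \<and> slt (rs (a n)) (rs x) \<and> slt (rs x) (rs (b n))))"

text \<open>The weight \<open>pw k\<close> makes the supremum over all intervals computable: those
  from \<open>m\<close> on contribute at most \<open>pw m\<close>.\<close>

definition tn :: "'n \<Rightarrow> 'f \<Rightarrow> 'n \<Rightarrow> 'n zz fract" where
  "tn k x n = pw k * clip (rs x n - rs (a k) n) (rs (b k) n - rs x n)"

lemma qdfn_tn: "dfn K \<Longrightarrow> dm X \<Longrightarrow> dfn M \<Longrightarrow> qdfn (\<lambda>z. tn (K z) (X z) (M z))"
  unfolding tn_def clip_def by (intro qdfn_intros dm_idx[OF dma] dm_idx[OF dmb])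

lemma tn_bounds: "0 \<le> tn k x n" "tn k x n \<le> pw k"
  using mult_left_mono[OF clip_bounds(2) pw_nonneg[of k]] by (simp_all add: tn_def clip_bounds)

lemma tn_lip:
  assumes "\<bar>rs x n - rs y m\<bar> \<le> c" "\<bar>rs (a k) n - rs (a k) m\<bar> \<le> d" "\<bar>rs (b k) n - rs (b k) m\<bar> \<le> d"
  shows "\<bar>tn k x n - tn k y m\<bar> \<le> c + d"
proof -
  let ?A = "clip (rs x n - rs (a k) n) (rs (b k) n - rs x n)" and ?B = "clip (rs y m - rs (a k) m) (rs (b k) m - rs y m)"
  have "\<bar>?A - ?B\<bar> \<le> c + d" by (rule clip_lip) (use assms in \<open>simp_all add: abs_le_iff\<close>)
  moreover have "\<bar>tn k x n - tn k y m\<bar> = pw k * \<bar>?A - ?B\<bar>"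
    unfolding tn_def right_diff_distrib[symmetric] abs_mult by simp
  moreover have "pw k * \<bar>?A - ?B\<bar> \<le> 1 * \<bar>?A - ?B\<bar>" by (intro mult_right_mono pw_le_1) simp
  ultimately show ?thesis by simp
qed

text \<open>\<open>hr x n m\<close> is the maximum of 0 and the first \<open>m\<close> tents, at
  precision \<open>n\<close>. It is described as a least upper bound, so that later estimates need
  no further induction; the last clause records that \<open>x\<close> enters only through
  \<open>rs x n\<close>.\<close>

lemma ex_hr:
  obtains hr where "qdfn (\<lambda>z. hr (lft z) (lf (rgt z $ 0)) (rg (rgt z $ 0)))"
    "\<And>x n m k. k < m \<Longrightarrow> tn k x n \<le> hr x n m" "\<And>x n m. 0 \<le> hr x n m"
    "\<And>x n m c. 0 \<le> c \<Longrightarrow> (\<And>k. k < m \<Longrightarrow> tn k x n \<le> c) \<Longrightarrow> hr x n m \<le> c"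
    "\<And>x y n m. rs x n = rs y n \<Longrightarrow> hr x n m = hr y n m"
proof -
  have "qdfn (\<lambda>z. max (rv (rg (rgt z $ 0))) (tn (lf (rgt z $ 0)) (lft (lft z)) (rgt (lft z) $ 0)))"
    by (intro qdfn_max qdfn_rv qdfn_tn dfn_intros)
  from qdfn_rec[of "\<lambda>_. 0" "\<lambda>z k q. max q (tn k (lft z) (rgt z $ 0))", OF qdfn_const this]
  obtain R where R: "qdfn (\<lambda>z. R (lft z) (rgt z $ 0))" "\<And>z. R z 0 = 0"
    "\<And>z n. R z (n + 1) = max (R z n) (tn n (lft z) (rgt z $ 0))" by blast
  define hr where "hr = (\<lambda>x n m. R (push x n) m)"
  have hr0: "hr x n 0 = 0" and hrS: "hr x n (m + 1) = max (hr x n m) (tn m x n)" for x n m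
    by (simp_all add: hr_def R)
  have q: "qdfn (\<lambda>z. hr (X z) (N z) (M z))" if "dm X" "dfn N" "dfn M" for X N M
    unfolding hr_def by (intro qdfn_subst[OF R(1)] dm_push that)
  have q1: "qdfn (\<lambda>z. hr x n (z $ 0))" for x n by (intro q dfn_intros)
  have lower: "k < m \<longrightarrow> tn k x n \<le> hr x n m" for k m x n
  proof (induction m rule: num_induct)
    show "dec (\<lambda>z. k < z $ 0 \<longrightarrow> tn k x n \<le> hr x n (z $ 0))"
      by (intro dfn_intros dec_qle q1 qdfn_tn)
  next
    fix m assume "k < m \<longrightarrow> tn k x n \<le> hr x n m"
    then show "k < m + 1 \<longrightarrow> tn k x n \<le> hr x n (m + 1)"
      by (cases "k = m") (auto simp: hrS le_max_iff_disj)
  qed simp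
  have nn: "0 \<le> hr x n m" for x n m
  proof (induction m rule: num_induct)
    show "dec (\<lambda>z. 0 \<le> hr x n (z $ 0))" by (intro dec_qle q1 qdfn_const)
  qed (auto simp: hr0 hrS le_max_iff_disj)
  have upper: "hr x n m \<le> c" if c: "0 \<le> c" "\<And>k. k < m \<Longrightarrow> tn k x n \<le> c" for x n m c
  proof -
    have "j \<le> m \<longrightarrow> hr x n j \<le> c" for j
    proof (induction j rule: num_induct)
      show "dec (\<lambda>z. z $ 0 \<le> m \<longrightarrow> hr x n (z $ 0) \<le> c)" by (intro dfn_intros dec_qle q1 qdfn_const)
    next
      fix j assume "j \<le> m \<longrightarrow> hr x n j \<le> c"
      then show "j + 1 \<le> m \<longrightarrow> hr x n (j + 1) \<le> c" using c(2)[of j] by (auto simp: hrS Suc_le)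
    qed (use c in \<open>simp add: hr0\<close>)
    then show ?thesis by blast
  qed
  have loc: "hr x n m = hr y n m" if "rs x n = rs y n" for x y n m
  proof -
    have t: "tn k x n = tn k y n" for k using that by (simp add: tn_def)
    show ?thesis
      by (rule antisym; rule upper[OF nn]) (use lower t in metis)+
  qed
  show ?thesis
  proof (rule that[of hr])
    show "qdfn (\<lambda>z. hr (lft z) (lf (rgt z $ 0)) (rg (rgt z $ 0)))" by (intro q dfn_intros)
    show "k < m \<Longrightarrow> tn k x n \<le> hr x n m" for k m x n using lower by blast
  qed (rule nn upper loc; assumption?)+
qed

text \<open>\<open>H x\<close> is the supremum of the weighted tents. The clause on
  \<open>rs x (n + (1 + 1))\<close> tells which approximation of \<open>x\<close> an approximation
  of \<open>H x\<close> reads; it will make a functional on binary sequences continuous.\<close>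

definition height :: "('f \<Rightarrow> 'f) \<Rightarrow> bool" where
  "height H \<longleftrightarrow> dm H \<and> (\<forall>x. isR x \<longrightarrow> isR (H x)) \<and>
    (\<forall>x y n. isR x \<and> isR y \<longrightarrow> \<bar>V (H x) - V (H y)\<bar> \<le> \<bar>V x - V y\<bar> + Pw n) \<and>
    (\<forall>x y n. rs x (n + (1 + 1)) = rs y (n + (1 + 1)) \<longrightarrow> rs (H x) n = rs (H y) n) \<and>
    (\<forall>x. 0 \<le> V (H x)) \<and> (\<forall>x. inC C x \<longrightarrow> (\<exists>n. Pw n \<le> V (H x))) \<and>
    (\<forall>N. (\<forall>x. inC C x \<longrightarrow> Pw N \<le> V (H x)) \<longrightarrow> finite_subcover)"

lemma ex_height: "\<exists>H. height H"
proof -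
  obtain hr where hr: "qdfn (\<lambda>z. hr (lft z) (lf (rgt z $ 0)) (rg (rgt z $ 0)))"
    "\<And>x n m k. k < m \<Longrightarrow> tn k x n \<le> hr x n m" "\<And>x n m. 0 \<le> hr x n m"
    "\<And>x n m c. 0 \<le> c \<Longrightarrow> (\<And>k. k < m \<Longrightarrow> tn k x n \<le> c) \<Longrightarrow> hr x n m \<le> c"
    "\<And>x y n m. rs x n = rs y n \<Longrightarrow> hr x n m = hr y n m" using ex_hr by blast
  \<comment> \<open>The shift by two makes the result fast converging: the error of
    \<open>x\<close>, the error of the end points and the omitted tents cost
    \<open>pw (?s n)\<close> each, together less than \<open>pw n = 4 * pw (?s n)\<close>.\<close>
  let ?s = "\<lambda>n. n + (1 + 1) :: 'n"
  have "qdfn (\<lambda>z. hr (lft z) (?s (rgt z $ 0)) (?s (rgt z $ 0)))"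
    using qdfn_subst[of "\<lambda>x p. hr x (lf p) (rg p)", OF hr(1), of lft "\<lambda>z. pair (?s (rgt z $ 0)) (?s (rgt z $ 0))"]
    by (simp add: dfn_intros dm_lft0 dm_rgt0)
  from rs_dm[of "\<lambda>x n. hr x (?s n) (?s n)", OF this]
  obtain H where H: "dm H" "\<And>x n. rs (H x) n = hr x (?s n) (?s n)" by blast
  have lip: "hr x n m \<le> hr y n' m + c" if "0 \<le> c" "\<And>k. k < m \<Longrightarrow> \<bar>tn k x n - tn k y n'\<bar> \<le> c" for x y n n' m c
  proof (rule hr(4))
    show "0 \<le> hr y n' m + c" using hr(3)[of y n' m] that by simp
    fix k assume "k < m"
    then show "tn k x n \<le> hr y n' m + c" using that(2)[of k] hr(2)[of k m y n'] by (simp add: abs_le_iff)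
  qed
  have lip2: "\<bar>hr x n m - hr y n' m\<bar> \<le> c" if "0 \<le> c" "\<And>k. k < m \<Longrightarrow> \<bar>tn k x n - tn k y n'\<bar> \<le> c" for x y n n' m c
    using lip[of c m x n y n'] lip[of c m y n' x n] that by (simp add: abs_le_iff abs_minus_commute)
  have tail: "\<bar>hr x n m - hr x n m'\<bar> \<le> pw m" if "m \<le> m'" for x n m m'
  proof -
    have "hr x n m \<le> hr x n m'" by (rule hr(4)[OF hr(3)]) (use hr(2) that in \<open>auto intro: less_le_trans\<close>)
    moreover have "hr x n m' \<le> hr x n m + pw m"
    proof (rule hr(4))
      show "0 \<le> hr x n m + pw m" using hr(3) by simp
      fix k assume "k < m'"
      show "tn k x n \<le> hr x n m + pw m"
      proof (cases "k < m")
        case True then show ?thesis using hr(2)[of k m x n] pw_nonneg[of m] by linarith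
      next
        case False then show ?thesis using tn_bounds(2)[of k x n] pw_mono[of m k] hr(3)[of x n m] by (simp add: not_less)
      qed
    qed
    ultimately show ?thesis by (simp add: abs_le_iff)
  qed
  have pws: "pw n = 4 * pw (?s n)" for n unfolding add.assoc[symmetric] by (simp only: pw_Suc; simp)
  have isH: "isR (H x)" if x: "isR x" for x
    unfolding isR_fast
  proof (rule fastI)
    fix n m :: 'n assume nm: "n \<le> m"
    then have nm': "?s n \<le> ?s m" by simp
    have "\<bar>hr x (?s n) (?s n) - hr x (?s m) (?s n)\<bar> \<le> pw (?s n) + pw (?s n)"
    proof (rule lip2)
      fix k
      show "\<bar>tn k x (?s n) - tn k x (?s m)\<bar> \<le> pw (?s n) + pw (?s n)"
        using fastD[OF rs_fast[OF x] nm'] fastD[OF rs_fast[OF ab(1)] nm'] fastD[OF rs_fast[OF ab(2)] nm']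
        by (intro tn_lip less_imp_le)
    qed simp
    moreover have "\<bar>hr x (?s m) (?s n) - hr x (?s m) (?s m)\<bar> \<le> pw (?s n)" by (rule tail[OF nm'])
    moreover have "0 < pw (?s n)" by simp
    ultimately show "\<bar>rs (H x) n - rs (H x) m\<bar> < pw n" unfolding H(2) using pws[of n] by linarith
  qed
  have lipH: "\<bar>V (H x) - V (H y)\<bar> \<le> \<bar>V x - V y\<bar> + Pw n" if xy: "isR x" "isR y" for x y n
  proof (rule seq_le_shift[of _ _ _ _ "1 + 1"])
    show "\<bar>rs (H x) n - rs (H y) n\<bar> \<le> \<bar>rs x (n + (1 + 1)) - rs y (n + (1 + 1))\<bar>" for n
      unfolding H(2)
    proof (rule lip2)
      fix k
      show "\<bar>tn k x (?s n) - tn k y (?s n)\<bar> \<le> \<bar>rs x (?s n) - rs y (?s n)\<bar>"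
        using tn_lip[of x "?s n" y "?s n" "\<bar>rs x (?s n) - rs y (?s n)\<bar>" k 0] by simp
    qed simp
  qed (use xy in \<open>simp_all add: rs_fast\<close>)
  have posH: "\<exists>n. Pw n \<le> V (H x)" if x: "inC C x" for x
  proof -
    have R: "isR x" using x by (simp add: inC_def)
    obtain k where "slt (rs (a k)) (rs x)" "slt (rs x) (rs (b k))" using covered[OF x] by blast
    then obtain i j where "V (a k) + Pw i \<le> V x" "V x + Pw j \<le> V (b k)"
      using slt_V R ab by blast
    then have ij: "V (a k) + Pw (max i j) \<le> V x" "V x + Pw (max i j) \<le> V (b k)"
      using Pw_mono[of i "max i j"] Pw_mono[of j "max i j"] by (auto intro: order_trans[rotated])
    define n where "n = max i j"
    \<comment> \<open>Precision beyond \<open>n + 3\<close> preserves half of the gap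
      \<open>Pw n\<close> at both end points, and beyond \<open>k\<close> the tent of interval
      \<open>k\<close> is among those counted.\<close>
    let ?N = "max (n + 1 + 1 + 1) k"
    have "pw k * pw (n + 1) \<le> rs (H x) m" if m: "?N \<le> m" for m
    proof -
      have "m < m + (1 + 1)" by (simp add: add_pos_pos)
      then have sm: "n + 1 + 1 + 1 \<le> ?s m" "k < ?s m" using m by (auto intro: order_trans less_imp_le le_less_trans)
      have P: "Pw n = 2 * Pw (n + 1)" "Pw (n + 1) = 4 * Pw (n + 1 + 1 + 1)" by (simp only: Pw_Suc; simp)+
      have le: "Pw (?s m) \<le> Pw (n + 1 + 1 + 1)" by (rule Pw_mono[OF sm(1)])
      have *: "cst (pw (n + 1)) \<le> cst (y (?s m)) - (cst (z (?s m)) :: ('n, 'n zz fract) upower)"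
        if "fast y" "fast z" "seq z + Pw n \<le> seq y" for y z
      proof -
        have "seq y - cst (y (?s m)) \<le> Pw (?s m)" "cst (z (?s m)) - seq z \<le> Pw (?s m)"
          using seq_bound[OF that(1), of "?s m"] seq_bound[OF that(2), of "?s m"] by (simp_all add: abs_le_iff)
        moreover define c d where "c = Pw (?s m)" and "d = Pw (n + 1 + 1 + 1)"
        moreover have "0 \<le> c" "0 \<le> d" by (simp_all add: c_def d_def less_imp_le)
        ultimately show ?thesis using that(3) P le unfolding c_def[symmetric] d_def[symmetric] by linarith
      qed
      have "cst (pw (n + 1)) \<le> (cst (rs x (?s m) - rs (a k) (?s m)) :: ('n, 'n zz fract) upower)"
         "cst (pw (n + 1)) \<le> (cst (rs (b k) (?s m) - rs x (?s m)) :: ('n, 'n zz fract) upower)"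
        using *[OF rs_fast[OF R] rs_fast[OF ab(1)[of k]]] *[OF rs_fast[OF ab(2)[of k]] rs_fast[OF R]] ij
        unfolding cst_simps(4) n_def by blast+
      then have "pw (n + 1) \<le> rs x (?s m) - rs (a k) (?s m)" "pw (n + 1) \<le> rs (b k) (?s m) - rs x (?s m)"
        unfolding cst_simps(9) .
      then have "pw (n + 1) \<le> clip (rs x (?s m) - rs (a k) (?s m)) (rs (b k) (?s m) - rs x (?s m))"
        using pw_le_1[of "n + 1"] unfolding clip_def by (simp add: le_max_iff_disj)
      then have "pw k * pw (n + 1) \<le> tn k x (?s m)" unfolding tn_def by (intro mult_left_mono) simp_all
      also have "\<dots> \<le> rs (H x) m" unfolding H(2) by (rule hr(2)[OF sm(2)])
      finally show ?thesis .
    qed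
    then have "seq (\<lambda>_. pw k * pw (n + 1)) \<le> V (H x)" by (rule seq_mono)
    then have "Pw (k + (n + 1)) \<le> V (H x)" by (simp only: seq_const pw_add)
    then show ?thesis by blast
  qed
  have sub: finite_subcover if N: "\<And>x. inC C x \<Longrightarrow> Pw N \<le> V (H x)" for N
    unfolding finite_subcover_def
  \<comment> \<open>If no interval up to \<open>N + 2\<close> contained \<open>x\<close>, all tents
    at \<open>x\<close> would be at most \<open>pw (N + 2)\<close>, a quarter of the assumed lower
    bound: the later ones by their weight, the earlier ones because they vanish up to the
    precision.\<close>
  proof (rule exI[of _ "N + 1 + 1"], intro allI impI)
    fix x assume x: "inC C x"
    then have R: "isR x" by (simp add: inC_def)
    show "\<exists>n. n \<le> N + 1 + 1 \<and> slt (rs (a n)) (rs x) \<and> slt (rs x) (rs (b n))"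
    proof (rule ccontr)
      assume no: "\<not> ?thesis"
      let ?M = "N + 1 + 1"
      have "rs (H x) m \<le> pw ?M" if m: "?M \<le> m" for m
        unfolding H(2)
      proof (rule hr(4))
        fix k
        show "tn k x (?s m) \<le> pw ?M"
        proof (cases "k \<le> ?M")
          case False
          then have "pw k \<le> pw ?M" by (intro pw_mono) simp
          then show ?thesis using tn_bounds(2)[of k x "?s m"] by linarith
        next
          case True
          then consider "\<not> slt (rs (a k)) (rs x)" | "\<not> slt (rs x) (rs (b k))" using no by blast
          then have "clip (rs x (?s m) - rs (a k) (?s m)) (rs (b k) (?s m) - rs x (?s m)) \<le> pw (?s m) + pw (?s m)"
          proof cases
            case 1
            then have "rs x (?s m) \<le> rs (a k) (?s m) + (pw (?s m) + pw (?s m))" unfolding slt_def by (simp add: not_less)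
            then have "rs x (?s m) - rs (a k) (?s m) \<le> pw (?s m) + pw (?s m)" by simp
            then show ?thesis unfolding clip_def by (simp add: min_le_iff_disj)
          next
            case 2
            then have "rs (b k) (?s m) \<le> rs x (?s m) + (pw (?s m) + pw (?s m))" unfolding slt_def by (simp add: not_less)
            then have "rs (b k) (?s m) - rs x (?s m) \<le> pw (?s m) + pw (?s m)" by simp
            then show ?thesis unfolding clip_def by (simp add: min_le_iff_disj)
          qed
          moreover have "pw (?s m) + pw (?s m) \<le> pw ?M" using pws[of m] pw_mono[OF m] pw_nonneg[of "?s m"] by linarith
          moreover have "tn k x (?s m) \<le> 1 * clip (rs x (?s m) - rs (a k) (?s m)) (rs (b k) (?s m) - rs x (?s m))"
            unfolding tn_def by (intro mult_right_mono pw_le_1 clip_bounds)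
          ultimately show ?thesis by simp
        qed
      qed simp
      then have "V (H x) \<le> seq (\<lambda>_. pw ?M)" by (rule seq_mono)
      moreover have "Pw N = 4 * Pw ?M" "0 < Pw ?M" by (simp only: Pw_Suc; simp)+
      ultimately show False using N[OF x] unfolding seq_const by linarith
    qed
  qed
  have nnH: "0 \<le> V (H x)" for x
    using seq_mono[of 0 "\<lambda>_. 0" "rs (H x)"] hr(3) by (simp add: H(2) seq_const)
  have "rs (H x) n = rs (H y) n" if "rs x (n + (1 + 1)) = rs y (n + (1 + 1))" for x y n
    unfolding H(2) using that by (rule hr(5))
  then have "height H"
    unfolding height_def using H(1) isH lipH nnH posH sub by blast
  then show ?thesis by blast
qed

text \<open>\<open>U\<close> will be the maximum of a height function and of \<open>C\<close>. The
  Lipschitz clause is restricted to points of the closed set, where \<open>C\<close> stays below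
  every \<open>Pw n\<close>; elsewhere nothing is known about the continuity of
  \<open>C\<close>.\<close>

definition unit_height :: "('f \<Rightarrow> 'f) \<Rightarrow> bool" where
  "unit_height U \<longleftrightarrow> dm U \<and> (\<forall>x. isR x \<longrightarrow> isR (U x)) \<and>
    (\<forall>x y. isR x \<and> isR y \<and> seqeqR x y \<longrightarrow> seqeqR (U x) (U y)) \<and>
    (\<forall>x y n. inC C x \<and> inC C y \<longrightarrow> \<bar>V (U x) - V (U y)\<bar> \<le> \<bar>V x - V y\<bar> + Pw n) \<and>
    (\<forall>x. isR x \<longrightarrow> (\<exists>n. Pw n \<le> V (U x))) \<and>
    (\<forall>N. (\<forall>x. inC C x \<longrightarrow> Pw N \<le> V (U x)) \<longrightarrow> finite_subcover)"

lemma ex_unit_height: "\<exists>U. unit_height U"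
proof -
  obtain H where "height H" using ex_height by blast
  then have H: "dm H" "\<And>x. isR x \<Longrightarrow> isR (H x)"
    "\<And>x y n. isR x \<Longrightarrow> isR y \<Longrightarrow> \<bar>V (H x) - V (H y)\<bar> \<le> \<bar>V x - V y\<bar> + Pw n"
    "\<And>x. 0 \<le> V (H x)"
    "\<And>x. inC C x \<Longrightarrow> \<exists>n. Pw n \<le> V (H x)"
    "\<And>N. (\<And>x. inC C x \<Longrightarrow> Pw N \<le> V (H x)) \<Longrightarrow> finite_subcover"
    unfolding height_def by blast+
  have "qdfn (\<lambda>z. max (rs (H (lft z)) (rgt z $ 0)) (rs (C (lft z)) (rgt z $ 0)))"
    by (intro qdfn_intros dm_comp[OF H(1)] dm_comp[OF dmC] dm_lft0 dm_rgt0 dfn_ap dfn_const)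
  from rs_dm[of "\<lambda>x n. max (rs (H x) n) (rs (C x) n)", OF this]
  obtain U where U: "dm U" "\<And>x n. rs (U x) n = max (rs (H x) n) (rs (C x) n)" by blast
  have V: "V (U x) = max (V (H x)) (V (C x))" for x
  proof -
    have "rs (U x) = (\<lambda>n. max (rs (H x) n) (rs (C x) n))" by (rule HOL.ext) (rule U(2))
    then show ?thesis by (simp add: seq_max)
  qed
  have RC: "isR x \<Longrightarrow> isR (C x)" and eqC: "isR x \<Longrightarrow> isR y \<Longrightarrow> seqeqR x y \<Longrightarrow> seqeqR (C x) (C y)" for x y
    using closedC by (auto simp: closedU_def openR_def RFun_def)
  have RU: "isR (U x)" if "isR x" for x
    unfolding isR_fast using fast_max[OF rs_fast[OF H(2)[OF that]] rs_fast[OF RC[OF that]]] by (simp add: U(2) fast_def)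
  have VU: "V (H x) \<le> V (U x)" "V (U x) \<le> V (H x) + Pw n" if "inC C x" for x n
  proof -
    have "V (C x) < Pw n" using that RC by (auto simp: inC_def not_pos0)
    then show "V (H x) \<le> V (U x)" "V (U x) \<le> V (H x) + Pw n" using H(4)[of x] cst_pos[of "pw n"] pw_pos[of n] unfolding V by (auto intro: less_imp_le)
  qed
  have "unit_height U" unfolding unit_height_def
  proof (intro conjI allI impI)
    fix x y assume "isR x \<and> isR y \<and> seqeqR x y"
    then have *: "isR x" "isR y" "seqeqR x y" by auto
    show "seqeqR (U x) (U y)"
      unfolding seqeqR_iff[OF RU[OF *(1)] RU[OF *(2)]]
    proof
      fix n :: 'n
      have "\<bar>V (H x) - V (H y)\<bar> \<le> Pw n"
        using H(3)[OF *(1,2), of "n + 1"] *(3)[unfolded seqeqR_iff[OF *(1,2)], rule_format, of "n + 1"] Pw_Suc[of n] by linarith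
      moreover have "\<bar>V (C x) - V (C y)\<bar> \<le> Pw n" using eqC[OF *] seqeqR_iff[OF RC[OF *(1)] RC[OF *(2)]] by blast
      ultimately show "\<bar>V (U x) - V (U y)\<bar> \<le> Pw n" unfolding V max_def abs_le_iff by (auto split: if_splits)
    qed
  next
    fix x y n assume "inC C x \<and> inC C y"
    then have *: "inC C x" "inC C y" by auto
    then have "isR x" "isR y" by (auto simp: inC_def)
    moreover have "Pw n = 4 * Pw (n + 1 + 1)" by (simp only: Pw_Suc; simp)
    ultimately show "\<bar>V (U x) - V (U y)\<bar> \<le> \<bar>V x - V y\<bar> + Pw n"
      using H(3)[of x y "n + 1 + 1"] VU(1)[OF *(1)] VU(1)[OF *(2)] VU(2)[OF *(1), of "n + 1 + 1"] VU(2)[OF *(2), of "n + 1 + 1"]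
      by linarith
  next
    fix x assume x: "isR x"
    show "\<exists>n. Pw n \<le> V (U x)"
    proof (cases "inC C x")
      case True
      then obtain n where "Pw n \<le> V (H x)" using H(5) by blast
      then show ?thesis unfolding V by (auto simp: le_max_iff_disj)
    next
      case False
      then have "pos0 (C x)" using x by (simp add: inC_def)
      then obtain n where "Pw n \<le> V (C x)" using pos0_iff[OF RC[OF x]] by blast
      then show ?thesis unfolding V by (auto simp: le_max_iff_disj)
    qed
  next
    fix N assume N: "\<forall>x. inC C x \<longrightarrow> Pw N \<le> V (U x)"
    have "Pw (N + 1) \<le> V (H x)" if "inC C x" for x
      using N[rule_format, OF that] VU(2)[OF that, of "N + 1"] Pw_Suc[of N] by linarith
    then show finite_subcover by (rule H(6))
  qed (use U RU in auto)
  then show ?thesis by blast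
qed

end

context rca begin

text \<open>Choice yields a witness for positivity; for arguments that are not fast converging it witnesses that instead.\<close>

lemma ex_positive_witness:
  assumes U: "dm U" "\<And>x. isR x \<Longrightarrow> isR (U x)" "\<And>x. isR x \<Longrightarrow> \<exists>n. Pw n \<le> V (U x)"
  obtains W where "dfn W" "\<And>x. isR x \<Longrightarrow> Pw (W x) \<le> V (U x)"
proof -
  let ?P = "\<lambda>x n. \<not> \<bar>rs x (lf n) - rs x (lf n + rg n)\<bar> < pw (lf n) \<or> pw n + pw n < rs (U x) n"
  have "dec (\<lambda>z. ?P (lft z) (rgt z $ 0))"
    by (intro dfn_intros qdfn_intros dm_comp[OF U(1)])
  moreover have "\<exists>n. ?P x n" for x
  proof (cases "isR x")
    case True
    then have "pos0 (U x)" using U(2,3) pos0_iff by blast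
    then show ?thesis unfolding pos0_def slt_def by auto
  next
    case False
    then obtain n i where "\<not> \<bar>rs x n - rs x (n + i)\<bar> < pw n" unfolding isR_def by blast
    then show ?thesis by (intro exI[of _ "pair n i"]) simp
  qed
  ultimately obtain W where W: "dfn W" "\<And>x. ?P x (W x)" using choice[of ?P] by blast
  have "Pw (W x) \<le> V (U x)" if x: "isR x" for x
  proof -
    have "pw (W x) + pw (W x) < rs (U x) (W x)" using W(2)[of x] x unfolding isR_def by blast
    then have "cst (pw (W x) + pw (W x)) < (cst (rs (U x) (W x)) :: ('n, 'n zz fract) upower)" by (simp only: cst_simps(11))
    then show ?thesis using seq_bound[OF rs_fast[OF U(2)[OF x]], of "W x"] unfolding cst_simps by linarith
  qed
  then show ?thesis using that W(1) by blast
qed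

section \<open>Reciprocals of positive functions\<close>

lemma inverse_diff:
  fixes p q :: "'b::linordered_field"
  assumes "0 < c" "c \<le> p" "c \<le> q"
  shows "\<bar>1 / p - 1 / q\<bar> \<le> \<bar>p - q\<bar> / (c * c)"
proof -
  have "1 / p - 1 / q = (q - p) / (p * q)" using assms by (simp add: diff_frac_eq)
  then have "\<bar>1 / p - 1 / q\<bar> = \<bar>p - q\<bar> / (p * q)" using assms by (simp add: abs_minus_commute)
  also have "\<dots> \<le> \<bar>p - q\<bar> / (c * c)" using assms by (intro divide_left_mono mult_mono) auto
  finally show ?thesis .
qed

lemma Pw_neq_0 [simp]: "Pw n \<noteq> 0" using cst_simps(10)[of "pw n" 0] pw_pos[of n] by simp

lemma Pw_add: "Pw (a + b) = Pw a * Pw b" by (simp add: pw_add)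

text \<open>The witness \<open>W x\<close> depends on the representation of \<open>x\<close>, so it
  may only govern the precision: cutting off at \<open>pw (W x)\<close> leaves the value
  \<open>1 / V (U x)\<close> unchanged up to every \<open>Pw n\<close>, and therefore
  \<open>F\<close> respects equality of reals.\<close>

lemma ex_inverse:
  assumes U: "dm U" "\<And>x. isR x \<Longrightarrow> isR (U x)" "\<And>x. isR x \<Longrightarrow> \<exists>n. Pw n \<le> V (U x)"
    "\<And>x y. isR x \<Longrightarrow> isR y \<Longrightarrow> seqeqR x y \<Longrightarrow> seqeqR (U x) (U y)"
  obtains F where "dm F" "RFun isR F" "\<And>x n. isR x \<Longrightarrow> \<bar>V (F x) - 1 / V (U x)\<bar> \<le> Pw n"
proof -
  obtain W where W: "dfn W" "\<And>x. isR x \<Longrightarrow> Pw (W x) \<le> V (U x)" using ex_positive_witness[OF U(1-3)] by blast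
  \<comment> \<open>Inversion multiplies errors by up to \<open>1 / (pw (W x) * pw (W x))\<close>;
    reading \<open>U x\<close> later by \<open>W x + W x\<close> indices compensates for
    this.\<close>
  let ?c = "\<lambda>x. 1 + (W x + W x)"
  let ?M = "\<lambda>x n. max (pw (W x)) (rs (U x) (n + ?c x))"
  have "qdfn (\<lambda>z. 1 / ?M (lft z) (rgt z $ 0))"
    by (intro qdfn_intros dfn_comp[OF W(1)] dm_comp[OF U(1)] dfn_intros dm_lft0 dm_rgt0)
  from rs_dm[of "\<lambda>x n. 1 / ?M x n", OF this]
  obtain F where F: "dm F" "\<And>x n. rs (F x) n = 1 / ?M x n" by blast
  have RF: "isR (F x)" if x: "isR x" for x
    unfolding isR_fast
  proof (rule fastI)
    fix n m :: 'n assume nm: "n \<le> m"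
    have "\<bar>?M x n - ?M x m\<bar> \<le> \<bar>rs (U x) (n + ?c x) - rs (U x) (m + ?c x)\<bar>" unfolding max_def by auto
    also have "\<dots> < pw (n + ?c x)" using nm by (intro fastD[OF rs_fast[OF U(2)[OF x]]]) simp
    finally have "\<bar>?M x n - ?M x m\<bar> / (pw (W x) * pw (W x)) < pw (n + ?c x) / (pw (W x) * pw (W x))"
      by (intro divide_strict_right_mono) simp_all
    also have "pw (n + ?c x) = pw (n + 1) * (pw (W x) * pw (W x))" by (simp only: pw_add add.assoc mult.assoc)
    finally have "\<bar>?M x n - ?M x m\<bar> / (pw (W x) * pw (W x)) < pw (n + 1)" using pw_pos[of "W x"] by simp
    moreover have "\<bar>1 / ?M x n - 1 / ?M x m\<bar> \<le> \<bar>?M x n - ?M x m\<bar> / (pw (W x) * pw (W x))"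
      by (rule inverse_diff) simp_all
    moreover have "pw (n + 1) \<le> pw n" by (rule pw_mono) simp
    ultimately show "\<bar>rs (F x) n - rs (F x) m\<bar> < pw n" unfolding F(2) by linarith
  qed
  have VF: "\<bar>V (F x) - 1 / V (U x)\<bar> \<le> Pw n" if x: "isR x" for x n
  proof -
    have "rs (F x) = (\<lambda>n. 1 / ?M x n)" by (rule HOL.ext) (rule F(2))
    then have "V (F x) = 1 / max (Pw (W x)) (seq (\<lambda>n. rs (U x) (n + ?c x)))"
      by (simp add: seq_inverse seq_max seq_const)
    moreover have "\<bar>1 / max (Pw (W x)) (seq (\<lambda>n. rs (U x) (n + ?c x))) - 1 / V (U x)\<bar>
        \<le> \<bar>max (Pw (W x)) (seq (\<lambda>n. rs (U x) (n + ?c x))) - V (U x)\<bar> / (Pw (W x) * Pw (W x))"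
      using W(2)[OF x] by (intro inverse_diff) simp_all
    moreover have "\<bar>max (Pw (W x)) (seq (\<lambda>n. rs (U x) (n + ?c x))) - V (U x)\<bar> \<le> Pw (n + (W x + W x))"
      using W(2)[OF x] seq_shift[OF rs_fast[OF U(2)[OF x]], of "?c x" "n + (W x + W x)"] unfolding max_def abs_le_iff by auto
    then have "\<bar>max (Pw (W x)) (seq (\<lambda>n. rs (U x) (n + ?c x))) - V (U x)\<bar> / (Pw (W x) * Pw (W x))
        \<le> Pw (n + (W x + W x)) / (Pw (W x) * Pw (W x))" by (intro divide_right_mono) simp_all
    moreover have "Pw (n + (W x + W x)) / (Pw (W x) * Pw (W x)) = Pw n" unfolding Pw_add using pw_pos[of "W x"] by simp
    ultimately show ?thesis by linarith
  qed
  have "seqeqR (F x) (F y)" if xy: "isR x" "isR y" "seqeqR x y" for x y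
    unfolding seqeqR_iff[OF RF[OF xy(1)] RF[OF xy(2)]]
  proof
    fix n :: 'n
    define N where "N = max (W x) (W y)"
    have N: "Pw N \<le> V (U x)" "Pw N \<le> V (U y)"
      using order_trans[OF Pw_mono W(2)[OF xy(1)], of N] order_trans[OF Pw_mono W(2)[OF xy(2)], of N] unfolding N_def by simp_all
    have "\<bar>1 / V (U x) - 1 / V (U y)\<bar> \<le> \<bar>V (U x) - V (U y)\<bar> / (Pw N * Pw N)"
      using N by (intro inverse_diff) simp_all
    also have "\<dots> \<le> Pw (n + 1 + 1 + (N + N)) / (Pw N * Pw N)"
      using U(4)[OF xy] seqeqR_iff[OF U(2)[OF xy(1)] U(2)[OF xy(2)]] by (intro divide_right_mono) simp_all
    also have "\<dots> = Pw (n + 1 + 1)" unfolding Pw_add[of _ "N + N"] Pw_add[of N N] by simp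
    finally have "\<bar>1 / V (U x) - 1 / V (U y)\<bar> \<le> Pw (n + 1 + 1)" .
    moreover have "Pw n = 4 * Pw (n + 1 + 1)" by (simp only: Pw_Suc; simp)
    ultimately show "\<bar>V (F x) - V (F y)\<bar> \<le> Pw n"
      using VF[OF xy(1), of "n + 1 + 1"] VF[OF xy(2), of "n + 1 + 1"] by linarith
  qed
  then have "RFun isR F" unfolding RFun_def using RF by blast
  then show ?thesis using that F(1) VF by blast
qed

definition bdd :: "('f \<Rightarrow> bool) \<Rightarrow> ('f \<Rightarrow> 'f) \<Rightarrow> bool" where
  "bdd A F \<longleftrightarrow> (\<exists>k. \<forall>x. A x \<longrightarrow> \<not> slt (\<lambda>_. qn k) (\<lambda>n. \<bar>rs (F x) n\<bar>))"

lemma abs_bound_iff: "isR x \<Longrightarrow> \<not> slt (\<lambda>_. q) (\<lambda>n. \<bar>rs x n\<bar>) \<longleftrightarrow> (\<forall>n. \<bar>V x\<bar> < cst q + Pw n)"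
  using slt_iff[OF fast_const fast_abs[OF rs_fast], of x q] by (auto simp: seq_const seq_abs not_le)

lemma bddI:
  assumes "\<And>x. A x \<Longrightarrow> isR (F x)" "\<And>x. A x \<Longrightarrow> \<bar>V (F x)\<bar> \<le> cst q"
  shows "bdd A F"
proof -
  obtain k :: 'n where k: "q \<le> qn k" using ex_upper by blast
  have "\<not> slt (\<lambda>_. qn k) (\<lambda>n. \<bar>rs (F x) n\<bar>)" if "A x" for x
    unfolding abs_bound_iff[OF assms(1)[OF that]]
  proof
    fix n :: 'n
    have "cst q \<le> (cst (qn k) :: ('n, 'n zz fract) upower)" using k by (simp only: cst_simps(9))
    moreover have "0 < Pw n" by simp
    ultimately show "\<bar>V (F x)\<bar> < cst (qn k) + Pw n" using assms(2)[OF that] by linarith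
  qed
  then show ?thesis unfolding bdd_def by blast
qed

lemma bddD:
  assumes "bdd A F" "\<And>x. A x \<Longrightarrow> isR (F x)"
  obtains q where "0 < q" "\<And>x. A x \<Longrightarrow> \<bar>V (F x)\<bar> \<le> cst q"
proof -
  obtain k where k: "\<And>x. A x \<Longrightarrow> \<not> slt (\<lambda>_. qn k) (\<lambda>n. \<bar>rs (F x) n\<bar>)" using assms(1) unfolding bdd_def by blast
  have "\<bar>V (F x)\<bar> \<le> cst (qn k + 1)" if "A x" for x
  proof -
    have "\<bar>V (F x)\<bar> < cst (qn k) + Pw 0" using k[OF that] abs_bound_iff[OF assms(2)[OF that], of "qn k"] by blast
    then show ?thesis by simp
  qed
  then show ?thesis using that[of "qn k + 1"] by simp
qed

text \<open>The premises give \<open>1 / u \<le> cst (q + 1)\<close>. The point is that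
  \<open>N\<close> depends on \<open>q\<close> alone and thus serves for all points of the closed
  set at once.\<close>

lemma lower_bound_of_inverse:
  assumes "0 < q"
  shows "\<exists>N :: 'n. \<forall>u f. 0 < u \<and> \<bar>f - 1 / u\<bar> \<le> (1 :: ('n, 'n zz fract) upower) \<and> f \<le> cst q \<longrightarrow> Pw N \<le> u"
proof -
  obtain N where N: "pw N < 1 / (q + 1)" using archimedean[of "1 / (q + 1)"] assms by (auto simp: add_pos_pos)
  have "Pw N \<le> u" if u: "0 < u" "\<bar>f - 1 / u\<bar> \<le> 1" "f \<le> cst q" for u f :: "('n, 'n zz fract) upower"
  proof -
    have "1 / u \<le> cst (q + 1)" using u unfolding abs_le_iff by simp
    then have "1 \<le> cst (q + 1) * u" using u by (simp add: divide_le_eq)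
    moreover have q: "0 < (cst (q + 1) :: ('n, 'n zz fract) upower)" using assms by (simp only: cst_pos; simp add: add_pos_pos)
    ultimately have "1 / cst (q + 1) \<le> u" by (simp add: divide_le_eq mult.commute)
    moreover have "Pw N < (cst (1 / (q + 1)) :: ('n, 'n zz fract) upower)" using N by (simp only: cst_simps(11))
    ultimately show ?thesis by simp
  qed
  then show ?thesis by blast
qed

end

section \<open>Boundedness, maxima and polynomials\<close>

context rca begin

definition contC :: "('f \<Rightarrow> 'f) \<Rightarrow> ('f \<Rightarrow> 'f) \<Rightarrow> bool" where
  "contC D F \<longleftrightarrow> (\<forall>x. inC D x \<longrightarrow> (\<forall>e. 0 < rv e \<longrightarrow>
     (\<exists>d. 0 < rv d \<and> (\<forall>y. inC D y \<and> near x y d \<longrightarrow> near (F x) (F y) e))))"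

definition ucontC :: "('f \<Rightarrow> 'f) \<Rightarrow> ('f \<Rightarrow> 'f) \<Rightarrow> bool" where
  "ucontC D F \<longleftrightarrow> (\<forall>e. 0 < rv e \<longrightarrow>
     (\<exists>d. 0 < rv d \<and> (\<forall>x y. inC D x \<and> inC D y \<and> near x y d \<longrightarrow> near (F x) (F y) e)))"

definition contCU :: "('f \<Rightarrow> 'f) \<Rightarrow> ('f \<Rightarrow> 'f) \<Rightarrow> bool" where
  "contCU D F \<longleftrightarrow> closedU D \<and> RFun isR F \<and> contC D F"

definition sem_Real_bounded :: bool where
  "sem_Real_bounded \<longleftrightarrow> (\<forall>F D. dm F \<and> dm D \<and> contCU D F \<longrightarrow> bdd (inC D) F)"

definition sem_Real_uniform :: bool where
  "sem_Real_uniform \<longleftrightarrow> (\<forall>F D. dm F \<and> dm D \<and> contCU D F \<longrightarrow> ucontC D F)"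

definition sem_Real_maximum :: bool where
  "sem_Real_maximum \<longleftrightarrow> (\<forall>F D. dm F \<and> dm D \<and> contCU D F \<and> (\<exists>x. inC D x) \<longrightarrow>
     (\<exists>x. inC D x \<and> (\<forall>y. inC D y \<longrightarrow> \<not> slt (rs (F x)) (rs (F y)))))"

text \<open>For a first approximation \<open>(p - m) / d\<close> this is \<open>p + m\<close>, a
  bound for its absolute value; it mirrors the index shift in \<open>real_mult\<close>.\<close>

definition sz :: "'f \<Rightarrow> 'n" where "sz x = lf (lf (x $ 0)) + rg (lf (x $ 0))"

definition smul :: "'f \<Rightarrow> 'f \<Rightarrow> 'n \<Rightarrow> 'n zz fract" where
  "smul x y n = rs x (n + (sz x + sz y + (1 + 1))) * rs y (n + (sz x + sz y + (1 + 1)))"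

definition poly_sums_sem :: "('n \<Rightarrow> 'f) \<Rightarrow> 'f \<Rightarrow> ('n \<Rightarrow> 'f) \<Rightarrow> ('n \<Rightarrow> 'f) \<Rightarrow> bool" where
  "poly_sums_sem c x w s \<longleftrightarrow> (\<forall>i. isR (w i) \<and> isR (s i)) \<and> seqeq (rs (w 0)) (\<lambda>_. qn 1) \<and> seqeq (rs (s 0)) (rs (c 0)) \<and>
     (\<forall>i. seqeq (rs (w (i + 1))) (smul (w i) x)) \<and>
     (\<forall>i. seqeq (rs (s (i + 1))) (\<lambda>n. rs (s i) (n + 1) + smul (c (i + 1)) (w (i + 1)) (n + 1)))"

definition sem_Real_polynomial :: bool where
  "sem_Real_polynomial \<longleftrightarrow> (\<forall>F D e. dm F \<and> dm D \<and> contCU D F \<and> isR e \<and> pos0 e \<longrightarrow>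
     (\<exists>c d. dmN c \<and> (\<forall>i. isR (c i)) \<and> (\<forall>x. inC D x \<longrightarrow> (\<exists>w s. dmN w \<and> dmN s \<and> poly_sums_sem c x w s \<and>
        slt (\<lambda>n. \<bar>rs (s d) (n + 1) - rs (F x) (n + 1)\<bar>) (rs e)))))"

lemma nearI: "isR x \<Longrightarrow> isR y \<Longrightarrow> \<bar>V x - V y\<bar> \<le> cst q \<Longrightarrow> q < rv e \<Longrightarrow> near x y e"
proof -
  assume *: "isR x" "isR y" "\<bar>V x - V y\<bar> \<le> cst q" "q < rv e"
  then obtain n where "pw n < rv e - q" using archimedean[of "rv e - q"] by auto
  then have "q + pw n < rv e" by simp
  then have "cst (q + pw n) < (cst (rv e) :: ('n, 'n zz fract) upower)" by (simp only: cst_simps(11))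
  then have "\<bar>V x - V y\<bar> + Pw n \<le> cst (rv e)" using *(3) by simp
  then show ?thesis using near_iff[OF *(1,2)] by blast
qed

lemma nearD: "isR x \<Longrightarrow> isR y \<Longrightarrow> near x y e \<Longrightarrow> \<bar>V x - V y\<bar> < cst (rv e)"
proof -
  assume *: "isR x" "isR y" "near x y e"
  then obtain n where "\<bar>V x - V y\<bar> + Pw n \<le> cst (rv e)" using near_iff[OF *(1,2)] by blast
  moreover have "0 < Pw n" by simp
  ultimately show ?thesis by linarith
qed

lemma RFunD: "RFun isR F \<Longrightarrow> isR x \<Longrightarrow> isR (F x)" by (simp add: RFun_def)

end

context cover begin

text \<open>Abstracts from the reciprocal of \<open>U\<close> what the principles need. By the last
  clause, an upper bound on the values is all that a principle has to deliver.\<close>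

definition recip :: "('f \<Rightarrow> 'f) \<Rightarrow> bool" where
  "recip F \<longleftrightarrow> dm F \<and> RFun isR F \<and> contC C F \<and> (\<forall>q. (\<forall>x. inC C x \<longrightarrow> V (F x) \<le> cst q) \<longrightarrow> finite_subcover)"

lemma inC_isR: "inC D x \<Longrightarrow> isR x" by (simp add: inC_def)

lemma ex_recip: "\<exists>F. recip F"
proof -
  obtain U where "unit_height U" using ex_unit_height by blast
  then have U: "dm U" "\<And>x. isR x \<Longrightarrow> isR (U x)" "\<And>x y. isR x \<Longrightarrow> isR y \<Longrightarrow> seqeqR x y \<Longrightarrow> seqeqR (U x) (U y)"
    "\<And>x y n. inC C x \<Longrightarrow> inC C y \<Longrightarrow> \<bar>V (U x) - V (U y)\<bar> \<le> \<bar>V x - V y\<bar> + Pw n"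
    "\<And>x. isR x \<Longrightarrow> \<exists>n. Pw n \<le> V (U x)"
    "\<And>N. \<forall>x. inC C x \<longrightarrow> Pw N \<le> V (U x) \<Longrightarrow> finite_subcover"
    unfolding unit_height_def by blast+
  obtain F where F: "dm F" "RFun isR F" "\<And>x n. isR x \<Longrightarrow> \<bar>V (F x) - 1 / V (U x)\<bar> \<le> Pw n"
    using ex_inverse[OF U(1,2,5,3)] by blast
  have "contC C F" unfolding contC_def
  proof (intro allI impI)
    fix x e assume x: "inC C x" and e: "0 < rv e"
    obtain N where N: "Pw N \<le> V (U x)" using U(5)[OF inC_isR[OF x]] by blast
    obtain j where j: "pw j < rv e" using archimedean[OF e] by blast
    \<comment> \<open>In the neighbourhood \<open>U\<close> varies by at most
      \<open>2 * Pw M\<close> and stays above \<open>Pw (N + 1)\<close>. The summand with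
      \<open>N\<close> absorbs the growth of errors under inversion; the three units added to
      \<open>j\<close> leave room for the deviation of \<open>F\<close> from
      \<open>1 / U\<close>.\<close>
    define M where "M = j + 1 + 1 + 1 + ((N + 1) + (N + 1))"
    obtain d where d: "rv d = pw M" using ex_rv by blast
    have "near (F x) (F y) e" if y: "inC C y" "near x y d" for y
    proof (rule nearI[OF _ _ _ j])
      show "isR (F x)" "isR (F y)" using F(2) x y by (auto intro: RFunD inC_isR)
      have "\<bar>V x - V y\<bar> < Pw M" using nearD[OF inC_isR[OF x] inC_isR[OF y(1)] y(2)] d by simp
      then have UU: "\<bar>V (U x) - V (U y)\<bar> \<le> 2 * Pw M" using U(4)[OF x y(1), of M] by linarith
      have "M = (j + 1 + 1 + 1 + N) + (N + 1 + 1)" by (simp add: M_def ac_simps)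
      then have "Pw M \<le> Pw (N + 1 + 1)" by (simp only: Pw_mono le_add_same_cancel2 nonneg)
      moreover have "Pw N = 2 * Pw (N + 1)" "Pw (N + 1) = 2 * Pw (N + 1 + 1)" by (simp only: Pw_Suc; simp)+
      ultimately have low: "Pw (N + 1) \<le> V (U x)" "Pw (N + 1) \<le> V (U y)" using N UU cst_pos[of "pw (N + 1)"] pw_pos[of "N + 1"] by linarith+
      have "\<bar>1 / V (U x) - 1 / V (U y)\<bar> \<le> \<bar>V (U x) - V (U y)\<bar> / (Pw (N + 1) * Pw (N + 1))"
        using low by (intro inverse_diff) simp_all
      also have "\<dots> \<le> (2 * Pw M) / (Pw (N + 1) * Pw (N + 1))" using UU by (intro divide_right_mono) simp_all
      also have "\<dots> = 2 * Pw (j + 1 + 1 + 1)"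
        unfolding M_def Pw_add[of _ "N + 1 + (N + 1)"] Pw_add[of "N + 1" "N + 1"] by simp
      finally have "\<bar>1 / V (U x) - 1 / V (U y)\<bar> \<le> 2 * Pw (j + 1 + 1 + 1)" .
      moreover have "Pw j = 8 * Pw (j + 1 + 1 + 1)" by (simp only: Pw_Suc; simp)
      ultimately show "\<bar>V (F x) - V (F y)\<bar> \<le> Pw j"
        using F(3)[OF inC_isR[OF x], of "j + 1 + 1 + 1"] F(3)[OF inC_isR[OF y(1)], of "j + 1 + 1 + 1"] by linarith
    qed
    then show "\<exists>d. 0 < rv d \<and> (\<forall>y. inC C y \<and> near x y d \<longrightarrow> near (F x) (F y) e)" using d by (intro exI[of _ d]) auto
  qed
  moreover have finite_subcover if q: "\<forall>x. inC C x \<longrightarrow> V (F x) \<le> cst q" for q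
  proof -
    have qq: "cst q \<le> (cst (max 1 q) :: ('n, 'n zz fract) upower)" by (simp only: cst_simps(9); simp)
    have "0 < max 1 q" by (simp add: less_max_iff_disj)
    from lower_bound_of_inverse[OF this]
    obtain N where N: "\<forall>u f. 0 < u \<and> \<bar>f - 1 / u\<bar> \<le> (1 :: ('n, 'n zz fract) upower) \<and> f \<le> cst (max 1 q) \<longrightarrow> Pw N \<le> u" ..
    have "Pw N \<le> V (U x)" if x: "inC C x" for x
    proof (rule N[rule_format], intro conjI)
      obtain n where "Pw n \<le> V (U x)" using U(5)[OF inC_isR[OF x]] by blast
      moreover have "0 < Pw n" by simp
      ultimately show "0 < V (U x)" by linarith
      show "\<bar>V (F x) - 1 / V (U x)\<bar> \<le> 1" using F(3)[OF inC_isR[OF x], of 0] by simp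
      show "V (F x) \<le> cst (max 1 q)" using order_trans[OF q[rule_format, OF x] qq] .
    qed
    then show ?thesis using U(6) by blast
  qed
  ultimately have "recip F" unfolding recip_def using F by blast
  then show ?thesis by blast
qed

lemma bounded_imp_subcover: "recip F \<Longrightarrow> bdd (inC C) F \<Longrightarrow> finite_subcover"
proof -
  assume F: "recip F" and b: "bdd (inC C) F"
  have R: "inC C x \<Longrightarrow> isR (F x)" for x using F by (auto simp: recip_def intro: RFunD inC_isR)
  obtain q where "\<And>x. inC C x \<Longrightarrow> \<bar>V (F x)\<bar> \<le> cst q" using bddD[OF b R] by blast
  then have "\<forall>x. inC C x \<longrightarrow> V (F x) \<le> cst q" by (meson abs_le_D1)
  then show ?thesis using F unfolding recip_def by blast
qed

lemma recip_contCU: "recip F \<Longrightarrow> dm F \<and> dm C \<and> contCU C F"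
  using closedC dmC by (simp add: recip_def contCU_def)

lemma Real_bounded_imp_subcover: "sem_Real_bounded \<Longrightarrow> finite_subcover"
  using ex_recip recip_contCU bounded_imp_subcover unfolding sem_Real_bounded_def by blast

lemma Real_maximum_imp_subcover: "sem_Real_maximum \<Longrightarrow> finite_subcover"
proof -
  assume max: sem_Real_maximum
  obtain F where F: "recip F" using ex_recip by blast
  show ?thesis
  proof (cases "\<exists>x. inC C x")
    case True
    then obtain x where x: "inC C x" "\<And>y. inC C y \<Longrightarrow> \<not> slt (rs (F x)) (rs (F y))"
      using max recip_contCU[OF F] unfolding sem_Real_maximum_def by blast
    have R: "inC C x \<Longrightarrow> isR (F x)" for x using F by (auto simp: recip_def intro: RFunD inC_isR)
    \<comment> \<open>One unit covers the distance of \<open>V (F x)\<close> from its first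
      approximation, the other one the gap \<open>Pw 0\<close> left by the negated
      inequality.\<close>
    have "V (F y) \<le> cst (rs (F x) 0 + 1 + 1)" if y: "inC C y" for y
    proof -
      have "\<not> V (F x) + Pw 0 \<le> V (F y)" using x(2)[OF y] slt_V[OF R[OF x(1)] R[OF y]] by blast
      then show ?thesis using seq_bound[OF rs_fast[OF R[OF x(1)]], of 0] by (simp add: abs_le_iff)
    qed
    then show ?thesis using F unfolding recip_def by blast
  next
    case False then show ?thesis unfolding finite_subcover_def by blast
  qed
qed

lemma fast_0: "isR x \<Longrightarrow> \<bar>rs x n\<bar> \<le> \<bar>rs x 0\<bar> + 1"
  using fastD[OF rs_fast, of x 0 n] by (simp add: abs_less_iff abs_le_iff) linarith

text \<open>A polynomial within 1 of the reciprocal bounds it, once polynomials are known to be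
  bounded on [0,1]. This needs a decidable induction hypothesis: bounds \<open>B i\<close> for the
  powers and \<open>S i\<close> for the partial sums are produced by recursion, independently of
  \<open>x\<close>, and compared with approximations at index 0.\<close>

lemma Real_polynomial_imp_subcover: "sem_Real_polynomial \<Longrightarrow> finite_subcover"
proof -
  assume poly: sem_Real_polynomial
  obtain F where F: "recip F" using ex_recip by blast
  have R: "inC C x \<Longrightarrow> isR (F x)" for x using F by (auto simp: recip_def intro: RFunD inC_isR)
  obtain e0 where e0: "rv e0 = 1" using ex_rv by blast
  let ?e = "kst e0"
  have rse: "rs ?e n = 1" for n by (simp add: rs_def e0)
  have "isR ?e" by (simp add: isR_def rse)
  moreover have "pos0 ?e" unfolding pos0_def slt_def
    using pw_Suc[of "0 + 1 :: 'n"] pw_Suc[of 0] by (intro exI[of _ "0 + 1 + 1"]) (simp add: rse)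
  ultimately have "dm F \<and> dm C \<and> contCU C F \<and> isR ?e \<and> pos0 ?e" using recip_contCU[OF F] by blast
  from poly[unfolded sem_Real_polynomial_def, rule_format, OF this]
  obtain c d where c: "dmN c" "\<And>i. isR (c i)" and app: "\<And>x. inC C x \<Longrightarrow>
      \<exists>w s. dmN w \<and> dmN s \<and> poly_sums_sem c x w s \<and> slt (\<lambda>n. \<bar>rs (s d) (n + 1) - rs (F x) (n + 1)\<bar>) (rs ?e)"
    by blast
  \<comment> \<open>Approximations of a point of [0,1] are at most 3 in absolute value, all
    approximations of a real lie within 1 of the first one, and equality of reals tolerates 2 at
    index 0. The constants in the recursions for \<open>B\<close> and \<open>S\<close> collect
    these.\<close>
  have "qdfn (\<lambda>z. 3 * (rv (rg (rgt z $ 0)) + 1) + 2)" by (intro qdfn_intros dfn_intros)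
  from qdfn_rec[of "\<lambda>_. 3" "\<lambda>z k q. 3 * (q + 1) + 2", OF qdfn_const this]
  obtain B' where B': "qdfn (\<lambda>z. B' (lft z) (rgt z $ 0))" "\<And>z. B' z 0 = 3" "\<And>z n. B' z (n + 1) = 3 * (B' z n + 1) + 2"
    by blast
  define B where "B = B' (kst 0)"
  have B: "qdfn (\<lambda>z. B (H z))" if "dfn H" for H
    unfolding B_def by (rule qdfn_subst[OF B'(1)]) (intro dfn_intros that)+
  have BS: "B 0 = 3" "B (n + 1) = 3 * (B n + 1) + 2" for n by (simp_all add: B_def B')
  let ?S = "\<lambda>k q. q + 3 + (\<bar>rs (c (k + 1)) 0\<bar> + 1) * (B (k + 1) + 1)"
  have "qdfn (\<lambda>z. ?S (lf (rgt z $ 0)) (rv (rg (rgt z $ 0))))" by (intro qdfn_intros B dm_idx[OF c(1)] dfn_intros)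
  from qdfn_rec[of "\<lambda>_. \<bar>rs (c 0) 0\<bar> + 2" "\<lambda>z. ?S", OF qdfn_const this]
  obtain S' where S': "qdfn (\<lambda>z. S' (lft z) (rgt z $ 0))" "\<And>z. S' z 0 = \<bar>rs (c 0) 0\<bar> + 2" "\<And>z n. S' z (n + 1) = ?S n (S' z n)"
    by blast
  define S where "S = S' (kst 0)"
  have S: "qdfn (\<lambda>z. S (H z))" if "dfn H" for H
    unfolding S_def by (rule qdfn_subst[OF S'(1)]) (intro dfn_intros that)+
  have SS: "S 0 = \<bar>rs (c 0) 0\<bar> + 2" "S (n + 1) = ?S n (S n)" for n by (simp_all add: S_def S')
  have "V (F x) \<le> cst (S d + 3)" if x: "inC C x" for x
  proof -
    obtain w s where ws: "dmN w" "dmN s" "poly_sums_sem c x w s" "slt (\<lambda>n. \<bar>rs (s d) (n + 1) - rs (F x) (n + 1)\<bar>) (rs ?e)"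
      using app[OF x] by blast
    have iR: "isR (w i)" "isR (s i)" for i using ws(3) by (auto simp: poly_sums_sem_def)
    have e: "\<bar>p 0 - q 0\<bar> \<le> 2" if "seqeq p q" for p q :: "'n \<Rightarrow> 'n zz fract"
      using that[unfolded seqeq_def, rule_format, of 0] by simp
    note P = ws(3)[unfolded poly_sums_sem_def]
    have w0: "\<bar>rs (w 0) 0 - 1\<bar> \<le> 2" using e[of "rs (w 0)" "\<lambda>_. qn 1"] P by simp
    have s0: "\<bar>rs (s 0) 0 - rs (c 0) 0\<bar> \<le> 2" using e[of "rs (s 0)" "rs (c 0)"] P by blast
    have wS: "\<bar>rs (w (i + 1)) 0 - smul (w i) x 0\<bar> \<le> 2" for i using e[of "rs (w (i + 1))" "smul (w i) x"] P by blast
    have sS: "\<bar>rs (s (i + 1)) 0 - (rs (s i) (0 + 1) + smul (c (i + 1)) (w (i + 1)) (0 + 1))\<bar> \<le> 2" for i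
      using e[of "rs (s (i + 1))" "\<lambda>n. rs (s i) (n + 1) + smul (c (i + 1)) (w (i + 1)) (n + 1)"] P by blast
    have unit: "unitR x" using closedC x by (auto simp: closedU_def)
    have xb: "\<bar>rs x n\<bar> \<le> 3" for n
    proof -
      have "\<not> rs x n + (pw n + pw n) < 0" "\<not> 1 + (pw n + pw n) < rs x n" using unit unfolding unitR_def slt_def by auto
      then show ?thesis using pw_le_1[of n] by linarith
    qed
    have wB: "\<bar>rs (w i) 0\<bar> \<le> B i" for i
    proof (induction i rule: num_induct)
      show "dec (\<lambda>z. \<bar>rs (w (z $ 0)) 0\<bar> \<le> B (z $ 0))" by (intro qdfn_intros dm_idx[OF ws(1)] B dfn_intros)
    next
      show "\<bar>rs (w 0) 0\<bar> \<le> B 0" using w0 by (simp add: BS abs_le_iff)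
    next
      fix i assume IH: "\<bar>rs (w i) 0\<bar> \<le> B i"
      have b: "\<bar>rs (w i) n\<bar> \<le> B i + 1" for n using fast_0[OF iR(1)[of i], of n] IH by linarith
      moreover have "0 \<le> B i + 1" using b[of 0] by linarith
      ultimately have "\<bar>smul (w i) x 0\<bar> \<le> (B i + 1) * 3"
        unfolding smul_def abs_mult by (intro mult_mono xb) simp_all
      then show "\<bar>rs (w (i + 1)) 0\<bar> \<le> B (i + 1)" using wS[of i] unfolding BS by linarith
    qed
    have sB: "\<bar>rs (s i) 0\<bar> \<le> S i" for i
    proof (induction i rule: num_induct)
      show "dec (\<lambda>z. \<bar>rs (s (z $ 0)) 0\<bar> \<le> S (z $ 0))" by (intro qdfn_intros dm_idx[OF ws(2)] S dfn_intros)
    next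
      show "\<bar>rs (s 0) 0\<bar> \<le> S 0" using s0 unfolding SS by linarith
    next
      fix i assume IH: "\<bar>rs (s i) 0\<bar> \<le> S i"
      have b: "\<bar>rs (w (i + 1)) n\<bar> \<le> B (i + 1) + 1" for n
        using fast_0[OF iR(1)[of "i + 1"], of n] wB[of "i + 1"] by linarith
      have "\<bar>smul (c (i + 1)) (w (i + 1)) (0 + 1)\<bar> \<le> (\<bar>rs (c (i + 1)) 0\<bar> + 1) * (B (i + 1) + 1)"
        unfolding smul_def abs_mult by (intro mult_mono b fast_0 c(2)) simp_all
      then show "\<bar>rs (s (i + 1)) 0\<bar> \<le> S (i + 1)" using sS[of i] fast_0[OF iR(2)[of i], of "0 + 1"] IH unfolding SS by linarith
    qed
    obtain n where "\<bar>rs (s d) (n + 1) - rs (F x) (n + 1)\<bar> + (pw n + pw n) < 1" using ws(4) unfolding slt_def rse by blast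
    then have "rs (F x) (n + 1) \<le> S d + 2"
      using fast_0[OF iR(2)[of d], of "n + 1"] sB[of d] pw_nonneg[of n] by linarith
    then have "rs (F x) (n + 1) + pw (n + 1) \<le> S d + 3" using pw_le_1[of "n + 1"] by linarith
    then have "cst (rs (F x) (n + 1) + pw (n + 1)) \<le> (cst (S d + 3) :: ('n, 'n zz fract) upower)" by (simp only: cst_simps(9))
    then show ?thesis using seq_bound[OF rs_fast[OF R[OF x]], of "n + 1"] unfolding abs_le_iff by simp
  qed
  then show ?thesis using F unfolding recip_def by blast
qed

end

section \<open>Discontinuous functionals\<close>

context rca begin

definition E2 :: bool where "E2 \<longleftrightarrow> (\<exists>E. dfn E \<and> (\<forall>f. E f = 0 \<longleftrightarrow> (\<exists>n. f $ n = 0)))"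

lemma dec_ex:
  assumes E2 "dec (\<lambda>z. P (lft z) (rgt z $ 0))"
  shows "dec (\<lambda>z. \<exists>n. P z n)"
proof -
  obtain E where E: "dfn E" "\<And>f. E f = 0 \<longleftrightarrow> (\<exists>n. f $ n = 0)" using assms(1) unfolding E2_def by blast
  let ?G = "\<lambda>z n. if P z n then 0 else (1 :: 'n)"
  have d: "dfn (\<lambda>z. ?G (lft z) (rgt z $ 0))" by (intro dfn_if assms(2) dfn_const)
  have "dec (\<lambda>z. E (Fn (?G z)) = 0)" by (intro dec_eq dfn_comp[OF E(1)] dm_Fn[OF d] dfn_const)
  moreover have "E (Fn (?G z)) = 0 \<longleftrightarrow> (\<exists>n. P z n)" for z
    unfolding E(2) Fn_ap[OF d] by auto
  ultimately show ?thesis by simp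
qed

lemma dm_if: "dec P \<Longrightarrow> dm A \<Longrightarrow> dm B \<Longrightarrow> dm (\<lambda>z. if P z then A z else B z)"
proof -
  assume P: "dec P" and A: "dm A" and B: "dm B"
  have "dfn (\<lambda>z. if P (lft z) then A (lft z) $ (rgt z $ 0) else B (lft z) $ (rgt z $ 0))"
    by (intro dfn_if dec_comp[OF P] dm_comp[OF A] dm_comp[OF B] dfn_ap dm_lft0 dm_rgt0 dfn_const)
  from dm_lam[of "\<lambda>z n. if P z then A z $ n else B z $ n", OF this]
  obtain D where D: "dm D" "\<And>z n. D z $ n = (if P z then A z $ n else B z $ n)" by blast
  have "(\<lambda>z. if P z then A z else B z) = D" by (intro HOL.ext ext) (simp add: D)
  then show ?thesis using D by simp
qed

text \<open>Grilliot's trick: follow \<open>x\<close> until \<open>f\<close> shows a zero, then switch to the sequence converging to \<open>x\<close>.\<close>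

lemma grilliot:
  assumes \<Phi>: "dfn \<Phi>" and s: "dmN s" and agree: "\<And>n i. i \<le> n \<Longrightarrow> s n $ i = x $ i" and diff: "\<And>n. \<Phi> (s n) \<noteq> \<Phi> x"
  shows E2
proof -
  have "dfn (\<lambda>z. if lft z $ rg (rgt z $ 0) = 0 then rg (rgt z $ 0) else rg (rgt z $ 0) + 1)" by (intro dfn_intros)
  from dfn_rec[of "\<lambda>_. 0" "\<lambda>z k v. if z $ v = 0 then v else v + 1", OF dfn_const this]
  obtain R where R: "dfn (\<lambda>z. R (lft z) (rgt z $ 0))" "\<And>z. R z 0 = 0"
    "\<And>z n. R z (n + 1) = (if z $ R z n = 0 then R z n else R z n + 1)" by blast
  \<comment> \<open>\<open>R f i\<close> counts up to the first zero \<open>c\<close> of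
    \<open>f\<close> and stays there. Since \<open>s k\<close> and \<open>x\<close> agree up to
    \<open>k\<close>, the diagonal is \<open>s c\<close> if there is a zero and \<open>x\<close>
    otherwise.\<close>
  let ?y = "\<lambda>f i. s (R f i) $ i"
  have d: "dfn (\<lambda>z. ?y (lft z) (rgt z $ 0))" by (intro dfn_ap dm_idx[OF s] R(1) dm_rgt0 dfn_const)
  have R1: "dfn (\<lambda>z. R f (z $ 0))" for f by (rule dfn_subst[OF R(1)]) (intro dfn_intros)+
  let ?E = "\<lambda>f. if \<Phi> (Fn (?y f)) = \<Phi> x then 1 else (0::'n)"
  have "?E f = 0 \<longleftrightarrow> (\<exists>n. f $ n = 0)" for f
  proof (cases "\<exists>n. f $ n = 0")
    case False
    have "R f i = i" for i
    proof (induction i rule: num_induct)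
      show "dec (\<lambda>z. R f (z $ 0) = z $ 0)" by (intro dfn_intros R1)
    qed (use False R in auto)
    then have "Fn (?y f) = x" by (intro Fn_eq) (simp add: agree)
    then show ?thesis using False by simp
  next
    case True
    then obtain n where "f $ n = 0" by blast
    then obtain c where c: "f $ c = 0" "\<And>k. k < c \<Longrightarrow> f $ k \<noteq> 0"
      using least_num[of "\<lambda>n. f $ n = 0" n] dec_eq[OF dfn_ap[OF dm_const[of f] dfn_ap[OF dm_id dfn_const[of 0]]] dfn_const[of 0]] by blast
    have Rc: "(i \<le> c \<longrightarrow> R f i = i) \<and> (c \<le> i \<longrightarrow> R f i = c)" for i
    proof (induction i rule: num_induct)
      show "dec (\<lambda>z. (z $ 0 \<le> c \<longrightarrow> R f (z $ 0) = z $ 0) \<and> (c \<le> z $ 0 \<longrightarrow> R f (z $ 0) = c))" by (intro dfn_intros R1)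
    next
      fix i assume IH: "(i \<le> c \<longrightarrow> R f i = i) \<and> (c \<le> i \<longrightarrow> R f i = c)"
      show "(i + 1 \<le> c \<longrightarrow> R f (i + 1) = i + 1) \<and> (c \<le> i + 1 \<longrightarrow> R f (i + 1) = c)"
      proof (cases "i < c")
        case True
        then show ?thesis using IH c(2)[of i] R(3)[of f i] Suc_le[of i c] by (auto simp: antisym)
      next
        case False
        then have "c \<le> i" "\<not> i + 1 \<le> c" by (auto simp: Suc_le)
        then show ?thesis using IH c(1) R(3)[of f i] by auto
      qed
    qed (simp add: R antisym)
    have "Fn (?y f) = s c"
    proof (rule Fn_eq)
      fix i show "s c $ i = s (R f i) $ i"
        using Rc[of i] agree[of i i] agree[of i c] by (cases "i \<le> c") auto
    qed
    then show ?thesis using diff[of c] True by simp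
  qed
  moreover have "dfn ?E" by (intro dfn_if dec_eq dfn_comp[OF \<Phi>] dm_Fn[OF d] dfn_const)
  ultimately show ?thesis unfolding E2_def by blast
qed

lemma pair_0 [simp]: "pair 0 0 = (0 :: 'n)" by (simp add: pair_def)
lemma lf_0 [simp]: "lf 0 = 0" and rg_0 [simp]: "rg 0 = 0"
  using lf_pair[of 0 0] rg_pair[of 0 0] by simp_all

text \<open>Choice picks numbers, so finite sequences need codes: iterated pairs, decoded by taking
  \<open>rg\<close> repeatedly and then \<open>lf\<close>. As \<open>pair 0 0 = 0\<close>, the code
  0 continues with zeros for ever. \<open>T\<close> builds the code from the end of the
  sequence.\<close>

lemma ex_finite_sequences:
  "\<exists>\<sigma>. dfn (\<lambda>z. \<sigma> (lft z $ 0) (rgt z $ 0)) \<and> (\<forall>g m. \<exists>c. \<forall>i. \<sigma> c i = (if i \<le> m then g $ i else 0))"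
proof -
  have "dfn (\<lambda>z. rg (rg (rgt z $ 0)))" by (intro dfn_intros)
  moreover have "dfn (\<lambda>z. z $ 0)" by (intro dfn_intros)
  ultimately obtain R where R: "dfn (\<lambda>z. R (lft z) (rgt z $ 0))" "\<And>z. R z 0 = z $ 0" "\<And>z n. R z (n + 1) = rg (R z n)"
    using dfn_rec[of "\<lambda>z. z $ 0" "\<lambda>z k v. rg v"] by blast
  let ?\<sigma> = "\<lambda>c i. lf (R (kst c) i)"
  have d: "dfn (\<lambda>z. ?\<sigma> (lft z $ 0) (rgt z $ 0))" by (intro dfn_lf dfn_subst[OF R(1)] dfn_intros)
  have "\<exists>c. \<forall>i. ?\<sigma> c i = (if i \<le> m then g $ i else 0)" for g m
  proof -
    have "dfn (\<lambda>z. pair (g $ (m - lf (rgt z $ 0))) (rg (rgt z $ 0)))" by (intro dfn_intros)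
    from dfn_rec[of "\<lambda>z. 0" "\<lambda>z k v. pair (g $ (m - k)) v", OF dfn_const this]
    obtain T' where T': "dfn (\<lambda>z. T' (lft z) (rgt z $ 0))" "\<And>z. T' z 0 = 0" "\<And>z k. T' z (k + 1) = pair (g $ (m - k)) (T' z k)"
      by blast
    define T where "T = T' (kst 0)"
    have T: "T 0 = 0" "T (k + 1) = pair (g $ (m - k)) (T k)" for k by (simp_all add: T_def T')
    have T1: "dfn (\<lambda>z. T (H z))" if "dfn H" for H unfolding T_def by (rule dfn_subst[OF T'(1)]) (intro dfn_intros that)+
    have step: "R (kst (T j)) i = T (j - i)" for i j
    proof (induction i rule: num_induct)
      show "dec (\<lambda>z. R (kst (T j)) (z $ 0) = T (j - z $ 0))"
        by (intro dfn_intros T1 dfn_subst[OF R(1)])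
    next
      fix i assume IH: "R (kst (T j)) i = T (j - i)"
      have e: "j - (i + 1) = j - i - 1" by (simp add: diff_diff_add)
      show "R (kst (T j)) (i + 1) = T (j - (i + 1))"
        unfolding R IH e by (cases "j - i" rule: num_cases) (auto simp: T)
    qed (simp add: R)
    have "?\<sigma> (T (m + 1)) i = (if i \<le> m then g $ i else 0)" for i
    proof (cases "i \<le> m")
      case True
      then obtain d where d: "m = i + d" by (metis le_add_diff_inverse)
      then have "m + 1 - i = d + 1" by (simp add: add.assoc)
      moreover have "m - d = i" unfolding d by simp
      ultimately have "?\<sigma> (T (m + 1)) i = g $ i" by (simp only: step[of "m + 1" i] T(2)[of d] lf_pair)
      then show ?thesis using True by simp
    next
      case False
      then have "m + 1 \<le> i" by (simp add: Suc_le)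
      then have "m + 1 - i = 0" using monus_less[of "m + 1" i] by (cases "m + 1 = i"; simp add: order.strict_iff_order)
      then have "R (kst (T (m + 1))) i = 0" by (simp only: step[of "m + 1" i] T(1))
      then show ?thesis using False by simp
    qed
    then show ?thesis by blast
  qed
  then have "dfn (\<lambda>z. ?\<sigma> (lft z $ 0) (rgt z $ 0)) \<and> (\<forall>g m. \<exists>c. \<forall>i. ?\<sigma> c i = (if i \<le> m then g $ i else 0))"
    using d by blast
  then show ?thesis by (rule exI[of _ ?\<sigma>])
qed

text \<open>Grilliot's trick needs the counterexamples to continuity as one sequence, and choice can
  find them only among the finite sequences. Either there are such counterexamples for every
  \<open>n\<close>, or some \<open>n\<close> admits none; then the finite truncations of an infinite
  counterexample \<open>g\<close> all have the value \<open>\<Phi> x\<close>, and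
  \<open>\<Phi>\<close> is discontinuous along them at \<open>g\<close>.\<close>

lemma continuity:
  assumes "\<not> E2" "dfn \<Phi>"
  shows "\<exists>n. \<forall>g. (\<forall>i<n. g $ i = x $ i) \<longrightarrow> \<Phi> g = \<Phi> x"
proof (rule ccontr)
  assume no: "\<not> ?thesis"
  obtain \<sigma> where \<sigma>: "dfn (\<lambda>z. \<sigma> (lft z $ 0) (rgt z $ 0))" "\<And>g m. \<exists>c. \<forall>i. \<sigma> c i = (if i \<le> m then g $ i else 0)"
    using ex_finite_sequences by blast
  let ?q = "\<lambda>n c i. if i \<le> n then x $ i else \<sigma> c i"
  have q: "dfn (\<lambda>z. ?q (lft (lft z) $ 0) (rgt (lft z) $ 0) (rgt z $ 0))"
    using dfn_comp[OF \<sigma>(1), of "\<lambda>z. push (kst (rgt (lft z) $ 0)) (rgt z $ 0)"]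
    by (intro dfn_intros) (simp add: dfn_intros)
  have q1: "dfn (\<lambda>z. ?q n c (rgt z $ 0))" for n c
    using dfn_comp[OF \<sigma>(1), of "\<lambda>z. push (kst c) (rgt z $ 0)"] by (intro dfn_intros) (simp add: dfn_intros)
  let ?p = "\<lambda>n c. Fn (?q n c)"
  have p_ap: "?p n c $ i = ?q n c i" for n c i by (rule Fn_ap'[OF q1])
  have dp: "dm (\<lambda>z. ?p (lft z $ 0) (rgt z $ 0))" by (rule dm_Fn[OF q])
  have dp': "dm (\<lambda>z. ?p (G z) (H z))" if "dfn G" "dfn H" for G H
    using dm_comp[OF dp, of "\<lambda>z. push (kst (G z)) (H z)"] that unfolding lft_push rgt_push kst_ap by (simp add: dm_push dm_kst)
  show False
  proof (cases "\<exists>n. \<forall>c. \<Phi> (?p n c) = \<Phi> x")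
    case True
    then obtain n where n: "\<And>c. \<Phi> (?p n c) = \<Phi> x" by blast
    obtain g where g: "\<And>i. i < n + 1 \<Longrightarrow> g $ i = x $ i" "\<Phi> g \<noteq> \<Phi> x" using no by blast
    let ?s = "\<lambda>m i. if i \<le> m + n then g $ i else 0"
    have ds: "dfn (\<lambda>z. ?s (lft z $ 0) (rgt z $ 0))" by (intro dfn_intros)
    have s_ap: "Fn (?s m) $ i = ?s m i" for m i
      by (rule Fn_ap') (intro dfn_intros)
    have "Fn (?s m) = ?p n c" if c: "\<And>i. \<sigma> c i = (if i \<le> m + n then g $ i else 0)" for m c
    proof (rule Fn_eq)
      fix i
      have "i \<le> n \<Longrightarrow> i \<le> m + n" by (rule order_trans[of i n]) simp_all
      then show "?p n c $ i = ?s m i" using g(1)[of i] by (simp add: p_ap c)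
    qed
    then have "\<Phi> (Fn (?s m)) = \<Phi> x" for m
    proof -
      obtain c where c: "\<forall>i. \<sigma> c i = (if i \<le> m + n then g $ i else 0)" using \<sigma>(2) by blast
      show ?thesis using \<open>\<And>m c. (\<And>i. \<sigma> c i = (if i \<le> m + n then g $ i else 0)) \<Longrightarrow> Fn (?s m) = ?p n c\<close>[OF c[rule_format]] n[of c] by (rule ssubst)
    qed
    then have "E2"
      using g(2) s_ap dm_Fn[OF ds] by (intro grilliot[OF assms(2), of "\<lambda>m. Fn (?s m)" g]) (auto simp: dmN_def intro: order_trans)
    then show False using assms(1) by simp
  next
    case False
    have "dec (\<lambda>z. \<Phi> (?p (lft z $ 0) (rgt z $ 0)) \<noteq> \<Phi> x)"
      by (intro dfn_intros dfn_comp[OF assms(2)] dp)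
    with False obtain Y where Y: "dfn (\<lambda>z. Y (z $ 0))" "\<And>n. \<Phi> (?p n (Y n)) \<noteq> \<Phi> x"
      using choiceN[of "\<lambda>n c. \<Phi> (?p n c) \<noteq> \<Phi> x"] by blast
    have "dmN (\<lambda>n. ?p n (Y n))" unfolding dmN_def by (intro dp' Y dfn_intros)
    then have E2 using Y(2) p_ap by (intro grilliot[OF assms(2), of "\<lambda>n. ?p n (Y n)" x]) auto
    then show False using assms(1) by simp
  qed
qed

text \<open>Continuity is applied to the approximation of the value at \<open>?m\<close>, which is a
  number. A real \<open>y\<close> close to \<open>x\<close> has a representation \<open>w\<close>
  that starts like \<open>x'\<close>; this gives the same approximation, and \<open>F\<close>
  respects the equality of \<open>w\<close> and \<open>y\<close>.\<close>

lemma continuity_real: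
  assumes "\<not> E2" "dm F" "RFun isR F" "isR x" "0 < rv e"
  shows "\<exists>d. 0 < rv d \<and> (\<forall>y. isR y \<and> near x y d \<longrightarrow> near (F x) (F y) e)"
proof -
  obtain m where m: "pw m < rv e" using archimedean[OF assms(5)] by blast
  \<comment> \<open>The chain from \<open>F x\<close> to \<open>F y\<close> uses four errors
    \<open>Pw ?m\<close>, while eight are available.\<close>
  let ?m = "m + 1 + 1 + 1"
  have P8: "Pw m = 8 * Pw ?m" by (simp only: Pw_Suc; simp)
  have p4: "pw i = 4 * pw (i + 1 + 1)" for i by (simp only: pw_Suc; simp)
  have sh: "dm (\<lambda>z. Fn (\<lambda>i. z $ (i + 1 + 1)))" "Fn (\<lambda>i. z $ (i + 1 + 1)) $ i = z $ (i + 1 + 1)" for z i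
  proof -
    have "dfn (\<lambda>z. lft z $ (rgt z $ 0 + 1 + 1))" by (intro dfn_intros)
    then show "dm (\<lambda>z. Fn (\<lambda>i. z $ (i + 1 + 1)))" "Fn (\<lambda>i. z $ (i + 1 + 1)) $ i = z $ (i + 1 + 1)"
      by (rule Fn[of "\<lambda>z i. z $ (i + 1 + 1)"])+
  qed
  \<comment> \<open>Dropping two entries gains the room to switch from \<open>x\<close> to
    \<open>y\<close> at index \<open>n\<close>: the jump costs at most
    \<open>3 * pw (i + 1 + 1)\<close>, less than \<open>pw i\<close>.\<close>
  define x' where "x' = Fn (\<lambda>i. x $ (i + 1 + 1))"
  have x': "rs x' i = rs x (i + 1 + 1)" for i by (simp add: rs_def x'_def sh)
  have "dfn (\<lambda>z. F z $ ?m)" by (intro dfn_ap dm_comp[OF assms(2)] dm_id dfn_const)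
  from continuity[OF assms(1) this, of x'] obtain n where n: "\<And>g. (\<And>i. i < n \<Longrightarrow> g $ i = x' $ i) \<Longrightarrow> F g $ ?m = F x' $ ?m" by blast
  obtain d where d: "rv d = pw (n + 1 + 1)" using ex_rv by blast
  have close: "isR w \<and> seqeqR w y" if y: "isR y" "\<bar>V x - V y\<bar> < Pw (n + 1 + 1)"
    and w: "\<And>i. rs w i = (if i < n then rs x (i + 1 + 1) else rs y (i + 1 + 1))" for w y
  proof -
    have fx: "fast (rs x)" and fy: "fast (rs y)" using assms(4) y(1) by (simp_all add: rs_fast)
    have "fast (rs w)"
    proof (rule fastI)
      fix i j :: 'n assume ij: "i \<le> j"
      then have ij': "i + 1 + 1 \<le> j + 1 + 1" by simp
      have pos: "0 < pw (i + 1 + 1)" by simp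
      show "\<bar>rs w i - rs w j\<bar> < pw i"
      proof (cases "i < n \<and> \<not> j < n")
        case True
        have "Pw (n + 1 + 1) \<le> Pw (i + 1 + 1)" "Pw (j + 1 + 1) \<le> Pw (i + 1 + 1)"
          using Pw_mono[of "i + 1 + 1" "n + 1 + 1"] Pw_mono[OF ij'] True by (simp_all add: less_imp_le)
        then have "\<bar>cst (rs x (i + 1 + 1)) - cst (rs y (j + 1 + 1))\<bar> \<le> Pw (i + 1 + 1) + Pw (i + 1 + 1) + Pw (i + 1 + 1)"
          using seq_bound[OF fx, of "i + 1 + 1"] seq_bound[OF fy, of "j + 1 + 1"] y(2) by linarith
        then have "cst \<bar>rs x (i + 1 + 1) - rs y (j + 1 + 1)\<bar> \<le> (cst (pw (i + 1 + 1) + pw (i + 1 + 1) + pw (i + 1 + 1)) :: ('n, 'n zz fract) upower)"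
          by simp
        then have "\<bar>rs x (i + 1 + 1) - rs y (j + 1 + 1)\<bar> \<le> pw (i + 1 + 1) + pw (i + 1 + 1) + pw (i + 1 + 1)" by (simp only: cst_simps(9))
        moreover have "rs w i = rs x (i + 1 + 1)" "rs w j = rs y (j + 1 + 1)" using True by (simp_all add: w)
        ultimately show ?thesis using pos p4[of i] by linarith
      next
        case False
        then have "\<bar>rs w i - rs w j\<bar> < pw (i + 1 + 1)"
          using fastD[OF fx ij'] fastD[OF fy ij'] ij by (auto simp: w)
        then show ?thesis using p4[of i] pos by linarith
      qed
    qed
    moreover have "seq (rs w) = seq (\<lambda>i. rs y (i + (1 + 1)))"
      by (rule antisym; rule seq_mono[of n]) (auto simp: w add.assoc)
    then have "\<bar>V w - V y\<bar> \<le> Pw k" for k using seq_shift[OF fy, of "1 + 1" k] by simp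
    ultimately show ?thesis using seqeqR_iff[of w y] y(1) by (simp add: isR_fast)
  qed
  have xx': "isR x'" "seqeqR x' x"
    using close[of x x'] assms(4) by (simp_all add: x')
  have Fm: "\<bar>V (F x) - V (F x')\<bar> \<le> Pw ?m"
    using assms(3,4) xx' seqeqR_iff[of "F x'" "F x"] unfolding RFun_def by (metis abs_minus_commute)
  have "near (F x) (F y) e" if y: "isR y" "near x y d" for y
  proof -
    let ?w = "\<lambda>i. if i < n then x $ (i + 1 + 1) else y $ (i + 1 + 1)"
    define w where "w = Fn ?w"
    have w_ap: "w $ i = ?w i" for i unfolding w_def by (rule Fn_ap') (intro dfn_intros)
    have "\<bar>V x - V y\<bar> < Pw (n + 1 + 1)" using nearD[OF assms(4) y] d by simp
    then have w: "isR w" "seqeqR w y" using close[OF y(1), of w] by (auto simp: rs_def w_ap)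
    have "F w $ ?m = F x' $ ?m" by (rule n) (simp add: w_ap x'_def sh)
    then have eq: "rs (F w) ?m = rs (F x') ?m" by (simp add: rs_def)
    have R: "isR (F x)" "isR (F x')" "isR (F w)" "isR (F y)" using assms(3,4) xx' w y by (auto intro: RFunD)
    have "\<bar>V (F w) - V (F y)\<bar> \<le> Pw ?m"
      using assms(3) w y seqeqR_iff[OF R(3,4)] unfolding RFun_def by blast
    moreover have "\<bar>V (F w) - V (F x')\<bar> \<le> Pw ?m + Pw ?m"
      using seq_bound[OF rs_fast[OF R(2)], of ?m] seq_bound[OF rs_fast[OF R(3)], of ?m] unfolding eq by linarith
    moreover have "0 < Pw ?m" by simp
    ultimately have "\<bar>V (F x) - V (F y)\<bar> \<le> Pw m" using Fm P8 by linarith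
    then show ?thesis using nearI[OF R(1,4) _ m] by simp
  qed
  then show ?thesis using d by (intro exI[of _ d]) auto
qed

section \<open>Pincherle's theorem\<close>

definition locbdd :: "('f \<Rightarrow> 'f) \<Rightarrow> bool" where
  "locbdd F \<longleftrightarrow> (\<forall>x. unitR x \<longrightarrow> (\<exists>r. 0 < rv r \<and> bdd (\<lambda>y. unitR y \<and> near x y r) F))"

definition sem_Pincherle :: bool where
  "sem_Pincherle \<longleftrightarrow> (\<forall>F. dm F \<and> RFun unitR F \<and> locbdd F \<longrightarrow> bdd unitR F)"

lemma unitR_isR: "unitR x \<Longrightarrow> isR x" by (simp add: unitR_def)

lemma near_bound:
  assumes "isR a" "isR b" "near a b e" "rv e = 1"
  shows "\<bar>V b\<bar> \<le> cst (\<bar>rs a 0\<bar> + 2)"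
  using nearD[OF assms(1-3)] assms(4) seq_bound[OF rs_fast[OF assms(1)], of 0] by (simp add: cst_abs)

lemma pos0_cong: "isR x \<Longrightarrow> isR y \<Longrightarrow> seqeqR x y \<Longrightarrow> pos0 x \<Longrightarrow> pos0 y"
proof -
  assume *: "isR x" "isR y" "seqeqR x y" "pos0 x"
  then obtain n where "Pw n \<le> V x" using pos0_iff by blast
  moreover have "\<bar>V x - V y\<bar> \<le> Pw (n + 1)" using * seqeqR_iff by blast
  ultimately have "Pw (n + 1) \<le> V y" using Pw_Suc[of n] by linarith
  then show ?thesis using * pos0_iff by blast
qed

end

context cover begin

text \<open>In the presence of \<open>E2\<close> the reciprocal is set to 0 off \<open>C\<close>.
  Local boundedness then uses openness of the complement at points off \<open>C\<close>, and
  continuity on \<open>C\<close> at the others, whose neighbourhoods may contain further points with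
  value 0.\<close>

lemma Pincherle_imp_subcover: "sem_Pincherle \<Longrightarrow> finite_subcover"
proof -
  assume pin: sem_Pincherle
  obtain F where F: "recip F" using ex_recip by blast
  have dF: "dm F" and RF: "RFun isR F" and cF: "contC C F" using F by (auto simp: recip_def)
  obtain e where e: "rv e = 1" using ex_rv by blast
  have CU: "inC C x \<Longrightarrow> unitR x" for x using closedC by (auto simp: closedU_def)
  show ?thesis
  proof (cases E2)
    case False
    have "locbdd F" unfolding locbdd_def
    proof (intro allI impI)
      fix x assume x: "unitR x"
      obtain d where d: "0 < rv d" "\<And>y. isR y \<Longrightarrow> near x y d \<Longrightarrow> near (F x) (F y) e"
        using continuity_real[OF False dF RF unitR_isR[OF x], of e] e by auto
      have "bdd (\<lambda>y. unitR y \<and> near x y d) F"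
      proof (rule bddI[of _ _ "\<bar>rs (F x) 0\<bar> + 2"])
        fix y assume y: "unitR y \<and> near x y d"
        then have R: "isR (F x)" "isR (F y)" "near (F x) (F y) e" using x RF d(2) by (auto intro: RFunD unitR_isR)
        show "isR (F y)" by (rule R)
        show "\<bar>V (F y)\<bar> \<le> cst (\<bar>rs (F x) 0\<bar> + 2)" by (rule near_bound[OF R e])
      qed
      then show "\<exists>r. 0 < rv r \<and> bdd (\<lambda>y. unitR y \<and> near x y r) F" using d by blast
    qed
    moreover have "RFun unitR F" using RF unfolding RFun_def by (blast intro: unitR_isR)
    ultimately have "bdd unitR F" using pin dF unfolding sem_Pincherle_def by blast
    then have "bdd (inC C) F" unfolding bdd_def using CU by blast
    then show ?thesis using bounded_imp_subcover[OF F] by blast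
  next
    case True
    obtain c0 where c0: "rv c0 = 0" using ex_rv by blast
    have rc0: "rs (kst c0) n = 0" for n by (simp add: rs_def c0)
    have R0: "isR (kst c0)" by (simp add: isR_def rc0)
    have V0: "V (kst c0) = 0" unfolding rc0[abs_def] seq_const by simp
    have RC: "RFun isR C" using closedC by (auto simp: closedU_def openR_def)
    let ?F = "\<lambda>x. if pos0 (C x) then kst c0 else F x"
    have "dec (\<lambda>z. pos0 (C z))" unfolding pos0_def slt_def
      by (rule dec_ex[OF True]) (intro qdfn_intros dm_comp[OF dmC] dfn_intros)
    then have dF': "dm ?F" by (intro dm_if dm_const dF)
    have refl0: "seqeqR (kst c0) (kst c0)" by (simp add: seqeqR_iff[OF R0 R0] less_imp_le)
    have RF1: "isR (?F x)" if "isR x" for x using that RF R0 by (auto intro: RFunD)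
    have "RFun isR ?F" unfolding RFun_def
    proof (intro conjI allI impI)
      fix x y assume xy: "isR x \<and> isR y \<and> seqeqR x y"
      then have yx: "isR y \<and> isR x \<and> seqeqR y x" using seqeqR_iff[of x y] seqeqR_iff[of y x] by (auto simp: abs_minus_commute)
      have "pos0 (C x) = pos0 (C y)"
        using xy yx RC pos0_cong[of "C x" "C y"] pos0_cong[of "C y" "C x"] unfolding RFun_def by blast
      then show "seqeqR (?F x) (?F y)"
        using xy RF refl0 unfolding RFun_def by auto
    qed (rule RF1)
    then have RF': "RFun unitR ?F" unfolding RFun_def by (blast intro: unitR_isR)
    have "locbdd ?F" unfolding locbdd_def
    proof (intro allI impI)
      fix x assume x: "unitR x"
      show "\<exists>r. 0 < rv r \<and> bdd (\<lambda>y. unitR y \<and> near x y r) ?F"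
      proof (cases "pos0 (C x)")
        case True
        then obtain r where r: "0 < rv r" "\<And>y. isR y \<Longrightarrow> near x y r \<Longrightarrow> pos0 (C y)"
          using closedC unitR_isR[OF x] unfolding closedU_def openR_def inO_def by blast
        have "bdd (\<lambda>y. unitR y \<and> near x y r) ?F"
          by (rule bddI[of _ _ 0]) (use r V0 R0 in \<open>auto intro: unitR_isR\<close>)
        then show ?thesis using r by blast
      next
        case False
        then have xC: "inC C x" using x by (simp add: inC_def unitR_isR)
        then obtain d where d: "0 < rv d" "\<And>y. inC C y \<Longrightarrow> near x y d \<Longrightarrow> near (F x) (F y) e"
          using cF e unfolding contC_def by (metis zero_less_one)
        have "bdd (\<lambda>y. unitR y \<and> near x y d) ?F"
        proof (rule bddI[of _ _ "\<bar>rs (F x) 0\<bar> + 2"])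
          fix y assume y: "unitR y \<and> near x y d"
          then show "isR (?F y)" by (intro RF1 unitR_isR) blast
          show "\<bar>V (?F y)\<bar> \<le> cst (\<bar>rs (F x) 0\<bar> + 2)"
          proof (cases "pos0 (C y)")
            case True
            have "cst 0 \<le> (cst (\<bar>rs (F x) 0\<bar> + 2) :: ('n, 'n zz fract) upower)" by (simp only: cst_simps(9); simp)
            then show ?thesis using True V0 by simp
          next
            case False
            then have "near (F x) (F y) e" using d(2)[of y] y by (simp add: inC_def unitR_isR)
            then show ?thesis using False near_bound[OF _ _ _ e] RF x y by (auto intro: RFunD unitR_isR)
          qed
        qed
        then show ?thesis using d by blast
      qed
    qed
    then have "bdd unitR ?F" using pin dF' RF' unfolding sem_Pincherle_def by blast
    then obtain k where k: "\<And>x. unitR x \<Longrightarrow> \<not> slt (\<lambda>_. qn k) (\<lambda>n. \<bar>rs (?F x) n\<bar>)" unfolding bdd_def by blast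
    have "\<not> slt (\<lambda>_. qn k) (\<lambda>n. \<bar>rs (F x) n\<bar>)" if "inC C x" for x
      using k[OF CU[OF that]] that by (simp add: inC_def)
    then have "bdd (inC C) F" unfolding bdd_def by blast
    then show ?thesis using bounded_imp_subcover[OF F] by blast
  qed
qed

end

section \<open>Uniform continuity on the unit interval\<close>

context rca begin

text \<open>The function \<open>max (- x) (x - 1)\<close> is positive exactly off [0,1].\<close>

lemma ex_unit_complement: "\<exists>D. dm D \<and> closedU D \<and> (\<forall>x. inC D x \<longleftrightarrow> unitR x)"
proof -
  have "qdfn (\<lambda>z. max (- rs (lft z) (rgt z $ 0)) (rs (lft z) (rgt z $ 0) - 1))" by (intro qdfn_intros dfn_intros)
  from rs_dm[of "\<lambda>x n. max (- rs x n) (rs x n - 1)", OF this]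
  obtain D where D: "dm D" "\<And>x n. rs (D x) n = max (- rs x n) (rs x n - 1)" by blast
  have R: "isR (D x)" if x: "isR x" for x
    unfolding isR_fast
  proof (rule fastI)
    fix n m :: 'n assume "n \<le> m"
    then have "\<bar>rs x n - rs x m\<bar> < pw n" by (rule fastD[OF rs_fast[OF x]])
    then show "\<bar>rs (D x) n - rs (D x) m\<bar> < pw n" unfolding D(2) max_def by auto
  qed
  have VD: "V (D x) = max (- V x) (V x - 1)" for x
  proof -
    have "V (D x) = seq (\<lambda>n. max (0 - rs x n) (rs x n - 1))" by (rule arg_cong[of _ _ seq]) (simp add: D fun_eq_iff)
    then show ?thesis unfolding seq_max seq_diff seq_const by simp
  qed
  have lip: "\<bar>V (D x) - V (D y)\<bar> \<le> \<bar>V x - V y\<bar>" for x y unfolding VD max_def by auto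
  have "RFun isR D" unfolding RFun_def using R lip by (meson order_trans seqeqR_iff)
  moreover have "\<exists>r. 0 < rv r \<and> (\<forall>y. isR y \<and> near x y r \<longrightarrow> inO D y)" if x: "inO D x" for x
  proof -
    have xR: "isR x" using x by (simp add: inO_def)
    then obtain n where n: "Pw n \<le> V (D x)" using x pos0_iff[OF R] by (auto simp: inO_def)
    obtain r where r: "rv r = pw (n + 1)" using ex_rv by blast
    have "inO D y" if y: "isR y" "near x y r" for y
    proof -
      have "\<bar>V x - V y\<bar> < Pw (n + 1)" using nearD[OF xR y] r by simp
      then have "Pw (n + 1) \<le> V (D y)" using n lip[of x y] Pw_Suc[of n] by linarith
      then show ?thesis using y pos0_iff[OF R] by (auto simp: inO_def)
    qed
    then show ?thesis using r by (intro exI[of _ r]) simp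
  qed
  ultimately have "openR D" unfolding openR_def by blast
  moreover have "inC D x \<longleftrightarrow> unitR x" for x
  proof (cases "isR x")
    case True
    have "(V (D x) < Pw n) = (- Pw n < V x \<and> V x < 1 + Pw n)" for n unfolding VD by auto
    then show ?thesis unfolding inC_def unitR_iff using not_pos0[OF R[OF True]] True by simp
  qed (simp add: inC_def unitR_def)
  ultimately show ?thesis using D(1) unfolding closedU_def by blast
qed

text \<open>A grid of mesh less than \<open>\<delta>\<close> reaches every point of \<open>[0,1]\<close>, and \<open>F\<close> changes by at most \<open>1\<close> between neighbours.\<close>

lemma uniform_imp_bounded:
  assumes "ucontC D F" "\<And>x. inC D x \<longleftrightarrow> unitR x" "dm F" "RFun isR F"
  shows "bdd unitR F"
proof -
  obtain e where e: "rv e = 1" using ex_rv by blast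
  then obtain d where d: "0 < rv d" "\<And>x y. unitR x \<Longrightarrow> unitR y \<Longrightarrow> near x y d \<Longrightarrow> near (F x) (F y) e"
    using assms(1,2) unfolding ucontC_def by (metis zero_less_one)
  \<comment> \<open>Half of the radius is taken, since the distance from a point to its grid point
    is only estimated by \<open>2 * pw j\<close>.\<close>
  obtain j where j: "pw j < rv d / 2" using archimedean[of "rv d / 2"] d(1) by auto
  then have j': "2 * pw j < rv d" by simp
  define g where "g i = kst (code i 0 (p2 j))" for i
  have rg: "rs (g i) n = qn i * pw j" for i n by (simp add: rs_def g_def rv_code pw_def)
  have gR: "isR (g i)" for i by (simp add: isR_def rg)
  have Vg: "V (g i) = cst (qn i * pw j)" for i unfolding rg[abs_def] seq_const ..
  have dg: "dm (\<lambda>z. g (z $ 0))" unfolding g_def by (intro dfn_intros dfn_code)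
  have le1: "qn i * pw j \<le> 1" if "i \<le> p2 j" for i using that by (simp add: pw_def divide_le_eq)
  have gU: "unitR (g i)" if "i \<le> p2 j" for i
    unfolding unitR_iff Vg
  proof (intro conjI allI gR)
    fix n
    have "- pw n < 0" by simp
    also have "0 \<le> qn i * pw j" by simp
    finally show "- Pw n < cst (qn i * pw j)" by (simp only: flip: cst_simps(5)) (simp only: cst_simps(11))
    have "qn i * pw j < 1 + pw n" using le1[OF that] pw_pos[of n] by linarith
    then have "cst (qn i * pw j) < (cst (1 + pw n) :: ('n, 'n zz fract) upower)" by (simp only: cst_simps(11))
    then show "cst (qn i * pw j) < 1 + Pw n" by simp
  qed
  have FR: "isR (F x)" if "isR x" for x using RFunD[OF assms(4) that] .
  \<comment> \<open>One step of the grid changes \<open>F\<close> by less than 1, and passing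
    between values and approximations at index 0 costs 1 at either end. Approximations are used
    because the induction hypothesis has to be decidable.\<close>
  have "i \<le> p2 j \<longrightarrow> \<bar>rs (F (g i)) 0\<bar> \<le> \<bar>rs (F (g 0)) 0\<bar> + 3 * qn i" for i
  proof (induction i rule: num_induct)
    show "dec (\<lambda>z. z $ 0 \<le> p2 j \<longrightarrow> \<bar>rs (F (g (z $ 0))) 0\<bar> \<le> \<bar>rs (F (g 0)) 0\<bar> + 3 * qn (z $ 0))"
      by (intro dfn_intros qdfn_intros dm_comp[OF assms(3) dg])
  next
    fix i assume IH: "i \<le> p2 j \<longrightarrow> \<bar>rs (F (g i)) 0\<bar> \<le> \<bar>rs (F (g 0)) 0\<bar> + 3 * qn i"
    show "i + 1 \<le> p2 j \<longrightarrow> \<bar>rs (F (g (i + 1))) 0\<bar> \<le> \<bar>rs (F (g 0)) 0\<bar> + 3 * qn (i + 1)"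
    proof
      assume i1: "i + 1 \<le> p2 j"
      then have i: "i \<le> p2 j" by (simp add: Suc_le)
      have "V (g i) - V (g (i + 1)) = - Pw j" unfolding Vg by (simp add: algebra_simps)
      then have "near (g i) (g (i + 1)) d"
        using j d(1) by (intro nearI[OF gR gR, of _ _ "pw j"]) (simp_all add: less_imp_le)
      then have "\<bar>V (F (g i)) - V (F (g (i + 1)))\<bar> < 1"
        using nearD[OF FR[OF gR] FR[OF gR] d(2)[OF gU[OF i] gU[OF i1]]] e by simp
      then have "cst \<bar>rs (F (g (i + 1))) 0\<bar> \<le> (cst (\<bar>rs (F (g i)) 0\<bar> + 3) :: ('n, 'n zz fract) upower)"
        using seq_bound[OF rs_fast[OF FR[OF gR]], of i 0] seq_bound[OF rs_fast[OF FR[OF gR]], of "i + 1" 0]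
        by (simp add: cst_abs)
      then have "\<bar>rs (F (g (i + 1))) 0\<bar> \<le> \<bar>rs (F (g i)) 0\<bar> + 3" by (simp only: cst_simps(9))
      then show "\<bar>rs (F (g (i + 1))) 0\<bar> \<le> \<bar>rs (F (g 0)) 0\<bar> + 3 * qn (i + 1)" using IH i by simp
    qed
  qed simp
  note grid = this
  have gb: "\<bar>rs (F (g i)) 0\<bar> \<le> \<bar>rs (F (g 0)) 0\<bar> + 3 * qn (p2 j)" if "i \<le> p2 j" for i
  proof -
    have "qn i \<le> qn (p2 j)" using that by simp
    then show ?thesis using grid[of i] that by linarith
  qed
  show ?thesis
  proof (rule bddI[of _ _ "\<bar>rs (F (g 0)) 0\<bar> + 3 * qn (p2 j) + 2"])
    fix x assume x: "unitR x"
    then have xR: "isR x" by (rule unitR_isR)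
    then show "isR (F x)" by (rule FR)
    let ?q = "rs x (j + 1 + 1)"
    have P4: "Pw j = 4 * Pw (j + 1 + 1)" by (simp only: Pw_Suc; simp)
    have xq: "\<bar>V x - cst ?q\<bar> \<le> Pw (j + 1 + 1)" by (rule seq_bound[OF rs_fast[OF xR]])
    have xb: "- Pw (j + 1 + 1) < V x" "V x < 1 + Pw (j + 1 + 1)" using x unfolding unitR_iff by blast+
    have p0: "0 < Pw (j + 1 + 1)" by simp
    \<comment> \<open>The grid point is the integer part of \<open>?q / pw j\<close>, found as the
      least number with a decidable property of the rational \<open>?q\<close>; a negative
      \<open>?q\<close> leads to \<open>i = 0\<close>.\<close>
    obtain k :: 'n where "?q / pw j \<le> qn k" using ex_upper by blast
    then have "?q < qn (k + 1) * pw j" by (simp add: divide_le_eq algebra_simps add_strict_increasing2 le_less_trans)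
    moreover have "dec (\<lambda>z. ?q < qn (z $ 0 + 1) * pw j)" by (intro qdfn_intros dfn_intros)
    ultimately obtain i where i: "?q < qn (i + 1) * pw j" "\<And>l. l < i \<Longrightarrow> \<not> ?q < qn (l + 1) * pw j"
      using least_num[of "\<lambda>i. ?q < qn (i + 1) * pw j" k] by blast
    have up: "?q < qn i * pw j + pw j" using i(1) by (simp add: algebra_simps)
    then have up': "cst ?q < cst (qn i * pw j) + Pw j" by (simp only: cst_simps(3)[symmetric] cst_simps(11))
    have low: "i = 0 \<or> cst (qn i * pw j) \<le> (cst ?q :: ('n, 'n zz fract) upower)"
    proof (cases i rule: num_cases)
      case (2 l)
      then show ?thesis using i(2)[of l] by (simp only: cst_simps(9)) (simp add: not_less)
    qed simp
    have "i \<le> p2 j"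
    proof (rule ccontr)
      assume "\<not> i \<le> p2 j"
      then have "p2 j + 1 \<le> i" by (simp add: Suc_le not_le)
      then have "qn (p2 j + 1) * pw j \<le> qn i * pw j" by (intro mult_right_mono) (simp_all del: qn_simps(3))
      moreover have "qn (p2 j) \<noteq> 0" by (metis qn_pos p2_pos less_irrefl)
      then have "qn (p2 j + 1) * pw j = 1 + pw j" by (simp add: pw_def add_divide_distrib)
      ultimately have "cst (1 + pw j) \<le> (cst (qn i * pw j) :: ('n, 'n zz fract) upower)" by (simp only: cst_simps(9))
      moreover have "i \<noteq> 0" using \<open>\<not> i \<le> p2 j\<close> by auto
      ultimately have "1 + Pw j \<le> cst ?q" using low by simp
      then show False using xq xb P4 p0 by linarith
    qed
    moreover have "\<bar>V (g i) - V x\<bar> \<le> cst (2 * pw j)"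
    proof (cases "i = 0")
      case True
      then have "V (g i) = 0" "cst ?q < Pw j" using up' unfolding Vg by simp_all
      then show ?thesis using xq xb P4 p0 by simp
    next
      case False
      then show ?thesis using low xq up' P4 p0 unfolding Vg by simp
    qed
    then have "near (g i) x d" by (rule nearI[OF gR xR _ j'])
    ultimately have n: "near (F (g i)) (F x) e" and b: "\<bar>rs (F (g i)) 0\<bar> \<le> \<bar>rs (F (g 0)) 0\<bar> + 3 * qn (p2 j)"
      using d(2)[OF gU x] gb by blast+
    have "\<bar>rs (F (g i)) 0\<bar> + 2 \<le> \<bar>rs (F (g 0)) 0\<bar> + 3 * qn (p2 j) + 2" using b by linarith
    then have "cst (\<bar>rs (F (g i)) 0\<bar> + 2) \<le> (cst (\<bar>rs (F (g 0)) 0\<bar> + 3 * qn (p2 j) + 2) :: ('n, 'n zz fract) upower)"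
      by (simp only: cst_simps(9))
    then show "\<bar>V (F x)\<bar> \<le> cst (\<bar>rs (F (g 0)) 0\<bar> + 3 * qn (p2 j) + 2)"
      using near_bound[OF FR[OF gR] FR[OF xR] n e] by (rule order_trans[rotated])
  qed
qed

end

lemma (in cover) Real_uniform_imp_subcover_continuous:
  assumes "\<not> E2" sem_Real_uniform
  shows finite_subcover
proof -
  obtain D where D: "dm D" "closedU D" "\<And>x. inC D x \<longleftrightarrow> unitR x" using ex_unit_complement by blast
  obtain F where F: "recip F" using ex_recip by blast
  have dF: "dm F" and RF: "RFun isR F" using F by (auto simp: recip_def)
  have "contC D F" unfolding contC_def
    using continuity_real[OF assms(1) dF RF] unfolding inC_def by blast
  then have "ucontC D F" using assms(2) dF D RF unfolding sem_Real_uniform_def contCU_def by blast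
  from uniform_imp_bounded[OF this D(3) dF RF]
  have "bdd (inC C) F" using closedC unfolding bdd_def closedU_def by blast
  then show ?thesis by (rule bounded_imp_subcover[OF F])
qed

section \<open>Cantor space\<close>

context rca begin

definition cantor :: "'f \<Rightarrow> bool" where "cantor f \<longleftrightarrow> (\<forall>n. f $ n \<le> 1)"

definition agree :: "'f \<Rightarrow> 'f \<Rightarrow> 'n \<Rightarrow> bool" where "agree f g n \<longleftrightarrow> (\<forall>i<n. f $ i = g $ i)"

definition inD :: "('f \<Rightarrow> 'n) \<Rightarrow> 'f \<Rightarrow> bool" where "inD D f \<longleftrightarrow> cantor f \<and> D f = 1"

definition closedD :: "('f \<Rightarrow> 'n) \<Rightarrow> bool" where
  "closedD D \<longleftrightarrow> (\<forall>f. cantor f \<longrightarrow> D f \<le> 1) \<and>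
    (\<forall>f. cantor f \<and> \<not> inD D f \<longrightarrow> (\<exists>n. \<forall>g. cantor g \<and> agree f g n \<longrightarrow> \<not> inD D g))"

definition contD :: "('f \<Rightarrow> 'n) \<Rightarrow> ('f \<Rightarrow> 'n) \<Rightarrow> bool" where
  "contD D F \<longleftrightarrow> (\<forall>f. inD D f \<longrightarrow> (\<exists>n. \<forall>g. inD D g \<and> agree f g n \<longrightarrow> F f = F g))"

definition sem_Cantor_bounded :: bool where
  "sem_Cantor_bounded \<longleftrightarrow> (\<forall>F D. dfn F \<and> dfn D \<and> closedD D \<and> contD D F \<longrightarrow> (\<exists>k. \<forall>f. inD D f \<longrightarrow> F f \<le> k))"

definition sem_Cantor_uniform :: bool where
  "sem_Cantor_uniform \<longleftrightarrow> (\<forall>F D. dfn F \<and> dfn D \<and> closedD D \<and> contD D F \<longrightarrow>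
    (\<exists>n. \<forall>f g. inD D f \<and> inD D g \<and> agree f g n \<longrightarrow> F f = F g))"

text \<open>The recursion \<open>v \<mapsto> n - v\<close> produces 0, 0, 1, 1, 2, 2 and so
  on.\<close>

lemma ex_half: "\<exists>hf. dfn (\<lambda>z. hf (z $ 0)) \<and> (\<forall>i. hf (i + i) = i \<and> hf (i + i + 1) = i)"
proof -
  have "dfn (\<lambda>z. lf (rgt z $ 0) - rg (rgt z $ 0))" by (intro dfn_intros)
  from dfn_rec[of "\<lambda>_. 0" "\<lambda>z n v. n - v", OF dfn_const this]
  obtain R where R: "dfn (\<lambda>z. R (lft z) (rgt z $ 0))" "\<And>z. R z 0 = 0" "\<And>z n. R z (n + 1) = n - R z n" by blast
  let ?h = "R (kst 0)"
  have d: "dfn (\<lambda>z. ?h (z $ 0))" by (rule dfn_subst[OF R(1)]) (intro dfn_intros)+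
  have d': "dfn (\<lambda>z. ?h (z $ 0 + z $ 0))" by (rule dfn_subst[OF R(1)]) (intro dfn_intros)+
  have e: "?h (i + i) = i" for i
  proof (induction i rule: num_induct)
    show "dec (\<lambda>z. ?h (z $ 0 + z $ 0) = z $ 0)" by (intro dfn_intros d')
  next
    fix i assume IH: "?h (i + i) = i"
    have "i + 1 + (i + 1) = i + i + 1 + 1" by (simp add: ac_simps)
    moreover have "i + i + 1 - i = i + 1" by (simp add: add.assoc)
    ultimately show "?h (i + 1 + (i + 1)) = i + 1" by (simp only: R IH) simp
  qed (simp add: R)
  then have "?h (i + i + 1) = i" for i by (simp only: R e) simp
  then show ?thesis using d e by blast
qed

text \<open>Interleaving \<open>f\<close> with a second sequence \<open>w\<close> turns \<open>F f\<close> into a position of \<open>w\<close> that has to be read.\<close>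

lemma Cantor_uniform_imp_bounded: "sem_Cantor_uniform \<Longrightarrow> sem_Cantor_bounded"
  unfolding sem_Cantor_bounded_def
proof (intro allI impI)
  fix F D assume u: sem_Cantor_uniform and "dfn F \<and> dfn D \<and> closedD D \<and> contD D F"
  then have F: "dfn F" and D: "dfn D" "closedD D" "contD D F" by blast+
  define ev where "ev = (\<lambda>f. Fn (\<lambda>i. f $ (i + i)))"
  have de: "dfn (\<lambda>z. lft z $ (rgt z $ 0 + rgt z $ 0))" by (intro dfn_intros)
  have ev: "dm ev" "ev f $ i = f $ (i + i)" for f i
    unfolding ev_def by (rule Fn[of "\<lambda>f i. f $ (i + i)", OF de])+
  let ?D = "\<lambda>f. D (ev f)" and ?F = "\<lambda>f. f $ (F (ev f) + F (ev f) + 1)"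
  have dD: "dfn ?D" and dF: "dfn ?F" by (intro dfn_intros dfn_comp[OF D(1)] dfn_comp[OF F] ev(1))+
  have cev: "cantor f \<Longrightarrow> cantor (ev f)" for f by (simp add: cantor_def ev)
  have aev: "agree f g (n + n) \<Longrightarrow> agree (ev f) (ev g) n" for f g n
    unfolding agree_def ev by (auto intro: add_strict_mono)
  have am: "agree f g n \<Longrightarrow> m \<le> n \<Longrightarrow> agree f g m" for f g n m unfolding agree_def by auto
  have "closedD ?D" unfolding closedD_def
  proof (intro conjI allI impI)
    fix f assume f: "cantor f \<and> \<not> inD ?D f"
    then have "cantor (ev f) \<and> \<not> inD D (ev f)" using cev by (simp add: inD_def)
    then obtain n where "\<forall>g. cantor g \<and> agree (ev f) g n \<longrightarrow> \<not> inD D g" using D(2) unfolding closedD_def by blast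
    then have "\<forall>g. cantor g \<and> agree f g (n + n) \<longrightarrow> \<not> inD ?D g" using aev cev by (auto simp: inD_def)
    then show "\<exists>n. \<forall>g. cantor g \<and> agree f g n \<longrightarrow> \<not> inD ?D g" by blast
  qed (use D(2) cev in \<open>auto simp: closedD_def\<close>)
  moreover have "contD ?D ?F" unfolding contD_def
  proof (intro allI impI)
    fix f assume "inD ?D f"
    then have "inD D (ev f)" using cev by (simp add: inD_def)
    then obtain n where n: "\<And>g. inD D g \<Longrightarrow> agree (ev f) g n \<Longrightarrow> F (ev f) = F g" using D(3) unfolding contD_def by blast
    let ?m = "F (ev f) + F (ev f) + 1"
    have "?F f = ?F g" if g: "inD ?D g" "agree f g (n + n + (?m + 1))" for g
    proof -
      have "agree f g (n + n)" "agree f g (?m + 1)" using g(2) by (auto elim!: am)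
      then have "F (ev f) = F (ev g)" "f $ ?m = g $ ?m" using n[OF _ aev] g(1) cev by (auto simp: inD_def agree_def)
      then show ?thesis by simp
    qed
    then show "\<exists>n. \<forall>g. inD ?D g \<and> agree f g n \<longrightarrow> ?F f = ?F g" by blast
  qed
  ultimately obtain n where n: "\<And>f g. inD ?D f \<Longrightarrow> inD ?D g \<Longrightarrow> agree f g n \<Longrightarrow> ?F f = ?F g"
    using u dD dF unfolding sem_Cantor_uniform_def by blast
  obtain hf where hf: "dfn (\<lambda>z. hf (z $ 0))" "\<And>i. hf (i + i) = i" "\<And>i. hf (i + i + 1) = i" using ex_half by blast
  have dh: "dfn (\<lambda>z. hf (G z))" if "dfn G" for G using dfn_comp[OF hf(1) dm_kst[OF that]] by simp
  have "F f \<le> n" if f: "inD D f" for f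
  proof (rule ccontr)
    assume "\<not> F f \<le> n"
    then have nF: "n \<le> F f + F f + 1" by (simp add: add_increasing order_trans less_imp_le not_le)
    \<comment> \<open>Both \<open>h 0\<close> and \<open>h 1\<close> carry \<open>f\<close> at the
      even positions and zeros at the odd ones below \<open>n\<close>. They agree up to
      \<open>n\<close> but differ at the odd position that \<open>?F\<close> reads, which is at
      least \<open>n\<close>.\<close>
    define h where "h b = Fn (\<lambda>i. if hf i + hf i = i then f $ (hf i) else if i < n then 0 else b)" for b
    have h: "h b $ i = (if hf i + hf i = i then f $ (hf i) else if i < n then 0 else b)" for b i
      unfolding h_def by (rule Fn_ap') (intro dfn_intros dh)
    have "ev (h b) = f" for b by (rule ext) (simp add: ev h hf)
    moreover have "b \<le> 1 \<Longrightarrow> cantor (h b)" for b using f by (simp add: cantor_def h inD_def)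
    ultimately have "inD ?D (h 0)" "inD ?D (h 1)" "?F (h b) = h b $ (F f + F f + 1)" for b using f by (simp_all add: inD_def)
    moreover have "agree (h 0) (h 1) n" by (simp add: agree_def h)
    moreover have "F f + F f \<noteq> F f + F f + 1" using less_add_one[of "F f + F f"] by (metis less_irrefl)
    then have "h b $ (F f + F f + 1) = b" for b using nF by (simp add: h hf leD)
    ultimately show False using n[of "h 0" "h 1"] by simp
  qed
  then show "\<exists>k. \<forall>f. inD D f \<longrightarrow> F f \<le> k" by blast
qed

end

section \<open>Binary sequences as real numbers\<close>

context rca begin

lemma ex_powers: "\<exists>R. qdfn (\<lambda>z. R (z $ 0)) \<and> R 0 = 1 \<and> (\<forall>n. R (n + 1) = R n * \<rho>)"
proof -
  have "qdfn (\<lambda>z. rv (rg (rgt z $ 0)) * \<rho>)" by (intro qdfn_intros dfn_intros)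
  from qdfn_rec[of "\<lambda>_. 1" "\<lambda>z n v. v * \<rho>", OF qdfn_const this]
  obtain R where R: "qdfn (\<lambda>z. R (lft z) (rgt z $ 0))" "\<And>z. R z 0 = 1" "\<And>z n. R z (n + 1) = R z n * \<rho>" by blast
  have "qdfn (\<lambda>z. R (kst 0) (z $ 0))" by (rule qdfn_subst[OF R(1)]) (intro dfn_intros)+
  then show ?thesis using R by blast
qed

definition rp :: "'n zz fract \<Rightarrow> 'n \<Rightarrow> 'n zz fract" where
  "rp \<rho> = (SOME R. qdfn (\<lambda>z. R (z $ 0)) \<and> R 0 = 1 \<and> (\<forall>n. R (n + 1) = R n * \<rho>))"

lemma rp: "qdfn (\<lambda>z. rp \<rho> (z $ 0))" "rp \<rho> 0 = 1" "rp \<rho> (n + 1) = rp \<rho> n * \<rho>"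
  using someI_ex[OF ex_powers[of \<rho>]] unfolding rp_def[symmetric] by blast+

lemma qdfn_rp: "dfn G \<Longrightarrow> qdfn (\<lambda>z. rp \<rho> (G z))"
  using qdfn_comp[OF rp(1) dm_kst[of G]] by simp

text \<open>The weights are normalised to add up to 1, and those from \<open>n\<close> on to
  \<open>rp \<rho> n\<close>; this bounds what is still to come after \<open>n\<close> bits.\<close>

definition bit_sum :: "'n zz fract \<Rightarrow> 'f \<Rightarrow> ('n \<Rightarrow> 'n zz fract) \<Rightarrow> bool" where
  "bit_sum \<rho> f S \<longleftrightarrow> S 0 = 0 \<and> (\<forall>n. S (n + 1) = S n + (if f $ n = 0 then 0 else rp \<rho> n * (1 - \<rho>)))"

lemma ex_bit_sum: "\<exists>S. qdfn (\<lambda>z. S (lft z) (rgt z $ 0)) \<and> (\<forall>f. bit_sum \<rho> f (S f))"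
proof -
  have "qdfn (\<lambda>z. rv (rg (rgt z $ 0)) + (if lft z $ lf (rgt z $ 0) = 0 then 0 else rp \<rho> (lf (rgt z $ 0)) * (1 - \<rho>)))"
    by (intro qdfn_intros dfn_intros qdfn_rp)
  from qdfn_rec[of "\<lambda>_. 0" "\<lambda>f n v. v + (if f $ n = 0 then 0 else rp \<rho> n * (1 - \<rho>))", OF qdfn_const this]
  obtain S where "qdfn (\<lambda>z. S (lft z) (rgt z $ 0))" "\<And>f. S f 0 = 0"
    "\<And>f n. S f (n + 1) = S f n + (if f $ n = 0 then 0 else rp \<rho> n * (1 - \<rho>))" by blast
  then have "qdfn (\<lambda>z. S (lft z) (rgt z $ 0)) \<and> (\<forall>f. bit_sum \<rho> f (S f))" unfolding bit_sum_def by simp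
  then show ?thesis by (rule exI[of _ S])
qed

definition bs :: "'n zz fract \<Rightarrow> 'f \<Rightarrow> 'n \<Rightarrow> 'n zz fract" where
  "bs \<rho> = (SOME S. qdfn (\<lambda>z. S (lft z) (rgt z $ 0)) \<and> (\<forall>f. bit_sum \<rho> f (S f)))"

lemma bs: "qdfn (\<lambda>z. bs \<rho> (lft z) (rgt z $ 0))" "bs \<rho> f 0 = 0"
  "bs \<rho> f (n + 1) = bs \<rho> f n + (if f $ n = 0 then 0 else rp \<rho> n * (1 - \<rho>))"
proof -
  have "qdfn (\<lambda>z. bs \<rho> (lft z) (rgt z $ 0)) \<and> (\<forall>f. bit_sum \<rho> f (bs \<rho> f))"
    unfolding bs_def by (rule someI_ex[OF ex_bit_sum])
  then show "qdfn (\<lambda>z. bs \<rho> (lft z) (rgt z $ 0))" "bs \<rho> f 0 = 0"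
    "bs \<rho> f (n + 1) = bs \<rho> f n + (if f $ n = 0 then 0 else rp \<rho> n * (1 - \<rho>))" unfolding bit_sum_def by blast+
qed

lemma qdfn_bs: "dm A \<Longrightarrow> dfn G \<Longrightarrow> qdfn (\<lambda>z. bs \<rho> (A z) (G z))"
  by (rule qdfn_subst[OF bs(1)])

text \<open>The approximation at \<open>n\<close> takes \<open>2 * (n + 1)\<close> bits, because
  \<open>\<rho> * \<rho>\<close> is at most 1/2 for the ratios in use.\<close>

definition sm :: "'n zz fract \<Rightarrow> 'f \<Rightarrow> 'f" where
  "sm \<rho> = (SOME A. dm A \<and> (\<forall>f n. rs (A f) n = bs \<rho> f (n + 1 + (n + 1))))"

lemma sm: "dm (sm \<rho>)" "rs (sm \<rho> f) n = bs \<rho> f (n + 1 + (n + 1))"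
proof -
  have "qdfn (\<lambda>z. bs \<rho> (lft z) (rgt z $ 0 + 1 + (rgt z $ 0 + 1)))" by (intro qdfn_bs dfn_intros)
  then have "\<exists>A. dm A \<and> (\<forall>f n. rs (A f) n = bs \<rho> f (n + 1 + (n + 1)))"
    using rs_dm[of "\<lambda>f n. bs \<rho> f (n + 1 + (n + 1))"] by metis
  from someI_ex[OF this] show "dm (sm \<rho>)" "rs (sm \<rho> f) n = bs \<rho> f (n + 1 + (n + 1))"
    unfolding sm_def[symmetric] by blast+
qed

text \<open>The greedy expansion, computed from rational approximations to \<open>x\<close>.\<close>

lemma ex_digits: "\<exists>B. dm B \<and> (\<forall>x n. B x $ n = (if rp \<rho> n / 2 \<le> rs x (n + n + 4) - bs \<rho> (B x) n then 1 else 0))"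
proof -
  let ?c = "\<lambda>x n v. if rp \<rho> n / 2 \<le> rs x (n + n + 4) - v then rp \<rho> n * (1 - \<rho>) else 0"
  have "qdfn (\<lambda>z. rv (rg (rgt z $ 0)) + ?c (lft z) (lf (rgt z $ 0)) (rv (rg (rgt z $ 0))))"
    by (intro qdfn_intros dfn_intros qdfn_rp)
  from qdfn_rec[of "\<lambda>_. 0" "\<lambda>x n v. v + ?c x n v", OF qdfn_const this]
  obtain T where T: "qdfn (\<lambda>z. T (lft z) (rgt z $ 0))" "\<And>x. T x 0 = 0" "\<And>x n. T x (n + 1) = T x n + ?c x n (T x n)" by blast
  have dT: "qdfn (\<lambda>z. T (A z) (G z))" if "dm A" "dfn G" for A G by (rule qdfn_subst[OF T(1) that])
  have "dfn (\<lambda>z. if rp \<rho> (rgt z $ 0) / 2 \<le> rs (lft z) (rgt z $ 0 + rgt z $ 0 + 4) - T (lft z) (rgt z $ 0) then 1 else 0)"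
    by (intro qdfn_intros dfn_intros qdfn_rp dT)
  from dm_lam[of "\<lambda>x n. if rp \<rho> n / 2 \<le> rs x (n + n + 4) - T x n then 1 else 0", OF this]
  obtain B where B: "dm B" "\<And>x n. B x $ n = (if rp \<rho> n / 2 \<le> rs x (n + n + 4) - T x n then 1 else 0)" by blast
  have "bs \<rho> (B x) n = T x n" for x n
  proof (induction n rule: num_induct)
    show "dec (\<lambda>z. bs \<rho> (B x) (z $ 0) = T x (z $ 0))" unfolding order_eq_iff by (intro dfn_intros qdfn_intros qdfn_bs dT)
  qed (simp_all add: bs T B)
  then show ?thesis using B by auto
qed

text \<open>Remainders are compared with \<open>rp \<rho> n\<close>. For \<rho> = 2/3, digit 1 is
  admissible from a third of it on and digit 0 up to two thirds; for \<rho> = 1/4, the remainder of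
  a sum is at most a quarter or at least three quarters of it. The threshold 1/2 keeps away from
  these limits, and index \<open>n + n + 4\<close> gives the precision
  \<open>rp \<rho> n / 16\<close> as \<open>\<rho> \<ge> 1 / 4\<close>.\<close>

definition dig :: "'n zz fract \<Rightarrow> 'f \<Rightarrow> 'f" where
  "dig \<rho> = (SOME B. dm B \<and> (\<forall>x n. B x $ n = (if rp \<rho> n / 2 \<le> rs x (n + n + 4) - bs \<rho> (B x) n then 1 else 0)))"

lemma dig: "dm (dig \<rho>)" "dig \<rho> x $ n = (if rp \<rho> n / 2 \<le> rs x (n + n + 4) - bs \<rho> (dig \<rho> x) n then 1 else 0)"
  using someI_ex[OF ex_digits[of \<rho>]] unfolding dig_def[symmetric] by blast+

lemma cantor_dig: "cantor (dig \<rho> x)" by (simp add: cantor_def dig(2)[of \<rho> x])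

lemma sq_le: "0 \<le> a \<Longrightarrow> a \<le> b \<Longrightarrow> a * a \<le> (b * b :: 'n zz fract)" by (rule mult_mono) simp_all

context
  fixes \<rho> :: "'n zz fract"
  assumes rho: "1 / 4 \<le> \<rho>" "\<rho> \<le> 2 / 3"
begin

lemma rho_simps: "0 < \<rho>" "\<rho> < 1" "0 \<le> 1 - \<rho>" using rho by linarith+

lemma rp_pos: "0 < rp \<rho> n"
proof (induction n rule: num_induct)
  show "dec (\<lambda>z. 0 < rp \<rho> (z $ 0))" by (intro qdfn_intros rp)
qed (simp_all add: rp rho_simps)

lemma rp_double: "rp \<rho> (n + 1 + (n + 1)) = rp \<rho> (n + n) * (\<rho> * \<rho>)"
proof -
  have "n + 1 + (n + 1) = n + n + 1 + 1" by (simp add: ac_simps)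
  then show ?thesis by (simp only: rp mult.assoc)
qed

text \<open>Here \<open>\<rho> \<le> 2 / 3\<close> enters, as 4/9 is below 1/2; the estimate
  \<open>pw_small\<close> in the other direction uses \<open>1 / 4 \<le> \<rho>\<close>.\<close>

lemma rp_small: "rp \<rho> (n + n) \<le> pw n"
proof (induction n rule: num_induct)
  show "dec (\<lambda>z. rp \<rho> (z $ 0 + z $ 0) \<le> pw (z $ 0))" by (intro qdfn_intros dfn_intros qdfn_rp)
next
  fix n assume IH: "rp \<rho> (n + n) \<le> pw n"
  have "\<rho> * \<rho> \<le> 2 / 3 * (2 / 3)" using rho rho_simps by (intro sq_le) simp_all
  also have "\<dots> \<le> 1 / 2" by simp
  finally have "rp \<rho> (n + n) * (\<rho> * \<rho>) \<le> pw n * (1 / 2)" using IH rho_simps by (intro mult_mono) simp_all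
  then show "rp \<rho> (n + 1 + (n + 1)) \<le> pw (n + 1)" unfolding rp_double pw_Suc by simp
qed (simp add: rp)

lemma pw_small: "pw (n + n) \<le> rp \<rho> n"
proof (induction n rule: num_induct)
  show "dec (\<lambda>z. pw (z $ 0 + z $ 0) \<le> rp \<rho> (z $ 0))" by (intro qdfn_intros dfn_intros qdfn_rp)
next
  fix n assume IH: "pw (n + n) \<le> rp \<rho> n"
  have e: "n + 1 + (n + 1) = n + n + 1 + 1" by (simp add: ac_simps)
  have "pw (n + n) * (1 / 4) \<le> rp \<rho> n * \<rho>" using IH rho less_imp_le[OF rp_pos] by (intro mult_mono) simp_all
  then show "pw (n + 1 + (n + 1)) \<le> rp \<rho> (n + 1)" unfolding e rp pw_Suc by simp
qed (simp add: rp)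

lemma bs_bounds: "bs \<rho> f n \<le> bs \<rho> f (n + k)" "bs \<rho> f (n + k) \<le> bs \<rho> f n + rp \<rho> n"
proof -
  \<comment> \<open>The upper bound is strengthened for the induction: partial sum plus remaining
    weight does not increase.\<close>
  have "bs \<rho> f n \<le> bs \<rho> f (n + k) \<and> bs \<rho> f (n + k) + rp \<rho> (n + k) \<le> bs \<rho> f n + rp \<rho> n"
  proof (induction k rule: num_induct)
    show "dec (\<lambda>z. bs \<rho> f n \<le> bs \<rho> f (n + z $ 0) \<and> bs \<rho> f (n + z $ 0) + rp \<rho> (n + z $ 0) \<le> bs \<rho> f n + rp \<rho> n)"
      by (intro dfn_intros qdfn_intros qdfn_bs qdfn_rp)
  next
    fix k assume IH: "bs \<rho> f n \<le> bs \<rho> f (n + k) \<and> bs \<rho> f (n + k) + rp \<rho> (n + k) \<le> bs \<rho> f n + rp \<rho> n"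
    have "0 \<le> rp \<rho> (n + k) * (1 - \<rho>)" using rp_pos[of "n + k"] rho_simps by simp
    then show "bs \<rho> f n \<le> bs \<rho> f (n + (k + 1)) \<and> bs \<rho> f (n + (k + 1)) + rp \<rho> (n + (k + 1)) \<le> bs \<rho> f n + rp \<rho> n"
      using IH unfolding add.assoc[symmetric] bs rp by (auto simp: algebra_simps)
  qed simp
  then show "bs \<rho> f n \<le> bs \<rho> f (n + k)" "bs \<rho> f (n + k) \<le> bs \<rho> f n + rp \<rho> n"
    using rp_pos[of "n + k"] by linarith+
qed

lemma isR_sm: "isR (sm \<rho> f)"
  unfolding isR_fast
proof (rule fastI)
  fix n m :: 'n assume "n \<le> m"
  then obtain k where m: "m = n + k" by (metis le_add_diff_inverse)
  have e: "m + 1 + (m + 1) = n + 1 + (n + 1) + (k + k)" unfolding m by (simp add: ac_simps)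
  have "\<bar>rs (sm \<rho> f) n - rs (sm \<rho> f) m\<bar> \<le> rp \<rho> (n + 1 + (n + 1))"
    using bs_bounds[of f "n + 1 + (n + 1)" "k + k"] unfolding sm(2) e by simp
  also have "\<dots> \<le> pw (n + 1)" by (rule rp_small)
  also have "\<dots> < pw n" using pw_pos[of n] unfolding pw_Suc by simp
  finally show "\<bar>rs (sm \<rho> f) n - rs (sm \<rho> f) m\<bar> < pw n" .
qed

lemma sm_bounds: "cst (bs \<rho> f n) \<le> V (sm \<rho> f)" "V (sm \<rho> f) \<le> cst (bs \<rho> f n + rp \<rho> n)"
proof -
  have "bs \<rho> f n \<le> rs (sm \<rho> f) m \<and> rs (sm \<rho> f) m \<le> bs \<rho> f n + rp \<rho> n" if m: "n \<le> m" for m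
  proof -
    obtain k where "m = n + k" using m by (metis le_add_diff_inverse)
    then have "m + 1 + (m + 1) = n + (n + k + k + 1 + 1)" by (simp add: ac_simps)
    then show ?thesis using bs_bounds unfolding sm(2) by presburger
  qed
  then show "cst (bs \<rho> f n) \<le> V (sm \<rho> f)" "V (sm \<rho> f) \<le> cst (bs \<rho> f n + rp \<rho> n)"
    using seq_mono[of n "\<lambda>_. bs \<rho> f n" "rs (sm \<rho> f)"] seq_mono[of n "rs (sm \<rho> f)" "\<lambda>_. bs \<rho> f n + rp \<rho> n"]
    unfolding seq_const by blast+
qed

lemma agree_bs: "agree f g n \<Longrightarrow> bs \<rho> f n = bs \<rho> g n"
proof -
  assume a: "agree f g n"
  have "i \<le> n \<longrightarrow> bs \<rho> f i = bs \<rho> g i" for i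
  proof (induction i rule: num_induct)
    show "dec (\<lambda>z. z $ 0 \<le> n \<longrightarrow> bs \<rho> f (z $ 0) = bs \<rho> g (z $ 0))"
      unfolding order_eq_iff by (intro dfn_intros qdfn_intros qdfn_bs)
  qed (use a in \<open>auto simp: bs agree_def Suc_le\<close>)
  then show ?thesis by blast
qed

lemma agree_sm: "agree f g n \<Longrightarrow> \<bar>V (sm \<rho> f) - V (sm \<rho> g)\<bar> \<le> cst (rp \<rho> n)"
  using agree_bs[of f g n] sm_bounds[of f n] sm_bounds[of g n] by simp

lemma rp_le: "i \<le> j \<Longrightarrow> rp \<rho> j \<le> rp \<rho> i"
proof -
  assume "i \<le> j"
  then obtain k where j: "j = i + k" by (metis le_add_diff_inverse)
  have "rp \<rho> (i + k) \<le> rp \<rho> i"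
  proof (induction k rule: num_induct)
    show "dec (\<lambda>z. rp \<rho> (i + z $ 0) \<le> rp \<rho> i)" by (intro dfn_intros qdfn_intros qdfn_rp)
  next
    fix k assume "rp \<rho> (i + k) \<le> rp \<rho> i"
    moreover have "rp \<rho> (i + k) * \<rho> \<le> rp \<rho> (i + k) * 1" using rho_simps rp_pos[of "i + k"] by (intro mult_left_mono) simp_all
    ultimately show "rp \<rho> (i + (k + 1)) \<le> rp \<rho> i" unfolding add.assoc[symmetric] rp by simp
  qed simp
  then show ?thesis unfolding j .
qed

lemma pw_rp: "pw (n + n + 4) \<le> rp \<rho> n / 16"
proof -
  have e: "n + n + 4 = n + n + 1 + 1 + 1 + 1" by (simp add: numeral_eq_Suc add.assoc)
  show ?thesis using pw_small[of n] unfolding e pw_Suc by simp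
qed

lemma ex_rp_less: "0 < q \<Longrightarrow> \<exists>n. rp \<rho> n < q"
  using archimedean[of q] rp_small by (metis le_less_trans)

end

text \<open>The greedy remainder stays between 0 and \<open>rp (2 / 3) i\<close>. To make this
  invariant decidable, the remainder is measured against a fixed rational approximation
  \<open>rs x N\<close>, at the price of an error \<open>2 * pw N\<close>.\<close>

lemma sm_dig:
  assumes x: "unitR x"
  shows "seqeqR (sm (2 / 3) (dig (2 / 3) x)) x"
proof -
  let ?\<rho> = "2 / 3 :: 'n zz fract"
  let ?d = "dig ?\<rho> x"
  have rho: "1 / 4 \<le> ?\<rho>" "?\<rho> \<le> 2 / 3" by simp_all
  have xR: "isR x" by (rule unitR_isR[OF x])
  have inv: "- (2 * pw N) \<le> rs x N - bs ?\<rho> ?d i \<and> rs x N - bs ?\<rho> ?d i \<le> rp ?\<rho> i + 2 * pw N" for i N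
  proof (induction i rule: num_induct)
    show "dec (\<lambda>z. - (2 * pw N) \<le> rs x N - bs ?\<rho> ?d (z $ 0) \<and> rs x N - bs ?\<rho> ?d (z $ 0) \<le> rp ?\<rho> (z $ 0) + 2 * pw N)"
      by (intro dfn_intros qdfn_intros qdfn_bs qdfn_rp)
  next
    have "\<not> rs x N + (pw N + pw N) < qn 0" "\<not> qn 1 + (pw N + pw N) < rs x N" using x unfolding unitR_def slt_def by blast+
    then show "- (2 * pw N) \<le> rs x N - bs ?\<rho> ?d 0 \<and> rs x N - bs ?\<rho> ?d 0 \<le> rp ?\<rho> 0 + 2 * pw N"
      by (simp add: bs rp not_less)
  next
    fix i assume IH: "- (2 * pw N) \<le> rs x N - bs ?\<rho> ?d i \<and> rs x N - bs ?\<rho> ?d i \<le> rp ?\<rho> i + 2 * pw N"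
    have "\<bar>rs x N - rs x (i + i + 4)\<bar> \<le> pw N + pw (i + i + 4)"
    proof (cases "N \<le> i + i + 4")
      case True
      then show ?thesis using fastD[OF rs_fast[OF xR] True] pw_pos[of "i + i + 4"] by linarith
    next
      case False
      then have "i + i + 4 \<le> N" by simp
      from fastD[OF rs_fast[OF xR] this] show ?thesis using pw_pos[of N] by linarith
    qed
    then have "\<bar>rs x N - rs x (i + i + 4)\<bar> \<le> pw N + rp ?\<rho> i / 16" using pw_rp[OF rho, of i] by linarith
    moreover have "0 < rp ?\<rho> i" "0 < pw N" using rp_pos[OF rho] by simp_all
    moreover have "bs ?\<rho> ?d (i + 1) = bs ?\<rho> ?d i + (if rp ?\<rho> i / 2 \<le> rs x (i + i + 4) - bs ?\<rho> ?d i then rp ?\<rho> i / 3 else 0)"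
      unfolding bs by (subst dig(2)) simp
    moreover have "rp ?\<rho> (i + 1) = rp ?\<rho> i * 2 / 3" by (simp add: rp)
    ultimately show "- (2 * pw N) \<le> rs x N - bs ?\<rho> ?d (i + 1) \<and> rs x N - bs ?\<rho> ?d (i + 1) \<le> rp ?\<rho> (i + 1) + 2 * pw N"
      using IH by (cases "rp ?\<rho> i / 2 \<le> rs x (i + i + 4) - bs ?\<rho> ?d i") (simp only: if_True if_False; linarith)+
  qed
  have "\<bar>V (sm ?\<rho> ?d) - V x\<bar> \<le> Pw k" for k
  proof -
    let ?N = "k + 1 + 1 + 1"
    let ?i = "?N + ?N"
    have P: "Pw k = 8 * Pw ?N" "0 < Pw ?N" by (simp only: Pw_Suc; simp)+
    have r: "cst (rp ?\<rho> ?i) \<le> Pw ?N" using rp_small[OF rho, of ?N] by (simp only: cst_simps(9))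
    have "cst (- (2 * pw ?N)) \<le> (cst (rs x ?N - bs ?\<rho> ?d ?i) :: ('n, 'n zz fract) upower)"
      "cst (rs x ?N - bs ?\<rho> ?d ?i) \<le> (cst (rp ?\<rho> ?i + 2 * pw ?N) :: ('n, 'n zz fract) upower)"
      using inv[of ?N ?i] by (simp_all only: cst_simps(9))
    then have "- (2 * Pw ?N) \<le> cst (rs x ?N) - cst (bs ?\<rho> ?d ?i)" "cst (rs x ?N) - cst (bs ?\<rho> ?d ?i) \<le> cst (rp ?\<rho> ?i) + 2 * Pw ?N"
      by simp_all
    moreover have "cst (bs ?\<rho> ?d ?i) \<le> V (sm ?\<rho> ?d)" "V (sm ?\<rho> ?d) \<le> cst (bs ?\<rho> ?d ?i) + cst (rp ?\<rho> ?i)"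
      using sm_bounds[OF rho, of ?d ?i] by simp_all
    ultimately show ?thesis using seq_bound[OF rs_fast[OF xR], of ?N] r P by linarith
  qed
  then show ?thesis using seqeqR_iff[OF isR_sm[OF rho] xR] by blast
qed

text \<open>The remainders for digit 0 and digit 1 keep a distance of a quarter of
  \<open>rp (1 / 4) j\<close> from the threshold, while the distance of \<open>z\<close> from the
  sum and the approximation to \<open>z\<close> cost a sixteenth each. Earlier digits agree by
  induction, so both tests start from the same partial sum.\<close>

lemma dig_close:
  assumes z: "isR z" and g: "cantor g" and close: "\<bar>V z - V (sm (1 / 4) g)\<bar> \<le> cst (rp (1 / 4) i / 16)" and j: "j \<le> i"
  shows "dig (1 / 4) z $ j = g $ j"
proof -
  let ?\<rho> = "1 / 4 :: 'n zz fract"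
  let ?d = "dig ?\<rho> z"
  have rho: "1 / 4 \<le> ?\<rho>" "?\<rho> \<le> 2 / 3" by simp_all
  have bit: "?d $ j = g $ j" if j: "j \<le> i" and eq: "bs ?\<rho> ?d j = bs ?\<rho> g j" for j
  proof -
    have "rp ?\<rho> i / 16 \<le> rp ?\<rho> j / 16" using rp_le[OF rho j] by simp
    then have "cst (rp ?\<rho> i / 16) \<le> (cst (rp ?\<rho> j / 16) :: ('n, 'n zz fract) upower)" by (simp only: cst_simps(9))
    moreover have "Pw (j + j + 4) \<le> cst (rp ?\<rho> j / 16)" using pw_rp[OF rho, of j] by (simp only: cst_simps(9))
    ultimately have *: "\<bar>cst (rs z (j + j + 4)) - V (sm ?\<rho> g)\<bar> \<le> cst (rp ?\<rho> j / 16) + cst (rp ?\<rho> j / 16)"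
      using close seq_bound[OF rs_fast[OF z], of "j + j + 4"] by linarith
    then have *: "cst (rs z (j + j + 4)) \<le> V (sm ?\<rho> g) + (cst (rp ?\<rho> j / 16) + cst (rp ?\<rho> j / 16))"
      "V (sm ?\<rho> g) - (cst (rp ?\<rho> j / 16) + cst (rp ?\<rho> j / 16)) \<le> cst (rs z (j + j + 4))" by (simp_all only: abs_le_iff) linarith+
    have r: "0 < rp ?\<rho> j" by (rule rp_pos[OF rho])
    show ?thesis
    proof (cases "g $ j = 0")
      case True
      then have "V (sm ?\<rho> g) \<le> cst (bs ?\<rho> g j + rp ?\<rho> j / 4)" using sm_bounds(2)[OF rho, of g "j + 1"] by (simp add: bs rp)
      then have "cst (rs z (j + j + 4)) \<le> (cst (bs ?\<rho> g j + rp ?\<rho> j / 4 + rp ?\<rho> j / 16 + rp ?\<rho> j / 16) :: ('n, 'n zz fract) upower)"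
        using * unfolding cst_simps(3,4) by linarith
      then have "rs z (j + j + 4) \<le> bs ?\<rho> g j + rp ?\<rho> j / 4 + rp ?\<rho> j / 16 + rp ?\<rho> j / 16" by (simp only: cst_simps(9))
      then have "\<not> rp ?\<rho> j / 2 \<le> rs z (j + j + 4) - bs ?\<rho> ?d j" using r eq by linarith
      then show ?thesis using True by (subst dig(2)) simp
    next
      case False
      then have "cst (bs ?\<rho> g j + rp ?\<rho> j * 3 / 4) \<le> V (sm ?\<rho> g)" using sm_bounds(1)[OF rho, of g "j + 1"] by (simp add: bs)
      then have "cst (bs ?\<rho> g j + rp ?\<rho> j * 3 / 4 - rp ?\<rho> j / 16 - rp ?\<rho> j / 16) \<le> (cst (rs z (j + j + 4)) :: ('n, 'n zz fract) upower)"
        using * unfolding cst_simps(3,4) by linarith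
      then have "bs ?\<rho> g j + rp ?\<rho> j * 3 / 4 - rp ?\<rho> j / 16 - rp ?\<rho> j / 16 \<le> rs z (j + j + 4)" by (simp only: cst_simps(9))
      then have "rp ?\<rho> j / 2 \<le> rs z (j + j + 4) - bs ?\<rho> ?d j" using r eq by linarith
      moreover have "g $ j = 1" using False g less_one[of "g $ j"] unfolding cantor_def by (metis order.order_iff_strict)
      ultimately show ?thesis by (subst dig(2)) simp
    qed
  qed
  have "j \<le> i + 1 \<longrightarrow> bs ?\<rho> ?d j = bs ?\<rho> g j" for j
  proof (induction j rule: num_induct)
    show "dec (\<lambda>z. z $ 0 \<le> i + 1 \<longrightarrow> bs ?\<rho> ?d (z $ 0) = bs ?\<rho> g (z $ 0))"
      unfolding order_eq_iff by (intro dfn_intros qdfn_intros qdfn_bs)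
  next
    fix j assume IH: "j \<le> i + 1 \<longrightarrow> bs ?\<rho> ?d j = bs ?\<rho> g j"
    show "j + 1 \<le> i + 1 \<longrightarrow> bs ?\<rho> ?d (j + 1) = bs ?\<rho> g (j + 1)"
    proof
      assume "j + 1 \<le> i + 1"
      then have "j \<le> i" "j \<le> i + 1" by (simp_all add: add_increasing2)
      then show "bs ?\<rho> ?d (j + 1) = bs ?\<rho> g (j + 1)" using IH bit[of j] by (simp add: bs)
    qed
  qed (simp add: bs)
  then show ?thesis using bit[OF j] j by (simp add: add_increasing2)
qed

end

section \<open>Functionals on Cantor space\<close>

context cover begin

lemma covered_by_cantor:
  assumes "inC C x"
  obtains f where "cantor f" "isR (sm (2 / 3) f)" "seqeqR x (sm (2 / 3) f)" "seqeqR (sm (2 / 3) f) x"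
proof -
  have rho: "1 / 4 \<le> (2 / 3 :: 'n zz fract)" "2 / 3 \<le> (2 / 3 :: 'n zz fract)" by simp_all
  have x: "unitR x" using assms closedC by (simp add: closedU_def)
  have R: "isR (sm (2 / 3) (dig (2 / 3) x))" by (rule isR_sm[OF rho])
  have "seqeqR (sm (2 / 3) (dig (2 / 3) x)) x" by (rule sm_dig[OF x])
  moreover from this have "seqeqR x (sm (2 / 3) (dig (2 / 3) x))"
    using seqeqR_iff[OF R unitR_isR[OF x]] seqeqR_iff[OF unitR_isR[OF x] R] by (simp add: abs_minus_commute)
  ultimately show ?thesis using that cantor_dig R by blast
qed

text \<open>In the absence of \<open>E2\<close> the witness of positivity obtained from choice is
  continuous by itself. In its presence choice guarantees nothing of the kind, so the least witness
  is taken: it is read off from finitely many approximations of \<open>H\<close>, hence from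
  finitely many bits.\<close>

lemma Cantor_bounded_imp_subcover: "sem_Cantor_bounded \<Longrightarrow> finite_subcover"
proof -
  assume bd: sem_Cantor_bounded
  let ?sm = "sm (2 / 3)"
  have rho: "1 / 4 \<le> (2 / 3 :: 'n zz fract)" "2 / 3 \<le> (2 / 3 :: 'n zz fract)" by simp_all
  have R: "isR (?sm f)" for f by (rule isR_sm[OF rho])
  show ?thesis
  proof (cases E2)
    case False
    obtain U where "unit_height U" using ex_unit_height by blast
    then have U: "dm U" "\<And>x. isR x \<Longrightarrow> isR (U x)" "\<And>x y. isR x \<Longrightarrow> isR y \<Longrightarrow> seqeqR x y \<Longrightarrow> seqeqR (U x) (U y)"
      "\<And>x. isR x \<Longrightarrow> \<exists>n. Pw n \<le> V (U x)"
      "\<And>N. \<forall>x. inC C x \<longrightarrow> Pw N \<le> V (U x) \<Longrightarrow> finite_subcover"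
      unfolding unit_height_def by blast+
    obtain W where W: "dfn W" "\<And>x. isR x \<Longrightarrow> Pw (W x) \<le> V (U x)" using ex_positive_witness[OF U(1,2,4)] by blast
    have "dfn (\<lambda>f. W (?sm f))" by (rule dfn_comp[OF W(1) sm(1)])
    moreover from continuity[OF False this] have "contD (\<lambda>_. 1) (\<lambda>f. W (?sm f))"
      unfolding contD_def agree_def by metis
    moreover have "closedD (\<lambda>_. 1)" "dfn (\<lambda>_. 1)" by (simp_all add: closedD_def inD_def dfn_const)
    ultimately obtain K where K: "\<And>f. cantor f \<Longrightarrow> W (?sm f) \<le> K" using bd unfolding sem_Cantor_bounded_def inD_def by blast
    \<comment> \<open>The sum \<open>?sm f\<close> equals \<open>x\<close> only as a real, which
      costs the step from \<open>K\<close> to \<open>K + 1\<close>.\<close>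
    have "Pw (K + 1) \<le> V (U x)" if x: "inC C x" for x
    proof -
      obtain f where f: "cantor f" "seqeqR x (?sm f)" using covered_by_cantor[OF x] by blast
      have "Pw K \<le> V (U (?sm f))" using Pw_mono[OF K[OF f(1)]] W(2)[OF R[of f]] by (rule order_trans)
      moreover have "\<bar>V (U x) - V (U (?sm f))\<bar> \<le> Pw (K + 1)"
        using U(3)[OF inC_isR[OF x] R f(2)] seqeqR_iff[OF U(2)[OF inC_isR[OF x]] U(2)[OF R]] by blast
      ultimately show ?thesis using Pw_Suc[of K] by linarith
    qed
    then show ?thesis using U(5) by blast
  next
    case True
    have RC: "RFun isR C" using closedC by (auto simp: closedU_def openR_def)
    obtain H where "height H" using ex_height by blast
    then have H: "dm H" "\<And>x. isR x \<Longrightarrow> isR (H x)"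
      "\<And>x y n. isR x \<Longrightarrow> isR y \<Longrightarrow> \<bar>V (H x) - V (H y)\<bar> \<le> \<bar>V x - V y\<bar> + Pw n"
      "\<And>x y n. rs x (n + (1 + 1)) = rs y (n + (1 + 1)) \<Longrightarrow> rs (H x) n = rs (H y) n"
      "\<And>x. inC C x \<Longrightarrow> \<exists>n. Pw n \<le> V (H x)"
      "\<And>N. \<forall>x. inC C x \<longrightarrow> Pw N \<le> V (H x) \<Longrightarrow> finite_subcover"
      unfolding height_def by blast+
    let ?D = "\<lambda>f. if pos0 (C (?sm f)) then 0 else 1 :: 'n"
    have "dec (\<lambda>f. pos0 (C (?sm f)))" unfolding pos0_def slt_def
      by (rule dec_ex[OF True]) (intro qdfn_intros dm_comp[OF dmC] dm_comp[OF sm(1)] dfn_intros)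
    then have dD: "dfn ?D" by (intro dfn_if dfn_const)
    have inD_C: "inD ?D f \<longleftrightarrow> cantor f \<and> inC C (?sm f)" for f using R by (simp add: inD_def inC_def)
    have cD: "closedD ?D" unfolding closedD_def
    proof (intro conjI allI impI)
      fix f assume "cantor f \<and> \<not> inD ?D f"
      then have "inO C (?sm f)" using R by (simp add: inD_C inC_def inO_def)
      then obtain r where r: "0 < rv r" "\<And>y. isR y \<Longrightarrow> near (?sm f) y r \<Longrightarrow> inO C y"
        using closedC unfolding closedU_def openR_def by blast
      obtain n where n: "rp (2 / 3) n < rv r" using ex_rp_less[OF rho r(1)] by blast
      have "\<not> inD ?D g" if "agree f g n" for g
        using r(2)[OF R nearI[OF R R agree_sm[OF rho that] n]] by (simp add: inD_C inC_def inO_def)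
      then show "\<exists>n. \<forall>g. cantor g \<and> agree f g n \<longrightarrow> \<not> inD ?D g" by blast
    qed simp
    \<comment> \<open>The second disjunct makes the relation total, as choice demands, for sequences
      that do not represent a point of \<open>C\<close>.\<close>
    let ?Q = "\<lambda>f n. pw n + pw n < rs (H (?sm f)) n \<or> ?D f = 0"
    have dQ: "dec (\<lambda>z. ?Q (A z) (G z))" if "dm A" "dfn G" for A G
      by (intro qdfn_intros dfn_intros dm_comp[OF H(1)] dm_comp[OF sm(1)] that dfn_comp[OF dD])
    have "dec (\<lambda>z. ?Q (lft z) (rgt z $ 0) \<and> (\<forall>k<rgt z $ 0. \<not> ?Q (lft z) k))"
      by (intro dec_and dec_ball[of "\<lambda>z k. \<not> ?Q (lft z) k"] dec_not dQ dfn_intros)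
    moreover have "\<exists>n. ?Q f n \<and> (\<forall>k<n. \<not> ?Q f k)" for f
    proof -
      have "\<exists>n. ?Q f n"
      proof (cases "pos0 (C (?sm f))")
        case False
        then have "inC C (?sm f)" using R by (simp add: inC_def)
        then obtain n where "Pw n \<le> V (H (?sm f))" using H(5) by blast
        then have "pos0 (H (?sm f))" using pos0_iff[OF H(2)[OF R]] by blast
        then show ?thesis unfolding pos0_def slt_def by auto
      qed simp
      then obtain n where "?Q f n" by blast
      moreover have "dec (\<lambda>z. ?Q f (z $ 0))" by (intro dQ dfn_intros)
      ultimately show ?thesis using least_num[of "?Q f" n] by blast
    qed
    ultimately obtain F where F: "dfn F" "\<And>f. ?Q f (F f) \<and> (\<forall>k<F f. \<not> ?Q f k)"
      using choice[of "\<lambda>f n. ?Q f n \<and> (\<forall>k<n. \<not> ?Q f k)"] by blast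
    have "contD ?D F" unfolding contD_def
    proof (intro allI impI)
      fix f assume f: "inD ?D f"
      \<comment> \<open>\<open>H\<close> reads its argument two indices later, and the approximation
        of \<open>?sm\<close> at \<open>n\<close> takes \<open>2 * (n + 1)\<close> bits.\<close>
      let ?m = "F f + (1 + 1)"
      have "F f = F g" if g: "inD ?D g" "agree f g (?m + 1 + (?m + 1))" for g
      proof -
        have Q: "?Q g k = ?Q f k" if k: "k \<le> F f" for k
        proof -
          let ?k = "k + (1 + 1)"
          have "?k + 1 + (?k + 1) \<le> ?m + 1 + (?m + 1)" by (intro add_mono order.refl k)
          then have "agree f g (?k + 1 + (?k + 1))" using g(2) unfolding agree_def by (meson less_le_trans)
          then have "rs (?sm f) ?k = rs (?sm g) ?k" using agree_bs[OF rho] by (simp only: sm(2))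
          then have "rs (H (?sm f)) k = rs (H (?sm g)) k" by (rule H(4))
          moreover have "?D f = 1" "?D g = 1" using f g(1) unfolding inD_def by blast+
          ultimately show ?thesis by simp
        qed
        show ?thesis
        proof (rule linorder_cases[of "F f" "F g"])
          assume "F f < F g" then show ?thesis using F(2)[of g] F(2)[of f] Q[of "F f"] by blast
        next
          assume "F g < F f" then show ?thesis using F(2)[of g] F(2)[of f] Q[of "F g"] less_imp_le by blast
        qed
      qed
      then show "\<exists>n. \<forall>g. inD ?D g \<and> agree f g n \<longrightarrow> F f = F g" by blast
    qed
    then obtain K where K: "\<And>f. inD ?D f \<Longrightarrow> F f \<le> K"
      using bd F(1) dD cD unfolding sem_Cantor_bounded_def by blast
    have "Pw (K + 1) \<le> V (H x)" if x: "inC C x" for x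
    proof -
      have xR: "isR x" by (rule inC_isR[OF x])
      obtain f where f: "cantor f" "seqeqR x (?sm f)" "seqeqR (?sm f) x" using covered_by_cantor[OF x] by blast
      have "\<not> pos0 (C (?sm f))"
        using x f(3) RC pos0_cong[of "C (?sm f)" "C x"] R unfolding inC_def RFun_def by blast
      then have fD: "inD ?D f" using f(1) by (simp add: inD_def)
      then have "pw (F f) + pw (F f) < rs (H (?sm f)) (F f)" using F(2)[of f] unfolding inD_def by auto
      then have "cst (pw (F f) + pw (F f)) < (cst (rs (H (?sm f)) (F f)) :: ('n, 'n zz fract) upower)" by (simp only: cst_simps(11))
      then have "Pw (F f) \<le> V (H (?sm f))" using seq_bound[OF rs_fast[OF H(2)[OF R]], of f "F f"] unfolding cst_simps(3) by linarith
      moreover have "Pw K \<le> Pw (F f)" by (rule Pw_mono[OF K[OF fD]])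
      moreover have "\<bar>V x - V (?sm f)\<bar> \<le> Pw (K + 1 + 1)" using f(2) seqeqR_iff[OF xR R] by blast
      moreover have "Pw K = 2 * Pw (K + 1)" "Pw (K + 1) = 2 * Pw (K + 1 + 1)" by (simp only: Pw_Suc; simp)+
      ultimately show ?thesis using H(3)[OF xR R, of f "K + 1 + 1"] by linarith
    qed
    then show ?thesis using H(6) by blast
  qed
qed

end

context rca begin

text \<open>The set \<open>D\<close> is embedded into \<open>[0,1]\<close> as a subset of a Cantor set whose digits can be read off.\<close>

lemma Real_uniform_imp_Cantor_uniform:
  assumes E2 sem_Real_uniform
  shows sem_Cantor_uniform
  unfolding sem_Cantor_uniform_def
proof (intro allI impI)
  fix F D assume "dfn F \<and> dfn D \<and> closedD D \<and> contD D F"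
  then have F: "dfn F" and D: "dfn D" "closedD D" "contD D F" by blast+
  let ?\<rho> = "1 / 4 :: 'n zz fract"
  let ?sm = "sm ?\<rho>" and ?dig = "dig ?\<rho>"
  have rho: "1 / 4 \<le> ?\<rho>" "?\<rho> \<le> 2 / 3" by simp_all
  have R: "isR (?sm f)" for f by (rule isR_sm[OF rho])
  \<comment> \<open>\<open>?P z\<close> says that \<open>z\<close> is the image of a member of
    \<open>D\<close>, which is then the sequence of its digits. \<open>E2\<close> decides it,
    equality of reals being a universal statement.\<close>
  let ?P = "\<lambda>z. seqeqR z (?sm (?dig z)) \<and> D (?dig z) = 1"
  have near_dig: "agree (?dig z) g (i + 1)" if "isR z" "cantor g" "\<bar>V z - V (?sm g)\<bar> \<le> cst (rp ?\<rho> i / 16)" for z g i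
    using dig_close[OF that(1-3)] unfolding agree_def by simp
  have eq_dig: "?dig z = g" if z: "isR z" and g: "cantor g" and eq: "seqeqR z (?sm g)" for z g
  proof (rule ext)
    fix i
    obtain k where k: "pw k < rp ?\<rho> i / 16" using archimedean[of "rp ?\<rho> i / 16"] rp_pos[OF rho, of i] by auto
    then have "Pw k < cst (rp ?\<rho> i / 16)" by (simp only: cst_simps(11))
    moreover have "\<bar>V z - V (?sm g)\<bar> \<le> Pw k" using eq seqeqR_iff[OF z R] by blast
    ultimately have "\<bar>V z - V (?sm g)\<bar> \<le> cst (rp ?\<rho> i / 16)" by linarith
    then show "?dig z $ i = g $ i" by (rule dig_close[OF z g]) simp
  qed
  have P_iff: "?P z \<longleftrightarrow> (\<exists>g. inD D g \<and> seqeqR z (?sm g))" if z: "isR z" for z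
    using eq_dig[OF z] cantor_dig[of ?\<rho> z] unfolding inD_def by metis
  have P_cong: "?P y \<and> ?dig y = ?dig z" if z: "isR z" "isR y" "seqeqR z y" "?P z" for y z
  proof -
    have "\<bar>V y - V (?sm (?dig z))\<bar> \<le> Pw n" for n
    proof -
      have "\<bar>V z - V (?sm (?dig z))\<bar> \<le> Pw (n + 1)" using z(4) seqeqR_iff[OF z(1) R] by blast
      moreover have "\<bar>V z - V y\<bar> \<le> Pw (n + 1)" using z(3) seqeqR_iff[OF z(1,2)] by blast
      ultimately show ?thesis using Pw_Suc[of n] by linarith
    qed
    then have "seqeqR y (?sm (?dig z))" using seqeqR_iff[OF z(2) R] by blast
    then show ?thesis using eq_dig[OF z(2) cantor_dig] z(4) by simp
  qed
  have seqeq_sym: "seqeqR x y \<Longrightarrow> seqeqR y x" for x y unfolding seqeqR_def seqeq_def by (simp add: abs_minus_commute)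
  have decP: "dec ?P"
  proof -
    have "dec (\<lambda>z. \<exists>n. \<not> \<bar>rs z n - rs (?sm (?dig z)) n\<bar> \<le> pw n + pw n)"
      by (rule dec_ex[OF assms(1)]) (intro qdfn_intros dfn_intros dm_comp[OF sm(1)] dm_comp[OF dig(1)])
    from dec_not[OF this] have "dec (\<lambda>z. seqeqR z (?sm (?dig z)))" by (simp add: seqeqR_def seqeq_def)
    then show ?thesis by (intro dec_and dec_eq dfn_comp[OF D(1) dig(1)] dfn_const)
  qed
  obtain c1 where c1: "rv c1 = 1" using ex_rv by blast
  \<comment> \<open>The characteristic function of the complement of the image. Off the image
    \<open>F'\<close> is cut off to 0; continuity is asked of it on the image only.\<close>
  define D' where "D' z = (if ?P z then kst (code 0 0 1) else kst c1)" for z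
  define F' where "F' z = (if ?P z then kst (code (F (?dig z)) 0 1) else kst (code 0 0 1))" for z
  have dD': "dm D'" unfolding D'_def by (intro dm_if decP dm_const)
  have dF': "dm F'" unfolding F'_def by (intro dm_if decP dm_const dm_kst dfn_code dfn_const dfn_comp[OF F dig(1)])
  have rsD: "rs (D' z) n = (if ?P z then 0 else 1)" for z n by (simp add: rs_def D'_def c1 rv_code)
  have rsF: "rs (F' z) n = (if ?P z then qn (F (?dig z)) else 0)" for z n by (simp add: rs_def F'_def rv_code)
  have DR: "isR (D' z)" and FR: "isR (F' z)" for z by (simp_all add: isR_def rsD rsF)
  have VD: "V (D' z) = (if ?P z then 0 else 1)" for z unfolding rsD[abs_def] seq_const by simp
  have VF: "V (F' z) = (if ?P z then cst (qn (F (?dig z))) else 0)" for z unfolding rsF[abs_def] seq_const by simp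
  have pos: "pos0 (D' z) \<longleftrightarrow> \<not> ?P z" for z
  proof (cases "?P z")
    case False
    have "Pw 0 \<le> V (D' z)" unfolding VD using False by auto
    then show ?thesis using pos0_iff[OF DR] False by blast
  next
    case True
    then have "V (D' z) < Pw n" for n unfolding VD by simp
    then show ?thesis using not_pos0[OF DR] True by blast
  qed
  have inC': "inC D' z \<longleftrightarrow> isR z \<and> ?P z" for z unfolding inC_def pos by blast
  have refl: "seqeqR x x" for x by (simp add: seqeqR_def seqeq_def)
  have cong: "D' x = D' y \<and> F' x = F' y" if "isR x" "isR y" "seqeqR x y" for x y
  proof (cases "?P x")
    case True
    then have y: "?P y" "?dig y = ?dig x" using P_cong[OF that] by blast+
    show ?thesis by (simp only: D'_def F'_def if_P[OF True] if_P[OF y(1)]; simp only: y(2))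
  next
    case False
    then have y: "\<not> ?P y" using P_cong[OF that(2,1) seqeq_sym[OF that(3)]] by blast
    show ?thesis unfolding D'_def F'_def if_not_P[OF False] if_not_P[OF y] by blast
  qed
  have RF: "RFun isR D'" "RFun isR F'" unfolding RFun_def using DR FR cong refl by metis+
  \<comment> \<open>The radius is half of what \<open>near_dig\<close> allows, because
    \<open>y\<close> equals the image of \<open>g\<close> only up to every
    \<open>Pw k\<close>.\<close>
  have sep: "agree (?dig z) g (i + 1)" if z: "isR z" "isR y" "near z y r" "rv r = rp ?\<rho> i / 32" and g: "cantor g" "seqeqR y (?sm g)" for z y r i g
  proof -
    have r: "0 < rp ?\<rho> i" by (rule rp_pos[OF rho])
    then obtain k where k: "pw k < rp ?\<rho> i / 32" using archimedean[of "rp ?\<rho> i / 32"] by auto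
    then have "Pw k < cst (rp ?\<rho> i / 32)" by (simp only: cst_simps(11))
    moreover have "\<bar>V y - V (?sm g)\<bar> \<le> Pw k" using g(2) seqeqR_iff[OF z(2) R] by blast
    moreover have "\<bar>V z - V y\<bar> < cst (rp ?\<rho> i / 32)" using nearD[OF z(1-3)] z(4) by simp
    moreover have "cst (rp ?\<rho> i / 16) = (cst (rp ?\<rho> i / 32) + cst (rp ?\<rho> i / 32) :: ('n, 'n zz fract) upower)" by simp
    ultimately have "\<bar>V z - V (?sm g)\<bar> \<le> cst (rp ?\<rho> i / 16)" by linarith
    then show ?thesis by (rule near_dig[OF z(1) g(1)])
  qed
  have mono: "agree f g (i + 1) \<Longrightarrow> agree f g i" for f g i unfolding agree_def by (simp add: less_imp_le)
  have exr: "\<exists>r. rv r = rp ?\<rho> i / 32 \<and> 0 < rv r" for i using ex_rv rp_pos[OF rho, of i] by fastforce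
  have "openR D'" unfolding openR_def
  proof (intro conjI allI impI RF)
    fix z assume "inO D' z"
    then have z: "isR z" "\<not> ?P z" using pos by (simp_all add: inO_def)
    \<comment> \<open>A point off the image is either the image of a sequence outside
      \<open>D\<close>, which has a neighbourhood free of members of \<open>D\<close>, or it has a
      positive distance from the image of its digits, and then from the images of all sequences that
      share enough of these digits.\<close>
    have "\<exists>i. \<forall>g. inD D g \<longrightarrow> agree (?dig z) g i \<longrightarrow> (\<exists>k. \<bar>V z - V (?sm g)\<bar> > cst (rp ?\<rho> k / 16) \<and> k \<le> i)"
    proof (cases "seqeqR z (?sm (?dig z))")
      case True
      then have "\<not> inD D (?dig z)" using z(2) by (simp add: inD_def)
      then obtain i where "\<And>g. cantor g \<Longrightarrow> agree (?dig z) g i \<Longrightarrow> \<not> inD D g" using D(2) cantor_dig unfolding closedD_def by blast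
      then show ?thesis unfolding inD_def by blast
    next
      case False
      then obtain n where n: "Pw n < \<bar>V z - V (?sm (?dig z))\<bar>" using seqeqR_iff[OF z(1) R] by (auto simp: not_le)
      obtain i where i: "rp ?\<rho> i < pw (n + 1)" using ex_rp_less[OF rho, of "pw (n + 1)"] by auto
      then have i': "cst (rp ?\<rho> i) < Pw (n + 1)" by (simp only: cst_simps(11))
      have "cst (rp ?\<rho> i / 16) < \<bar>V z - V (?sm g)\<bar>" if g: "agree (?dig z) g i" for g
      proof -
        have "rp ?\<rho> i / 16 < pw (n + 1)" using rp_pos[OF rho, of i] i by linarith
        then have "cst (rp ?\<rho> i / 16) < Pw (n + 1)" by (simp only: cst_simps(11))
        then show ?thesis using agree_sm[OF rho g] n i' Pw_Suc[of n] by linarith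
      qed
      then show ?thesis by blast
    qed
    then obtain i where i: "\<And>g. inD D g \<Longrightarrow> agree (?dig z) g i \<Longrightarrow> \<exists>k. \<bar>V z - V (?sm g)\<bar> > cst (rp ?\<rho> k / 16) \<and> k \<le> i" by blast
    obtain r where r: "rv r = rp ?\<rho> i / 32" "0 < rv r" using exr by blast
    have "inO D' y" if y: "isR y" "near z y r" for y
    proof (rule ccontr)
      assume "\<not> inO D' y"
      then have "?P y" using y(1) pos by (simp add: inO_def)
      then obtain g where g: "inD D g" "seqeqR y (?sm g)" using P_iff[OF y(1)] by blast
      then have gc: "cantor g" by (simp add: inD_def)
      obtain k where k: "\<bar>V z - V (?sm g)\<bar> > cst (rp ?\<rho> k / 16)" "k \<le> i" using i[OF g(1) mono[OF sep[OF z(1) y r(1) gc g(2)]]] by blast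
      obtain l where l: "pw l < rp ?\<rho> i / 32" using archimedean[of "rp ?\<rho> i / 32"] r by auto
      then have "Pw l < cst (rp ?\<rho> i / 32)" by (simp only: cst_simps(11))
      moreover have "\<bar>V y - V (?sm g)\<bar> \<le> Pw l" using g(2) seqeqR_iff[OF y(1) R] by blast
      moreover have "\<bar>V z - V y\<bar> < cst (rp ?\<rho> i / 32)" using nearD[OF z(1) y] r by simp
      moreover have "cst (rp ?\<rho> i / 16) = (cst (rp ?\<rho> i / 32) + cst (rp ?\<rho> i / 32) :: ('n, 'n zz fract) upower)" by simp
      moreover have "rp ?\<rho> i / 16 \<le> rp ?\<rho> k / 16" using rp_le[OF rho k(2)] by simp
      then have "cst (rp ?\<rho> i / 16) \<le> (cst (rp ?\<rho> k / 16) :: ('n, 'n zz fract) upower)" by (simp only: cst_simps(9))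
      ultimately show False using k(1) by linarith
    qed
    then show "\<exists>r. 0 < rv r \<and> (\<forall>y. isR y \<and> near z y r \<longrightarrow> inO D' y)" using r by blast
  qed
  moreover have "unitR z" if z: "inC D' z" for z
    unfolding unitR_iff
  proof (intro conjI allI)
    show zR: "isR z" using z inC' by blast
    fix n
    have "\<bar>V z - V (?sm (?dig z))\<bar> \<le> Pw (n + 1)" using z inC' seqeqR_iff[OF zR R] by blast
    moreover have "0 \<le> V (?sm (?dig z))" "V (?sm (?dig z)) \<le> 1" using sm_bounds[OF rho, of "?dig z" 0] by (simp_all add: bs rp)
    moreover have "0 < Pw (n + 1)" "Pw n = 2 * Pw (n + 1)" by (simp_all add: pw_Suc)
    ultimately show "- Pw n < V z" "V z < 1 + Pw n" by linarith+
  qed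
  ultimately have "closedU D'" unfolding closedU_def by blast
  moreover have "contC D' F'" unfolding contC_def
  proof (intro allI impI)
    fix z e assume z: "inC D' z" and e: "0 < rv e"
    have "inD D (?dig z)" using z inC' cantor_dig by (simp add: inD_def)
    then obtain n where n: "\<And>g. inD D g \<Longrightarrow> agree (?dig z) g n \<Longrightarrow> F (?dig z) = F g" using D(3) unfolding contD_def by blast
    obtain r where r: "rv r = rp ?\<rho> n / 32" "0 < rv r" using exr by blast
    have "near (F' z) (F' y) e" if y: "inC D' y" "near z y r" for y
    proof -
      have y': "isR z" "isR y" "?P y" "?P z" using y z inC' by blast+
      have "agree (?dig z) (?dig y) (n + 1)" by (rule sep[OF y'(1,2) y(2) r(1) cantor_dig]) (use y' in blast)
      then have "F (?dig z) = F (?dig y)" using n[OF _ mono] y' cantor_dig by (simp add: inD_def)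
      then have "F' y = F' z" unfolding F'_def using y' by simp
      then show ?thesis using nearI[OF FR FR, of z z 0 e] e by simp
    qed
    then show "\<exists>d. 0 < rv d \<and> (\<forall>y. inC D' y \<and> near z y d \<longrightarrow> near (F' z) (F' y) e)" using r by blast
  qed
  ultimately have "ucontC D' F'" using assms(2) dD' dF' RF unfolding sem_Real_uniform_def contCU_def by blast
  then obtain d where d: "0 < rv d" "\<And>x y. inC D' x \<Longrightarrow> inC D' y \<Longrightarrow> near x y d \<Longrightarrow> near (F' x) (F' y) c1"
    unfolding ucontC_def using c1 by (metis zero_less_one)
  obtain n where n: "rp ?\<rho> n < rv d" using ex_rp_less[OF rho d(1)] by blast
  have "F f = F g" if fg: "inD D f" "inD D g" "agree f g n" for f g
  proof -
    have dg: "?dig (?sm h) = h" "?P (?sm h)" if "inD D h" for h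
      using eq_dig[OF R _ refl] P_iff[OF R, of h] that refl by (auto simp: inD_def)
    have "near (?sm f) (?sm g) d" by (rule nearI[OF R R agree_sm[OF rho fg(3)] n])
    then have "near (F' (?sm f)) (F' (?sm g)) c1" using d(2) inC' R dg(2) fg by blast
    then have "\<bar>V (F' (?sm f)) - V (F' (?sm g))\<bar> < cst 1" using nearD[OF FR FR] c1 by metis
    moreover have "V (F' (?sm h)) = cst (qn (F h))" if "inD D h" for h unfolding VF using dg[OF that] by simp
    ultimately have "cst \<bar>qn (F f) - qn (F g)\<bar> < (cst 1 :: ('n, 'n zz fract) upower)" using fg by simp
    then have "\<bar>qn (F f) - qn (F g)\<bar> < 1" by (simp only: cst_simps(11))
    then have "qn (F f) < qn (F g + 1)" "qn (F g) < qn (F f + 1)" by simp_all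
    then show ?thesis by (metis antisym less_Suc qn_simps(7))
  qed
  then show "\<exists>n. \<forall>f g. inD D f \<and> inD D g \<and> agree f g n \<longrightarrow> F f = F g" by blast
qed

end

lemma (in cover) Real_uniform_imp_subcover: "sem_Real_uniform \<Longrightarrow> finite_subcover"
  using Real_uniform_imp_subcover_continuous Real_uniform_imp_Cantor_uniform Cantor_uniform_imp_bounded
    Cantor_bounded_imp_subcover by blast

section \<open>Evaluation of primitive recursive terms\<close>

declare bracket.simps [simp del] fvt_bracket [simp]

lemma fvt_empty_idxt: "fvt t = {} \<Longrightarrow> idxt t = 0" by (induction t) auto
lemma fvt_empty_sub: "fvt t = {} \<Longrightarrow> sub e t = t" using sub_cong[of t e "\<lambda>(x, \<sigma>). Var x \<sigma>"] by (simp add: sub_Var)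

lemma Var_Dom [simp]: "Var x \<sigma> \<in> Dom \<tau> \<longleftrightarrow> \<sigma> = \<tau>" by (simp add: Dom_def)

lemma sub_Dom [simp]: "typed e \<Longrightarrow> t \<in> Dom \<sigma> \<Longrightarrow> sub e t \<in> Dom \<sigma>" by (auto simp: Dom_def wt_sub)

lemma Dom_N: "t \<in> Dom N \<Longrightarrow> wt t" "t \<in> Dom N \<Longrightarrow> ty_of t = N" by (simp_all add: Dom_def)

lemma bracket_Dom [simp]: "t \<in> Dom \<tau> \<Longrightarrow> bracket x \<sigma> t \<in> Dom (\<sigma> \<rightarrow> \<tau>)" using bracket_wt[of t x \<sigma>] by (simp add: Dom_def)

lemma lam_Dom: "(\<And>x. F (Var x \<sigma>) \<in> Dom \<tau>) \<Longrightarrow> lam \<sigma> F \<in> Dom (\<sigma> \<rightarrow> \<tau>)"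
  by (simp add: lam_def Let_def)

lemma fvt_lam: "(\<And>x. fvt (F (Var x \<sigma>)) \<subseteq> insert (x, \<sigma>) A) \<Longrightarrow> fvt (lam \<sigma> F) \<subseteq> A"
  by (auto simp: lam_def Let_def fvt_bracket)

lemma closed_terms [simp]:
  "fvt prd = {}" "fvt monus = {}" "fvt pow2 = {}" "fvt sqr = {}" "fvt left = {}" "fvt right = {}"
proof -
  show prd: "fvt prd = {}"
    unfolding prd_def subset_empty[symmetric] by (intro fvt_lam, simp, intro fvt_lam, simp)
  show monus: "fvt monus = {}"
    unfolding monus_def subset_empty[symmetric] by (intro fvt_lam, simp add: prd, intro fvt_lam, simp add: prd)
  show "fvt pow2 = {}"
    unfolding pow2_def subset_empty[symmetric] by (intro fvt_lam, simp, intro fvt_lam, simp)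
  show sqr: "fvt sqr = {}"
    unfolding sqr_def subset_empty[symmetric] by (intro fvt_lam, simp add: monus, intro fvt_lam, simp add: monus)
  show left: "fvt left = {}"
    unfolding left_def subset_empty[symmetric] by (intro fvt_lam, simp add: monus sqr)
  show "fvt right = {}"
    unfolding right_def subset_empty[symmetric] by (intro fvt_lam, simp add: monus sqr left)
qed

lemmas closed_idxt [simp] = closed_terms[THEN fvt_empty_idxt]
lemmas closed_sub [simp] = closed_terms[THEN fvt_empty_sub]

lemma app_Dom_N [simp]: "f \<in> Dom T1 \<Longrightarrow> s \<in> Dom N \<Longrightarrow> f \<cdot> s \<in> Dom N"
  and app_Dom_T1 [simp]: "f \<in> Dom T2 \<Longrightarrow> x \<in> Dom T1 \<Longrightarrow> f \<cdot> x \<in> Dom N"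
  and app_Dom_NT [simp]: "f \<in> Dom (N \<rightarrow> T1) \<Longrightarrow> s \<in> Dom N \<Longrightarrow> f \<cdot> s \<in> Dom T1"
  and app_Dom_T1T [simp]: "f \<in> Dom (T1 \<rightarrow> T1) \<Longrightarrow> x \<in> Dom T1 \<Longrightarrow> f \<cdot> x \<in> Dom T1"
  by (rule app_Dom; assumption)+

lemma Rec_Dom [simp]: "f \<in> Dom (N \<rightarrow> T1) \<Longrightarrow> z \<in> Dom N \<Longrightarrow> Con Rec \<cdot> f \<cdot> z \<in> Dom T1" by (simp add: Dom_def)

lemma closed_Dom [simp]:
  "prd \<in> Dom T1" "monus \<in> Dom (N \<rightarrow> T1)" "pow2 \<in> Dom T1" "sqr \<in> Dom T1" "left \<in> Dom T1" "right \<in> Dom T1"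
proof -
  show prd: "prd \<in> Dom T1" unfolding prd_def by (intro lam_Dom app_Dom_N Rec_Dom) simp_all
  show monus: "monus \<in> Dom (N \<rightarrow> T1)" unfolding monus_def by (intro lam_Dom app_Dom_N Rec_Dom prd) simp_all
  show "pow2 \<in> Dom T1" unfolding pow2_def by (intro lam_Dom app_Dom_N Rec_Dom plus_Dom) simp_all
  have mon: "s \<in> Dom N \<Longrightarrow> t \<in> Dom N \<Longrightarrow> s \<^bold>- t \<in> Dom N" for s t using monus by simp
  show sqr: "sqr \<in> Dom T1" unfolding sqr_def
    by (intro lam_Dom app_Dom_N[of "Con Rec \<cdot> f \<cdot> z" for f z] Rec_Dom plus_Dom times_Dom mon) simp_all
  have sqr': "s \<in> Dom N \<Longrightarrow> sqr \<cdot> s \<in> Dom N" for s using sqr by simp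
  show left: "left \<in> Dom T1" unfolding left_def by (intro lam_Dom times_Dom mon sqr') simp_all
  show "right \<in> Dom T1" unfolding right_def using left by (intro lam_Dom mon sqr' app_Dom_N[of left]) simp_all
qed

context countermodel
begin

lemma eqv_num: "s \<in> Dom N \<Longrightarrow> t \<in> Dom N \<Longrightarrow> eqv \<Gamma>\<^sub>0 N s t \<Longrightarrow> num s = num t" by (simp add: num_eq_iff)

lemma num_lam:
  assumes "typed e" "s \<in> Dom N" "\<And>x. F (Var x N) \<in> Dom N" "\<And>x. num (sub (upd e x N s) (F (Var x N))) = a"
  shows "num (sub e (lam N F) \<cdot> s) = a"
  using assms(3) by (simp add: lam_def Let_def num_bracket[OF assms(1,2)] Dom_def assms(4))

lemma num_lam2:
  assumes "typed e" "s \<in> Dom N" "t \<in> Dom N" "\<And>x y. F (Var x N) (Var y N) \<in> Dom N"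
    and "\<And>x y. idxt (F (Var x N) (Var 0 N)) \<le> y \<Longrightarrow> num (sub (upd (upd e x N s) y N t) (F (Var x N) (Var y N))) = a"
  shows "num (sub e (lam N (\<lambda>m. lam N (F m))) \<cdot> s \<cdot> t) = a"
proof -
  obtain x where x: "lam N (\<lambda>m. lam N (F m)) = bracket x N (bracket (idxt (F (Var x N) (Var 0 N))) N (F (Var x N) (Var (idxt (F (Var x N) (Var 0 N))) N)))"
    unfolding lam_def Let_def by blast
  show ?thesis unfolding x using assms(4) by (simp add: num_bracket2[OF assms(1-3)] Dom_def assms(5))
qed

text \<open>Packages a use of the recursor as a function on numbers, definable so that induction can
  be applied to it.\<close>

lemma ex_rec:
  assumes "f \<in> Dom (N \<rightarrow> T1)" "z \<in> Dom N" "\<And>s t. s \<in> Dom N \<Longrightarrow> t \<in> Dom N \<Longrightarrow> num (f \<cdot> s \<cdot> t) = S (num s) (num t)"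
  shows "\<exists>r. definable r \<and> r 0 = num z \<and> (\<forall>n. r (n + 1) = S n (r n)) \<and> (\<forall>s\<in>Dom N. num (Con Rec \<cdot> f \<cdot> z \<cdot> s) = r (num s))"
proof -
  let ?g = "Con Rec \<cdot> f \<cdot> z" and ?r = "\<lambda>n. num (Con Rec \<cdot> f \<cdot> z \<cdot> term_of n)"
  have g: "?g \<in> Dom T1" using assms by simp
  have eq: "num (?g \<cdot> s) = ?r (num s)" if "s \<in> Dom N" for s using num_cong[OF g that term_of(1)] term_of by simp
  then have "definable ?r" unfolding definable_def using g by blast
  moreover have "?r 0 = num z" using eq[of "\<^bold>0"] num_Rec(1)[OF assms(1,2)] by simp
  moreover have "?r (n + 1) = S n (?r n)" for n
    using eq[of "term_of n \<^bold>+ \<^bold>1"] num_Rec(2)[OF assms(1,2) term_of(1)[of n]] assms(3)[OF term_of(1)[of n], of "?g \<cdot> term_of n"] g term_of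
    by simp
  ultimately show ?thesis using eq by (intro exI[of _ ?r]) blast
qed

lemma mnat_zero_minus [simp]: "0 - a = (0 :: mnat)"
proof (cases "a = 0")
  case False
  then have "\<nexists>d. 0 = a + d" using mnat_zero_sum[of a] by metis
  then show ?thesis by (simp add: minus_mnat_def)
next
  case True
  then show ?thesis using add_diff_cancel_left'[of "0 :: mnat" 0] by simp
qed

lemma mnat_minus_le: "a \<le> b \<longleftrightarrow> a - b = (0 :: mnat)"
proof
  assume "a \<le> b"
  then obtain d where "b = a + d" unfolding less_eq_mnat_def by blast
  then show "a - b = 0" by (simp flip: diff_diff_add)
next
  assume *: "a - b = 0"
  show "a \<le> b"
  proof (rule ccontr)
    assume "\<not> a \<le> b"
    then have "a - b + b = a" by (intro le_add_diff_inverse2) simp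
    then show False using * \<open>\<not> a \<le> b\<close> by simp
  qed
qed

lemma num_prd [simp]: "s \<in> Dom N \<Longrightarrow> num (prd \<cdot> s) = num s - 1"
proof -
  assume s: "s \<in> Dom N"
  have "num (sub VV prd \<cdot> s) = num s - 1" unfolding prd_def
  proof (rule num_lam[OF typed_Var s])
    let ?K = "lam N (\<lambda>k. lam N (\<lambda>v. k))"
    have K: "?K \<in> Dom (N \<rightarrow> T1)" by (intro lam_Dom) simp
    then show "Con Rec \<cdot> ?K \<cdot> \<^bold>0 \<cdot> Var x N \<in> Dom N" for x by simp
    fix x
    let ?e = "upd VV x N s"
    have e: "typed ?e" using s by simp
    have "num (sub ?e ?K \<cdot> p \<cdot> q) = num p" if "p \<in> Dom N" "q \<in> Dom N" for p q
      by (rule num_lam2[OF e that]) auto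
    from ex_rec[OF sub_Dom[OF e K] _ this, of "\<^bold>0"] obtain r where r: "r 0 = 0" "\<And>n. r (n + 1) = n"
      "\<forall>s\<in>Dom N. num (Con Rec \<cdot> sub ?e ?K \<cdot> \<^bold>0 \<cdot> s) = r (num s)" by auto
    then show "num (sub ?e (Con Rec \<cdot> ?K \<cdot> \<^bold>0 \<cdot> Var x N)) = num s - 1"
      using s mnat_cases[of "num s"] by auto
  qed
  then show ?thesis by simp
qed

text \<open>Subtraction on \<open>mnat\<close> is defined by choosing a difference. It has to be
  shown definable before an induction can compare it with the recursion;
  \<open>num_linear_strong\<close> supplies that.\<close>

lemma num_monus [simp]:
  assumes s: "s \<in> Dom N" and t: "t \<in> Dom N"
  shows "num (s \<^bold>- t) = num s - num t"
proof -
  have "num (sub VV monus \<cdot> s \<cdot> t) = num s - num t" unfolding monus_def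
  proof (rule num_lam2[OF typed_Var s t])
    let ?K = "lam N (\<lambda>k. lam N (\<lambda>v. prd \<cdot> v))"
    have K: "?K \<in> Dom (N \<rightarrow> T1)" by (intro lam_Dom) simp
    then show "Con Rec \<cdot> ?K \<cdot> Var x N \<cdot> Var y N \<in> Dom N" for x y by simp
    fix x y
    assume y: "idxt (Con Rec \<cdot> ?K \<cdot> Var x N \<cdot> Var 0 N) \<le> y"
    let ?e = "upd (upd VV x N s) y N t"
    have e: "typed ?e" using s t by simp
    have "num (sub ?e ?K \<cdot> p \<cdot> q) = num q - 1" if "p \<in> Dom N" "q \<in> Dom N" for p q
      by (rule num_lam2[OF e that]) (use that in auto)
    from ex_rec[OF sub_Dom[OF e K] s this] obtain r where r: "definable r" "r 0 = num s" "\<And>n. r (n + 1) = r n - 1"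
      "\<forall>t\<in>Dom N. num (Con Rec \<cdot> sub ?e ?K \<cdot> s \<cdot> t) = r (num t)" by auto
    obtain m d where m: "definable m" "\<And>b. b + m b = num s + d b" "\<And>b. m b = 0 \<or> d b = 0" using num_linear_strong by metis
    have m': "m b = num s - b" for b
    proof (cases "m b = 0")
      case True
      then have "num s \<le> b" using m(2)[of b] unfolding less_eq_mnat_def by auto
      then show ?thesis using True mnat_minus_le by simp
    next
      case False
      then have "b + m b = num s" using m(2,3)[of b] by auto
      then show ?thesis using add_diff_cancel_left'[of b "m b"] by simp
    qed
    have "r n = num s - n" for n
    proof (induction n rule: num_induct)
      show "decidable (\<lambda>n. r n = num s - n)" using m(1) r(1) unfolding m' by (intro decidable_eq) (simp_all add: m'[abs_def])
      show "r 0 = num s - 0" using add_diff_cancel_left'[of 0 "num s"] r by simp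
    qed (simp add: r diff_diff_add)
    then show "num (sub ?e (Con Rec \<cdot> ?K \<cdot> Var x N \<cdot> Var y N)) = num s - num t"
      using y r t by auto
  qed
  then show ?thesis by simp
qed

definition sq2 :: "mnat \<Rightarrow> mnat" where "sq2 n = num (sqr \<cdot> term_of n)"
definition lf :: "mnat \<Rightarrow> mnat" where "lf n = n - sq2 n * sq2 n"
definition rg :: "mnat \<Rightarrow> mnat" where "rg n = sq2 n - lf n"
definition p2 :: "mnat \<Rightarrow> mnat" where "p2 n = num (pow2 \<cdot> term_of n)"

lemma num_sqr: "s \<in> Dom N \<Longrightarrow> num (sqr \<cdot> s) = sq2 (num s)"
  unfolding sq2_def by (rule num_cong) (simp_all add: term_of)
lemma num_pow2 [simp]: "s \<in> Dom N \<Longrightarrow> num (pow2 \<cdot> s) = p2 (num s)"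
  unfolding p2_def by (rule num_cong) (simp_all add: term_of)
lemma num_left [simp]: "s \<in> Dom N \<Longrightarrow> num (left \<cdot> s) = lf (num s)"
proof -
  assume s: "s \<in> Dom N"
  have "num (sub VV left \<cdot> s) = lf (num s)" unfolding left_def
    by (rule num_lam[OF typed_Var s]) (use s in \<open>simp_all add: lf_def num_sqr\<close>)
  then show ?thesis by simp
qed
lemma num_right [simp]: "s \<in> Dom N \<Longrightarrow> num (right \<cdot> s) = rg (num s)"
proof -
  assume s: "s \<in> Dom N"
  have "num (sub VV right \<cdot> s) = rg (num s)" unfolding right_def
    by (rule num_lam[OF typed_Var s]) (use s in \<open>simp_all add: rg_def num_sqr\<close>)
  then show ?thesis by simp
qed

lemma p2_rec: "p2 0 = 1" "p2 (n + 1) = p2 n + p2 n"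
proof -
  let ?K = "lam N (\<lambda>k. lam N (\<lambda>v. v \<^bold>+ v))"
  have K: "?K \<in> Dom (N \<rightarrow> T1)" by (intro lam_Dom) simp
  have "num (sub VV ?K \<cdot> p \<cdot> q) = num q + num q" if "p \<in> Dom N" "q \<in> Dom N" for p q
    by (rule num_lam2[OF typed_Var that]) (use that in auto)
  from ex_rec[OF sub_Dom[OF typed_Var K] _ this, of "\<^bold>1"] obtain r where r: "r 0 = 1" "\<And>n. r (n + 1) = r n + r n"
    "\<forall>s\<in>Dom N. num (Con Rec \<cdot> sub VV ?K \<cdot> \<^bold>1 \<cdot> s) = r (num s)" by auto
  have fK: "fvt ?K = {}" unfolding subset_empty[symmetric] by (intro fvt_lam) simp
  have "num (pow2 \<cdot> s) = r (num s)" if s: "s \<in> Dom N" for s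
  proof -
    have "num (sub VV pow2 \<cdot> s) = r (num s)" unfolding pow2_def
      by (rule num_lam[OF typed_Var s]) (use s K r(3) in \<open>auto simp: fvt_empty_sub[OF fK]\<close>)
    then show ?thesis by simp
  qed
  from this[OF term_of(1)] have "p2 n = r n" for n unfolding p2_def by (simp add: term_of)
  then show "p2 0 = 1" "p2 (n + 1) = p2 n + p2 n" using r by simp_all
qed

lemma mnat_less_Suc: "a < b + 1 \<longleftrightarrow> a \<le> (b :: mnat)"
  using mnat_discrete[of b a] by (metis leD le_less_trans less_add_one not_le)

lemma mnat_Suc_le: "a + 1 \<le> b \<longleftrightarrow> a < (b :: mnat)"
  using mnat_discrete[of a b] less_le_trans[OF less_add_one[of a], of b] by blast

lemma definable_minus: "definable G \<Longrightarrow> definable H \<Longrightarrow> definable (\<lambda>n. G n - H n)"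
proof -
  assume "definable G" "definable H"
  then obtain g h where *: "g \<in> Dom T1" "h \<in> Dom T1" "\<forall>s\<in>Dom N. num (g \<cdot> s) = G (num s)" "\<forall>s\<in>Dom N. num (h \<cdot> s) = H (num s)"
    unfolding definable_def by blast
  then show ?thesis
    by (intro definable_term[of "upd (env 1 T1 g) 2 T1 h" "Var 1 T1 \<cdot> Var 0 N \<^bold>- Var 2 T1 \<cdot> Var 0 N" 0])
      (auto simp: closed_Dom(2)[unfolded Dom_def, simplified])
qed

lemma sq2_spec: "sq2 n * sq2 n \<le> n \<and> n < (sq2 n + 1) * (sq2 n + 1)"
proof -
  let ?G = "\<lambda>k v. v \<^bold>+ (\<^bold>1 \<^bold>- ((v \<^bold>+ \<^bold>1) \<^bold>* (v \<^bold>+ \<^bold>1) \<^bold>- (k \<^bold>+ \<^bold>1)))"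
  let ?K = "lam N (\<lambda>k. lam N (?G k))"
  have G: "?G (Var x N) (Var y N) \<in> Dom N" for x y by simp
  have K: "?K \<in> Dom (N \<rightarrow> T1)" by (intro lam_Dom G)
  have "num (sub VV ?K \<cdot> p \<cdot> q) = num q + (1 - ((num q + 1) * (num q + 1) - (num p + 1)))" if "p \<in> Dom N" "q \<in> Dom N" for p q
    by (rule num_lam2[OF typed_Var that]) (use that G in auto)
  from ex_rec[OF sub_Dom[OF typed_Var K] _ this, of "\<^bold>0"] obtain r where r: "definable r" "r 0 = 0"
    "\<And>n. r (n + 1) = r n + (1 - ((r n + 1) * (r n + 1) - (n + 1)))"
    "\<forall>s\<in>Dom N. num (Con Rec \<cdot> sub VV ?K \<cdot> \<^bold>0 \<cdot> s) = r (num s)" by auto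
  have fK: "fvt ?K = {}" unfolding subset_empty[symmetric] by (intro fvt_lam) simp
  have *: "num (sqr \<cdot> s) = r (num s)" if s: "s \<in> Dom N" for s
  proof -
    have "num (sub VV sqr \<cdot> s) = r (num s)" unfolding sqr_def
      by (rule num_lam[OF typed_Var s]) (use s K r(4) in \<open>auto simp: fvt_empty_sub[OF fK]\<close>)
    then show ?thesis by simp
  qed
  from this[OF term_of(1)] have eq: "sq2 n = r n" for n unfolding sq2_def by (simp add: term_of)
  have "r n * r n \<le> n \<and> n < (r n + 1) * (r n + 1)"
  proof (induction n rule: num_induct)
    show "decidable (\<lambda>n. r n * r n \<le> n \<and> n < (r n + 1) * (r n + 1))"
      unfolding mnat_Suc_le[symmetric] mnat_minus_le
      by (intro decidable_and decidable_eq definable_minus definable_plus definable_times r(1) definable_id definable_const)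
  next
    show "r 0 * r 0 \<le> 0 \<and> 0 < (r 0 + 1) * (r 0 + 1)" by (simp add: r)
  next
    fix n assume IH: "r n * r n \<le> n \<and> n < (r n + 1) * (r n + 1)"
    let ?v = "r n + 1"
    show "r (n + 1) * r (n + 1) \<le> n + 1 \<and> n + 1 < (r (n + 1) + 1) * (r (n + 1) + 1)"
    proof (cases "?v * ?v \<le> n + 1")
      case True
      then have "n + 1 = ?v * ?v" using IH mnat_Suc_le[of n "?v * ?v"] by simp
      moreover have "r (n + 1) = ?v" using True mnat_minus_le[of "?v * ?v" "n + 1"] add_diff_cancel_left'[of "0 :: mnat" 1] by (simp add: r)
      moreover have "?v * ?v < (?v + 1) * (?v + 1)"
        by (rule mult_strict_mono) (simp_all add: mnat_nonneg add_nonneg_pos mnat_less_Suc)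
      ultimately show ?thesis by simp
    next
      case False
      then have "?v * ?v - (n + 1) \<noteq> 0" using mnat_minus_le by blast
      then obtain d where "?v * ?v - (n + 1) = d + 1" using mnat_cases by blast
      then have "r (n + 1) = r n" using mnat_minus_le[of 1 "d + 1"] mnat_nonneg[of d] by (simp add: r)
      moreover have "r n * r n \<le> n + 1" using IH less_imp_le[OF less_add_one[of n]] by (blast intro: order_trans)
      ultimately show ?thesis using False by (simp only: not_le)
    qed
  qed
  then show ?thesis unfolding eq .
qed

text \<open>\<open>pair a b\<close> exceeds the square of \<open>a + b\<close> by \<open>a\<close>
  only and thus stays below the next square; hence the root recovers \<open>a + b\<close>, and from
  it both projections.\<close>

lemma sq2_pair: "sq2 (pair a b) = a + b"
proof -
  let ?n = "pair a b" and ?v = "sq2 (pair a b)" and ?w = "a + b"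
  have w: "?w * ?w \<le> ?n" "?n < (?w + 1) * (?w + 1)"
  proof -
    show "?w * ?w \<le> ?n" unfolding pair_def by (simp add: mnat_nonneg)
    have "(?w + 1) * (?w + 1) = ?n + (b + (a + b) + 1)" by (simp add: pair_def algebra_simps)
    also have "?n + 0 < \<dots>" by (intro add_strict_left_mono) (simp add: mnat_less_Suc mnat_nonneg)
    finally show "?n < (?w + 1) * (?w + 1)" by simp
  qed
  note v = sq2_spec[of ?n]
  have "\<not> ?v < ?w"
  proof
    assume "?v < ?w"
    then have "(?v + 1) * (?v + 1) \<le> ?w * ?w" by (intro mult_mono) (simp_all add: mnat_Suc_le mnat_nonneg)
    then show False using v w by (meson leD le_less_trans less_le_trans)
  qed
  moreover have "\<not> ?w < ?v"
  proof
    assume "?w < ?v"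
    then have "(?w + 1) * (?w + 1) \<le> ?v * ?v" by (intro mult_mono) (simp_all add: mnat_Suc_le mnat_nonneg)
    then show False using v w by (meson leD le_less_trans less_le_trans)
  qed
  ultimately show ?thesis by simp
qed

lemma lf_pair: "lf (pair a b) = a" and rg_pair: "rg (pair a b) = b"
proof -
  show "lf (pair a b) = a" unfolding lf_def sq2_pair using add_diff_cancel_left'[of "(a + b) * (a + b)" a] by (simp add: pair_def)
  then show "rg (pair a b) = b" unfolding rg_def sq2_pair by simp
qed

end

section \<open>The countermodel as a model of recursive comprehension\<close>

text \<open>Type-1 objects of the countermodel up to extensional equality.\<close>

typedef fn1 = "{g :: mnat \<Rightarrow> mnat. good \<longrightarrow> countermodel.definable g}"
proof (intro exI[of _ "\<lambda>_. 0"] CollectI impI)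
  assume good
  then interpret countermodel by unfold_locales (simp add: good_def)
  show "definable (\<lambda>_. 0)" by (rule definable_const)
qed

notation Rep_fn1 (infixl "$" 900)

context countermodel
begin

lemma fn1_ext: "(\<And>n. x $ n = y $ n) \<Longrightarrow> x = y" by (simp add: Rep_fn1_inject[symmetric] fun_eq_iff)

lemma Abs_fn1: "definable g \<Longrightarrow> Abs_fn1 g $ n = g n" by (simp add: Abs_fn1_inverse)

definition obj :: "tm \<Rightarrow> fn1" where "obj t = Abs_fn1 (\<lambda>n. num (t \<cdot> term_of n))"

lemma obj [simp]: "t \<in> Dom T1 \<Longrightarrow> s \<in> Dom N \<Longrightarrow> obj t $ num s = num (t \<cdot> s)"
proof -
  assume t: "t \<in> Dom T1" and s: "s \<in> Dom N"
  have eq: "num (t \<cdot> term_of (num s)) = num (t \<cdot> s)" if "s \<in> Dom N" for s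
    by (rule num_cong) (use t that term_of in auto)
  then have "definable (\<lambda>n. num (t \<cdot> term_of n))" unfolding definable_def using t by (intro bexI[of _ t]) simp_all
  then show ?thesis using eq[OF s] by (simp add: obj_def Abs_fn1)
qed

lemma obj_eqI: "t \<in> Dom T1 \<Longrightarrow> (\<And>s. s \<in> Dom N \<Longrightarrow> num (t \<cdot> s) = x $ num s) \<Longrightarrow> obj t = x"
  by (rule fn1_ext) (metis obj term_of)

lemma obj_cong: "s \<in> Dom T1 \<Longrightarrow> t \<in> Dom T1 \<Longrightarrow> obj s = obj t \<longleftrightarrow> eqv \<Gamma>\<^sub>0 T1 s t"
proof
  assume *: "s \<in> Dom T1" "t \<in> Dom T1" "obj s = obj t"
  then have "num (s \<cdot> u) = num (t \<cdot> u)" if "u \<in> Dom N" for u using that by (metis obj)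
  then show "eqv \<Gamma>\<^sub>0 T1 s t" using * by (auto simp: num_eq_iff)
qed (auto intro!: obj_eqI simp: num_eq_iff)

definition rep :: "fn1 \<Rightarrow> tm" where "rep x = (SOME t. t \<in> Dom T1 \<and> obj t = x)"

lemma rep [simp]: "rep x \<in> Dom T1" "obj (rep x) = x"
proof -
  have "definable (Rep_fn1 x)" using Rep_fn1[of x] good by simp
  then obtain t where "t \<in> Dom T1" "\<forall>s\<in>Dom N. num (t \<cdot> s) = x $ num s" unfolding definable_def by blast
  then have "\<exists>t. t \<in> Dom T1 \<and> obj t = x" using obj_eqI by blast
  then have "rep x \<in> Dom T1 \<and> obj (rep x) = x" unfolding rep_def by (rule someI_ex)
  then show "rep x \<in> Dom T1" "obj (rep x) = x" by auto
qed

text \<open>Terms act on classes through a chosen representative; extensionality makes the value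
  independent of it.\<close>

definition fn2 :: "tm \<Rightarrow> fn1 \<Rightarrow> mnat" where "fn2 t x = num (t \<cdot> rep x)"
definition fn11 :: "tm \<Rightarrow> fn1 \<Rightarrow> fn1" where "fn11 t x = obj (t \<cdot> rep x)"
definition fn01 :: "tm \<Rightarrow> mnat \<Rightarrow> fn1" where "fn01 t n = obj (t \<cdot> term_of n)"

lemma fn2: "t \<in> Dom T2 \<Longrightarrow> s \<in> Dom T1 \<Longrightarrow> num (t \<cdot> s) = fn2 t (obj s)"
  unfolding fn2_def by (rule num_app[where \<sigma> = T1]) (simp_all add: eqv_refl obj_cong[symmetric] del: eqv.simps)

lemma fn11: "t \<in> Dom (T1 \<rightarrow> T1) \<Longrightarrow> s \<in> Dom T1 \<Longrightarrow> obj (t \<cdot> s) = fn11 t (obj s)"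
  unfolding fn11_def using extensionality[of s T1 "rep (obj s)" t T1] by (simp add: obj_cong[symmetric] del: eqv.simps)

lemma fn01: "t \<in> Dom (N \<rightarrow> T1) \<Longrightarrow> s \<in> Dom N \<Longrightarrow> obj (t \<cdot> s) = fn01 t (num s)"
  unfolding fn01_def using extensionality[of s N "term_of (num s)" t T1] by (simp add: obj_cong num_eq_iff[symmetric] term_of del: eqv.simps(2))

definition dfn :: "(fn1 \<Rightarrow> mnat) \<Rightarrow> bool" where "dfn \<Phi> \<longleftrightarrow> (\<exists>t\<in>Dom T2. \<Phi> = fn2 t)"
definition dm :: "(fn1 \<Rightarrow> fn1) \<Rightarrow> bool" where "dm A \<longleftrightarrow> (\<exists>t\<in>Dom (T1 \<rightarrow> T1). A = fn11 t)"

lemma dfnE: "dfn \<Phi> \<Longrightarrow> \<exists>t\<in>Dom T2. \<forall>s\<in>Dom T1. num (t \<cdot> s) = \<Phi> (obj s)"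
  using fn2 unfolding dfn_def by blast

lemma dmE:
  assumes "dm A"
  shows "\<exists>t\<in>Dom (T1 \<rightarrow> T1). (\<forall>s\<in>Dom T1. obj (t \<cdot> s) = A (obj s)) \<and>
    (\<forall>s\<in>Dom T1. \<forall>n\<in>Dom N. num (t \<cdot> s \<cdot> n) = A (obj s) $ num n)"
proof -
  obtain t where t: "t \<in> Dom (T1 \<rightarrow> T1)" "A = fn11 t" using assms unfolding dm_def by blast
  then have o: "\<And>s. s \<in> Dom T1 \<Longrightarrow> obj (t \<cdot> s) = A (obj s)" using fn11 by simp
  have "num (t \<cdot> s \<cdot> n) = A (obj s) $ num n" if "s \<in> Dom T1" "n \<in> Dom N" for s n
    unfolding o[OF that(1), symmetric] using t(1) that by simp
  with t o show ?thesis by blast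
qed

lemma sub_bracket_Dom:
  assumes "typed e" "s \<in> Dom \<sigma>" "t \<in> Dom \<tau>"
  shows "eqv \<Gamma>\<^sub>0 \<tau> (sub e (bracket x \<sigma> t) \<cdot> s) (sub (upd e x \<sigma> s) t)"
  using sub_bracket[OF assms(1,2), of t x] assms(3) by (simp add: Dom_def)

lemma num_bracket':
  assumes "typed e" "s \<in> Dom \<sigma>" "t \<in> Dom N"
  shows "num (sub e (bracket x \<sigma> t) \<cdot> s) = num (sub (upd e x \<sigma> s) t)"
proof (rule eqv_num[OF _ _ sub_bracket_Dom[OF assms]])
  show "sub e (bracket x \<sigma> t) \<cdot> s \<in> Dom N" by (rule app_Dom[OF sub_Dom[OF assms(1) bracket_Dom[OF assms(3)]] assms(2)])
qed (use assms in simp)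

lemma obj_bracket:
  assumes "typed e" "u \<in> Dom N" "n \<in> Dom N"
  shows "obj (sub e (bracket y N u)) $ num n = num (sub (upd e y N n) u)"
  using assms by (simp add: num_bracket')

lemma dfnI:
  assumes "typed e" "t \<in> Dom N" "\<And>s. s \<in> Dom T1 \<Longrightarrow> num (sub (upd e x T1 s) t) = \<Phi> (obj s)"
  shows "dfn \<Phi>"
  unfolding dfn_def
proof (intro bexI HOL.ext)
  show "sub e (bracket x T1 t) \<in> Dom T2" using assms by simp
  show "\<Phi> z = fn2 (sub e (bracket x T1 t)) z" for z
    unfolding fn2_def using assms(3)[of "rep z"] by (simp add: num_bracket'[OF assms(1) _ assms(2)])
qed

lemma dmI':
  assumes "typed e" "u \<in> Dom T1" "\<And>s. s \<in> Dom T1 \<Longrightarrow> obj (sub (upd e x T1 s) u) = A (obj s)"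
  shows "dm A"
  unfolding dm_def
proof (intro bexI HOL.ext)
  let ?t = "sub e (bracket x T1 u)"
  show t: "?t \<in> Dom (T1 \<rightarrow> T1)" using assms by simp
  show "A z = fn11 ?t z" for z
  proof -
    have "obj (?t \<cdot> rep z) = obj (sub (upd e x T1 (rep z)) u)"
      using sub_bracket_Dom[OF assms(1) _ assms(2), of "rep z" T1] app_Dom_T1T[OF t] assms(1,2)
      by (subst obj_cong) (simp_all del: eqv.simps)
    then show ?thesis unfolding fn11_def using assms(3)[of "rep z"] by simp
  qed
qed

lemma dmI:
  assumes "typed e" "u \<in> Dom N" "\<And>s n. s \<in> Dom T1 \<Longrightarrow> n \<in> Dom N \<Longrightarrow> num (sub (upd (upd e x T1 s) y N n) u) = A (obj s) $ num n"
  shows "dm A"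
proof (rule dmI'[OF assms(1)])
  show "bracket y N u \<in> Dom T1" using assms by simp
  show "obj (sub (upd e x T1 s) (bracket y N u)) = A (obj s)" if "s \<in> Dom T1" for s
    by (rule obj_eqI) (use assms that in \<open>simp_all add: num_bracket'\<close>)
qed

lemma definable_lf: "definable lf" unfolding definable_def by (intro bexI[of _ left]) simp_all
lemma definable_rg: "definable rg" unfolding definable_def by (intro bexI[of _ right]) simp_all

lemma definable_Rep: "definable (Rep_fn1 x)" using Rep_fn1[of x] good by simp

definition lft :: "fn1 \<Rightarrow> fn1" where "lft z = Abs_fn1 (\<lambda>n. lf (z $ n))"
definition rgt :: "fn1 \<Rightarrow> fn1" where "rgt z = Abs_fn1 (\<lambda>n. rg (z $ n))"
definition push :: "fn1 \<Rightarrow> mnat \<Rightarrow> fn1" where "push z a = Abs_fn1 (\<lambda>n. pair (z $ n) a)"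

lemma lft_ap: "lft z $ n = lf (z $ n)" and rgt_ap: "rgt z $ n = rg (z $ n)" and push_ap: "push z a $ n = pair (z $ n) a"
  unfolding lft_def rgt_def push_def pair_def
  by (rule Abs_fn1; intro definable_plus definable_times definable_const definable_comp[OF definable_lf]
      definable_comp[OF definable_rg] definable_Rep)+

definition pairT :: "tm \<Rightarrow> tm \<Rightarrow> tm" where "pairT a b = (a \<^bold>+ b) \<^bold>* (a \<^bold>+ b) \<^bold>+ a"

lemma pairT [simp]:
  "a \<in> Dom N \<Longrightarrow> b \<in> Dom N \<Longrightarrow> pairT a b \<in> Dom N" "sub e (pairT a b) = pairT (sub e a) (sub e b)"
  "a \<in> Dom N \<Longrightarrow> b \<in> Dom N \<Longrightarrow> num (pairT a b) = pair (num a) (num b)" "fvt (pairT a b) = fvt a \<union> fvt b"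
  by (auto simp: pairT_def pair_def)

text \<open>Writes \<open>push\<close> as a term: this is how a functional of one sequence receives
  an additional number.\<close>

lemma obj_pairT:
  assumes "typed e" "z \<in> Dom T1" "fvt z \<subseteq> {(x, T1) |x. True}" "a \<in> Dom N" "(m, N) \<notin> fvt a"
  shows "obj (sub e (bracket m N (pairT (z \<cdot> Var m N) a))) = push (obj (sub e z)) (num (sub e a))"
proof (rule obj_eqI)
  show "sub e (bracket m N (pairT (z \<cdot> Var m N) a)) \<in> Dom T1" using assms by simp
  fix n assume n: "n \<in> Dom N"
  have "sub (upd e m N n) z = sub e z" by (rule sub_cong) (use assms(3) in auto)
  moreover have "sub (upd e m N n) a = sub e a" by (rule sub_cong) (use assms(5) in auto)
  ultimately show "num (sub e (bracket m N (pairT (z \<cdot> Var m N) a)) \<cdot> n) = push (obj (sub e z)) (num (sub e a)) $ num n"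
    using assms n by (simp add: num_bracket' push_ap)
qed

lemma lft_push: "lft (push z a) = z" by (rule fn1_ext) (simp add: push_ap lft_ap lf_pair)
lemma rgt_push: "rgt (push z a) $ n = a" by (simp add: push_ap rgt_ap rg_pair)

text \<open>The recursor works at type 0 only, so the sequence \<open>z\<close> enters as a
  parameter of the step term and is abstracted afterwards. The step functional is applied to
  \<open>z\<close> with the pair of index and previous value pushed onto it.\<close>

lemma dm_rec:
  assumes "dfn G" "dfn (\<lambda>z. S (lft z) (lf (rgt z $ 0)) (rg (rgt z $ 0)))"
  shows "\<exists>A. dm A \<and> (\<forall>z. A z $ 0 = G z) \<and> (\<forall>z n. A z $ (n + 1) = S z n (A z $ n))"
proof -
  obtain g where g: "g \<in> Dom T2" "\<And>s. s \<in> Dom T1 \<Longrightarrow> num (g \<cdot> s) = G (obj s)" using dfnE[OF assms(1)] by blast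
  obtain p where p: "p \<in> Dom T2" "\<And>s. s \<in> Dom T1 \<Longrightarrow> num (p \<cdot> s) = S (lft (obj s)) (lf (rgt (obj s) $ 0)) (rg (rgt (obj s) $ 0))"
    using dfnE[OF assms(2)] by blast
  let ?b = "Var 2 T2 \<cdot> bracket 2 N (pairT (Var 0 T1 \<cdot> Var 2 N) (pairT (Var 0 N) (Var 1 N)))"
  let ?f = "bracket 0 N (bracket 1 N ?b)"
  let ?u = "Con Rec \<cdot> ?f \<cdot> (Var 1 T2 \<cdot> Var 0 T1) \<cdot> Var 3 N"
  let ?e = "upd (upd VV 1 T2 g) 2 T2 p"
  have e: "typed ?e" using g p by simp
  have f: "?f \<in> Dom (N \<rightarrow> T1)" by simp
  have "\<exists>r. definable r \<and> r 0 = G (obj z) \<and> (\<forall>n. r (n + 1) = S (obj z) n (r n)) \<and>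
      (\<forall>n\<in>Dom N. num (sub (upd (upd ?e 0 T1 z) 3 N n) ?u) = r (num n))" if z: "z \<in> Dom T1" for z
  proof -
    let ?e' = "upd ?e 0 T1 z"
    have e': "typed ?e'" using e z by simp
    have "num (sub ?e' ?f \<cdot> s \<cdot> t) = S (obj z) (num s) (num t)" if st: "s \<in> Dom N" "t \<in> Dom N" for s t
    proof -
      let ?e2 = "upd (upd ?e' 0 N s) 1 N t"
      have e2: "typed ?e2" using e' st by simp
      have "num (sub ?e' ?f \<cdot> s \<cdot> t) = num (sub ?e2 ?b)"
        by (rule num_bracket2[OF e' st Dom_N]) simp_all
      also have "\<dots> = num (p \<cdot> sub ?e2 (bracket 2 N (pairT (Var 0 T1 \<cdot> Var 2 N) (pairT (Var 0 N) (Var 1 N)))))" by simp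
      also have "\<dots> = S (obj z) (num s) (num t)"
        using e2 z st by (subst p(2)) (simp_all add: obj_pairT lft_push rgt_push lf_pair rg_pair)
      finally show ?thesis .
    qed
    from ex_rec[OF sub_Dom[OF e' f] _ this, of "g \<cdot> z"] obtain r where r: "definable r" "r 0 = G (obj z)"
      "\<And>n. r (n + 1) = S (obj z) n (r n)" "\<forall>s\<in>Dom N. num (Con Rec \<cdot> sub ?e' ?f \<cdot> (g \<cdot> z) \<cdot> s) = r (num s)"
      using g z by auto
    have "sub (upd ?e' 3 N n) ?f = sub ?e' ?f" for n by (rule sub_cong) (auto simp: fvt_bracket)
    then have "num (sub (upd ?e' 3 N n) ?u) = r (num n)" if "n \<in> Dom N" for n using r(4) that by simp
    with r show ?thesis by blast
  qed
  then obtain r where r: "\<And>z. z \<in> Dom T1 \<Longrightarrow> definable (r z) \<and> r z 0 = G (obj z) \<and> (\<forall>n. r z (n + 1) = S (obj z) n (r z n)) \<and>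
      (\<forall>n\<in>Dom N. num (sub (upd (upd ?e 0 T1 z) 3 N n) ?u) = r z (num n))" by metis
  let ?t = "sub ?e (bracket 0 T1 (bracket 3 N ?u))"
  have t: "?t \<in> Dom (T1 \<rightarrow> T1)" using e f by simp
  have "fn11 ?t z $ num n = r (rep z) (num n)" if n: "n \<in> Dom N" for z n
  proof -
    have "eqv \<Gamma>\<^sub>0 T1 (?t \<cdot> rep z) (sub (upd ?e 0 T1 (rep z)) (bracket 3 N ?u))"
      by (rule sub_bracket_Dom[OF e]) (use f in simp_all)
    then have "obj (?t \<cdot> rep z) = obj (sub (upd ?e 0 T1 (rep z)) (bracket 3 N ?u))"
      using app_Dom_T1T[OF t, of "rep z"] e f by (subst obj_cong) (simp_all del: eqv.simps)
    moreover have "obj (sub (upd ?e 0 T1 (rep z)) (bracket 3 N ?u)) $ num n = num (sub (upd (upd ?e 0 T1 (rep z)) 3 N n) ?u)"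
      by (rule obj_bracket) (use e f n in simp_all)
    ultimately show ?thesis unfolding fn11_def using r[of "rep z"] n by simp
  qed
  then have eq: "fn11 ?t z $ n = r (rep z) n" for z n by (metis term_of)
  have "dm (fn11 ?t)" unfolding dm_def using t by blast
  then show ?thesis using eq r[OF rep(1)] by (intro exI[of _ "fn11 ?t"]) simp
qed

lemma dm_lam:
  assumes "dfn (\<lambda>z. K (lft z) (rgt z $ 0))"
  shows "\<exists>A. dm A \<and> (\<forall>z n. A z $ n = K z n)"
proof -
  obtain k where k: "k \<in> Dom T2" "\<And>s. s \<in> Dom T1 \<Longrightarrow> num (k \<cdot> s) = K (lft (obj s)) (rgt (obj s) $ 0)" using dfnE[OF assms] by blast
  let ?e = "upd VV 1 T2 k"
  let ?u = "Var 1 T2 \<cdot> bracket 1 N (pairT (Var 0 T1 \<cdot> Var 1 N) (Var 0 N))"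
  have e: "typed ?e" using k by simp
  have *: "num (sub (upd (upd ?e 0 T1 z) 0 N n) ?u) = K (obj z) (num n)" if "z \<in> Dom T1" "n \<in> Dom N" for z n
  proof -
    let ?e' = "upd (upd ?e 0 T1 z) 0 N n"
    have e': "typed ?e'" using e that by simp
    have "num (sub ?e' ?u) = num (k \<cdot> sub ?e' (bracket 1 N (pairT (Var 0 T1 \<cdot> Var 1 N) (Var 0 N))))" by simp
    also have "\<dots> = K (obj z) (num n)"
      using e' that by (subst k(2)) (simp_all add: obj_pairT lft_push rgt_push)
    finally show ?thesis .
  qed
  have "definable (K z)" for z
  proof (rule definable_term[of "upd ?e 0 T1 (rep z)" ?u 0])
    show "wt ?u" "ty_of ?u = N" using bracket_wt[of "pairT (Var 0 T1 \<cdot> Var 1 N) (Var 0 N)" 1 N] by (auto simp: pairT_def)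
  qed (use e *[of "rep z"] in simp_all)
  then have A: "Abs_fn1 (K z) $ n = K z n" for z n by (rule Abs_fn1)
  have "dm (\<lambda>z. Abs_fn1 (K z))" by (rule dmI[OF e, of ?u 0 0]) (use * in \<open>simp_all add: A\<close>)
  then show ?thesis using A by blast
qed

text \<open>For each closure condition a term is written down and abstracted; induction and choice
  come from the corresponding axioms.\<close>

sublocale M: rca Rep_fn1 lf rg p2 lft rgt push dfn dm
proof
  show "dfn (\<lambda>z. a)" for a by (rule dfnI[of "upd VV 0 N (term_of a)" "Var 0 N" 0]) (simp_all add: term_of)
  fix G H assume G: "dfn G"
  obtain g where g: "g \<in> Dom T2" "\<And>s. s \<in> Dom T1 \<Longrightarrow> num (g \<cdot> s) = G (obj s)" using dfnE[OF G] by blast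
  have e1: "typed (upd VV 1 T2 g)" using g by simp
  show "dfn (\<lambda>z. lf (G z))" by (rule dfnI[OF e1, of "left \<cdot> (Var 1 T2 \<cdot> Var 0 T1)" 0]) (use g in simp_all)
  show "dfn (\<lambda>z. rg (G z))" by (rule dfnI[OF e1, of "right \<cdot> (Var 1 T2 \<cdot> Var 0 T1)" 0]) (use g in simp_all)
  show "dfn (\<lambda>z. p2 (G z))" by (rule dfnI[OF e1, of "pow2 \<cdot> (Var 1 T2 \<cdot> Var 0 T1)" 0]) (use g in simp_all)
  {
    assume H: "dfn H"
    obtain h where h: "h \<in> Dom T2" "\<And>s. s \<in> Dom T1 \<Longrightarrow> num (h \<cdot> s) = H (obj s)" using dfnE[OF H] by blast
    have e2: "typed (upd (upd VV 1 T2 g) 2 T2 h)" using g h by simp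
    show "dfn (\<lambda>z. G z + H z)" by (rule dfnI[OF e2, of "Var 1 T2 \<cdot> Var 0 T1 \<^bold>+ Var 2 T2 \<cdot> Var 0 T1" 0]) (use g h in simp_all)
    show "dfn (\<lambda>z. G z * H z)" by (rule dfnI[OF e2, of "Var 1 T2 \<cdot> Var 0 T1 \<^bold>* Var 2 T2 \<cdot> Var 0 T1" 0]) (use g h in simp_all)
    show "dfn (\<lambda>z. G z - H z)" by (rule dfnI[OF e2, of "Var 1 T2 \<cdot> Var 0 T1 \<^bold>- Var 2 T2 \<cdot> Var 0 T1" 0]) (use g h in simp_all)
  }
  {
    fix A assume A: "dm A"
    obtain a where a: "a \<in> Dom (T1 \<rightarrow> T1)" "\<And>s. s \<in> Dom T1 \<Longrightarrow> obj (a \<cdot> s) = A (obj s)"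
      "\<And>s n. s \<in> Dom T1 \<Longrightarrow> n \<in> Dom N \<Longrightarrow> num (a \<cdot> s \<cdot> n) = A (obj s) $ num n" using dmE[OF A] by blast
    have e2: "typed (upd (upd VV 1 T2 g) 2 (T1 \<rightarrow> T1) a)" using g a by simp
    show "dfn (\<lambda>z. A z $ G z)"
      by (rule dfnI[OF e2, of "Var 2 (T1 \<rightarrow> T1) \<cdot> Var 0 T1 \<cdot> (Var 1 T2 \<cdot> Var 0 T1)" 0]) (use g a in simp_all)
    show "dfn (\<lambda>z. G (A z))"
      by (rule dfnI[OF e2, of "Var 1 T2 \<cdot> (Var 2 (T1 \<rightarrow> T1) \<cdot> Var 0 T1)" 0]) (use g a in simp_all)
  }
next
  fix B A assume B: "dm B" and A: "dm A"
  obtain a where a: "a \<in> Dom (T1 \<rightarrow> T1)" "\<And>s. s \<in> Dom T1 \<Longrightarrow> obj (a \<cdot> s) = A (obj s)" using dmE[OF A] by blast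
  obtain b where b: "b \<in> Dom (T1 \<rightarrow> T1)" "\<And>s. s \<in> Dom T1 \<Longrightarrow> obj (b \<cdot> s) = B (obj s)" using dmE[OF B] by blast
  have e: "typed (upd (upd VV 1 (T1 \<rightarrow> T1) a) 2 (T1 \<rightarrow> T1) b)" using a b by simp
  show "dm (\<lambda>z. B (A z))"
    by (rule dmI'[OF e, of "Var 2 (T1 \<rightarrow> T1) \<cdot> (Var 1 (T1 \<rightarrow> T1) \<cdot> Var 0 T1)" 0]) (use a b in simp_all)
next
  show "dm (\<lambda>z. z)" by (rule dmI'[OF typed_Var, of "Var 0 T1" 0]) simp_all
  show "dm (\<lambda>z. x)" for x by (rule dmI'[of "upd VV 1 T1 (rep x)" "Var 1 T1" 0]) simp_all
  show "dm lft" by (rule dmI[OF typed_Var, of "left \<cdot> (Var 0 T1 \<cdot> Var 0 N)" 0 0]) (simp_all add: lft_ap)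
  show "dm rgt" by (rule dmI[OF typed_Var, of "right \<cdot> (Var 0 T1 \<cdot> Var 0 N)" 0 0]) (simp_all add: rgt_ap)
next
  fix G S assume *: "dfn G" "dfn (\<lambda>z. S (lft z) (lf (rgt z $ 0)) (rg (rgt z $ 0)))"
  obtain A where A: "dm A" "\<And>z. A z $ 0 = G z" "\<And>z n. A z $ (n + 1) = S z n (A z $ n)" using dm_rec[OF *] by blast
  obtain a where a: "a \<in> Dom (T1 \<rightarrow> T1)" "\<And>s n. s \<in> Dom T1 \<Longrightarrow> n \<in> Dom N \<Longrightarrow> num (a \<cdot> s \<cdot> n) = A (obj s) $ num n"
    using dmE[OF A(1)] by blast
  let ?l = "bracket 1 N (left \<cdot> (Var 0 T1 \<cdot> Var 1 N))"
  have l: "?l \<in> Dom T1" by simp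
  have "dfn (\<lambda>z. A (lft z) $ (rgt z $ 0))"
  proof (rule dfnI[of "upd VV 1 (T1 \<rightarrow> T1) a" "Var 1 (T1 \<rightarrow> T1) \<cdot> ?l \<cdot> (right \<cdot> (Var 0 T1 \<cdot> \<^bold>0))" 0])
    fix s assume s: "s \<in> Dom T1"
    let ?e = "upd (upd VV 1 (T1 \<rightarrow> T1) a) 0 T1 s"
    have e: "typed ?e" using a s by simp
    have ol: "obj (sub ?e ?l) = lft (obj s)" by (rule obj_eqI) (use e l s in \<open>simp_all add: num_bracket' lft_ap\<close>)
    have r: "right \<cdot> (s \<cdot> \<^bold>0) \<in> Dom N" "num (right \<cdot> (s \<cdot> \<^bold>0)) = rgt (obj s) $ 0"
      using s obj[of s "\<^bold>0"] by (simp_all add: rgt_ap)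
    show "num (sub ?e (Var 1 (T1 \<rightarrow> T1) \<cdot> ?l \<cdot> (right \<cdot> (Var 0 T1 \<cdot> \<^bold>0)))) = A (lft (obj s)) $ (rgt (obj s) $ 0)"
      using a(2)[OF sub_Dom[OF e l] r(1)] ol r by simp
  qed (use a l in simp_all)
  then show "\<exists>R. dfn (\<lambda>z. R (lft z) (rgt z $ 0)) \<and> (\<forall>z. R z 0 = G z) \<and> (\<forall>z n. R z (n + 1) = S z n (R z n))"
    using A by (intro exI[of _ "\<lambda>z n. A z $ n"]) simp
next
  fix f n assume f: "dfn (\<lambda>z. f (z $ 0))" "f 0 = 1" "\<And>n. f n = 1 \<Longrightarrow> f (n + 1) = 1"
  obtain t where t: "t \<in> Dom T2" "\<And>s. s \<in> Dom T1 \<Longrightarrow> num (t \<cdot> s) = f (obj s $ 0)" using dfnE[OF f(1)] by blast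
  \<comment> \<open>The constant sequence of a number, on which the functional is evaluated.\<close>
  let ?k = "bracket 1 N (Var 0 N)"
  have k: "?k \<in> Dom T1" by simp
  have "definable f"
  proof (rule definable_term[of "upd VV 1 T2 t" "Var 1 T2 \<cdot> ?k" 0])
    show "wt (Var 1 T2 \<cdot> ?k)" "ty_of (Var 1 T2 \<cdot> ?k) = N" by (rule Dom_N, simp)+
    fix s assume s: "s \<in> Dom N"
    let ?e = "upd (upd VV 1 T2 t) 0 N s"
    have e: "typed ?e" using t s by simp
    have "obj (sub ?e ?k) $ 0 = num s" using obj_bracket[OF e, of "Var 0 N" "\<^bold>0" 1] by simp
    then show "num (sub ?e (Var 1 T2 \<cdot> ?k)) = f (num s)" using t(2)[OF sub_Dom[OF e k]] by simp
  qed (use t in simp)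
  then have "decidable (\<lambda>n. f n = 1)" by (intro decidable_eq definable_const)
  then show "f n = 1" using f(2,3) by (rule num_induct)
next
  fix K assume K: "dfn (\<lambda>z. K (lft z) (rgt z $ 0))" "\<And>x. \<exists>n. K x n = 1"
  obtain A where A: "dm A" "\<And>z n. A z $ n = K z n" using dm_lam[OF K(1)] by blast
  obtain a where a: "a \<in> Dom (T1 \<rightarrow> T1)" "\<And>s n. s \<in> Dom T1 \<Longrightarrow> n \<in> Dom N \<Longrightarrow> num (a \<cdot> s \<cdot> n) = A (obj s) $ num n"
    using dmE[OF A(1)] by blast
  have one: "a \<cdot> s \<cdot> n \<approx> \<^bold>1 \<longleftrightarrow> K (obj s) (num n) = 1" if "s \<in> Dom T1" "n \<in> Dom N" for s n
    using num_eq_iff[of "a \<cdot> s \<cdot> n" "\<^bold>1"] a that by (simp add: A)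
  have "\<exists>n\<in>Dom N. a \<cdot> s \<cdot> n \<approx> \<^bold>1" if "s \<in> Dom T1" for s
    using K(2)[of "obj s"] one[OF that] term_of by metis
  from qf_ac[OF _ this] obtain Y where Y: "Y \<in> Dom T2" "\<And>s. s \<in> Dom T1 \<Longrightarrow> a \<cdot> s \<cdot> (Y \<cdot> s) \<approx> \<^bold>1" using a(1) by blast
  have "K x (fn2 Y x) = 1" for x
    using Y(2)[of "rep x"] one[of "rep x" "Y \<cdot> rep x"] Y(1) by (simp add: fn2_def)
  then show "\<exists>Y. dfn Y \<and> (\<forall>x. K x (Y x) = 1)" using Y(1) unfolding dfn_def by blast
qed (simp_all add: fn1_ext mnat_nonneg mnat_discrete lf_pair rg_pair p2_rec lft_ap rgt_ap push_ap dm_lam)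

end

section \<open>Rational and real expressions\<close>

fun idxr :: "rat_expr \<Rightarrow> nat" where "idxr (p, m, d) = max (idxt p) (max (idxt m) (idxt d))"
fun wfr :: "rat_expr \<Rightarrow> bool" where "wfr (p, m, d) \<longleftrightarrow> p \<in> Dom N \<and> m \<in> Dom N \<and> d \<in> Dom N"

lemma idxr_ops [simp]:
  "idxr (rat_add r s) = max (idxr r) (idxr s)" "idxr (rat_minus r) = idxr r" "idxr (rat_abs r) = idxr r"
  "idxr (rat_mult r s) = max (idxr r) (idxr s)" "idxr (rat q) = idxt q" "idxr (Defs.rat_of_nat q) = idxt q"
  "idxr (pow2_neg q) = idxt q" "idx (r <\<^sub>Q s) = max (idxr r) (idxr s)"
  by (cases r; cases s; rule order_antisym; simp add: rat_def rat_of_nat_def pow2_neg_def; simp add: le_max_iff_disj)+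

lemma wfr_ops [simp]:
  "wfr r \<Longrightarrow> wfr s \<Longrightarrow> wfr (rat_add r s)" "wfr r \<Longrightarrow> wfr (rat_minus r)" "wfr r \<Longrightarrow> wfr (rat_abs r)"
  "wfr r \<Longrightarrow> wfr s \<Longrightarrow> wfr (rat_mult r s)" "q \<in> Dom N \<Longrightarrow> wfr (rat q)" "q \<in> Dom N \<Longrightarrow> wfr (Defs.rat_of_nat q)"
  "q \<in> Dom N \<Longrightarrow> wfr (pow2_neg q)" "wfr r \<Longrightarrow> wfr s \<Longrightarrow> wf (r <\<^sub>Q s)"
  by (cases r; cases s; auto simp: rat_def rat_of_nat_def pow2_neg_def Dom_N)+

declare rat_add.simps [simp del] rat_minus.simps [simp del] rat_abs.simps [simp del] rat_mult.simps [simp del] rat_less.simps [simp del]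

lemma divide_less_divide_iff:
  "0 < d \<Longrightarrow> 0 < d' \<Longrightarrow> (p - m) / d < (p' - m') / d' \<longleftrightarrow> p * d' + m' * d < p' * d + m * (d' :: 'a::linordered_field)"
  by (simp only: pos_divide_less_eq times_divide_eq_left pos_less_divide_eq; simp add: algebra_simps)

lemma idxt_sub_cong: "(\<And>y \<sigma>. y < idxt t \<Longrightarrow> e' (y, \<sigma>) = e (y, \<sigma>)) \<Longrightarrow> sub e' t = sub e t"
  by (rule sub_cong) (auto dest: fvt_idxt)

context countermodel
begin

fun rq :: "(nat \<times> ty \<Rightarrow> tm) \<Rightarrow> rat_expr \<Rightarrow> mnat zz fract" where
  "rq e (p, m, d) = (qn (num (sub e p)) - qn (num (sub e m))) / qn (num (sub e d))"
fun pos_den :: "(nat \<times> ty \<Rightarrow> tm) \<Rightarrow> rat_expr \<Rightarrow> bool" where "pos_den e (p, m, d) \<longleftrightarrow> 0 < num (sub e d)"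

definition okr :: "(nat \<times> ty \<Rightarrow> tm) \<Rightarrow> rat_expr \<Rightarrow> bool" where "okr e r \<longleftrightarrow> typed e \<and> wfr r \<and> pos_den e r"

lemma qn_abs: "qn (a - b) + qn (b - a) = \<bar>qn a - qn (b :: mnat)\<bar>"
proof -
  have le: "qn (a - b) + qn (b - a) = qn b - qn a \<and> qn a \<le> qn b" if "a \<le> b" for a b :: mnat
  proof -
    have "qn (b - a) + qn a = qn b" using le_add_diff_inverse2[OF that] qn_simps(3) by metis
    moreover have "qn (a - b) = 0" using that mnat_minus_le by simp
    ultimately show ?thesis using that by simp
  qed
  show ?thesis using le[of a b] le[of b a] by (cases rule: linorder_le_cases[of a b]) (auto simp: add.commute)
qed

lemma okr_ops [simp]:
  "okr e r \<Longrightarrow> okr e s \<Longrightarrow> okr e (rat_add r s)" "okr e r \<Longrightarrow> okr e (rat_minus r)" "okr e r \<Longrightarrow> okr e (rat_abs r)"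
  "okr e r \<Longrightarrow> okr e s \<Longrightarrow> okr e (rat_mult r s)" "typed e \<Longrightarrow> q \<in> Dom N \<Longrightarrow> okr e (rat q)"
  "typed e \<Longrightarrow> q \<in> Dom N \<Longrightarrow> okr e (Defs.rat_of_nat q)" "typed e \<Longrightarrow> q \<in> Dom N \<Longrightarrow> okr e (pow2_neg q)"
  by (cases r; cases s; auto simp: okr_def rat_def rat_of_nat_def pow2_neg_def rat_add.simps rat_minus.simps rat_abs.simps
      rat_mult.simps mnat_less_Suc mnat_nonneg)+

lemma rq_ops [simp]:
  "okr e r \<Longrightarrow> okr e s \<Longrightarrow> rq e (rat_add r s) = rq e r + rq e s" "okr e r \<Longrightarrow> rq e (rat_minus r) = - rq e r"
  "okr e r \<Longrightarrow> rq e (rat_abs r) = \<bar>rq e r\<bar>" "okr e r \<Longrightarrow> okr e s \<Longrightarrow> rq e (rat_mult r s) = rq e r * rq e s"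
  "typed e \<Longrightarrow> q \<in> Dom N \<Longrightarrow> rq e (rat q) = M.rv (num (sub e q))"
  "typed e \<Longrightarrow> q \<in> Dom N \<Longrightarrow> rq e (Defs.rat_of_nat q) = qn (num (sub e q))"
  "typed e \<Longrightarrow> q \<in> Dom N \<Longrightarrow> rq e (pow2_neg q) = M.pw (num (sub e q))"
proof -
  have nz: "0 < a \<Longrightarrow> qn a \<noteq> 0" for a :: mnat by (metis qn_pos less_irrefl)
  show "okr e r \<Longrightarrow> okr e s \<Longrightarrow> rq e (rat_add r s) = rq e r + rq e s"
    by (cases r; cases s) (simp add: okr_def rat_add.simps nz add_frac_eq algebra_simps)
  show "okr e r \<Longrightarrow> rq e (rat_minus r) = - rq e r"
    by (cases r) (simp add: okr_def rat_minus.simps minus_divide_left)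
  show "okr e r \<Longrightarrow> okr e s \<Longrightarrow> rq e (rat_mult r s) = rq e r * rq e s"
    by (cases r; cases s) (simp add: okr_def rat_mult.simps algebra_simps)
  show "rq e (rat_abs r) = \<bar>rq e r\<bar>" if ok: "okr e r"
  proof (cases r)
    case (fields p m d)
    let ?a = "num (sub e p)" and ?b = "num (sub e m)" and ?d = "num (sub e d)"
    have "rq e (rat_abs r) = (qn (?a - ?b) + qn (?b - ?a)) / qn ?d"
      using ok by (simp add: fields okr_def rat_abs.simps)
    also have "\<dots> = \<bar>rq e r\<bar>" using ok unfolding qn_abs by (simp add: fields okr_def abs_divide)
    finally show ?thesis .
  qed
qed (simp_all add: rat_def rat_of_nat_def pow2_neg_def M.rv_def M.pw_def)

lemma ev_rat_less [simp]: "okr e r \<Longrightarrow> okr e s \<Longrightarrow> ev \<Gamma>\<^sub>0 e (r <\<^sub>Q s) \<longleftrightarrow> rq e r < rq e s"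
  by (cases r; cases s)
    (simp add: okr_def rat_less.simps Lt_iff divide_less_divide_iff flip: qn_simps(3,4))

text \<open>The last clause makes a bound variable that is fresh for \<open>E\<close> fresh for the parameters of \<open>E\<close>,
  which have indices below \<open>k\<close>.\<close>

definition rx :: "(nat \<times> ty \<Rightarrow> tm) \<Rightarrow> real_expr \<Rightarrow> (mnat \<Rightarrow> mnat zz fract) \<Rightarrow> nat \<Rightarrow> bool" where
  "rx e E s k \<longleftrightarrow> (\<forall>e' \<tau>. typed e' \<and> (\<forall>y \<sigma>. y < k \<longrightarrow> e' (y, \<sigma>) = e (y, \<sigma>)) \<and> \<tau> \<in> Dom N \<longrightarrow>
     okr e' (E \<tau>) \<and> rq e' (E \<tau>) = s (num (sub e' \<tau>))) \<and> (\<forall>\<tau>. k \<le> idxr (E \<tau>))"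

lemma rxD:
  assumes "rx e E s k" "typed e'" "\<And>y \<sigma>. y < k \<Longrightarrow> e' (y, \<sigma>) = e (y, \<sigma>)" "\<tau> \<in> Dom N"
  shows "okr e' (E \<tau>)" "rq e' (E \<tau>) = s (num (sub e' \<tau>))"
  using assms unfolding rx_def by blast+

lemma rxI:
  assumes "\<And>e' \<tau>. typed e' \<Longrightarrow> (\<And>y \<sigma>. y < k \<Longrightarrow> e' (y, \<sigma>) = e (y, \<sigma>)) \<Longrightarrow> \<tau> \<in> Dom N \<Longrightarrow>
     okr e' (E \<tau>) \<and> rq e' (E \<tau>) = s (num (sub e' \<tau>))" "\<And>\<tau>. k \<le> idxr (E \<tau>)"
  shows "rx e E s k"
  using assms unfolding rx_def by blast

lemma rx_real: "x \<in> Dom T1 \<Longrightarrow> rx e (real x) (M.rs (obj (sub e x))) (idxt x)"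
proof (rule rxI)
  fix e' \<tau> assume *: "x \<in> Dom T1" "typed e'" "\<And>y \<sigma>. y < idxt x \<Longrightarrow> e' (y, \<sigma>) = e (y, \<sigma>)" "\<tau> \<in> Dom N"
  have "sub e x = sub e' x" using idxt_sub_cong[of x e' e] *(3) by simp
  then show "okr e' (real x \<tau>) \<and> rq e' (real x \<tau>) = M.rs (obj (sub e x)) (num (sub e' \<tau>))"
    using * by (simp add: real_def M.rs_def)
qed (simp add: real_def)

lemma rx_nat: "k \<in> Dom N \<Longrightarrow> rx e (Defs.real_of_nat k) (\<lambda>_. qn (num (sub e k))) (idxt k)"
proof (rule rxI)
  fix e' \<tau> assume *: "k \<in> Dom N" "typed e'" "\<And>y \<sigma>. y < idxt k \<Longrightarrow> e' (y, \<sigma>) = e (y, \<sigma>)" "\<tau> \<in> Dom N"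
  have "sub e k = sub e' k" using idxt_sub_cong[of k e' e] *(3) by simp
  then show "okr e' (Defs.real_of_nat k \<tau>) \<and> rq e' (Defs.real_of_nat k \<tau>) = qn (num (sub e k))"
    using * by (simp add: real_of_nat_def real_of_rat_def)
qed (simp add: real_of_nat_def real_of_rat_def)

lemma rx_rat: "q \<in> Dom N \<Longrightarrow> rx e (real_of_rat (rat q)) (\<lambda>_. M.rv (num (sub e q))) (idxt q)"
proof (rule rxI)
  fix e' \<tau> assume *: "q \<in> Dom N" "typed e'" "\<And>y \<sigma>. y < idxt q \<Longrightarrow> e' (y, \<sigma>) = e (y, \<sigma>)" "\<tau> \<in> Dom N"
  have "sub e q = sub e' q" using idxt_sub_cong[of q e' e] *(3) by simp
  then show "okr e' (real_of_rat (rat q) \<tau>) \<and> rq e' (real_of_rat (rat q) \<tau>) = M.rv (num (sub e q))"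
    using * by (simp add: real_of_rat_def)
qed (simp add: real_of_rat_def)

lemma rx_add: "rx e E s k \<Longrightarrow> rx e E' s' k' \<Longrightarrow> rx e (E +\<^sub>R E') (\<lambda>n. s (n + 1) + s' (n + 1)) (max k k')"
  and rx_diff: "rx e E s k \<Longrightarrow> rx e E' s' k' \<Longrightarrow> rx e (E -\<^sub>R E') (\<lambda>n. s (n + 1) - s' (n + 1)) (max k k')"
proof -
  assume r: "rx e E s k" "rx e E' s' k'"
  have i: "k \<le> idxr (E \<tau>)" "k' \<le> idxr (E' \<tau>)" for \<tau> using r unfolding rx_def by blast+
  have *: "okr e' (E (\<tau> \<^bold>+ \<^bold>1))" "rq e' (E (\<tau> \<^bold>+ \<^bold>1)) = s (num (sub e' \<tau>) + 1)"
    "okr e' (E' (\<tau> \<^bold>+ \<^bold>1))" "rq e' (E' (\<tau> \<^bold>+ \<^bold>1)) = s' (num (sub e' \<tau>) + 1)"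
    if "typed e'" "\<And>y \<sigma>. y < max k k' \<Longrightarrow> e' (y, \<sigma>) = e (y, \<sigma>)" "\<tau> \<in> Dom N" for e' \<tau>
    using rxD[OF r(1) that(1), of "\<tau> \<^bold>+ \<^bold>1"] rxD[OF r(2) that(1), of "\<tau> \<^bold>+ \<^bold>1"] that by auto
  have j: "k \<le> max (idxr (E \<tau>)) u" "k' \<le> max u (idxr (E' \<tau>))" for \<tau> u using i[of \<tau>] by auto
  show "rx e (E +\<^sub>R E') (\<lambda>n. s (n + 1) + s' (n + 1)) (max k k')"
    by (rule rxI) (use * j in \<open>simp_all add: real_add_def\<close>)
  show "rx e (E -\<^sub>R E') (\<lambda>n. s (n + 1) - s' (n + 1)) (max k k')"
    by (rule rxI) (use * j in \<open>simp_all add: real_diff_def\<close>)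
qed

lemma rx_abs: "rx e E s k \<Longrightarrow> rx e (real_abs E) (\<lambda>n. \<bar>s n\<bar>) k"
  unfolding rx_def real_abs_def by simp

text \<open>The index shift in a product inspects the numerators at index 0, which the rational
  values do not determine. Hence the factors are restricted to the form \<open>real x\<close>, where
  the code is known.\<close>

lemma rx_mult:
  assumes "x \<in> Dom T1" "y \<in> Dom T1"
  shows "rx e (real x *\<^sub>R real y) (M.smul (obj (sub e x)) (obj (sub e y))) (max (idxt x) (idxt y))"
proof (rule rxI)
  fix e' \<tau> assume *: "typed e'" "\<And>v \<sigma>. v < max (idxt x) (idxt y) \<Longrightarrow> e' (v, \<sigma>) = e (v, \<sigma>)" "\<tau> \<in> Dom N"
  have s: "sub e x = sub e' x" "sub e y = sub e' y" using idxt_sub_cong[of x e' e] idxt_sub_cong[of y e' e] *(2) by simp_all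
  have o: "num (sub e' z \<cdot> t) = obj (sub e' z) $ num t" if "z \<in> Dom T1" "t \<in> Dom N" for z t using that *(1) by simp
  show "okr e' ((real x *\<^sub>R real y) \<tau>) \<and> rq e' ((real x *\<^sub>R real y) \<tau>) = M.smul (obj (sub e x)) (obj (sub e y)) (num (sub e' \<tau>))"
    using * assms o[OF assms(1)] o[OF assms(2)]
    by (simp add: s real_mult_def real_def rat_def[of "x \<cdot> \<^bold>0"] rat_def[of "y \<cdot> \<^bold>0"] Let_def M.smul_def M.rs_def M.sz_def del: obj)
qed (simp add: real_mult_def real_def rat_def[of "x \<cdot> \<^bold>0"] rat_def[of "y \<cdot> \<^bold>0"] Let_def)

end

section \<open>Formulas about reals\<close>

lemma idx_real_lessD: "idx (E <\<^sub>R E') \<le> k \<Longrightarrow> \<exists>\<tau>. idxr (E \<tau>) \<le> k \<and> idxr (E' \<tau>) \<le> k"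
  by (auto simp: real_less_def dest!: idx_ex)
lemma idx_real_eqD: "idx (E =\<^sub>R E') \<le> k \<Longrightarrow> \<exists>\<tau>. idxr (E \<tau>) \<le> k \<and> idxr (E' \<tau>) \<le> k"
  by (auto simp: real_eq_def rat_le_def dest!: idx_all)

lemma wf_real_less: "(\<And>x. wfr (E (Var x N))) \<Longrightarrow> (\<And>x. wfr (E' (Var x N))) \<Longrightarrow> wf (E <\<^sub>R E')"
  unfolding real_less_def by (intro wf_ex) simp
lemma wf_real_eq: "(\<And>x. wfr (E (Var x N))) \<Longrightarrow> (\<And>x. wfr (E' (Var x N))) \<Longrightarrow> wf (E =\<^sub>R E')"
  unfolding real_eq_def rat_le_def Neg_def by (intro wf_all) simp

context countermodel
begin

lemma ev_Eq [simp]: "typed e \<Longrightarrow> t \<in> Dom N \<Longrightarrow> u \<in> Dom N \<Longrightarrow> ev \<Gamma>\<^sub>0 e (t \<^bold>= u) \<longleftrightarrow> num (sub e t) = num (sub e u)"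
  by (simp add: num_eq_iff)
lemma ev_Lt [simp]: "typed e \<Longrightarrow> t \<in> Dom N \<Longrightarrow> u \<in> Dom N \<Longrightarrow> ev \<Gamma>\<^sub>0 e (t \<^bold>< u) \<longleftrightarrow> num (sub e t) < num (sub e u)"
  by (simp add: Lt_iff)
lemma ev_Le [simp]: "typed e \<Longrightarrow> t \<in> Dom N \<Longrightarrow> u \<in> Dom N \<Longrightarrow> ev \<Gamma>\<^sub>0 e (t \<^bold>\<le> u) \<longleftrightarrow> num (sub e t) \<le> num (sub e u)"
  by (simp add: Le_def mnat_less_Suc del: ev.simps)

text \<open>Identifies sequences of type-1 objects with terms of type
  \<open>N \<rightarrow> T1\<close>: in one direction a number is passed as a constant sequence, in
  the other it is read as entry 0.\<close>

lemma dmN_iff: "M.dmN a \<longleftrightarrow> (\<exists>t\<in>Dom (N \<rightarrow> T1). a = fn01 t)"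
proof
  assume "M.dmN a"
  then obtain t where t: "t \<in> Dom (T1 \<rightarrow> T1)" "\<forall>s\<in>Dom T1. obj (t \<cdot> s) = a (obj s $ 0)"
    using dmE[of "\<lambda>z. a (z $ 0)"] unfolding M.dmN_def by blast
  let ?k = "bracket 1 N (Var 0 N)"
  let ?u = "Var 1 (T1 \<rightarrow> T1) \<cdot> ?k"
  let ?e = "upd VV 1 (T1 \<rightarrow> T1) t"
  have e: "typed ?e" and u: "?u \<in> Dom T1" using t by simp_all
  have d: "sub ?e (bracket 0 N ?u) \<in> Dom (N \<rightarrow> T1)" using e u by simp
  have "fn01 (sub ?e (bracket 0 N ?u)) n = a n" for n
  proof -
    let ?e' = "upd ?e 0 N (term_of n)"
    have e': "typed ?e'" using e by (simp add: term_of)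
    have k: "obj (sub ?e' ?k) $ 0 = n" using obj_bracket[OF e', of "Var 0 N" "\<^bold>0" 1] by (simp add: term_of)
    have "obj (sub ?e (bracket 0 N ?u) \<cdot> term_of n) = obj (sub ?e' ?u)"
      by (rule obj_cong[THEN iffD2, OF app_Dom_NT[OF d term_of(1)] sub_Dom[OF e' u] sub_bracket_Dom[OF e term_of(1) u]])
    also have "\<dots> = a n" using t(2)[rule_format, OF sub_Dom[OF e', of ?k T1]] k by simp
    finally show ?thesis unfolding fn01_def .
  qed
  then have "a = fn01 (sub ?e (bracket 0 N ?u))" by (simp add: fun_eq_iff)
  then show "\<exists>t\<in>Dom (N \<rightarrow> T1). a = fn01 t" using d by blast
next
  assume "\<exists>t\<in>Dom (N \<rightarrow> T1). a = fn01 t"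
  then obtain t where t: "t \<in> Dom (N \<rightarrow> T1)" "a = fn01 t" by blast
  show "M.dmN a" unfolding M.dmN_def
  proof (rule dmI'[of "upd VV 1 (N \<rightarrow> T1) t" "Var 1 (N \<rightarrow> T1) \<cdot> (Var 0 T1 \<cdot> \<^bold>0)" 0])
    fix s assume s: "s \<in> Dom T1"
    have "num (s \<cdot> \<^bold>0) = obj s $ 0" using obj[OF s, of "\<^bold>0"] by simp
    then show "obj (sub (upd (upd VV 1 (N \<rightarrow> T1) t) 0 T1 s) (Var 1 (N \<rightarrow> T1) \<cdot> (Var 0 T1 \<cdot> \<^bold>0))) = a (obj s $ 0)"
      using s t fn01[OF t(1), of "s \<cdot> \<^bold>0"] by simp
  qed (use t in simp_all)
qed

lemma ev_all_num:
  "(\<And>x s. idx (F (Var 0 N)) \<le> x \<Longrightarrow> s \<in> Dom N \<Longrightarrow> ev \<Gamma>\<^sub>0 (upd e x N s) (F (Var x N)) \<longleftrightarrow> P (num s)) \<Longrightarrow>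
   ev \<Gamma>\<^sub>0 e (all N F) \<longleftrightarrow> (\<forall>n. P n)"
  using ev_all[of F N \<Gamma>\<^sub>0 e "\<lambda>s. P (num s)"] by (simp add: all_num)
lemma ev_ex_num:
  "(\<And>x s. idx (F (Var 0 N)) \<le> x \<Longrightarrow> s \<in> Dom N \<Longrightarrow> ev \<Gamma>\<^sub>0 (upd e x N s) (F (Var x N)) \<longleftrightarrow> P (num s)) \<Longrightarrow>
   ev \<Gamma>\<^sub>0 e (ex N F) \<longleftrightarrow> (\<exists>n. P n)"
  using ev_ex[of F N \<Gamma>\<^sub>0 e "\<lambda>s. P (num s)"] by (simp add: ex_num)
lemma ev_all_obj:
  "(\<And>x s. idx (F (Var 0 T1)) \<le> x \<Longrightarrow> s \<in> Dom T1 \<Longrightarrow> ev \<Gamma>\<^sub>0 (upd e x T1 s) (F (Var x T1)) \<longleftrightarrow> P (obj s)) \<Longrightarrow>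
   ev \<Gamma>\<^sub>0 e (all T1 F) \<longleftrightarrow> (\<forall>z. P z)"
  using ev_all[of F T1 \<Gamma>\<^sub>0 e "\<lambda>s. P (obj s)"] rep by metis
lemma ev_ex_obj:
  "(\<And>x s. idx (F (Var 0 T1)) \<le> x \<Longrightarrow> s \<in> Dom T1 \<Longrightarrow> ev \<Gamma>\<^sub>0 (upd e x T1 s) (F (Var x T1)) \<longleftrightarrow> P (obj s)) \<Longrightarrow>
   ev \<Gamma>\<^sub>0 e (ex T1 F) \<longleftrightarrow> (\<exists>z. P z)"
  using ev_ex[of F T1 \<Gamma>\<^sub>0 e "\<lambda>s. P (obj s)"] rep by metis
lemma ev_all_map:
  "(\<And>x s. idx (F (Var 0 (T1 \<rightarrow> T1))) \<le> x \<Longrightarrow> s \<in> Dom (T1 \<rightarrow> T1) \<Longrightarrow>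
     ev \<Gamma>\<^sub>0 (upd e x (T1 \<rightarrow> T1) s) (F (Var x (T1 \<rightarrow> T1))) \<longleftrightarrow> P (fn11 s)) \<Longrightarrow>
   ev \<Gamma>\<^sub>0 e (all (T1 \<rightarrow> T1) F) \<longleftrightarrow> (\<forall>A. dm A \<longrightarrow> P A)"
  using ev_all[of F "T1 \<rightarrow> T1" \<Gamma>\<^sub>0 e "\<lambda>s. P (fn11 s)"] unfolding dm_def by blast
lemma ev_all_seq:
  "(\<And>x s. idx (F (Var 0 (N \<rightarrow> T1))) \<le> x \<Longrightarrow> s \<in> Dom (N \<rightarrow> T1) \<Longrightarrow>
     ev \<Gamma>\<^sub>0 (upd e x (N \<rightarrow> T1) s) (F (Var x (N \<rightarrow> T1))) \<longleftrightarrow> P (fn01 s)) \<Longrightarrow>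
   ev \<Gamma>\<^sub>0 e (all (N \<rightarrow> T1) F) \<longleftrightarrow> (\<forall>a. M.dmN a \<longrightarrow> P a)"
  using ev_all[of F "N \<rightarrow> T1" \<Gamma>\<^sub>0 e "\<lambda>s. P (fn01 s)"] unfolding dmN_iff by blast
lemma ev_ex_seq:
  "(\<And>x s. idx (F (Var 0 (N \<rightarrow> T1))) \<le> x \<Longrightarrow> s \<in> Dom (N \<rightarrow> T1) \<Longrightarrow>
     ev \<Gamma>\<^sub>0 (upd e x (N \<rightarrow> T1) s) (F (Var x (N \<rightarrow> T1))) \<longleftrightarrow> P (fn01 s)) \<Longrightarrow>
   ev \<Gamma>\<^sub>0 e (ex (N \<rightarrow> T1) F) \<longleftrightarrow> (\<exists>a. M.dmN a \<and> P a)"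
  using ev_ex[of F "N \<rightarrow> T1" \<Gamma>\<^sub>0 e "\<lambda>s. P (fn01 s)"] unfolding dmN_iff by blast
lemma ev_all_fun:
  "(\<And>x s. idx (F (Var 0 T2)) \<le> x \<Longrightarrow> s \<in> Dom T2 \<Longrightarrow> ev \<Gamma>\<^sub>0 (upd e x T2 s) (F (Var x T2)) \<longleftrightarrow> P (fn2 s)) \<Longrightarrow>
   ev \<Gamma>\<^sub>0 e (all T2 F) \<longleftrightarrow> (\<forall>\<Phi>. dfn \<Phi> \<longrightarrow> P \<Phi>)"
  using ev_all[of F T2 \<Gamma>\<^sub>0 e "\<lambda>s. P (fn2 s)"] unfolding dfn_def by blast

lemma ev_connectives:
  "(ev \<Gamma>\<^sub>0 e \<phi> \<longleftrightarrow> P) \<Longrightarrow> (ev \<Gamma>\<^sub>0 e \<psi> \<longleftrightarrow> Q) \<Longrightarrow> ev \<Gamma>\<^sub>0 e (\<phi> \<^bold>\<longrightarrow> \<psi>) \<longleftrightarrow> (P \<longrightarrow> Q)"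
  "(ev \<Gamma>\<^sub>0 e \<phi> \<longleftrightarrow> P) \<Longrightarrow> (ev \<Gamma>\<^sub>0 e \<psi> \<longleftrightarrow> Q) \<Longrightarrow> ev \<Gamma>\<^sub>0 e (\<phi> \<^bold>\<and> \<psi>) \<longleftrightarrow> (P \<and> Q)"
  "(ev \<Gamma>\<^sub>0 e \<phi> \<longleftrightarrow> P) \<Longrightarrow> ev \<Gamma>\<^sub>0 e (\<^bold>\<not> \<phi>) \<longleftrightarrow> (\<not> P)"
  by simp_all

lemmas ev_intros = ev_connectives ev_all_num ev_ex_num ev_all_obj ev_ex_obj ev_all_map ev_all_seq ev_ex_seq ev_all_fun

lemma obj_app11 [simp]: "t \<in> Dom (T1 \<rightarrow> T1) \<Longrightarrow> s \<in> Dom T1 \<Longrightarrow> obj (t \<cdot> s) = fn11 t (obj s)" by (rule fn11)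
lemma obj_app01 [simp]: "t \<in> Dom (N \<rightarrow> T1) \<Longrightarrow> s \<in> Dom N \<Longrightarrow> obj (t \<cdot> s) = fn01 t (num s)" by (rule fn01)
lemma num_app2 [simp]: "t \<in> Dom T2 \<Longrightarrow> s \<in> Dom T1 \<Longrightarrow> num (t \<cdot> s) = fn2 t (obj s)" by (rule fn2)

lemma ev_real_less:
  assumes "rx e E s k" "rx e E' s' k'" "typed e"
  shows "ev \<Gamma>\<^sub>0 e (E <\<^sub>R E') \<longleftrightarrow> M.slt s s'"
  unfolding real_less_def M.slt_def
proof (rule ev_ex_num)
  fix x m assume x: "idx (rat_add (E (Var 0 N)) (rat_add (pow2_neg (Var 0 N)) (pow2_neg (Var 0 N))) <\<^sub>Q E' (Var 0 N)) \<le> x" and m: "m \<in> Dom N"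
  have "k \<le> idxr (E (Var 0 N))" "k' \<le> idxr (E' (Var 0 N))" using assms unfolding rx_def by blast+
  then have k: "k \<le> x" "k' \<le> x" using x by simp_all
  let ?e = "upd e x N m"
  have e: "typed ?e" using assms m by simp
  have "okr ?e (E (Var x N)) \<and> rq ?e (E (Var x N)) = s (num m)" "okr ?e (E' (Var x N)) \<and> rq ?e (E' (Var x N)) = s' (num m)"
    using rxD[OF assms(1) e, of "Var x N"] rxD[OF assms(2) e, of "Var x N"] k by auto
  then show "ev \<Gamma>\<^sub>0 ?e (rat_add (E (Var x N)) (rat_add (pow2_neg (Var x N)) (pow2_neg (Var x N))) <\<^sub>Q E' (Var x N)) \<longleftrightarrow>
      s (num m) + (M.pw (num m) + M.pw (num m)) < s' (num m)"
    using e m by simp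
qed

lemma ev_real_eq:
  assumes "rx e E s k" "rx e E' s' k'" "typed e"
  shows "ev \<Gamma>\<^sub>0 e (E =\<^sub>R E') \<longleftrightarrow> M.seqeq s s'"
  unfolding real_eq_def M.seqeq_def rat_le_def
proof (rule ev_all_num)
  fix x m assume x: "idx (\<^bold>\<not> rat_add (pow2_neg (Var 0 N)) (pow2_neg (Var 0 N)) <\<^sub>Q rat_abs (rat_add (E (Var 0 N)) (rat_minus (E' (Var 0 N))))) \<le> x"
    and m: "m \<in> Dom N"
  have "k \<le> idxr (E (Var 0 N))" "k' \<le> idxr (E' (Var 0 N))" using assms unfolding rx_def by blast+
  then have k: "k \<le> x" "k' \<le> x" using x by simp_all
  let ?e = "upd e x N m"
  have e: "typed ?e" using assms m by simp
  have "okr ?e (E (Var x N)) \<and> rq ?e (E (Var x N)) = s (num m)" "okr ?e (E' (Var x N)) \<and> rq ?e (E' (Var x N)) = s' (num m)"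
    using rxD[OF assms(1) e, of "Var x N"] rxD[OF assms(2) e, of "Var x N"] k by auto
  then show "ev \<Gamma>\<^sub>0 ?e (\<^bold>\<not> rat_add (pow2_neg (Var x N)) (pow2_neg (Var x N)) <\<^sub>Q rat_abs (rat_add (E (Var x N)) (rat_minus (E' (Var x N))))) \<longleftrightarrow>
      \<bar>s (num m) - s' (num m)\<bar> \<le> M.pw (num m) + M.pw (num m)"
    using e m by (simp add: not_less)
qed

end

section \<open>Translation of the principles\<close>

lemma real_expr_simps [simp]:
  "idxr (real x \<tau>) = max (idxt x) (idxt \<tau>)" "idxr (real_of_rat r \<tau>) = idxr r" "idxr (Defs.real_of_nat k \<tau>) = idxt k"
  "idxr (real_abs E \<tau>) = idxr (E \<tau>)"
  "idxr ((E +\<^sub>R E') \<tau>) = max (idxr (E (\<tau> \<^bold>+ \<^bold>1))) (idxr (E' (\<tau> \<^bold>+ \<^bold>1)))"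
  "idxr ((E -\<^sub>R E') \<tau>) = max (idxr (E (\<tau> \<^bold>+ \<^bold>1))) (idxr (E' (\<tau> \<^bold>+ \<^bold>1)))"
  "x \<in> Dom T1 \<Longrightarrow> \<tau> \<in> Dom N \<Longrightarrow> wfr (real x \<tau>)" "q \<in> Dom N \<Longrightarrow> wfr (real_of_rat (rat q) \<tau>)"
  "k \<in> Dom N \<Longrightarrow> wfr (Defs.real_of_nat k \<tau>)" "wfr (E \<tau>) \<Longrightarrow> wfr (real_abs E \<tau>)"
  "wfr (E (\<tau> \<^bold>+ \<^bold>1)) \<Longrightarrow> wfr (E' (\<tau> \<^bold>+ \<^bold>1)) \<Longrightarrow> wfr ((E +\<^sub>R E') \<tau>)"
  "wfr (E (\<tau> \<^bold>+ \<^bold>1)) \<Longrightarrow> wfr (E' (\<tau> \<^bold>+ \<^bold>1)) \<Longrightarrow> wfr ((E -\<^sub>R E') \<tau>)"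
  by (simp_all add: real_def real_of_rat_def real_of_nat_def real_abs_def real_add_def real_diff_def)

lemma real_mult_idxr: "idxr ((real x *\<^sub>R real y) \<tau>) \<le> k \<Longrightarrow> idxt x \<le> k \<and> idxt y \<le> k"
  and real_mult_wfr [simp]: "x \<in> Dom T1 \<Longrightarrow> y \<in> Dom T1 \<Longrightarrow> \<tau> \<in> Dom N \<Longrightarrow> wfr ((real x *\<^sub>R real y) \<tau>)"
  by (simp_all add: real_mult_def real_def rat_def[of "x \<cdot> \<^bold>0"] rat_def[of "y \<cdot> \<^bold>0"] Let_def)

section \<open>Well-formedness and index bounds of the defined notions\<close>

lemma wf_atoms [simp]:
  "t \<in> Dom N \<Longrightarrow> u \<in> Dom N \<Longrightarrow> wf (t \<^bold>= u)" "t \<in> Dom N \<Longrightarrow> u \<in> Dom N \<Longrightarrow> wf (t \<^bold>< u)" "t \<in> Dom N \<Longrightarrow> u \<in> Dom N \<Longrightarrow> wf (t \<^bold>\<le> u)"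
  by (simp_all add: Dom_N Le_def)

declare wf.simps(1,2) [simp del] ev.simps(1,2) [simp del]

lemma idx_Le [simp]: "idx (t \<^bold>\<le> u) = max (idxt t) (idxt u)" by (simp add: Le_def)

lemmas wf_intros = wf_real_less wf_real_eq

lemmas idx_dests = idx_all idx_ex idx_real_lessD idx_real_eqD real_mult_idxr

lemma wf_is_real [simp]: "x \<in> Dom T1 \<Longrightarrow> wf (is_real x)" unfolding is_real_def by (intro wf_all) simp
lemma idx_is_real: "idx (is_real x) \<le> k \<Longrightarrow> idxt x \<le> k" unfolding is_real_def by (auto dest!: idx_dests)

lemma wf_unit_interval [simp]: "x \<in> Dom T1 \<Longrightarrow> wf (unit_interval x)"
  unfolding unit_interval_def real_le_def by (auto intro!: wf_intros)
lemma idx_unit_interval: "idx (unit_interval x) \<le> k \<Longrightarrow> idxt x \<le> k" unfolding unit_interval_def by (auto dest!: idx_is_real)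

lemma wf_pos_rat [simp]: "q \<in> Dom N \<Longrightarrow> wf (pos_rat q)" and idx_pos_rat [simp]: "idx (pos_rat q) = idxt q"
  unfolding pos_rat_def by simp_all

lemma wf_near [simp]: "x \<in> Dom T1 \<Longrightarrow> y \<in> Dom T1 \<Longrightarrow> q \<in> Dom N \<Longrightarrow> wf (near x y q)"
  unfolding near_def by (auto intro!: wf_intros)
lemma idx_near: "idx (near x y q) \<le> k \<Longrightarrow> idxt x \<le> k \<and> idxt y \<le> k \<and> idxt q \<le> k"
  unfolding near_def by (auto dest!: idx_dests)

lemma wf_real_function_on [simp]:
  "F \<in> Dom (T1 \<rightarrow> T1) \<Longrightarrow> (\<And>x. wf (A (Var x T1))) \<Longrightarrow> wf (real_function_on A F)"
  unfolding real_function_on_def by (auto intro!: wf_intros)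
lemma idx_real_function_on: "idx (real_function_on A F) \<le> k \<Longrightarrow> idxt F \<le> k"
  unfolding real_function_on_def by (auto dest!: idx_dests idx_is_real)

lemma wf_in_real_set [simp]: "Y \<in> Dom (T1 \<rightarrow> T1) \<Longrightarrow> x \<in> Dom T1 \<Longrightarrow> wf (in_real_set Y x)"
  unfolding in_real_set_def by (auto intro!: wf_intros)
lemma idx_in_real_set: "idx (in_real_set Y x) \<le> k \<Longrightarrow> idxt Y \<le> k \<and> idxt x \<le> k"
  unfolding in_real_set_def by (auto dest!: idx_dests)

lemma wf_open_real_set [simp]: "Y \<in> Dom (T1 \<rightarrow> T1) \<Longrightarrow> wf (open_real_set Y)" unfolding open_real_set_def by auto
lemma idx_open_real_set: "idx (open_real_set Y) \<le> k \<Longrightarrow> idxt Y \<le> k"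
  unfolding open_real_set_def by (auto dest!: idx_real_function_on)

lemma wf_in_closed [simp]: "Y \<in> Dom (T1 \<rightarrow> T1) \<Longrightarrow> x \<in> Dom T1 \<Longrightarrow> wf (in_closed Y x)"
  unfolding in_closed_def by (auto intro!: wf_intros)
lemma idx_in_closed: "idx (in_closed Y x) \<le> k \<Longrightarrow> idxt Y \<le> k \<and> idxt x \<le> k"
  unfolding in_closed_def by (auto dest!: idx_dests)

lemma wf_closed_subset_unit [simp]: "Y \<in> Dom (T1 \<rightarrow> T1) \<Longrightarrow> wf (closed_subset_unit Y)" unfolding closed_subset_unit_def by auto
lemma idx_closed_subset_unit: "idx (closed_subset_unit Y) \<le> k \<Longrightarrow> idxt Y \<le> k"
  unfolding closed_subset_unit_def by (auto dest!: idx_open_real_set)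

lemma wf_cantor [simp]: "f \<in> Dom T1 \<Longrightarrow> wf (cantor f)" unfolding cantor_def by auto
lemma idx_cantor: "idx (cantor f) \<le> k \<Longrightarrow> idxt f \<le> k" unfolding cantor_def by (auto dest!: idx_dests)

lemma wf_agree [simp]: "f \<in> Dom T1 \<Longrightarrow> g \<in> Dom T1 \<Longrightarrow> n \<in> Dom N \<Longrightarrow> wf (agree f g n)" unfolding agree_def by auto
lemma idx_agree: "idx (agree f g n) \<le> k \<Longrightarrow> idxt f \<le> k \<and> idxt g \<le> k \<and> idxt n \<le> k" unfolding agree_def by (auto dest!: idx_dests)

lemma wf_in_cantor_set [simp]: "D \<in> Dom T2 \<Longrightarrow> f \<in> Dom T1 \<Longrightarrow> wf (in_cantor_set D f)" unfolding in_cantor_set_def by simp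
lemma idx_in_cantor_set: "idx (in_cantor_set D f) \<le> k \<Longrightarrow> idxt D \<le> k \<and> idxt f \<le> k" unfolding in_cantor_set_def by simp

lemma wf_closed_cantor_set [simp]: "D \<in> Dom T2 \<Longrightarrow> wf (closed_cantor_set D)" unfolding closed_cantor_set_def by auto
lemma idx_closed_cantor_set: "idx (closed_cantor_set D) \<le> k \<Longrightarrow> idxt D \<le> k" unfolding closed_cantor_set_def by (auto dest!: idx_dests)

lemma wf_cantor_continuous_on [simp]: "D \<in> Dom T2 \<Longrightarrow> F \<in> Dom T2 \<Longrightarrow> wf (cantor_continuous_on D F)" unfolding cantor_continuous_on_def by auto
lemma idx_cantor_continuous_on: "idx (cantor_continuous_on D F) \<le> k \<Longrightarrow> idxt D \<le> k \<and> idxt F \<le> k"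
  unfolding cantor_continuous_on_def by (auto dest!: idx_dests idx_in_cantor_set)

lemma wf_bounded_on [simp]: "F \<in> Dom (T1 \<rightarrow> T1) \<Longrightarrow> (\<And>x. wf (A (Var x T1))) \<Longrightarrow> wf (bounded_on A F)"
  unfolding bounded_on_def real_le_def by (auto intro!: wf_intros)
lemma idx_bounded_on: "idx (bounded_on A F) \<le> k \<Longrightarrow> idxt F \<le> k \<and> (\<exists>v. idx (A (Var v T1)) \<le> k)"
  unfolding bounded_on_def real_le_def by (auto dest!: idx_dests)

lemma wf_locally_bounded_unit [simp]: "F \<in> Dom (T1 \<rightarrow> T1) \<Longrightarrow> wf (locally_bounded_unit F)" unfolding locally_bounded_unit_def by auto
lemma idx_locally_bounded_unit: "idx (locally_bounded_unit F) \<le> k \<Longrightarrow> idxt F \<le> k"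
  unfolding locally_bounded_unit_def by (auto dest!: idx_dests idx_bounded_on)

lemma wf_continuous_on_closed [simp]: "D \<in> Dom (T1 \<rightarrow> T1) \<Longrightarrow> F \<in> Dom (T1 \<rightarrow> T1) \<Longrightarrow> wf (continuous_on_closed D F)"
  unfolding continuous_on_closed_def by auto
lemma idx_continuous_on_closed: "idx (continuous_on_closed D F) \<le> k \<Longrightarrow> idxt D \<le> k \<and> idxt F \<le> k"
  unfolding continuous_on_closed_def by (auto dest!: idx_dests idx_in_closed idx_near)

lemma wf_uniformly_continuous_on_closed [simp]:
  "D \<in> Dom (T1 \<rightarrow> T1) \<Longrightarrow> F \<in> Dom (T1 \<rightarrow> T1) \<Longrightarrow> wf (uniformly_continuous_on_closed D F)"
  unfolding uniformly_continuous_on_closed_def by auto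

lemma wf_continuous_on_closed_unit [simp]: "D \<in> Dom (T1 \<rightarrow> T1) \<Longrightarrow> F \<in> Dom (T1 \<rightarrow> T1) \<Longrightarrow> wf (continuous_on_closed_unit D F)"
  unfolding continuous_on_closed_unit_def by auto
lemma idx_continuous_on_closed_unit: "idx (continuous_on_closed_unit D F) \<le> k \<Longrightarrow> idxt D \<le> k \<and> idxt F \<le> k"
  unfolding continuous_on_closed_unit_def by (auto dest!: idx_continuous_on_closed)

lemma wf_poly_sums [simp]:
  "c \<in> Dom (N \<rightarrow> T1) \<Longrightarrow> x \<in> Dom T1 \<Longrightarrow> w \<in> Dom (N \<rightarrow> T1) \<Longrightarrow> s \<in> Dom (N \<rightarrow> T1) \<Longrightarrow> wf (poly_sums c x w s)"
  unfolding poly_sums_def by (auto intro!: wf_intros)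
lemma idx_poly_sums: "idx (poly_sums c x w s) \<le> k \<Longrightarrow> idxt c \<le> k \<and> idxt x \<le> k \<and> idxt w \<le> k \<and> idxt s \<le> k"
  unfolding poly_sums_def by (auto dest!: idx_dests)

lemmas idx_formula = idx_dests idx_is_real idx_unit_interval idx_near idx_real_function_on idx_in_real_set idx_open_real_set
  idx_in_closed idx_closed_subset_unit idx_cantor idx_agree idx_in_cantor_set idx_closed_cantor_set idx_cantor_continuous_on
  idx_bounded_on idx_locally_bounded_unit idx_continuous_on_closed idx_continuous_on_closed_unit idx_poly_sums

lemma wf_HBC: "wf HBC" unfolding HBC_def by (auto intro!: wf_intros)

lemma wf_principles: "P \<in> principles \<Longrightarrow> wf P"
  unfolding principles_def Pincherle_def Cantor_bounded_def Cantor_uniform_def Real_bounded_def Real_uniform_def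
    Real_maximum_def Real_polynomial_def real_le_def by (auto intro!: wf_intros)

context countermodel
begin

section \<open>Meaning of the defined notions in the countermodel\<close>

lemma real_okr [simp]:
  assumes "typed e" "x \<in> Dom T1" "\<tau> \<in> Dom N"
  shows "okr e (real x \<tau>)" "rq e (real x \<tau>) = M.rs (obj (sub e x)) (num (sub e \<tau>))"
  using rxD[OF rx_real[OF assms(2)] assms(1) _ assms(3)] by blast+

lemmas ev_real_atoms [simp] = ev_real_less[OF rx_nat rx_real] ev_real_less[OF rx_real rx_nat] ev_real_less[OF rx_real rx_real]
  ev_real_less[OF rx_abs[OF rx_diff[OF rx_real rx_real]] rx_rat] ev_real_less[OF rx_nat rx_abs[OF rx_real]]
  ev_real_less[OF rx_abs[OF rx_diff[OF rx_real rx_real]] rx_real]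
  ev_real_eq[OF rx_real rx_real] ev_real_eq[OF rx_real rx_nat] ev_real_eq[OF rx_real rx_mult]
  ev_real_eq[OF rx_real rx_add[OF rx_real rx_mult]]

lemma ev_is_real [simp]: "typed e \<Longrightarrow> x \<in> Dom T1 \<Longrightarrow> ev \<Gamma>\<^sub>0 e (is_real x) \<longleftrightarrow> M.isR (obj (sub e x))"
  unfolding is_real_def M.isR_def by (intro ev_intros; clarsimp dest!: idx_formula)

lemma ev_unit_interval [simp]: "typed e \<Longrightarrow> x \<in> Dom T1 \<Longrightarrow> ev \<Gamma>\<^sub>0 e (unit_interval x) \<longleftrightarrow> M.unitR (obj (sub e x))"
  unfolding unit_interval_def M.unitR_def real_le_def by simp

lemma ev_pos_rat [simp]: "typed e \<Longrightarrow> q \<in> Dom N \<Longrightarrow> ev \<Gamma>\<^sub>0 e (pos_rat q) \<longleftrightarrow> 0 < M.rv (num (sub e q))"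
  unfolding pos_rat_def by simp

lemma ev_near [simp]:
  "typed e \<Longrightarrow> x \<in> Dom T1 \<Longrightarrow> y \<in> Dom T1 \<Longrightarrow> q \<in> Dom N \<Longrightarrow>
   ev \<Gamma>\<^sub>0 e (near x y q) \<longleftrightarrow> M.near (obj (sub e x)) (obj (sub e y)) (num (sub e q))"
  unfolding near_def M.near_def by simp

lemma ev_real_function_on:
  assumes "typed e" "F \<in> Dom (T1 \<rightarrow> T1)" "\<And>e' x. typed e' \<Longrightarrow> x \<in> Dom T1 \<Longrightarrow> ev \<Gamma>\<^sub>0 e' (A x) \<longleftrightarrow> A' (obj (sub e' x))"
  shows "ev \<Gamma>\<^sub>0 e (real_function_on A F) \<longleftrightarrow> M.RFun A' (fn11 (sub e F))"
  unfolding real_function_on_def M.RFun_def M.seqeqR_def by (intro ev_intros) (use assms in \<open>auto dest!: idx_formula\<close>)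

lemmas ev_real_functions [simp] = ev_real_function_on[OF _ _ ev_is_real] ev_real_function_on[OF _ _ ev_unit_interval]

lemma ev_in_real_set [simp]:
  "typed e \<Longrightarrow> Y \<in> Dom (T1 \<rightarrow> T1) \<Longrightarrow> x \<in> Dom T1 \<Longrightarrow> ev \<Gamma>\<^sub>0 e (in_real_set Y x) \<longleftrightarrow> M.inO (fn11 (sub e Y)) (obj (sub e x))"
  unfolding in_real_set_def M.inO_def M.pos0_def by simp

lemma ev_open_real_set [simp]: "typed e \<Longrightarrow> Y \<in> Dom (T1 \<rightarrow> T1) \<Longrightarrow> ev \<Gamma>\<^sub>0 e (open_real_set Y) \<longleftrightarrow> M.openR (fn11 (sub e Y))"
  unfolding open_real_set_def M.openR_def by (intro ev_intros; clarsimp dest!: idx_formula)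

lemma ev_in_closed [simp]:
  "typed e \<Longrightarrow> Y \<in> Dom (T1 \<rightarrow> T1) \<Longrightarrow> x \<in> Dom T1 \<Longrightarrow> ev \<Gamma>\<^sub>0 e (in_closed Y x) \<longleftrightarrow> M.inC (fn11 (sub e Y)) (obj (sub e x))"
  unfolding in_closed_def M.inC_def M.pos0_def by simp

lemma ev_closed_subset_unit [simp]:
  "typed e \<Longrightarrow> Y \<in> Dom (T1 \<rightarrow> T1) \<Longrightarrow> ev \<Gamma>\<^sub>0 e (closed_subset_unit Y) \<longleftrightarrow> M.closedU (fn11 (sub e Y))"
  unfolding closed_subset_unit_def M.closedU_def by (intro ev_intros; clarsimp dest!: idx_formula)

lemma ev_cantor [simp]: "typed e \<Longrightarrow> f \<in> Dom T1 \<Longrightarrow> ev \<Gamma>\<^sub>0 e (cantor f) \<longleftrightarrow> M.cantor (obj (sub e f))"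
  unfolding cantor_def M.cantor_def by (intro ev_intros; clarsimp dest!: idx_formula)

lemma ev_agree [simp]:
  "typed e \<Longrightarrow> f \<in> Dom T1 \<Longrightarrow> g \<in> Dom T1 \<Longrightarrow> n \<in> Dom N \<Longrightarrow>
   ev \<Gamma>\<^sub>0 e (agree f g n) \<longleftrightarrow> M.agree (obj (sub e f)) (obj (sub e g)) (num (sub e n))"
  unfolding agree_def M.agree_def by (intro ev_intros; clarsimp dest!: idx_formula)

lemma ev_in_cantor_set [simp]:
  "typed e \<Longrightarrow> D \<in> Dom T2 \<Longrightarrow> f \<in> Dom T1 \<Longrightarrow> ev \<Gamma>\<^sub>0 e (in_cantor_set D f) \<longleftrightarrow> M.inD (fn2 (sub e D)) (obj (sub e f))"
  unfolding in_cantor_set_def M.inD_def by simp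

lemma ev_closed_cantor_set [simp]: "typed e \<Longrightarrow> D \<in> Dom T2 \<Longrightarrow> ev \<Gamma>\<^sub>0 e (closed_cantor_set D) \<longleftrightarrow> M.closedD (fn2 (sub e D))"
  unfolding closed_cantor_set_def M.closedD_def by (intro ev_intros; clarsimp dest!: idx_formula)

lemma ev_cantor_continuous_on [simp]:
  "typed e \<Longrightarrow> D \<in> Dom T2 \<Longrightarrow> F \<in> Dom T2 \<Longrightarrow> ev \<Gamma>\<^sub>0 e (cantor_continuous_on D F) \<longleftrightarrow> M.contD (fn2 (sub e D)) (fn2 (sub e F))"
  unfolding cantor_continuous_on_def M.contD_def by (intro ev_intros; clarsimp dest!: idx_formula)

text \<open>The set \<open>A\<close> may contain parameters, so its meaning is asked for only below
  the two binders, for the bound and for the point, with variables fresh for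
  \<open>A\<close>.\<close>

lemma ev_bounded_on:
  assumes "typed e" "F \<in> Dom (T1 \<rightarrow> T1)"
    and "\<And>x s y t v. idx (A (Var v T1)) \<le> x \<Longrightarrow> idx (A (Var 0 T1)) \<le> y \<Longrightarrow> s \<in> Dom N \<Longrightarrow> t \<in> Dom T1 \<Longrightarrow>
      ev \<Gamma>\<^sub>0 (upd (upd e x N s) y T1 t) (A (Var y T1)) \<longleftrightarrow> A' (obj t)"
  shows "ev \<Gamma>\<^sub>0 e (bounded_on A F) \<longleftrightarrow> M.bdd A' (fn11 (sub e F))"
  unfolding bounded_on_def M.bdd_def real_le_def
  by (intro ev_intros) (use assms in \<open>auto dest!: idx_formula\<close>)

lemma ev_bounded_on_unit [simp]:
  "typed e \<Longrightarrow> F \<in> Dom (T1 \<rightarrow> T1) \<Longrightarrow> ev \<Gamma>\<^sub>0 e (bounded_on unit_interval F) \<longleftrightarrow> M.bdd M.unitR (fn11 (sub e F))"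
  by (rule ev_bounded_on) simp_all
lemma ev_bounded_on_closed [simp]:
  "typed e \<Longrightarrow> D \<in> Dom (T1 \<rightarrow> T1) \<Longrightarrow> F \<in> Dom (T1 \<rightarrow> T1) \<Longrightarrow>
   ev \<Gamma>\<^sub>0 e (bounded_on (in_closed D) F) \<longleftrightarrow> M.bdd (M.inC (fn11 (sub e D))) (fn11 (sub e F))"
  by (rule ev_bounded_on) (auto dest!: idx_formula)
lemma ev_bounded_on_near [simp]:
  "typed e \<Longrightarrow> x \<in> Dom T1 \<Longrightarrow> r \<in> Dom N \<Longrightarrow> F \<in> Dom (T1 \<rightarrow> T1) \<Longrightarrow>
   ev \<Gamma>\<^sub>0 e (bounded_on (\<lambda>y. unit_interval y \<^bold>\<and> near x y r) F) \<longleftrightarrow>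
   M.bdd (\<lambda>y. M.unitR y \<and> M.near (obj (sub e x)) y (num (sub e r))) (fn11 (sub e F))"
  by (rule ev_bounded_on) (auto dest!: idx_formula)

lemma ev_locally_bounded_unit [simp]:
  "typed e \<Longrightarrow> F \<in> Dom (T1 \<rightarrow> T1) \<Longrightarrow> ev \<Gamma>\<^sub>0 e (locally_bounded_unit F) \<longleftrightarrow> M.locbdd (fn11 (sub e F))"
  unfolding locally_bounded_unit_def M.locbdd_def by (intro ev_intros; clarsimp dest!: idx_formula)

lemma ev_continuous_on_closed [simp]:
  "typed e \<Longrightarrow> D \<in> Dom (T1 \<rightarrow> T1) \<Longrightarrow> F \<in> Dom (T1 \<rightarrow> T1) \<Longrightarrow>
   ev \<Gamma>\<^sub>0 e (continuous_on_closed D F) \<longleftrightarrow> M.contC (fn11 (sub e D)) (fn11 (sub e F))"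
  unfolding continuous_on_closed_def M.contC_def by (intro ev_intros; clarsimp dest!: idx_formula)

lemma ev_uniformly_continuous_on_closed [simp]:
  "typed e \<Longrightarrow> D \<in> Dom (T1 \<rightarrow> T1) \<Longrightarrow> F \<in> Dom (T1 \<rightarrow> T1) \<Longrightarrow>
   ev \<Gamma>\<^sub>0 e (uniformly_continuous_on_closed D F) \<longleftrightarrow> M.ucontC (fn11 (sub e D)) (fn11 (sub e F))"
  unfolding uniformly_continuous_on_closed_def M.ucontC_def by (intro ev_intros; clarsimp dest!: idx_formula)

lemma ev_continuous_on_closed_unit [simp]:
  "typed e \<Longrightarrow> D \<in> Dom (T1 \<rightarrow> T1) \<Longrightarrow> F \<in> Dom (T1 \<rightarrow> T1) \<Longrightarrow>
   ev \<Gamma>\<^sub>0 e (continuous_on_closed_unit D F) \<longleftrightarrow> M.contCU (fn11 (sub e D)) (fn11 (sub e F))"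
  unfolding continuous_on_closed_unit_def M.contCU_def by simp

lemma ev_poly_sums [simp]:
  "typed e \<Longrightarrow> c \<in> Dom (N \<rightarrow> T1) \<Longrightarrow> x \<in> Dom T1 \<Longrightarrow> w \<in> Dom (N \<rightarrow> T1) \<Longrightarrow> s \<in> Dom (N \<rightarrow> T1) \<Longrightarrow>
   ev \<Gamma>\<^sub>0 e (poly_sums c x w s) \<longleftrightarrow> M.poly_sums_sem (fn01 (sub e c)) (obj (sub e x)) (fn01 (sub e w)) (fn01 (sub e s))"
  unfolding poly_sums_def M.poly_sums_sem_def by (intro ev_intros; clarsimp dest!: idx_formula)

lemma ev_HBC:
  "ev \<Gamma>\<^sub>0 VV HBC \<longleftrightarrow> (\<forall>C. dm C \<longrightarrow> (\<forall>a. M.dmN a \<longrightarrow> (\<forall>b. M.dmN b \<longrightarrow>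
     M.closedU C \<and> (\<forall>n. M.isR (a n) \<and> M.isR (b n)) \<and>
     (\<forall>x. M.inC C x \<longrightarrow> (\<exists>n. M.slt (M.rs (a n)) (M.rs x) \<and> M.slt (M.rs x) (M.rs (b n)))) \<longrightarrow>
     (\<exists>n0. \<forall>x. M.inC C x \<longrightarrow> (\<exists>n. n \<le> n0 \<and> M.slt (M.rs (a n)) (M.rs x) \<and> M.slt (M.rs x) (M.rs (b n)))))))"
  unfolding HBC_def by (intro ev_intros; clarsimp dest!: idx_formula)

lemma ev_Pincherle: "ev \<Gamma>\<^sub>0 VV Pincherle \<Longrightarrow> M.sem_Pincherle"
proof -
  have "ev \<Gamma>\<^sub>0 VV Pincherle \<longleftrightarrow> (\<forall>F. dm F \<longrightarrow> M.RFun M.unitR F \<and> M.locbdd F \<longrightarrow> M.bdd M.unitR F)"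
    unfolding Pincherle_def by (intro ev_intros; clarsimp dest!: idx_formula)
  then show "ev \<Gamma>\<^sub>0 VV Pincherle \<Longrightarrow> M.sem_Pincherle" unfolding M.sem_Pincherle_def by blast
qed

lemma ev_Cantor_bounded: "ev \<Gamma>\<^sub>0 VV Cantor_bounded \<Longrightarrow> M.sem_Cantor_bounded"
proof -
  have "ev \<Gamma>\<^sub>0 VV Cantor_bounded \<longleftrightarrow> (\<forall>F. dfn F \<longrightarrow> (\<forall>D. dfn D \<longrightarrow> M.closedD D \<and> M.contD D F \<longrightarrow> (\<exists>k. \<forall>f. M.inD D f \<longrightarrow> F f \<le> k)))"
    unfolding Cantor_bounded_def by (intro ev_intros; clarsimp dest!: idx_formula)
  then show "ev \<Gamma>\<^sub>0 VV Cantor_bounded \<Longrightarrow> M.sem_Cantor_bounded" unfolding M.sem_Cantor_bounded_def by blast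
qed

lemma ev_Cantor_uniform: "ev \<Gamma>\<^sub>0 VV Cantor_uniform \<Longrightarrow> M.sem_Cantor_uniform"
proof -
  have "ev \<Gamma>\<^sub>0 VV Cantor_uniform \<longleftrightarrow> (\<forall>F. dfn F \<longrightarrow> (\<forall>D. dfn D \<longrightarrow> M.closedD D \<and> M.contD D F \<longrightarrow>
      (\<exists>n. \<forall>f g. M.inD D f \<and> M.inD D g \<and> M.agree f g n \<longrightarrow> F f = F g)))"
    unfolding Cantor_uniform_def by (intro ev_intros; clarsimp dest!: idx_formula)
  then show "ev \<Gamma>\<^sub>0 VV Cantor_uniform \<Longrightarrow> M.sem_Cantor_uniform" unfolding M.sem_Cantor_uniform_def by blast
qed

lemma ev_Real_bounded: "ev \<Gamma>\<^sub>0 VV Real_bounded \<Longrightarrow> M.sem_Real_bounded"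
proof -
  have "ev \<Gamma>\<^sub>0 VV Real_bounded \<longleftrightarrow> (\<forall>F. dm F \<longrightarrow> (\<forall>D. dm D \<longrightarrow> M.contCU D F \<longrightarrow> M.bdd (M.inC D) F))"
    unfolding Real_bounded_def by (intro ev_intros; clarsimp dest!: idx_formula)
  then show "ev \<Gamma>\<^sub>0 VV Real_bounded \<Longrightarrow> M.sem_Real_bounded" unfolding M.sem_Real_bounded_def by blast
qed

lemma ev_Real_uniform: "ev \<Gamma>\<^sub>0 VV Real_uniform \<Longrightarrow> M.sem_Real_uniform"
proof -
  have "ev \<Gamma>\<^sub>0 VV Real_uniform \<longleftrightarrow> (\<forall>F. dm F \<longrightarrow> (\<forall>D. dm D \<longrightarrow> M.contCU D F \<longrightarrow> M.ucontC D F))"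
    unfolding Real_uniform_def by (intro ev_intros; clarsimp dest!: idx_formula)
  then show "ev \<Gamma>\<^sub>0 VV Real_uniform \<Longrightarrow> M.sem_Real_uniform" unfolding M.sem_Real_uniform_def by blast
qed

lemma ev_Real_maximum: "ev \<Gamma>\<^sub>0 VV Real_maximum \<Longrightarrow> M.sem_Real_maximum"
proof -
  have "ev \<Gamma>\<^sub>0 VV Real_maximum \<longleftrightarrow> (\<forall>F. dm F \<longrightarrow> (\<forall>D. dm D \<longrightarrow> M.contCU D F \<and> (\<exists>x. M.inC D x) \<longrightarrow>
      (\<exists>x. M.inC D x \<and> (\<forall>y. M.inC D y \<longrightarrow> \<not> M.slt (M.rs (F x)) (M.rs (F y))))))"
    unfolding Real_maximum_def real_le_def by (intro ev_intros; clarsimp dest!: idx_formula)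
  then show "ev \<Gamma>\<^sub>0 VV Real_maximum \<Longrightarrow> M.sem_Real_maximum" unfolding M.sem_Real_maximum_def by blast
qed

lemma ev_Real_polynomial: "ev \<Gamma>\<^sub>0 VV Real_polynomial \<Longrightarrow> M.sem_Real_polynomial"
proof -
  have "ev \<Gamma>\<^sub>0 VV Real_polynomial \<longleftrightarrow> (\<forall>F. dm F \<longrightarrow> (\<forall>D. dm D \<longrightarrow> (\<forall>e. M.contCU D F \<and> M.isR e \<and> M.pos0 e \<longrightarrow>
      (\<exists>c. M.dmN c \<and> (\<exists>d. (\<forall>i. M.isR (c i)) \<and> (\<forall>x. M.inC D x \<longrightarrow> (\<exists>w. M.dmN w \<and> (\<exists>s. M.dmN s \<and>
        M.poly_sums_sem c x w s \<and> M.slt (\<lambda>n. \<bar>M.rs (s d) (n + 1) - M.rs (F x) (n + 1)\<bar>) (M.rs e)))))))))"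
    unfolding Real_polynomial_def M.pos0_def by (intro ev_intros; clarsimp dest!: idx_formula)
  then show "M.sem_Real_polynomial" if "ev \<Gamma>\<^sub>0 VV Real_polynomial"
    using that unfolding M.sem_Real_polynomial_def by (simp only: ex_simps simp_thms) blast
qed

lemma principle_imp_HBC:
  assumes "P \<in> principles" "P \<in> \<Gamma>\<^sub>0"
  shows "HBC \<in> \<Gamma>\<^sub>0"
proof -
  have "ev \<Gamma>\<^sub>0 VV P" using truth[OF henkin wf_principles[OF assms(1)]] assms(2) by blast
  then have sem: "M.sem_Pincherle \<or> M.sem_Cantor_bounded \<or> M.sem_Real_bounded \<or> M.sem_Real_uniform \<or> M.sem_Real_maximum \<or> M.sem_Real_polynomial"
    using assms(1) ev_Pincherle ev_Cantor_bounded M.Cantor_uniform_imp_bounded[OF ev_Cantor_uniform] ev_Real_bounded ev_Real_uniform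
      ev_Real_maximum ev_Real_polynomial unfolding principles_def by blast
  have "ev \<Gamma>\<^sub>0 VV HBC" unfolding ev_HBC
  proof (intro allI impI)
    fix C a b
    assume *: "dm C" "M.dmN a" "M.dmN b" "M.closedU C \<and> (\<forall>n. M.isR (a n) \<and> M.isR (b n)) \<and>
      (\<forall>x. M.inC C x \<longrightarrow> (\<exists>n. M.slt (M.rs (a n)) (M.rs x) \<and> M.slt (M.rs x) (M.rs (b n))))"
    then interpret cover Rep_fn1 lf rg p2 lft rgt push dfn dm C a b by unfold_locales blast+
    show "\<exists>n0. \<forall>x. M.inC C x \<longrightarrow> (\<exists>n. n \<le> n0 \<and> M.slt (M.rs (a n)) (M.rs x) \<and> M.slt (M.rs x) (M.rs (b n)))"
      using sem Pincherle_imp_subcover Cantor_bounded_imp_subcover Real_bounded_imp_subcover Real_uniform_imp_subcover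
        Real_maximum_imp_subcover Real_polynomial_imp_subcover unfolding finite_subcover_def by blast
  qed
  then show ?thesis using truth[OF henkin wf_HBC] by blast
qed

end

text \<open>The theory obtained from completeness need not be \<open>\<Gamma>\<^sub>0\<close>; it
  only shows that the choice defining \<open>\<Gamma>\<^sub>0\<close> succeeds. The contradiction
  then arises in \<open>\<Gamma>\<^sub>0\<close>, for whichever principle it contains.\<close>

lemma derivable_HBC:
  assumes "P \<in> principles"
  shows "RCA0w \<turnstile> (P \<^bold>\<longrightarrow> HBC)"
proof (rule ccontr)
  assume no: "\<not> ?thesis"
  have wf: "wf (P \<^bold>\<longrightarrow> HBC)" using wf_principles[OF assms] wf_HBC by simp
  obtain \<Gamma> where \<Gamma>: "henkin RCA0w \<Gamma>" "(P \<^bold>\<longrightarrow> HBC) \<notin> \<Gamma>" using completeness[OF wf no] by blast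
  then have "henkin RCA0w \<Gamma> \<and> HBC \<notin> \<Gamma> \<and> \<Gamma> \<inter> principles \<noteq> {}"
    using henkin_Imp[OF \<Gamma>(1) wf_principles[OF assms] wf_HBC] assms by blast
  then have \<Gamma>0: "henkin RCA0w \<Gamma>\<^sub>0 \<and> HBC \<notin> \<Gamma>\<^sub>0 \<and> \<Gamma>\<^sub>0 \<inter> principles \<noteq> {}" unfolding \<Gamma>\<^sub>0_def by (rule someI)
  then interpret countermodel by unfold_locales blast
  show False using \<Gamma>0 principle_imp_HBC by blast
qed

theorem theorem3p8:
  shows "(RCA0w \<turnstile> (Pincherle \<^bold>\<longrightarrow> HBC)) \<and>
    (RCA0w \<turnstile> (Cantor_bounded \<^bold>\<longrightarrow> HBC)) \<and>
    (RCA0w \<turnstile> (Cantor_uniform \<^bold>\<longrightarrow> HBC)) \<and>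
    (RCA0w \<turnstile> (Real_bounded \<^bold>\<longrightarrow> HBC)) \<and>
    (RCA0w \<turnstile> (Real_uniform \<^bold>\<longrightarrow> HBC)) \<and>
    (RCA0w \<turnstile> (Real_maximum \<^bold>\<longrightarrow> HBC)) \<and>
    (RCA0w \<turnstile> (Real_polynomial \<^bold>\<longrightarrow> HBC))"
  by (simp add: derivable_HBC principles_def)

end
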